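(* Let $m\ge2$, let $\Omega\subset\mathbb{R}^m$ be a bounded domain, and let $\alpha>0$. The functional $R(u)=\alpha\,\mathrm{TV}(u)$, where $\mathrm{TV}(u)=|Du|(\Omega)$ is the isotropic total variation, is an admissible regularisation functional on $L^1(\Omega)$, and it is both double-Lipschitz comparable and separably double-Lipschitz comparable. Moreover, if $\phi$ is an admissible $p$-increasing fidelity function on $\Omega$ for some $p\ge1$, then every solution $u$ of $\min_{u\in L^1(\Omega)}\int_\Omega\phi(f(x)-u(x))\,dx+R(u)$ satisfies $\|u\|_{L^\infty(\Omega)}\le\|f\|_{L^\infty(\Omega)}$.
   Context: $\|\cdot\|$ is the Euclidean norm on $\mathbb{R}^m$ (and the associated operator norm). For $u\in BV(\Omega)$, $|Du|$ is the total variation measure of the distributional gradient with respect to the Euclidean norm; $\mathrm{TV}(u)=\sup\{\int_\Omega u\operatorname{div}\varphi\,dx:\varphi\in C_c^\infty(\Omega;\mathbb{R}^m),\ \sup_x\|\varphi(x)\|\le1\}$ ($=\infty$ for $u\in L^1(\Omega)\setminus BV(\Omega)$). "Solution" means a minimiser with finite minimal value. Admissible regularisation functional: $R:L^1(\Omega)\to\mathbb{R}\cup\{\infty\}$ is convex, lower semicontinuous with respect to weak* convergence in $BV(\Omega)$, and there is $C>0$ with $|Du|(\Omega)\le C(1+\|u\|_{L^1(\Omega)}+R(u))$ for all $u\in L^1(\Omega)$. Lipschitz $(m-1)$-graph: a set $\Gamma=\{v+f_\Gamma(v)z_\Gamma:v\in V_\Gamma\}$ with $z_\Gamma$ a unit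 vector, $V_\Gamma\subset z_\Gamma^\perp$ open, $f_\Gamma:V_\Gamma\to\mathbb{R}$ Lipschitz. $\mathcal{F}(\Omega)$ is the set of one-to-one (bijective) Lipschitz maps $\gamma:\Omega\to\Omega$ with $\gamma^{-1}$ also Lipschitz, both mapping $\mathcal{L}^m$-null sets to $\mathcal{L}^m$-null sets. For open $U\subset\Omega$, $\mathcal{F}(\Omega,U)=\{\gamma\in\mathcal{F}(\Omega):\gamma(x)=x\text{ for }x\notin U\}$. $\gamma_\#u=u\circ\gamma^{-1}$. $\nabla\gamma(x)$ is the transposed Jacobian matrix, $\mathcal{J}_m\gamma(x)=|\det\nabla\gamma(x)|$; suprema over $x$ are over points where the derivatives exist. Put $A_\gamma(x)=\nabla\gamma^{-1}(\gamma(x))\mathcal{J}_m\gamma(x)$ and $$G_{\gamma_1,\gamma_2}=\sup_{x\in\Omega,\|v\|=1}\big(\|A_{\gamma_1}(x)v\|+\|A_{\gamma_2}(x)v\|-2\|v\|\big),\quad \bar J_{\gamma_1,\gamma_2}=\sup_{x\in\Omega}|\mathcal{J}_m\gamma_1(x)+\mathcal{J}_m\gamma_2(x)-2|,$$ $$D_\gamma=\sup_{x\in\Omega}\|\nabla\gamma^{-1}(\gamma(x))-I\|,\qquad T_{\gamma_1,\gamma_2}=G_{\gamma_1,\gamma_2}+\bar J_{\gamma_1,\gamma_2}+D_{\gamma_1}^2+D_{\gamma_2}^2.$$ $R$ is double-Lipschitz comparable if there is a constant $R^a$ such that for every $u\in BV(\Omega)$, open $U\subset\Omega$ and $\gamma_1,\gamma_2\in\mathcal{F}(\Omega,U)$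 with $T_{\gamma_1,\gamma_2}<1$: $R(\gamma_{1\#}u)+R(\gamma_{2\#}u)-2R(u)\le R^aT_{\gamma_1,\gamma_2}|Du|(\operatorname{cl}U)$. $R$ is separably double-Lipschitz comparable if there are constants $R^a,R^s$ such that for every such $u,U,\gamma_1,\gamma_2$ and every Lipschitz $(m-1)$-graph $\Gamma$: $R(\gamma_{1\#}u)+R(\gamma_{2\#}u)-2R(u)\le R^aT_{\gamma_1,\gamma_2}|Du|(\operatorname{cl}U\setminus\Gamma)+R^s\big(|D\gamma_{1\#}u|(\gamma_1(\Gamma))+|D\gamma_{2\#}u|(\gamma_2(\Gamma))-2|Du|(\Gamma)\big)$. Admissible fidelity function on $\Omega$: $\phi:\mathbb{R}\to[0,\infty]$ convex, lower semicontinuous, $\phi(0)=0$, $\phi(-t)=\phi(t)$, and for some $C>0$, $\|u\|_{L^1(\Omega)}\le C(\int_\Omega\phi(u(x))\,dx+1)$ for all $u\in L^1(\Omega)$. It is $p$-increasing if for some $C_\phi>0$, $\phi(x)-\phi(y)\le C_\phi(|x|-|y|)|x|^{p-1}$ for all $x,y\in\mathbb{R}$ (with $|x|^0=1$). *)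

theory Defs
  imports "HOL-Analysis.Analysis" "HOL-Probability.Essential_Supremum"
begin

text \<open>
  Functions on \<open>\<Omega> \<subseteq> \<real>\<^sup>m\<close> are total functions on \<open>real ^ 'n\<close>, of which only the values on \<open>\<Omega>\<close>
  matter; elements of \<open>L\<^sup>1(\<Omega>)\<close> are represented by integrable functions rather than by classes of
  functions that agree almost everywhere.
\<close>

definition L1 :: "(real ^ 'n) set \<Rightarrow> (real ^ 'n \<Rightarrow> real) set"
  where "L1 \<Omega> = {u. integrable (lebesgue_on \<Omega>) u}"

definition norm_L1 :: "(real ^ 'n) set \<Rightarrow> (real ^ 'n \<Rightarrow> real) \<Rightarrow> real"
  where "norm_L1 \<Omega> u = (\<integral>x. \<bar>u x\<bar> \<partial>lebesgue_on \<Omega>)"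

definition norm_Linf :: "(real ^ 'n) set \<Rightarrow> (real ^ 'n \<Rightarrow> real) \<Rightarrow> ereal"
  where "norm_Linf \<Omega> u = esssup (lebesgue_on \<Omega>) (\<lambda>x. ereal \<bar>u x\<bar>)"

subsection \<open>Test functions and total variation\<close>

definition partial_deriv :: "'n \<Rightarrow> (real ^ 'n \<Rightarrow> real) \<Rightarrow> real ^ 'n \<Rightarrow> real"
  where "partial_deriv i f x = frechet_derivative f (at x) (axis i 1)"

primrec C_k :: "nat \<Rightarrow> (real ^ 'n \<Rightarrow> real) \<Rightarrow> bool" where
  "C_k 0 f \<longleftrightarrow> continuous_on UNIV f"
| "C_k (Suc k) f \<longleftrightarrow> (\<forall>x. f differentiable (at x)) \<and> (\<forall>i. C_k k (partial_deriv i f))"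

text \<open>An element of \<open>C\<^sub>c\<^sup>\<infinity>(\<Omega>)\<close> is identified with its (smooth) extension by zero to \<open>\<real>\<^sup>m\<close>.\<close>

definition test_function :: "(real ^ 'n) set \<Rightarrow> (real ^ 'n \<Rightarrow> real) \<Rightarrow> bool"
  where "test_function \<Omega> \<phi> \<longleftrightarrow>
    (\<forall>k. C_k k \<phi>) \<and> compact (closure {x. \<phi> x \<noteq> 0}) \<and> closure {x. \<phi> x \<noteq> 0} \<subseteq> \<Omega>"

definition divergence :: "(real ^ 'n \<Rightarrow> real ^ 'n) \<Rightarrow> real ^ 'n \<Rightarrow> real"
  where "divergence \<phi> x = (\<Sum>i\<in>UNIV. partial_deriv i (\<lambda>y. \<phi> y $ i) x)"

definition TV :: "(real ^ 'n) set \<Rightarrow> (real ^ 'n \<Rightarrow> real) \<Rightarrow> ereal"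
  where "TV \<Omega> u =
    (SUP \<phi> \<in> {\<phi>. (\<forall>i. test_function \<Omega> (\<lambda>x. \<phi> x $ i)) \<and> (\<forall>x. norm (\<phi> x) \<le> 1)}.
       ereal (\<integral>x. u x * divergence \<phi> x \<partial>lebesgue_on \<Omega>))"

subsection \<open>Finite vector measures and BV\<close>

text \<open>
  A finite \<open>\<real>\<^sup>m\<close>-valued Borel measure on \<open>\<Omega>\<close> is a set function each component of which is the
  difference of two finite positive Borel measures. Since \<open>measure M A = 0\<close> for \<open>A \<notin> sets M\<close>, it
  vanishes on sets that are not Borel subsets of \<open>\<Omega>\<close>.
\<close>

definition vm_decomposition ::
  "(real ^ 'n) set \<Rightarrow> ((real ^ 'n) set \<Rightarrow> real ^ 'n) \<Rightarrow>
   ('n \<Rightarrow> (real ^ 'n) measure) \<Rightarrow> ('n \<Rightarrow> (real ^ 'n) measure) \<Rightarrow> bool"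
  where "vm_decomposition \<Omega> \<mu> P N \<longleftrightarrow>
    (\<forall>i. finite_measure (P i) \<and> sets (P i) = sets (restrict_space borel \<Omega>) \<and>
         finite_measure (N i) \<and> sets (N i) = sets (restrict_space borel \<Omega>)) \<and>
    \<mu> = (\<lambda>A. \<chi> i. measure (P i) A - measure (N i) A)"

definition vector_measure :: "(real ^ 'n) set \<Rightarrow> ((real ^ 'n) set \<Rightarrow> real ^ 'n) \<Rightarrow> bool"
  where "vector_measure \<Omega> \<mu> \<longleftrightarrow> (\<exists>P N. vm_decomposition \<Omega> \<mu> P N)"

text \<open>The integral of a bounded Borel function does not depend on the decomposition.\<close>

definition vm_integral ::
  "(real ^ 'n) set \<Rightarrow> ((real ^ 'n) set \<Rightarrow> real ^ 'n) \<Rightarrow> (real ^ 'n \<Rightarrow> real) \<Rightarrow> real ^ 'n"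
  where "vm_integral \<Omega> \<mu> \<phi> =
    (SOME v. \<exists>P N. vm_decomposition \<Omega> \<mu> P N \<and> v = (\<chi> i. (\<integral>x. \<phi> x \<partial>P i) - (\<integral>x. \<phi> x \<partial>N i)))"

definition vm_variation ::
  "(real ^ 'n) set \<Rightarrow> ((real ^ 'n) set \<Rightarrow> real ^ 'n) \<Rightarrow> (real ^ 'n) set \<Rightarrow> ennreal"
  where "vm_variation \<Omega> \<mu> A =
    (SUP E \<in> {E :: nat \<Rightarrow> (real ^ 'n) set. range E \<subseteq> sets (restrict_space borel \<Omega>) \<and>
                disjoint_family E \<and> (\<Union>k. E k) = A}.
       \<Sum>k. ennreal (norm (\<mu> (E k))))"

definition has_gradient_measure ::
  "(real ^ 'n) set \<Rightarrow> (real ^ 'n \<Rightarrow> real) \<Rightarrow> ((real ^ 'n) set \<Rightarrow> real ^ 'n) \<Rightarrow> bool"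
  where "has_gradient_measure \<Omega> u \<mu> \<longleftrightarrow> vector_measure \<Omega> \<mu> \<and>
    (\<forall>\<phi> i. test_function \<Omega> \<phi> \<longrightarrow>
       (\<integral>x. u x * partial_deriv i \<phi> x \<partial>lebesgue_on \<Omega>) = - (vm_integral \<Omega> \<mu> \<phi> $ i))"

definition BV :: "(real ^ 'n) set \<Rightarrow> (real ^ 'n \<Rightarrow> real) set"
  where "BV \<Omega> = {u \<in> L1 \<Omega>. \<exists>\<mu>. has_gradient_measure \<Omega> u \<mu>}"

text \<open>The gradient measure of \<open>u \<in> BV \<Omega>\<close> is unique if \<open>\<Omega>\<close> is open.\<close>

definition gradient_measure ::
  "(real ^ 'n) set \<Rightarrow> (real ^ 'n \<Rightarrow> real) \<Rightarrow> (real ^ 'n) set \<Rightarrow> real ^ 'n"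
  where "gradient_measure \<Omega> u = (SOME \<mu>. has_gradient_measure \<Omega> u \<mu>)"

text \<open>
  \<open>|Du|(A)\<close>, for Borel sets \<open>A\<close>. As \<open>|Du|\<close> lives on \<open>\<Omega>\<close>, the part of \<open>A\<close> outside \<open>\<Omega>\<close> is ignored;
  this is relevant for closures. The value is infinite for \<open>u \<notin> BV \<Omega>\<close>.
\<close>

definition Dvar :: "(real ^ 'n) set \<Rightarrow> (real ^ 'n \<Rightarrow> real) \<Rightarrow> (real ^ 'n) set \<Rightarrow> ereal"
  where "Dvar \<Omega> u A =
    (if u \<in> BV \<Omega> then enn2ereal (vm_variation \<Omega> (gradient_measure \<Omega> u) (A \<inter> \<Omega>)) else \<infinity>)"

text \<open>\<open>C\<^sub>0(\<Omega>)\<close>, the uniform closure of \<open>C\<^sub>c(\<Omega>)\<close>.\<close>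

definition C0 :: "(real ^ 'n) set \<Rightarrow> (real ^ 'n \<Rightarrow> real) set"
  where "C0 \<Omega> = {\<phi>. continuous_on \<Omega> \<phi> \<and>
    (\<forall>\<epsilon>>0. \<exists>K. compact K \<and> K \<subseteq> \<Omega> \<and> (\<forall>x\<in>\<Omega> - K. \<bar>\<phi> x\<bar> < \<epsilon>))}"

definition weak_star_BV ::
  "(real ^ 'n) set \<Rightarrow> (nat \<Rightarrow> real ^ 'n \<Rightarrow> real) \<Rightarrow> (real ^ 'n \<Rightarrow> real) \<Rightarrow> bool"
  where "weak_star_BV \<Omega> us u \<longleftrightarrow>
    (\<forall>k. us k \<in> BV \<Omega>) \<and> u \<in> BV \<Omega> \<and>
    (\<lambda>k. norm_L1 \<Omega> (\<lambda>x. us k x - u x)) \<longlonglongrightarrow> 0 \<and>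
    (\<forall>\<phi>\<in>C0 \<Omega>. (\<lambda>k. vm_integral \<Omega> (gradient_measure \<Omega> (us k)) \<phi>)
                 \<longlonglongrightarrow> vm_integral \<Omega> (gradient_measure \<Omega> u) \<phi>)"

subsection \<open>Admissible regularisation functionals\<close>

text \<open>The second conjunct says that \<open>R\<close> is well defined on \<open>L\<^sup>1(\<Omega>)\<close>.\<close>

definition admissible_regularisation ::
  "(real ^ 'n) set \<Rightarrow> ((real ^ 'n \<Rightarrow> real) \<Rightarrow> ereal) \<Rightarrow> bool"
  where "admissible_regularisation \<Omega> R \<longleftrightarrow>
    (\<forall>u\<in>L1 \<Omega>. R u \<noteq> -\<infinity>) \<and>
    (\<forall>u\<in>L1 \<Omega>. \<forall>v\<in>L1 \<Omega>. (AE x in lebesgue_on \<Omega>. u x = v x) \<longrightarrow> R u = R v) \<and>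
    (\<forall>u\<in>L1 \<Omega>. \<forall>v\<in>L1 \<Omega>. \<forall>t\<in>{0..1}.
       R (\<lambda>x. (1 - t) * u x + t * v x) \<le> ereal (1 - t) * R u + ereal t * R v) \<and>
    (\<forall>us u. weak_star_BV \<Omega> us u \<longrightarrow> R u \<le> liminf (\<lambda>k. R (us k))) \<and>
    (\<exists>C>0. \<forall>u\<in>L1 \<Omega>. Dvar \<Omega> u \<Omega> \<le> ereal C * (1 + ereal (norm_L1 \<Omega> u) + R u))"

subsection \<open>Lipschitz transformations\<close>

definition lipschitz_graph :: "(real ^ 'n) set \<Rightarrow> bool"
  where "lipschitz_graph \<Gamma> \<longleftrightarrow>
    (\<exists>z V f L. norm z = 1 \<and> openin (top_of_set {v. z \<bullet> v = 0}) V \<and>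
       L-lipschitz_on V (f :: real ^ 'n \<Rightarrow> real) \<and> \<Gamma> = (\<lambda>v. v + f v *\<^sub>R z) ` V)"

text \<open>In the sequel \<open>inv_into \<Omega> \<gamma>\<close> is the inverse of the bijection \<open>\<gamma> : \<Omega> \<rightarrow> \<Omega>\<close>.\<close>

definition lip_trans :: "(real ^ 'n) set \<Rightarrow> (real ^ 'n \<Rightarrow> real ^ 'n) set"
  where "lip_trans \<Omega> = {\<gamma>. bij_betw \<gamma> \<Omega> \<Omega> \<and>
    (\<exists>L. L-lipschitz_on \<Omega> \<gamma>) \<and> (\<exists>L. L-lipschitz_on \<Omega> (inv_into \<Omega> \<gamma>)) \<and>
    (\<forall>S\<subseteq>\<Omega>. negligible S \<longrightarrow> negligible (\<gamma> ` S) \<and> negligible (inv_into \<Omega> \<gamma> ` S))}"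

definition lip_trans_on ::
  "(real ^ 'n) set \<Rightarrow> (real ^ 'n) set \<Rightarrow> (real ^ 'n \<Rightarrow> real ^ 'n) set"
  where "lip_trans_on \<Omega> U = {\<gamma> \<in> lip_trans \<Omega>. \<forall>x\<in>\<Omega> - U. \<gamma> x = x}"

definition push ::
  "(real ^ 'n) set \<Rightarrow> (real ^ 'n \<Rightarrow> real ^ 'n) \<Rightarrow> (real ^ 'n \<Rightarrow> real) \<Rightarrow> real ^ 'n \<Rightarrow> real"
  where "push \<Omega> \<gamma> u = u \<circ> inv_into \<Omega> \<gamma>"

definition grad :: "(real ^ 'n \<Rightarrow> real ^ 'n) \<Rightarrow> real ^ 'n \<Rightarrow> real ^ 'n ^ 'n"
  where "grad \<gamma> x = transpose (jacobian \<gamma> (at x))"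

definition Jac :: "(real ^ 'n \<Rightarrow> real ^ 'n) \<Rightarrow> real ^ 'n \<Rightarrow> real"
  where "Jac \<gamma> x = \<bar>det (grad \<gamma> x)\<bar>"

definition A_mat :: "(real ^ 'n) set \<Rightarrow> (real ^ 'n \<Rightarrow> real ^ 'n) \<Rightarrow> real ^ 'n \<Rightarrow> real ^ 'n ^ 'n"
  where "A_mat \<Omega> \<gamma> x = Jac \<gamma> x *\<^sub>R grad (inv_into \<Omega> \<gamma>) (\<gamma> x)"

definition diff_pts :: "(real ^ 'n) set \<Rightarrow> (real ^ 'n \<Rightarrow> real ^ 'n) \<Rightarrow> (real ^ 'n) set"
  where "diff_pts \<Omega> \<gamma> = {x \<in> \<Omega>. \<gamma> differentiable (at x)}"

definition inv_diff_pts :: "(real ^ 'n) set \<Rightarrow> (real ^ 'n \<Rightarrow> real ^ 'n) \<Rightarrow> (real ^ 'n) set"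
  where "inv_diff_pts \<Omega> \<gamma> = {x \<in> \<Omega>. inv_into \<Omega> \<gamma> differentiable (at (\<gamma> x))}"

text \<open>
  For \<open>\<gamma>\<^sub>1, \<gamma>\<^sub>2 \<in> lip_trans \<Omega>\<close> with \<open>\<Omega>\<close> open, bounded and nonempty, the sets over which the following
  real suprema are taken are nonempty (by Rademacher's theorem) and bounded.
\<close>

definition G_dist ::
  "(real ^ 'n) set \<Rightarrow> (real ^ 'n \<Rightarrow> real ^ 'n) \<Rightarrow> (real ^ 'n \<Rightarrow> real ^ 'n) \<Rightarrow> real"
  where "G_dist \<Omega> \<gamma>\<^sub>1 \<gamma>\<^sub>2 =
    (SUP (x, v) \<in> (diff_pts \<Omega> \<gamma>\<^sub>1 \<inter> diff_pts \<Omega> \<gamma>\<^sub>2 \<inter> inv_diff_pts \<Omega> \<gamma>\<^sub>1 \<inter> inv_diff_pts \<Omega> \<gamma>\<^sub>2)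
                  \<times> {v. norm v = 1}.
       norm (A_mat \<Omega> \<gamma>\<^sub>1 x *v v) + norm (A_mat \<Omega> \<gamma>\<^sub>2 x *v v) - 2 * norm v)"

definition J_dist ::
  "(real ^ 'n) set \<Rightarrow> (real ^ 'n \<Rightarrow> real ^ 'n) \<Rightarrow> (real ^ 'n \<Rightarrow> real ^ 'n) \<Rightarrow> real"
  where "J_dist \<Omega> \<gamma>\<^sub>1 \<gamma>\<^sub>2 =
    (SUP x \<in> diff_pts \<Omega> \<gamma>\<^sub>1 \<inter> diff_pts \<Omega> \<gamma>\<^sub>2. \<bar>Jac \<gamma>\<^sub>1 x + Jac \<gamma>\<^sub>2 x - 2\<bar>)"

definition D_dist :: "(real ^ 'n) set \<Rightarrow> (real ^ 'n \<Rightarrow> real ^ 'n) \<Rightarrow> real"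
  where "D_dist \<Omega> \<gamma> =
    (SUP x \<in> inv_diff_pts \<Omega> \<gamma>. onorm (\<lambda>v. (grad (inv_into \<Omega> \<gamma>) (\<gamma> x) - mat 1) *v v))"

definition T_dist ::
  "(real ^ 'n) set \<Rightarrow> (real ^ 'n \<Rightarrow> real ^ 'n) \<Rightarrow> (real ^ 'n \<Rightarrow> real ^ 'n) \<Rightarrow> real"
  where "T_dist \<Omega> \<gamma>\<^sub>1 \<gamma>\<^sub>2 =
    G_dist \<Omega> \<gamma>\<^sub>1 \<gamma>\<^sub>2 + J_dist \<Omega> \<gamma>\<^sub>1 \<gamma>\<^sub>2 + (D_dist \<Omega> \<gamma>\<^sub>1)\<^sup>2 + (D_dist \<Omega> \<gamma>\<^sub>2)\<^sup>2"

text \<open>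
  In the two comparability conditions the term \<open>2 R(u)\<close> is moved to the right-hand side, so that no
  difference \<open>\<infinity> - \<infinity>\<close> occurs if \<open>R u\<close> is infinite.
\<close>

definition double_lipschitz_comparable ::
  "(real ^ 'n) set \<Rightarrow> ((real ^ 'n \<Rightarrow> real) \<Rightarrow> ereal) \<Rightarrow> bool"
  where "double_lipschitz_comparable \<Omega> R \<longleftrightarrow>
    (\<exists>Ra :: real. \<forall>u\<in>BV \<Omega>. \<forall>U \<gamma>\<^sub>1 \<gamma>\<^sub>2.
       open U \<and> U \<subseteq> \<Omega> \<and> \<gamma>\<^sub>1 \<in> lip_trans_on \<Omega> U \<and> \<gamma>\<^sub>2 \<in> lip_trans_on \<Omega> U \<and> T_dist \<Omega> \<gamma>\<^sub>1 \<gamma>\<^sub>2 < 1 \<longrightarrow>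
       R (push \<Omega> \<gamma>\<^sub>1 u) + R (push \<Omega> \<gamma>\<^sub>2 u)
         \<le> 2 * R u + ereal (Ra * T_dist \<Omega> \<gamma>\<^sub>1 \<gamma>\<^sub>2) * Dvar \<Omega> u (closure U))"

text \<open>
  As the transformations are only defined on \<open>\<Omega>\<close>, the image of \<open>\<Gamma>\<close> under \<open>\<gamma>\<close> is that of \<open>\<Gamma> \<inter> \<Omega>\<close>,
  which is again a Lipschitz graph.
\<close>

definition separably_double_lipschitz_comparable ::
  "(real ^ 'n) set \<Rightarrow> ((real ^ 'n \<Rightarrow> real) \<Rightarrow> ereal) \<Rightarrow> bool"
  where "separably_double_lipschitz_comparable \<Omega> R \<longleftrightarrow>
    (\<exists>Ra Rs :: real. \<forall>u\<in>BV \<Omega>. \<forall>U \<gamma>\<^sub>1 \<gamma>\<^sub>2 \<Gamma>.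
       open U \<and> U \<subseteq> \<Omega> \<and> \<gamma>\<^sub>1 \<in> lip_trans_on \<Omega> U \<and> \<gamma>\<^sub>2 \<in> lip_trans_on \<Omega> U \<and> T_dist \<Omega> \<gamma>\<^sub>1 \<gamma>\<^sub>2 < 1 \<and>
       lipschitz_graph \<Gamma> \<longrightarrow>
       R (push \<Omega> \<gamma>\<^sub>1 u) + R (push \<Omega> \<gamma>\<^sub>2 u)
         \<le> 2 * R u + ereal (Ra * T_dist \<Omega> \<gamma>\<^sub>1 \<gamma>\<^sub>2) * Dvar \<Omega> u (closure U - \<Gamma>)
           + ereal Rs * (Dvar \<Omega> (push \<Omega> \<gamma>\<^sub>1 u) (\<gamma>\<^sub>1 ` (\<Gamma> \<inter> \<Omega>))
                         + Dvar \<Omega> (push \<Omega> \<gamma>\<^sub>2 u) (\<gamma>\<^sub>2 ` (\<Gamma> \<inter> \<Omega>)) - 2 * Dvar \<Omega> u \<Gamma>))"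

subsection \<open>Fidelity functions and minimisers\<close>

definition fidelity :: "(real ^ 'n) set \<Rightarrow> (real \<Rightarrow> ennreal) \<Rightarrow> (real ^ 'n \<Rightarrow> real) \<Rightarrow> ennreal"
  where "fidelity \<Omega> \<phi> w = (\<integral>\<^sup>+x. \<phi> (w x) \<partial>lebesgue_on \<Omega>)"

definition admissible_fidelity :: "(real ^ 'n) set \<Rightarrow> (real \<Rightarrow> ennreal) \<Rightarrow> bool"
  where "admissible_fidelity \<Omega> \<phi> \<longleftrightarrow>
    (\<forall>x y. \<forall>t\<in>{0..1}. \<phi> ((1 - t) * x + t * y) \<le> ennreal (1 - t) * \<phi> x + ennreal t * \<phi> y) \<and>
    (\<forall>x. \<phi> x \<le> Liminf (at x) \<phi>) \<and>
    \<phi> 0 = 0 \<and> (\<forall>t. \<phi> (- t) = \<phi> t) \<and>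
    (\<exists>C>0. \<forall>u\<in>L1 \<Omega>. ennreal (norm_L1 \<Omega> u) \<le> ennreal C * (fidelity \<Omega> \<phi> u + 1))"

text \<open>The case \<open>p = 1\<close> is separate because of \<open>0 powr 0 = 0\<close>.\<close>

definition p_increasing :: "real \<Rightarrow> (real \<Rightarrow> ennreal) \<Rightarrow> bool"
  where "p_increasing p \<phi> \<longleftrightarrow>
    (\<exists>C>0. \<forall>x y. enn2ereal (\<phi> x) - enn2ereal (\<phi> y)
       \<le> ereal (C * (\<bar>x\<bar> - \<bar>y\<bar>) * (if p = 1 then 1 else \<bar>x\<bar> powr (p - 1))))"

definition objective ::
  "(real ^ 'n) set \<Rightarrow> (real \<Rightarrow> ennreal) \<Rightarrow> ((real ^ 'n \<Rightarrow> real) \<Rightarrow> ereal) \<Rightarrow>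
   (real ^ 'n \<Rightarrow> real) \<Rightarrow> (real ^ 'n \<Rightarrow> real) \<Rightarrow> ereal"
  where "objective \<Omega> \<phi> R f u = enn2ereal (fidelity \<Omega> \<phi> (\<lambda>x. f x - u x)) + R u"

definition solution ::
  "(real ^ 'n) set \<Rightarrow> (real \<Rightarrow> ennreal) \<Rightarrow> ((real ^ 'n \<Rightarrow> real) \<Rightarrow> ereal) \<Rightarrow>
   (real ^ 'n \<Rightarrow> real) \<Rightarrow> (real ^ 'n \<Rightarrow> real) \<Rightarrow> bool"
  where "solution \<Omega> \<phi> R f u \<longleftrightarrow> u \<in> L1 \<Omega> \<and>
    (\<forall>v\<in>L1 \<Omega>. objective \<Omega> \<phi> R f u \<le> objective \<Omega> \<phi> R f v) \<and> \<bar>objective \<Omega> \<phi> R f u\<bar> \<noteq> \<infinity>"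

end

theory Submission
  imports Defs "HOL-Probability.Helly_Selection"
begin

text \<open>
  A function of finite total variation is BV because the gradients of its mollifications are weakly
  compact; Helly's theorem, transported along a space-filling curve, replaces the Riesz representation
  theorem.

  For a mollification \<open>w\<close> of \<open>u\<close>, Rademacher's theorem and the change of variables give
  \<open>TV(\<gamma>\<^sub>1\<^sub># w) + TV(\<gamma>\<^sub>2\<^sub># w) = \<integral> |A\<^sub>1 \<nabla>w| + |A\<^sub>2 \<nabla>w| \<le> \<integral> (2 + G 1\<^bsub>cl U\<^esub>) |\<nabla>w|\<close>, as \<open>\<gamma>\<^sub>i\<close> is the
  identity outside of \<open>cl U\<close>. The weight is upper semicontinuous on \<open>\<Omega>\<close>, as \<open>G \<ge> 0\<close> unless \<open>\<Omega> \<subseteq> cl U\<close>, so the estimate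
  passes to \<open>u\<close>, first on open sets, then by outer regularity on Borel sets such as \<open>\<Omega> - \<Gamma>\<close>;
  hence \<open>\<alpha>\<close> serves for both \<open>R\<^sup>a\<close> and \<open>R\<^sup>s\<close>.

  Truncating \<open>u\<close> at \<open>\<plusminus>\<parallel>f\<parallel>\<^sub>\<infinity>\<close> does not increase TV and decreases the fidelity strictly
  unless \<open>|u| \<le> \<parallel>f\<parallel>\<^sub>\<infinity>\<close> almost everywhere, because a \<open>p\<close>-increasing \<open>\<phi>\<close> is finite and strictly increasing in \<open>|t|\<close>.
\<close>

subsection \<open>Smooth functions\<close>

text \<open>\<open>G_dist\<close> is a supremum over points where the derivatives exist, so it
  bounds something almost everywhere only through Rademacher's theorem and the null-set condition on
  the transformations. A BV function has no gradient at these points to which \<open>A_mat\<close>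
  could be applied; mollifications have one, and its norm is at most the mollified variation measure
  of \<open>u\<close>. Mollifying smears mass across the boundary of cl U, where the weight of the
  estimate jumps. The limit is under control because the jump goes upwards on the closed side.

  What \<open>G_dist\<close> controls is the sum |A1 v| + |A2 v|, not its terms, so both
  transformations are treated in one integral over the same point x. The two test fields live on the
  different images of an open set W, and their supports are pulled back to one compact subset of W.

  On \<Gamma> nothing is estimated: the transformations are bijections, so the variations split
  exactly into the parts over \<Gamma> and over its complement. The estimate is applied to the
  complement, and the parts over \<Gamma> are what the separated condition keeps. The plain
  condition is the case of empty \<Gamma>.\<close>

abbreviation gradient :: "(real^'n \<Rightarrow> real) \<Rightarrow> real^'n \<Rightarrow> real^'n"
  where "gradient f x \<equiv> \<chi> i. partial_deriv i f x"

abbreviation div_pairing :: "(real^'n) set \<Rightarrow> (real^'n \<Rightarrow> real) \<Rightarrow> (real^'n \<Rightarrow> real^'n) \<Rightarrow> real"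
  where "div_pairing \<Omega> u \<phi> \<equiv> \<integral>x. u x * divergence \<phi> x \<partial>lebesgue_on \<Omega>"

abbreviation partial_pairing :: "(real^'n) set \<Rightarrow> (real^'n \<Rightarrow> real) \<Rightarrow> 'n \<Rightarrow> (real^'n \<Rightarrow> real) \<Rightarrow> real"
  where "partial_pairing \<Omega> u i \<phi> \<equiv> \<integral>x. u x * partial_deriv i \<phi> x \<partial>lebesgue_on \<Omega>"

lemma partial_deriv_eq:
  assumes "(f has_derivative f') (at x)"
  shows "partial_deriv i f x = f' (axis i 1)"
  unfolding partial_deriv_def using frechet_derivative_at[OF assms] by simp

lemma has_derivative_partial_deriv:
  fixes f :: "real^'n \<Rightarrow> real"
  assumes "f differentiable (at x)"
  shows "(f has_derivative (\<lambda>h. \<Sum>i\<in>UNIV. h $ i * partial_deriv i f x)) (at x)"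
proof -
  let ?D = "frechet_derivative f (at x)"
  have D: "(f has_derivative ?D) (at x)" using assms frechet_derivative_works by blast
  hence lin: "linear ?D" using has_derivative_linear by blast
  have "?D h = (\<Sum>i\<in>UNIV. h $ i * partial_deriv i f x)" for h
  proof -
    have "?D h = ?D (\<Sum>i\<in>UNIV. h $ i *\<^sub>R axis i 1)" by (simp add: basis_expansion flip: scalar_mult_eq_scaleR)
    also have "... = (\<Sum>i\<in>UNIV. h $ i * partial_deriv i f x)" by (simp add: linear_sum[OF lin] linear_scale[OF lin] partial_deriv_def)
    finally show ?thesis .
  qed
  hence "?D = (\<lambda>h. \<Sum>i\<in>UNIV. h $ i * partial_deriv i f x)" by auto
  with D show ?thesis by simp
qed

text \<open>The functions have the same derivatives at \<open>x\<close>, so the choice operator in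
  \<open>frechet_derivative\<close> picks the same value for both. This covers points of
  non-differentiability as well.\<close>

lemma partial_deriv_transform:
  assumes "open S" "x \<in> S" "\<And>y. y \<in> S \<Longrightarrow> f y = g y"
  shows "partial_deriv i f x = partial_deriv i g x"
proof -
  have "(f has_derivative f') (at x) \<longleftrightarrow> (g has_derivative f') (at x)" for f' using assms by (metis has_derivative_transform_within_open)
  thus ?thesis
    unfolding partial_deriv_def frechet_derivative_def by simp
qed

lemma C_k_continuous: "C_k k f \<Longrightarrow> continuous_on UNIV f"
proof (cases k)
  case (Suc k')
  assume "C_k k f"
  with Suc show ?thesis
    by (intro differentiable_imp_continuous_on) (auto simp: differentiable_on_def)
qed simp

lemma C_k_SucD: "C_k (Suc k) f \<Longrightarrow> C_k k f"
proof (induction k arbitrary: f)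
  case 0 thus ?case using C_k_continuous[OF 0] by (metis C_k.simps(1))
next
  case (Suc k) thus ?case by (metis C_k.simps(2))
qed

lemma C_k_const: "C_k k (\<lambda>x. c)"
proof (induction k arbitrary: c)
  case (Suc k)
  have "partial_deriv i (\<lambda>x::real^'a. c) = (\<lambda>x. 0)" for i by (intro ext) (subst partial_deriv_eq[OF has_derivative_const], simp)
  with Suc show ?case by simp
qed simp

lemma C_k_add:
  assumes "C_k k f" "C_k k g" shows "C_k k (\<lambda>x. f x + g x)" using assms
proof (induction k arbitrary: f g)
  case 0 thus ?case by (auto intro: continuous_intros)
next
  case (Suc k)
  hence d: "f differentiable (at x)" "g differentiable (at x)" for x by auto
  have "partial_deriv i (\<lambda>x. f x + g x) = (\<lambda>x. partial_deriv i f x + partial_deriv i g x)" for i using frechet_derivative_works d partial_deriv_def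
    by (intro ext) (subst partial_deriv_eq[OF has_derivative_add], auto simp: partial_deriv_def frechet_derivative_works[symmetric])
  with Suc d show ?case by (auto intro: differentiable_add)
qed

lemma partial_deriv_mult:
  assumes "f differentiable (at x)" "g differentiable (at x)"
  shows "partial_deriv i (\<lambda>x. f x * g x) x = f x * partial_deriv i g x + partial_deriv i f x * g x"
  using assms
  by (subst partial_deriv_eq[OF has_derivative_mult]) (auto simp: partial_deriv_def frechet_derivative_works[symmetric])

lemma C_k_mult:
  assumes "C_k k f" "C_k k g" shows "C_k k (\<lambda>x. f x * g x)" using assms
proof (induction k arbitrary: f g)
  case 0 thus ?case by (auto intro: continuous_intros)
next
  case (Suc k)
  hence d: "f differentiable (at x)" "g differentiable (at x)" for x by auto
  have "C_k k f" "C_k k g" using Suc.prems C_k_SucD by auto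
  moreover have "C_k k (partial_deriv i f)" "C_k k (partial_deriv i g)" for i using Suc.prems by auto
  ultimately have "C_k k (\<lambda>x. f x * partial_deriv i g x + partial_deriv i f x * g x)" for i using Suc.IH by (intro C_k_add) auto
  moreover have "partial_deriv i (\<lambda>x. f x * g x) = (\<lambda>x. f x * partial_deriv i g x + partial_deriv i f x * g x)" for i
    using d by (intro ext partial_deriv_mult) auto
  ultimately show ?case using d by (auto intro: differentiable_mult)
qed

lemma C_k_cmult: "C_k k f \<Longrightarrow> C_k k (\<lambda>x. c * f x)" by (intro C_k_mult C_k_const)

lemma C_k_sum: "(\<And>j. j \<in> J \<Longrightarrow> C_k k (f j)) \<Longrightarrow> C_k k (\<lambda>x. \<Sum>j\<in>J. f j x)" by (induction J rule: infinite_finite_induct) (auto intro: C_k_add C_k_const)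

lemma C_k_component: "C_k k (\<lambda>x::real^'n. x $ j)"
proof (cases k)
  case (Suc k')
  have *: "((\<lambda>x. x $ j) has_derivative (\<lambda>h. h $ j)) (at x)" for x :: "real^'n"
    by (auto intro: derivative_intros bounded_linear_imp_has_derivative bounded_linear_vec_nth)
  hence "partial_deriv i (\<lambda>x. x $ j) = (\<lambda>x. axis i 1 $ j)" for i :: 'n using partial_deriv_eq[OF *] by (intro ext) simp
  thus ?thesis using * Suc C_k_const by (auto simp: differentiable_def)
qed (auto intro: continuous_intros)

lemma partial_deriv_reflect:
  assumes "f differentiable (at (a - x))"
  shows "partial_deriv i (\<lambda>y. f (a - y)) x = - partial_deriv i f (a - x)"
proof -
  let ?D = "frechet_derivative f (at (a - x))"
  have D: "(f has_derivative ?D) (at (a - x))" using assms frechet_derivative_works by blast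
  have "((\<lambda>y. f (a - y)) has_derivative (\<lambda>h. ?D (0 - h))) (at x)" by (rule has_derivative_compose[where g=f and f="\<lambda>y. a - y", OF _ D])
       (auto intro!: derivative_eq_intros)
  thus ?thesis using linear_neg[OF has_derivative_linear[OF D]]
    by (subst partial_deriv_eq) (auto simp: partial_deriv_def)
qed

lemma C_k_reflect: "C_k k f \<Longrightarrow> C_k k (\<lambda>y. f (a - y))"
proof (induction k arbitrary: f)
  case 0 thus ?case by (auto intro!: continuous_on_compose2[of UNIV f] continuous_intros)
next
  case (Suc k)
  hence d: "f differentiable (at x)" for x by auto
  have d2: "(\<lambda>y. f (a - y)) differentiable (at x)" for x using d[of "a - x"]
    by (rule differentiable_compose[of f "\<lambda>y. a - y"]) (auto intro!: derivative_intros)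
  have "partial_deriv i (\<lambda>y. f (a - y)) = (\<lambda>x. (-1) * partial_deriv i f (a - x))" for i using partial_deriv_reflect[OF d] by (intro ext) simp
  moreover have "C_k k (\<lambda>x. (-1) * partial_deriv i f (a - x))" for i using Suc by (intro C_k_cmult) auto
  ultimately show ?case using d2 by simp
qed

text \<open>The powers of \<open>t\<close> are carried along because the family is then closed under
  differentiation up to linear combinations (\<open>flat_exp_deriv\<close>), so that smoothness of
  the bump function is an induction over all \<open>n\<close> at once.\<close>

definition flat_exp :: "nat \<Rightarrow> real \<Rightarrow> real"
  where "flat_exp n t = (if t > 0 then exp (- (1 / t)) / t ^ n else 0)"

text \<open>With \<open>s = 1 / t\<close> the right-hand limit is that of
  \<open>s ^ n / exp s\<close> at infinity.\<close>

lemma flat_exp_tendsto: "(flat_exp n \<longlongrightarrow> 0) (at 0)"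
proof -
  have "((\<lambda>t. (inverse t) ^ n / exp (inverse t)) \<longlongrightarrow> 0) (at_right (0::real))"
    by (rule filterlim_compose[OF tendsto_power_div_exp_0 filterlim_inverse_at_top_right])
  hence "(flat_exp n \<longlongrightarrow> 0) (at_right 0)" by (rule Lim_transform_eventually)
      (auto simp: eventually_at_filter flat_exp_def exp_minus field_simps)
  moreover have "(flat_exp n \<longlongrightarrow> 0) (at_left 0)" by (rule tendsto_eventually) (auto simp: eventually_at_filter flat_exp_def)
  ultimately show ?thesis by (simp add: filterlim_split_at)
qed

lemma flat_exp_deriv:
  "(flat_exp n has_real_derivative flat_exp (n + 2) t - n * flat_exp (n + 1) t) (at t)"
proof -
  consider "t > 0" | "t = 0" | "t < 0" by linarith
  thus ?thesis
  proof cases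
    case 1
    have "((\<lambda>t. exp (- (1 / t)) / t ^ n) has_real_derivative flat_exp (n + 2) t - n * flat_exp (n + 1) t) (at t)"
    proof -
      have "((\<lambda>t. exp (- (1 / t)) / t ^ n) has_real_derivative
          (exp (- (1 / t)) * (1 / t\<^sup>2) * t ^ n - exp (- (1 / t)) * (real n * t ^ (n - 1))) / (t ^ n * t ^ n)) (at t)"
        using 1 by (auto intro!: derivative_eq_intros simp: power2_eq_square)
      moreover have e: "real n * t ^ (n - 1) = real n * t ^ n / t" using 1 by (cases n) auto
      moreover have "(exp (- (1 / t)) * (1 / t\<^sup>2) * t ^ n - exp (- (1 / t)) * (real n * t ^ (n - 1))) / (t ^ n * t ^ n)
          = flat_exp (n + 2) t - n * flat_exp (n + 1) t" unfolding e using 1 by (simp add: flat_exp_def field_simps power2_eq_square)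
      ultimately show ?thesis by simp
    qed
    thus ?thesis
      using 1 by (subst DERIV_cong_ev[OF refl _ refl, where g="\<lambda>t. exp (- (1 / t)) / t ^ n"])
        (auto simp: flat_exp_def intro!: eventually_mono[OF eventually_nhds_in_open[of "{0<..}"]])
  next
    case 3
    thus ?thesis
      by (subst DERIV_cong_ev[OF refl _ refl, where g="\<lambda>t. 0"])
        (auto simp: flat_exp_def intro!: eventually_mono[OF eventually_nhds_in_open[of "{..<0}"]])
  next
    case 2
    \<comment> \<open>The difference quotient of \<open>flat_exp n\<close> at 0 is
      \<open>flat_exp (Suc n)\<close>, whose limit is known.\<close>
    have "((\<lambda>h. (flat_exp n (0 + h) - flat_exp n 0) / h) \<longlongrightarrow> 0) (at 0)" by (rule Lim_transform_eventually[OF flat_exp_tendsto[of "Suc n"]])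
        (auto simp: flat_exp_def eventually_at_filter)
    thus ?thesis using 2 by (simp add: DERIV_def flat_exp_def)
  qed
qed

lemma C_k_flat_exp: "C_k k (\<lambda>x::real^'n. flat_exp n (c - x \<bullet> x))"
proof (induction k arbitrary: n)
  case 0
  have "continuous_on UNIV (flat_exp n)" using flat_exp_deriv[THEN DERIV_isCont] by (simp add: continuous_on_eq_continuous_at)
  thus ?case by (auto intro!: continuous_on_compose2[of UNIV "flat_exp n"] continuous_intros)
next
  case (Suc k)
  let ?f = "\<lambda>x::real^'n. flat_exp n (c - x \<bullet> x)"
  let ?g = "\<lambda>x::real^'n. flat_exp (n + 2) (c - x \<bullet> x) + (- real n) * flat_exp (n + 1) (c - x \<bullet> x)"
  have d: "(?f has_derivative (\<lambda>h. - (2 * (x \<bullet> h)) * ?g x)) (at x)" for x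
    by (rule has_derivative_eq_rhs, rule has_derivative_compose[where g="flat_exp n" and f="\<lambda>x. c - x \<bullet> x", OF _ flat_exp_deriv[unfolded has_field_derivative_def]])
      (auto intro!: derivative_eq_intros simp: fun_eq_iff inner_commute algebra_simps)
  hence "partial_deriv i ?f = (\<lambda>x. ((-2) * x $ i) * ?g x)" for i by (intro ext) (subst partial_deriv_eq[OF d], simp add: inner_axis)
  moreover have "C_k k (\<lambda>x. ((-2) * x $ i) * ?g x)" for i using Suc by (intro C_k_mult C_k_add C_k_cmult C_k_component C_k_const) auto
  ultimately show ?case using d by (auto simp: differentiable_def)
qed

text \<open>The radius of the support is explicit because it is compared with distances to the
  boundary of \<Omega>, and it does not grow under partial derivatives.\<close>

definition smooth_ball :: "real \<Rightarrow> (real^'n \<Rightarrow> real) \<Rightarrow> bool"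
  where "smooth_ball e r \<longleftrightarrow> (\<forall>k. C_k k r) \<and> (\<forall>x. norm x > e \<longrightarrow> r x = 0)"

lemma smooth_ball_differentiable: "smooth_ball e r \<Longrightarrow> r differentiable (at x)" unfolding smooth_ball_def by (metis C_k.simps(2))

lemma smooth_ball_continuous: "smooth_ball e r \<Longrightarrow> continuous_on UNIV r" unfolding smooth_ball_def using C_k_continuous by blast

lemma smooth_ball_partial_deriv:
  assumes "smooth_ball e r" shows "smooth_ball e (partial_deriv i r)"
proof -
  have "C_k k (partial_deriv i r)" for k using assms unfolding smooth_ball_def by (metis C_k.simps(2))
  moreover have "partial_deriv i r x = 0" if "norm x > e" for x
  proof -
    have "partial_deriv i r x = partial_deriv i (\<lambda>x. 0) x"
    proof (rule partial_deriv_transform)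
      show "open {x. norm x > e}" by (intro open_Collect_less continuous_intros)
    qed (use assms that in \<open>auto simp: smooth_ball_def\<close>)
    also have "... = 0" by (subst partial_deriv_eq[OF has_derivative_const]) simp
    finally show ?thesis .
  qed
  ultimately show ?thesis unfolding smooth_ball_def by auto
qed

lemma continuous_compact_support_bounded:
  fixes r :: "'a::euclidean_space \<Rightarrow> real"
  assumes c: "continuous_on UNIV r" and s: "\<And>x. norm x > e \<Longrightarrow> r x = 0"
  obtains B where "B > 0" "\<And>x. \<bar>r x\<bar> \<le> B"
proof -
  have "compact (r ` cball 0 e)" by (intro compact_continuous_image continuous_on_subset[OF c]) auto
  then obtain B where B: "\<And>x. x \<in> cball 0 e \<Longrightarrow> \<bar>r x\<bar> \<le> B" using compact_imp_bounded bounded_real by (metis imageI)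
  have "\<bar>r x\<bar> \<le> max B 1" for x using B[of x] s[of x] by (cases "norm x > e") auto
  thus ?thesis using that[of "max B 1"] by auto
qed

text \<open>Two points at distance less than 1 either both lie in the ball of radius
  \<open>e + 1\<close>, where compactness applies, or both lie outside of the support.\<close>

lemma continuous_compact_support_uniformly_continuous:
  fixes r :: "'a::euclidean_space \<Rightarrow> real"
  assumes c: "continuous_on UNIV r" and s: "\<And>x. norm x > e \<Longrightarrow> r x = 0" and "d > 0"
  obtains d' where "d' > 0" "\<And>x y. dist x y < d' \<Longrightarrow> \<bar>r x - r y\<bar> < d"
proof -
  have "uniformly_continuous_on (cball 0 (e + 1)) r" by (intro compact_uniformly_continuous continuous_on_subset[OF c]) auto
  then obtain d1 where d1: "d1 > 0"
    "\<And>x y. x \<in> cball 0 (e + 1) \<Longrightarrow> y \<in> cball 0 (e + 1) \<Longrightarrow> dist y x < d1 \<Longrightarrow> dist (r y) (r x) < d" using \<open>d > 0\<close> unfolding uniformly_continuous_on_def by meson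
  have "\<bar>r x - r y\<bar> < d" if "dist x y < min d1 1" for x y
  proof (cases "norm x \<le> e \<or> norm y \<le> e")
    case True
    moreover have "\<bar>norm x - norm y\<bar> < 1" using that norm_triangle_ineq3[of x y] by (simp add: dist_norm)
    ultimately have "x \<in> cball 0 (e + 1)" "y \<in> cball 0 (e + 1)" by auto
    thus ?thesis using d1(2)[of y x] that by (auto simp: dist_real_def)
  next
    case False thus ?thesis using s \<open>d > 0\<close> by simp
  qed
  thus ?thesis using that[of "min d1 1"] \<open>d1 > 0\<close> by auto
qed

lemma continuous_compact_support_integrable:
  fixes r :: "'a::euclidean_space \<Rightarrow> real"
  assumes c: "continuous_on UNIV r" and s: "\<And>x. norm x > e \<Longrightarrow> r x = 0"
  shows "integrable lborel r"
proof -
  have "set_integrable lborel (cball 0 e) r" unfolding set_integrable_def by (rule borel_integrable_compact) (auto intro: continuous_on_subset[OF c])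
  moreover have "(\<lambda>x. indicator (cball 0 e) x *\<^sub>R r x) = r" using s by (force simp: indicator_def)
  ultimately show ?thesis unfolding set_integrable_def by simp
qed

text \<open>Mean value theorem on the segment from \<open>z\<close> to \<open>z + h\<close>, with
  uniform continuity of the partial derivatives. The point is that \<open>d'\<close> does not depend
  on \<open>z\<close>, so the estimate can be integrated in
  \<open>conv_has_derivative\<close>.\<close>

lemma smooth_ball_taylor:
  fixes r :: "real^'n \<Rightarrow> real"
  assumes r: "smooth_ball e r" and "d > 0"
  obtains d' where "d' > 0"
    "\<And>z h. norm h < d' \<Longrightarrow> \<bar>r (z + h) - r z - (\<Sum>i\<in>UNIV. h $ i * partial_deriv i r z)\<bar> \<le> d * norm h"
proof -
  let ?c = "d / CARD('n)"
  have "?c > 0" using \<open>d > 0\<close> by simp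
  have "\<exists>d'>0. \<forall>x y. dist x y < d' \<longrightarrow> \<bar>partial_deriv i r x - partial_deriv i r y\<bar> < ?c" for i
  proof -
    have p: "smooth_ball e (partial_deriv i r)" by (rule smooth_ball_partial_deriv[OF r])
    hence "norm x > e \<Longrightarrow> partial_deriv i r x = 0" for x unfolding smooth_ball_def by blast
    from continuous_compact_support_uniformly_continuous[OF smooth_ball_continuous[OF p] this \<open>?c > 0\<close>]
    show ?thesis by blast
  qed
  hence "\<forall>i. \<exists>d'>0. \<forall>x y. dist x y < d' \<longrightarrow> \<bar>partial_deriv i r x - partial_deriv i r y\<bar> < ?c" by blast
  from choice[OF this] obtain dd where dd: "\<And>i. dd i > 0"
    "\<And>i x y. dist x y < dd i \<Longrightarrow> \<bar>partial_deriv i r x - partial_deriv i r y\<bar> < ?c" by blast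
  let ?d = "Min (range dd)"
  have "?d > 0" using dd(1) by auto
  moreover have "\<bar>r (z + h) - r z - (\<Sum>i\<in>UNIV. h $ i * partial_deriv i r z)\<bar> \<le> d * norm h"
    if h: "norm h < ?d" for z h
  proof -
    have der: "((\<lambda>t. r (z + t *\<^sub>R h)) has_derivative
        (\<lambda>s. \<Sum>i\<in>UNIV. (s *\<^sub>R h) $ i * partial_deriv i r (z + t *\<^sub>R h))) (at t within {0..1})" for t
      by (rule has_derivative_compose[where g=r and f="\<lambda>t. z + t *\<^sub>R h", OF _ has_derivative_partial_deriv[OF smooth_ball_differentiable[OF r]]])
         (auto intro!: derivative_eq_intros)
    have "\<exists>t\<in>{0<..<1}. r (z + 1 *\<^sub>R h) - r (z + 0 *\<^sub>R h) = 
        (\<Sum>i\<in>UNIV. ((1 - 0) *\<^sub>R h) $ i * partial_deriv i r (z + t *\<^sub>R h))" by (rule mvt_simple[OF zero_less_one der])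
    then obtain t where t: "t \<in> {0<..<1}" "r (z + 1 *\<^sub>R h) - r (z + 0 *\<^sub>R h) = 
        (\<Sum>i\<in>UNIV. ((1 - 0) *\<^sub>R h) $ i * partial_deriv i r (z + t *\<^sub>R h))" by blast
    have "\<bar>r (z + h) - r z - (\<Sum>i\<in>UNIV. h $ i * partial_deriv i r z)\<bar> =
      \<bar>\<Sum>i\<in>UNIV. h $ i * (partial_deriv i r (z + t *\<^sub>R h) - partial_deriv i r z)\<bar>" using t(2) by (simp add: sum_subtractf right_diff_distrib)
    also have "... \<le> (\<Sum>i\<in>UNIV. \<bar>h $ i\<bar> * \<bar>partial_deriv i r (z + t *\<^sub>R h) - partial_deriv i r z\<bar>)" by (rule order_trans[OF sum_abs]) (simp add: abs_mult)
    also have "... \<le> (\<Sum>i\<in>(UNIV::'n set). norm h * ?c)"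
    proof (intro sum_mono mult_mono)
      fix i
      have "norm (t *\<^sub>R h) \<le> norm h" using t(1) by (simp add: mult_left_le_one_le)
      also have "... < dd i" using h by simp
      finally have "dist (z + t *\<^sub>R h) z < dd i" by (simp add: dist_norm)
      thus "\<bar>partial_deriv i r (z + t *\<^sub>R h) - partial_deriv i r z\<bar> \<le> ?c" using dd(2) less_imp_le by blast
    qed (auto simp: component_le_norm_cart)
    also have "... = d * norm h" by simp
    finally show ?thesis .
  qed
  ultimately show ?thesis using that by blast
qed

section \<open>Convolution and mollifiers\<close>

definition conv :: "(real^'n \<Rightarrow> real) \<Rightarrow> (real^'n \<Rightarrow> real) \<Rightarrow> real^'n \<Rightarrow> real"
  where "conv r u x = (\<integral>y. r (x - y) * u y \<partial>lborel)"

lemma integrable_bounded_mult: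
  fixes u :: "'a \<Rightarrow> real"
  assumes "integrable M u" "g \<in> borel_measurable M" "\<And>x. \<bar>g x\<bar> \<le> B"
  shows "integrable M (\<lambda>x. g x * u x)"
proof (rule Bochner_Integration.integrable_bound)
  show "integrable M (\<lambda>x. B * u x)" using assms by simp
  show "AE x in M. norm (g x * u x) \<le> norm (B * u x)" unfolding real_norm_def abs_mult
    by (intro always_eventually allI mult_right_mono order_trans[OF assms(3) abs_ge_self]) simp
qed (use assms in measurable)

lemma conv_integrable:
  assumes "smooth_ball e r" "integrable lborel u"
  shows "integrable lborel (\<lambda>y. r (x - y) * u y)"
proof -
  obtain B where "\<And>x. \<bar>r x\<bar> \<le> B" using continuous_compact_support_bounded[OF smooth_ball_continuous[OF assms(1)], of e] assms(1)
    unfolding smooth_ball_def by metis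
  moreover have [measurable]: "r \<in> borel_measurable borel" using smooth_ball_continuous[OF assms(1)] by (rule borel_measurable_continuous_onI)
  ultimately show ?thesis using assms(2) by (intro integrable_bounded_mult[where B=B]) auto
qed

text \<open>Differentiation under the integral: the uniform first-order expansion of
  \<open>r\<close> is integrated against \<open>|u|\<close>. Its error is taken as
  \<open>d / (N + 1)\<close>, with \<open>N\<close> the L1 norm of \<open>u\<close>, which may be
  0.\<close>

lemma conv_has_derivative:
  fixes r :: "real^'n \<Rightarrow> real"
  assumes r: "smooth_ball e r" and u: "integrable lborel u"
  shows "(conv r u has_derivative (\<lambda>h. \<Sum>i\<in>UNIV. h $ i * conv (partial_deriv i r) u x)) (at x)"
  unfolding has_derivative_at_alt
proof (intro conjI allI impI)
  show "bounded_linear (\<lambda>h. \<Sum>i\<in>UNIV. h $ i * conv (partial_deriv i r) u x)"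
    by (intro bounded_linear_sum bounded_linear_mult_left[THEN bounded_linear_compose] bounded_linear_vec_nth)
  fix d :: real assume "d > 0"
  define N where "N = (\<integral>y. \<bar>u y\<bar> \<partial>lborel)"
  have "N \<ge> 0" unfolding N_def by simp
  hence d1: "d / (N + 1) > 0" using \<open>d > 0\<close> by simp
  obtain d' where d': "d' > 0"
    "\<And>z h. norm h < d' \<Longrightarrow> \<bar>r (z + h) - r z - (\<Sum>i\<in>UNIV. h $ i * partial_deriv i r z)\<bar> \<le> d / (N + 1) * norm h" using smooth_ball_taylor[OF r d1] by metis
  have "norm (conv r u y - conv r u x - (\<Sum>i\<in>UNIV. (y - x) $ i * conv (partial_deriv i r) u x)) \<le> d * norm (y - x)"
    if "norm (y - x) < d'" for y
  proof -
    let ?F = "\<lambda>z. (r (y - z) - r (x - z) - (\<Sum>i\<in>UNIV. (y - x) $ i * partial_deriv i r (x - z))) * u z"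
    have p: "integrable lborel (\<lambda>z. (y - x) $ i * (partial_deriv i r (x - z) * u z))" for i
      using conv_integrable[OF smooth_ball_partial_deriv[OF r] u] by auto
    note I = conv_integrable[OF r u]
    have eq: "conv r u y - conv r u x - (\<Sum>i\<in>UNIV. (y - x) $ i * conv (partial_deriv i r) u x) = integral\<^sup>L lborel ?F"
      unfolding conv_def left_diff_distrib sum_distrib_right
      using I p by (simp add: mult.assoc)
    have "norm (integral\<^sup>L lborel ?F) \<le> (\<integral>z. (d / (N + 1) * norm (y - x)) * \<bar>u z\<bar> \<partial>lborel)"
    proof (rule Bochner_Integration.integral_norm_bound_integral)
      show "integrable lborel ?F" unfolding left_diff_distrib sum_distrib_right using I p by (auto simp: mult.assoc)
      show "norm (?F z) \<le> (d / (N + 1) * norm (y - x)) * \<bar>u z\<bar>" for z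
      proof -
        have "\<bar>r (y - z) - r (x - z) - (\<Sum>i\<in>UNIV. (y - x) $ i * partial_deriv i r (x - z))\<bar> \<le> d / (N + 1) * norm (y - x)"
          using d'(2)[OF that, of "x - z"] by simp
        thus ?thesis unfolding real_norm_def abs_mult by (rule mult_right_mono) simp
      qed
    qed (use u in auto)
    also have "... = d * norm (y - x) * (N / (N + 1))" by (simp add: N_def)
    also have "... \<le> d * norm (y - x)" using \<open>N \<ge> 0\<close> \<open>d > 0\<close> by (intro mult_left_le) auto
    finally show ?thesis unfolding eq .
  qed
  thus "\<exists>d'>0. \<forall>y. norm (y - x) < d' \<longrightarrow> norm (conv r u y - conv r u x - (\<Sum>i\<in>UNIV. (y - x) $ i * conv (partial_deriv i r) u x)) \<le> d * norm (y - x)"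
    using d'(1) by blast
qed

lemma partial_deriv_conv:
  assumes "smooth_ball e r" "integrable lborel u"
  shows "partial_deriv i (conv r u) = conv (partial_deriv i r) u"
proof
  fix x
  have "partial_deriv i (conv r u) x = (\<Sum>j\<in>UNIV. axis i 1 $ j * conv (partial_deriv j r) u x)" by (rule partial_deriv_eq[OF conv_has_derivative[OF assms]])
  also have "... = (\<Sum>j\<in>UNIV. if j = i then conv (partial_deriv j r) u x else 0)" by (intro sum.cong) (auto simp: axis_def)
  finally show "partial_deriv i (conv r u) x = conv (partial_deriv i r) u x" by simp
qed

lemma C_k_conv:
  assumes "smooth_ball e r" "integrable lborel u" shows "C_k k (conv r u)" using assms
proof (induction k arbitrary: r)
  case 0
  hence "conv r u differentiable (at x)" for x using conv_has_derivative differentiable_def by blast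
  thus ?case by (simp add: continuous_on_eq_continuous_at differentiable_imp_continuous_within)
next
  case (Suc k)
  hence "conv r u differentiable (at x)" for x using conv_has_derivative differentiable_def by blast
  moreover have "C_k k (conv (partial_deriv i r) u)" for i using Suc smooth_ball_partial_deriv by blast
  ultimately show ?case using Suc.prems by (simp add: partial_deriv_conv)
qed

text \<open>Evenness makes convolution with \<open>r\<close> self-adjoint
  (\<open>conv_symmetric\<close>), so that smoothing of a function can be moved to the test
  field.\<close>

definition mollifier :: "real \<Rightarrow> (real^'n \<Rightarrow> real) \<Rightarrow> bool"
  where "mollifier e r \<longleftrightarrow> smooth_ball e r \<and> (\<forall>x. 0 \<le> r x) \<and> (\<forall>x. r (- x) = r x) \<and> integral\<^sup>L lborel r = 1"

lemma mollifier_exists: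
  assumes "e > 0" shows "\<exists>r :: real^'n \<Rightarrow> real. mollifier e r"
proof -
  \<comment> \<open>The classical bump \<open>exp (- 1 / (e^2 - |x|^2))\<close>, divided below by
    its integral \<open>c\<close>. That \<open>c\<close> is not 0 follows from positivity on an open
    ball.\<close>
  let ?b = "\<lambda>x::real^'n. flat_exp 0 (e\<^sup>2 - x \<bullet> x)"
  have s: "?b x = 0" if "norm x > e" for x
  proof -
    have "e\<^sup>2 < norm x ^ 2" using that assms by (intro power_strict_mono) auto
    thus ?thesis by (simp add: flat_exp_def power2_norm_eq_inner)
  qed
  hence sm: "smooth_ball e ?b" unfolding smooth_ball_def using C_k_flat_exp by blast
  have nn: "?b x \<ge> 0" for x by (simp add: flat_exp_def)
  have int: "integrable lborel ?b" using continuous_compact_support_integrable[OF smooth_ball_continuous[OF sm] s] by blast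
  define c where "c = integral\<^sup>L lborel ?b"
  have "c \<noteq> 0"
  proof
    assume "c = 0"
    hence "AE x in lborel. ?b x = 0" using integral_nonneg_eq_0_iff_AE[OF int] nn unfolding c_def by auto
    moreover have "?b x \<noteq> 0" if "x \<in> ball 0 e" for x
    proof -
      have "norm x ^ 2 < e\<^sup>2" using that by (intro power_strict_mono) auto
      thus ?thesis by (simp add: flat_exp_def power2_norm_eq_inner)
    qed
    ultimately have "AE x in lborel. x \<notin> ball (0::real^'n) e" by (auto elim: eventually_mono)
    hence "emeasure lborel (ball (0::real^'n) e) = 0" by (subst (asm) AE_iff_measurable[where N="ball 0 e"]) auto
    moreover have "emeasure lborel (ball (0::real^'n) e) \<noteq> 0" using open_not_negligible[of "ball (0::real^'n) e"] assms
      by (auto simp: negligible_iff_null_sets null_sets_def)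
    ultimately show False by simp
  qed
  hence "c > 0" using nn c_def by (simp add: order_less_le)
  have "mollifier e (\<lambda>x. (1 / c) * ?b x)" unfolding mollifier_def smooth_ball_def
    using \<open>c > 0\<close> nn s int by (auto simp: c_def intro!: C_k_cmult[OF C_k_flat_exp, of _ "1 / c" 0 "e\<^sup>2", unfolded c_def, simplified])
  thus ?thesis by blast
qed

subsection \<open>Convergence of mollifications\<close>

lemma lborel_distr_reflect: "distr lborel borel (\<lambda>y::'a::euclidean_space. x - y) = lborel" using lborel_affine[of "-1" x] by (simp add: density_1)

lemma lborel_integral_reflect:
  fixes f :: "'a::euclidean_space \<Rightarrow> real"
  assumes "f \<in> borel_measurable borel"
  shows "(\<integral>y. f (x - y) \<partial>lborel) = (\<integral>y. f y \<partial>lborel)"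
  using integral_distr[of "\<lambda>y. x - y" lborel borel f] assms by (simp add: lborel_distr_reflect)

lemma lborel_integrable_reflect:
  fixes f :: "'a::euclidean_space \<Rightarrow> real"
  assumes "integrable lborel f"
  shows "integrable lborel (\<lambda>y. f (x - y))"
  using integrable_distr[of "\<lambda>y. x - y" lborel borel f] assms by (simp add: lborel_distr_reflect)

lemma lborel_distr_minus: "distr lborel borel (\<lambda>y::'a::euclidean_space. y - x) = lborel"
proof -
  have "(\<lambda>y. y - x) = (+) (- x)" by auto
  thus ?thesis by (metis lborel_distr_plus)
qed

lemma lborel_integral_translate:
  fixes f :: "'a::euclidean_space \<Rightarrow> real"
  assumes "f \<in> borel_measurable borel"
  shows "(\<integral>y. f (y - x) \<partial>lborel) = (\<integral>y. f y \<partial>lborel)"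
  using integral_distr[of "\<lambda>y. y - x" lborel borel f] assms by (simp add: lborel_distr_minus)

lemma lborel_integrable_translate:
  fixes f :: "'a::euclidean_space \<Rightarrow> real"
  assumes "integrable lborel f"
  shows "integrable lborel (\<lambda>y. f (y - x))"
  using integrable_distr[of "\<lambda>y. y - x" lborel borel f] assms by (simp add: lborel_distr_minus)

text \<open>Sequences of translations allow dominated convergence to be used directly;
  \<open>L1_translation_small\<close> recovers the uniform form by contradiction.\<close>

definition L1_translation_continuous :: "('a::euclidean_space \<Rightarrow> real) \<Rightarrow> bool"
  where "L1_translation_continuous u \<longleftrightarrow>
    (\<forall>h. h \<longlonglongrightarrow> 0 \<longrightarrow> (\<lambda>n::nat. \<integral>x. \<bar>u (x - h n) - u x\<bar> \<partial>lborel) \<longlonglongrightarrow> 0)"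

text \<open>A three-epsilon argument. By translation invariance the distance of \<open>u\<close>
  from its approximation \<open>v\<close> is paid twice.\<close>

lemma L1_translation_continuous_approx:
  fixes u :: "'a::euclidean_space \<Rightarrow> real"
  assumes u: "integrable lborel u"
    and ap: "\<And>d. d > 0 \<Longrightarrow> \<exists>v. integrable lborel v \<and> L1_translation_continuous v \<and> (\<integral>x. \<bar>u x - v x\<bar> \<partial>lborel) < d"
  shows "L1_translation_continuous u"
  unfolding L1_translation_continuous_def
proof (intro allI impI)
  fix h :: "nat \<Rightarrow> 'a" assume h: "h \<longlonglongrightarrow> 0"
  show "(\<lambda>n. \<integral>x. \<bar>u (x - h n) - u x\<bar> \<partial>lborel) \<longlonglongrightarrow> 0"
  proof (rule LIMSEQ_I)
    fix d :: real assume "d > 0"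
    then obtain v where v: "integrable lborel v" "L1_translation_continuous v" "(\<integral>x. \<bar>u x - v x\<bar> \<partial>lborel) < d / 3" using ap[of "d / 3"] by auto
    have "(\<lambda>n. \<integral>x. \<bar>v (x - h n) - v x\<bar> \<partial>lborel) \<longlonglongrightarrow> 0" using v(2) h unfolding L1_translation_continuous_def by blast
    then obtain N where N: "\<And>n. n \<ge> N \<Longrightarrow> (\<integral>x. \<bar>v (x - h n) - v x\<bar> \<partial>lborel) < d / 3" using LIMSEQ_D[of _ 0 "d / 3"] \<open>d > 0\<close> by fastforce
    have "norm ((\<integral>x. \<bar>u (x - h n) - u x\<bar> \<partial>lborel) - 0) < d" if "n \<ge> N" for n
    proof -
      note i = u v(1) lborel_integrable_translate[OF u, of "h n"] lborel_integrable_translate[OF v(1), of "h n"]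
      have "(\<integral>x. \<bar>u (x - h n) - u x\<bar> \<partial>lborel) \<le>
         (\<integral>x. \<bar>u (x - h n) - v (x - h n)\<bar> + \<bar>v (x - h n) - v x\<bar> + \<bar>u x - v x\<bar> \<partial>lborel)" using i by (intro integral_mono) auto
      also have "... = (\<integral>x. \<bar>u (x - h n) - v (x - h n)\<bar> \<partial>lborel) + (\<integral>x. \<bar>v (x - h n) - v x\<bar> \<partial>lborel) + (\<integral>x. \<bar>u x - v x\<bar> \<partial>lborel)" using i by simp
      also have "(\<integral>x. \<bar>u (x - h n) - v (x - h n)\<bar> \<partial>lborel) = (\<integral>x. \<bar>u x - v x\<bar> \<partial>lborel)"
        using u v(1) by (intro lborel_integral_translate[of "\<lambda>x. \<bar>u x - v x\<bar>"]) (auto dest!: borel_measurable_integrable)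
      also have "... + (\<integral>x. \<bar>v (x - h n) - v x\<bar> \<partial>lborel) + (\<integral>x. \<bar>u x - v x\<bar> \<partial>lborel) < d" using N[OF that] v(3) by linarith
      finally show ?thesis by simp
    qed
    thus "\<exists>N. \<forall>n\<ge>N. norm ((\<integral>x. \<bar>u (x - h n) - u x\<bar> \<partial>lborel) - 0) < d" by blast
  qed
qed

text \<open>A point of an open set stays in it under small translations, so the positive part of
  \<open>g x - g (x - h n)\<close> tends to 0 with majorant \<open>g\<close>. Since \<open>g\<close>
  and its translate have the same integral, the integral of the absolute value is twice that of the
  positive part.\<close>

lemma L1_translation_continuous_indicator_open:
  fixes G :: "'a::euclidean_space set"
  assumes G: "open G" "emeasure lborel G < \<infinity>"
  shows "L1_translation_continuous (indicator G)"
  unfolding L1_translation_continuous_def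
proof (intro allI impI)
  fix h :: "nat \<Rightarrow> 'a" assume h: "h \<longlonglongrightarrow> 0"
  define g :: "'a \<Rightarrow> real" where [simp]: "g = indicator G"
  have gm[measurable]: "G \<in> sets borel" using G by auto
  have gi: "integrable lborel g" using G by (simp add: integrable_real_indicator)
  note ti = lborel_integrable_translate[OF gi]
  have "(\<lambda>n. \<integral>x. max 0 (g x - g (x - h n)) \<partial>lborel) \<longlonglongrightarrow> integral\<^sup>L lborel (\<lambda>x::'a. 0)"
  proof (rule integral_dominated_convergence[where w="indicator G"])
    show "AE x in lborel. (\<lambda>n. max 0 (g x - g (x - h n))) \<longlonglongrightarrow> 0"
    proof (intro always_eventually allI)
      fix x
      show "(\<lambda>n. max 0 (g x - g (x - h n))) \<longlonglongrightarrow> 0"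
      proof (cases "x \<in> G")
        case True
        have "(\<lambda>n. x - h n) \<longlonglongrightarrow> x - 0" by (intro tendsto_intros h)
        hence "eventually (\<lambda>n. x - h n \<in> G) sequentially" using topological_tendstoD[OF _ G(1)] True by force
        thus ?thesis by (intro tendsto_eventually) (auto elim!: eventually_mono)
      qed simp
    qed
    show "AE x in lborel. norm (max 0 (g x - g (x - h n))) \<le> indicator G x" for n by (auto simp: indicator_def)
  qed (use gi in auto)
  hence "(\<lambda>n. 2 * (\<integral>x. max 0 (g x - g (x - h n)) \<partial>lborel)) \<longlonglongrightarrow> 0" using tendsto_mult_right_zero by force
  moreover have "(\<integral>x. \<bar>g (x - h n) - g x\<bar> \<partial>lborel) = 2 * (\<integral>x. max 0 (g x - g (x - h n)) \<partial>lborel)" for n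
  proof -
    have "(\<integral>x. \<bar>g (x - h n) - g x\<bar> \<partial>lborel) = (\<integral>x. 2 * max 0 (g x - g (x - h n)) - (g x - g (x - h n)) \<partial>lborel)"
      by (intro Bochner_Integration.integral_cong) (auto simp: indicator_def)
    also have "... = 2 * (\<integral>x. max 0 (g x - g (x - h n)) \<partial>lborel) - (\<integral>x. g x - g (x - h n) \<partial>lborel)"
      using gi ti[of "h n"] by (subst Bochner_Integration.integral_diff) auto
    also have "(\<integral>x. g x - g (x - h n) \<partial>lborel) = 0" using gi ti[of "h n"] lborel_integral_translate[of g "h n"] by simp
    finally show ?thesis by simp
  qed
  ultimately show "(\<lambda>n. \<integral>x. \<bar>indicator G (x - h n) - indicator G x\<bar> \<partial>lborel) \<longlonglongrightarrow> (0::real)" by simp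
qed

lemma lborel_outer_open:
  fixes A :: "'a::euclidean_space set"
  assumes A: "A \<in> sets borel" "emeasure lborel A < \<infinity>" and "d > 0"
  obtains G where "open G" "A \<subseteq> G" "emeasure lborel G < \<infinity>" "measure lborel (G - A) < d"
proof -
  have "A \<in> lmeasurable" using A by (auto simp: fmeasurable_def)
  obtain G where G: "open G" "A \<subseteq> G" "G - A \<in> lmeasurable" "emeasure lebesgue (G - A) < ennreal d"
    using sets_lebesgue_outer_open[of A d] A \<open>d > 0\<close> by (metis lborelD sets_completionI_sets sets_lborel)
  have gm: "G - A \<in> sets borel" using G A by auto
  hence eq: "emeasure lebesgue (G - A) = emeasure lborel (G - A)" by simp
  have "emeasure lborel G \<le> emeasure lborel A + emeasure lborel (G - A)" using G A gm emeasure_subadditive[of A lborel "G - A"] by (auto simp: Un_absorb1)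
  also have "... < \<infinity>" using A G(4) eq by (auto intro: order.strict_trans)
  finally have "emeasure lborel G < \<infinity>" .
  moreover have "measure lborel (G - A) < d"
    using G(4) eq \<open>d > 0\<close> by (simp add: measure_def enn2real_less_iff) (metis enn2real_less_iff ennreal_less_top order_less_trans)
  ultimately show ?thesis using that G by blast
qed

text \<open>Indicators of Borel sets are approximated by those of open supersets through outer
  regularity; sums and dominated limits lead to all integrable functions.\<close>

lemma L1_translation_continuous_integrable:
  fixes u :: "'a::euclidean_space \<Rightarrow> real"
  assumes "integrable lborel u"
  shows "L1_translation_continuous u"
  using assms
proof (induction rule: integrable_induct)
  case (base A c)
  have cm: "L1_translation_continuous (\<lambda>x. f x * c)" if "L1_translation_continuous f" for f
  proof -
    have "(\<integral>x. \<bar>f (x - h) * c - f x * c\<bar> \<partial>lborel) = (\<integral>x. \<bar>f (x - h) - f x\<bar> \<partial>lborel) * \<bar>c\<bar>" for h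
      by (subst integral_mult_left_zero[symmetric]) (simp add: abs_mult[symmetric] left_diff_distrib)
    thus ?thesis using that unfolding L1_translation_continuous_def by (auto intro: tendsto_mult_left_zero)
  qed
  have "L1_translation_continuous (indicator A)"
  proof (rule L1_translation_continuous_approx)
    show "integrable lborel (indicator A :: 'a \<Rightarrow> real)" using base by (simp add: integrable_real_indicator)
    fix d :: real assume "d > 0"
    then obtain G where G: "open G" "A \<subseteq> G" "emeasure lborel G < \<infinity>" "measure lborel (G - A) < d" using lborel_outer_open[of A d] base by auto
    have "(\<integral>x. \<bar>indicat_real A x - indicat_real G x\<bar> \<partial>lborel) = (\<integral>x. indicat_real (G - A) x \<partial>lborel)"
      using G(2) by (intro Bochner_Integration.integral_cong refl) (auto split: split_indicator)
    also have "... < d" using G by simp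
    finally show "\<exists>v. integrable lborel v \<and> L1_translation_continuous v \<and> (\<integral>x. \<bar>indicator A x - v x\<bar> \<partial>lborel) < d"
      using G L1_translation_continuous_indicator_open[OF G(1,3)] by (intro exI[of _ "indicator G"]) (auto simp: integrable_real_indicator)
  qed
  thus ?case using cm by simp
next
  case (add f g)
  show ?case unfolding L1_translation_continuous_def
  proof (intro allI impI)
    fix h :: "nat \<Rightarrow> 'a" assume h: "h \<longlonglongrightarrow> 0"
    have "(\<lambda>n. \<integral>x. \<bar>f (x - h n) - f x\<bar> \<partial>lborel) \<longlonglongrightarrow> 0" "(\<lambda>n. \<integral>x. \<bar>g (x - h n) - g x\<bar> \<partial>lborel) \<longlonglongrightarrow> 0"
      using add h unfolding L1_translation_continuous_def by blast+
    from tendsto_add[OF this]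
    have l: "(\<lambda>n. (\<integral>x. \<bar>f (x - h n) - f x\<bar> \<partial>lborel) + (\<integral>x. \<bar>g (x - h n) - g x\<bar> \<partial>lborel)) \<longlonglongrightarrow> 0" by simp
    have "(\<integral>x. \<bar>f (x - h n) + g (x - h n) - (f x + g x)\<bar> \<partial>lborel)
      \<le> (\<integral>x. \<bar>f (x - h n) - f x\<bar> + \<bar>g (x - h n) - g x\<bar> \<partial>lborel)" for n
      using add.hyps lborel_integrable_translate[OF add.hyps(1), of "h n"] lborel_integrable_translate[OF add.hyps(2), of "h n"]
      by (intro integral_mono) auto
    moreover have "(\<integral>x. \<bar>f (x - h n) - f x\<bar> + \<bar>g (x - h n) - g x\<bar> \<partial>lborel) =
       (\<integral>x. \<bar>f (x - h n) - f x\<bar> \<partial>lborel) + (\<integral>x. \<bar>g (x - h n) - g x\<bar> \<partial>lborel)" for n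
      using add.hyps lborel_integrable_translate[OF add.hyps(1), of "h n"] lborel_integrable_translate[OF add.hyps(2), of "h n"] by simp
    ultimately show "(\<lambda>n. \<integral>x. \<bar>f (x - h n) + g (x - h n) - (f x + g x)\<bar> \<partial>lborel) \<longlonglongrightarrow> 0" by (intro tendsto_sandwich[OF _ _ tendsto_const l]) auto
  qed
next
  case (lim f s)
  note lim = lim.hyps lim.IH
  show ?case
  proof (rule L1_translation_continuous_approx[OF lim(4)])
    fix d :: real assume "d > 0"
    have "(\<lambda>n. \<integral>x. \<bar>f x - s n x\<bar> \<partial>lborel) \<longlonglongrightarrow> integral\<^sup>L lborel (\<lambda>x::'a. 0)"
    proof (rule integral_dominated_convergence[where w="\<lambda>x. 3 * \<bar>f x\<bar>"])
      show "AE x in lborel. (\<lambda>n. \<bar>f x - s n x\<bar>) \<longlonglongrightarrow> 0"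
      proof (intro always_eventually allI tendsto_rabs_zero)
        fix x
        show "(\<lambda>n. f x - s n x) \<longlonglongrightarrow> 0" using tendsto_diff[OF tendsto_const lim(2)[of x], of "f x"] by simp
      qed
      show "AE x in lborel. norm \<bar>f x - s n x\<bar> \<le> 3 * \<bar>f x\<bar>" for n
      proof (intro always_eventually allI)
        fix x show "norm \<bar>f x - s n x\<bar> \<le> 3 * \<bar>f x\<bar>" using lim(3)[of x n] by simp
      qed
    qed (use lim(1,4) in \<open>auto dest!: borel_measurable_integrable\<close>)
    hence "eventually (\<lambda>n. (\<integral>x. \<bar>f x - s n x\<bar> \<partial>lborel) < d) sequentially" using order_tendstoD(2)[of _ 0 sequentially d] \<open>d > 0\<close> by simp
    thus "\<exists>v. integrable lborel v \<and> L1_translation_continuous v \<and> (\<integral>x. \<bar>f x - v x\<bar> \<partial>lborel) < d" using lim(1,5) by (auto simp: eventually_sequentially)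
  qed
qed

lemma L1_translation_small:
  fixes u :: "'a::euclidean_space \<Rightarrow> real"
  assumes u: "integrable lborel u" and "d > 0"
  obtains e where "e > 0" "\<And>h. norm h \<le> e \<Longrightarrow> (\<integral>x. \<bar>u (x - h) - u x\<bar> \<partial>lborel) < d"
proof (rule ccontr)
  assume "\<not> thesis"
  hence "\<forall>n::nat. \<exists>h. norm h \<le> 1 / Suc n \<and> (\<integral>x. \<bar>u (x - h) - u x\<bar> \<partial>lborel) \<ge> d"
    using that[of "1 / Suc _"] by (metis not_le of_nat_0_less_iff zero_less_Suc zero_less_divide_1_iff)
  then obtain h where h: "\<And>n::nat. norm (h n) \<le> 1 / Suc n" "\<And>n. (\<integral>x. \<bar>u (x - h n) - u x\<bar> \<partial>lborel) \<ge> d" by metis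
  have "h \<longlonglongrightarrow> 0" by (rule Lim_null_comparison[OF _ LIMSEQ_Suc[OF lim_const_over_n[of 1]]]) (use h(1) in auto)
  hence "(\<lambda>n. \<integral>x. \<bar>u (x - h n) - u x\<bar> \<partial>lborel) \<longlonglongrightarrow> 0" using L1_translation_continuous_integrable[OF u] unfolding L1_translation_continuous_def by blast
  hence "d \<le> 0" using h(2) by (intro tendsto_lowerbound[of _ 0 sequentially d]) auto
  thus False using \<open>d > 0\<close> by simp
qed

lemma smooth_ball_measurable[measurable_dest]: "smooth_ball e r \<Longrightarrow> r \<in> borel_measurable borel"
  using smooth_ball_continuous borel_measurable_continuous_onI by blast

lemma smooth_ball_bounded: "smooth_ball e r \<Longrightarrow> \<exists>B>0. \<forall>x. \<bar>r x\<bar> \<le> B"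
  using continuous_compact_support_bounded[OF smooth_ball_continuous, of e r] unfolding smooth_ball_def
  by metis

lemma smooth_ball_integrable: "smooth_ball e r \<Longrightarrow> integrable lborel r"
  using continuous_compact_support_integrable[OF smooth_ball_continuous] unfolding smooth_ball_def by blast

lemma conv_continuous:
  assumes "smooth_ball e r" "integrable lborel u" shows "continuous_on UNIV (conv r u)" using C_k_continuous[OF C_k_conv[OF assms]] .

lemma integrable_conv_product:
  fixes u v :: "real^'n \<Rightarrow> real"
  assumes r: "smooth_ball e r" and u: "integrable lborel u" and v: "integrable lborel v"
  shows "integrable (lborel \<Otimes>\<^sub>M lborel) (\<lambda>(x, y). r (x - y) * (u y * v x))"
proof -
  note [measurable] = smooth_ball_measurable[OF r]
  obtain B where B: "\<And>x. \<bar>r x\<bar> \<le> B" using smooth_ball_bounded[OF r] by blast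
  have "integrable (lborel \<Otimes>\<^sub>M lborel) (\<lambda>z. u (snd z) * v (fst z))"
  proof (rule lborel_pair.Fubini_integrable)
    show "(\<lambda>z. u (snd z) * v (fst z)) \<in> borel_measurable (lborel \<Otimes>\<^sub>M lborel)"
      using borel_measurable_integrable[OF u] borel_measurable_integrable[OF v] by measurable
    have "(\<integral>y. norm (u (snd (x, y)) * v (fst (x, y))) \<partial>lborel) = (\<integral>y. \<bar>u y\<bar> \<partial>lborel) * \<bar>v x\<bar>" for x by (simp add: abs_mult)
    thus "integrable lborel (\<lambda>x. \<integral>y. norm (u (snd (x, y)) * v (fst (x, y))) \<partial>lborel)" using v by simp
  qed (use u in auto)
  hence "integrable (lborel \<Otimes>\<^sub>M lborel) (\<lambda>z. r (fst z - snd z) * (u (snd z) * v (fst z)))" by (rule integrable_bounded_mult[where B=B]) (use B in auto)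
  thus ?thesis by (simp add: case_prod_unfold)
qed

lemma conv_symmetric:
  fixes u v :: "real^'n \<Rightarrow> real"
  assumes r: "smooth_ball e r" and even: "\<And>x. r (- x) = r x" and u: "integrable lborel u" and v: "integrable lborel v"
  shows "(\<integral>x. conv r u x * v x \<partial>lborel) = (\<integral>x. u x * conv r v x \<partial>lborel)"
proof -
  have "(\<integral>x. conv r u x * v x \<partial>lborel) = (\<integral>x. (\<integral>y. r (x - y) * (u y * v x) \<partial>lborel) \<partial>lborel)"
    unfolding conv_def by (simp flip: integral_mult_left_zero add: mult.assoc)
  also have "... = (\<integral>y. (\<integral>x. r (x - y) * (u y * v x) \<partial>lborel) \<partial>lborel)" using lborel_pair.Fubini_integral[OF integrable_conv_product[OF r u v]] by simp
  also have "... = (\<integral>y. u y * conv r v y \<partial>lborel)" unfolding conv_def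
  proof (intro Bochner_Integration.integral_cong refl)
    fix y
    have "r (x - y) = r (y - x)" for x using even[of "x - y"] by simp
    hence "(\<integral>x. r (x - y) * (u y * v x) \<partial>lborel) = (\<integral>x. u y * (r (y - x) * v x) \<partial>lborel)" by (simp add: mult.left_commute)
    thus "(\<integral>x. r (x - y) * (u y * v x) \<partial>lborel) = u y * (\<integral>x. r (y - x) * v x \<partial>lborel)" by simp
  qed
  finally show ?thesis .
qed

lemma conv_commute:
  fixes u v :: "real^'n \<Rightarrow> real"
  assumes [measurable]: "u \<in> borel_measurable borel" "v \<in> borel_measurable borel"
  shows "conv u v = conv v u"
proof
  fix x show "conv u v x = conv v u x" unfolding conv_def using lborel_integral_reflect[of "\<lambda>y. v (x - y) * u y" x] by (simp add: mult.commute)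
qed

text \<open>As convolution commutes, the derivative may fall on either factor.\<close>

lemma conv_partial_deriv:
  assumes r: "smooth_ball e r" and p: "smooth_ball R \<phi>"
  shows "partial_deriv i (conv r \<phi>) = conv r (partial_deriv i \<phi>)"
proof -
  note [measurable] = smooth_ball_measurable[OF r] smooth_ball_measurable[OF p]
    smooth_ball_measurable[OF smooth_ball_partial_deriv[OF p]]
  have "partial_deriv i (conv r \<phi>) = partial_deriv i (conv \<phi> r)" by (subst conv_commute) auto
  also have "... = conv (partial_deriv i \<phi>) r" using partial_deriv_conv[OF p smooth_ball_integrable[OF r]] .
  finally show ?thesis by (subst conv_commute) auto
qed

lemma conv_eq_0:
  assumes "smooth_ball e r" "\<And>y. norm (x - y) \<le> e \<Longrightarrow> u y = 0"
  shows "conv r u x = 0"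
proof -
  have "r (x - y) * u y = 0" for y using assms unfolding smooth_ball_def by (metis mult_eq_0_iff not_le)
  hence "(\<lambda>y. r (x - y) * u y) = (\<lambda>y. 0)" by blast
  thus ?thesis unfolding conv_def by simp
qed

text \<open>The difference \<open>conv r u x - u x\<close> is the average of
  \<open>u (x - y) - u x\<close> with weight \<open>r y\<close>; after exchanging the integrals only
  translations by at most \<open>e\<close> enter. Integrability comes along, because
  \<open>conv r u\<close> differs from \<open>u\<close> by an integrable function.\<close>

lemma nn_integral_conv_le:
  fixes r u :: "real^'n \<Rightarrow> real"
  assumes r: "mollifier e r" and u: "integrable lborel u" and d: "\<And>h. norm h \<le> e \<Longrightarrow> (\<integral>x. \<bar>u (x - h) - u x\<bar> \<partial>lborel) \<le> d"
  shows "integrable lborel (conv r u)" "(\<integral>x. \<bar>conv r u x - u x\<bar> \<partial>lborel) \<le> d"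
proof -
  have rs: "smooth_ball e r" and r0: "\<And>x. r x \<ge> 0" and r1: "integral\<^sup>L lborel r = 1" using r unfolding mollifier_def by auto
  note rm[measurable] = smooth_ball_measurable[OF rs]
  have um[measurable]: "u \<in> borel_measurable borel" using borel_measurable_integrable[OF u] by simp
  have cm[measurable]: "conv r u \<in> borel_measurable borel" using conv_continuous[OF rs u] borel_measurable_continuous_onI by blast
  have ri: "integrable lborel r" by (rule smooth_ball_integrable[OF rs])
  \<comment> \<open>With a negative radius \<open>r\<close> would vanish identically, against
    integral 1. The translation by \<open>0\<close> is then admissible and gives
    \<open>d \<ge> 0\<close>.\<close>
  have "e \<ge> 0"
  proof (rule ccontr)
    assume "\<not> e \<ge> 0"
    hence "r x = 0" for x using rs norm_ge_zero[of x] unfolding smooth_ball_def by (meson less_le_trans not_le)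
    hence "r = (\<lambda>x. 0)" by blast
    thus False using r1 by simp
  qed
  hence d0: "d \<ge> 0" using d[of 0] by simp
  have bnd: "ennreal \<bar>conv r u x - u x\<bar> \<le> (\<integral>\<^sup>+y. ennreal (r y * \<bar>u (x - y) - u x\<bar>) \<partial>lborel)" for x
  proof -
    have c1: "conv r u x = (\<integral>y. r y * u (x - y) \<partial>lborel)" unfolding conv_def using lborel_integral_reflect[of "\<lambda>y. r y * u (x - y)" x] by simp
    have i1: "integrable lborel (\<lambda>y. r y * u (x - y))" using lborel_integrable_reflect[OF conv_integrable[OF rs u, of x], of x] by simp
    have "conv r u x - u x = (\<integral>y. r y * u (x - y) \<partial>lborel) - (\<integral>y. r y * u x \<partial>lborel)" using r1 by (simp add: c1)
    also have "... = (\<integral>y. r y * (u (x - y) - u x) \<partial>lborel)"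
      using i1 ri by (subst Bochner_Integration.integral_diff[symmetric]) (auto simp: right_diff_distrib)
    finally have "ennreal \<bar>conv r u x - u x\<bar> \<le> (\<integral>\<^sup>+y. ennreal (norm (r y * (u (x - y) - u x))) \<partial>lborel)"
      using integral_norm_bound_ennreal[of lborel "\<lambda>y. r y * (u (x - y) - u x)"] i1 ri by (auto simp: right_diff_distrib)
    thus ?thesis using r0 by (simp add: abs_mult)
  qed
  have "(\<integral>\<^sup>+x. ennreal \<bar>conv r u x - u x\<bar> \<partial>lborel) \<le> (\<integral>\<^sup>+x. (\<integral>\<^sup>+y. ennreal (r y * \<bar>u (x - y) - u x\<bar>) \<partial>lborel) \<partial>lborel)" by (intro nn_integral_mono bnd)
  also have "... = (\<integral>\<^sup>+y. (\<integral>\<^sup>+x. ennreal (r y * \<bar>u (x - y) - u x\<bar>) \<partial>lborel) \<partial>lborel)" by (rule lborel_pair.Fubini') measurable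
  also have "... \<le> (\<integral>\<^sup>+y. ennreal (r y) * ennreal d \<partial>lborel)"
  proof (rule nn_integral_mono)
    fix y
    show "(\<integral>\<^sup>+x. ennreal (r y * \<bar>u (x - y) - u x\<bar>) \<partial>lborel) \<le> ennreal (r y) * ennreal d"
    proof (cases "norm y \<le> e")
      case True
      have ii: "integrable lborel (\<lambda>x. \<bar>u (x - y) - u x\<bar>)" using u lborel_integrable_translate[OF u, of y] by auto
      have "(\<integral>\<^sup>+x. ennreal (r y * \<bar>u (x - y) - u x\<bar>) \<partial>lborel) = ennreal (r y) * (\<integral>\<^sup>+x. ennreal \<bar>u (x - y) - u x\<bar> \<partial>lborel)"
        using r0 by (simp add: ennreal_mult nn_integral_cmult)
      also have "(\<integral>\<^sup>+x. ennreal \<bar>u (x - y) - u x\<bar> \<partial>lborel) = ennreal (\<integral>x. \<bar>u (x - y) - u x\<bar> \<partial>lborel)" by (rule nn_integral_eq_integral[OF ii]) auto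
      also have "ennreal (r y) * ... \<le> ennreal (r y) * ennreal d" by (intro mult_left_mono ennreal_leI d True) auto
      finally show ?thesis .
    next
      case False
      hence "r y = 0" using rs unfolding smooth_ball_def by auto
      thus ?thesis by simp
    qed
  qed
  also have "... = ennreal d" using r1 r0 by (simp add: nn_integral_multc nn_integral_eq_integral[OF ri])
  finally have fin: "(\<integral>\<^sup>+x. ennreal \<bar>conv r u x - u x\<bar> \<partial>lborel) \<le> ennreal d" .
  have i2: "integrable lborel (\<lambda>x. conv r u x - u x)" by (rule integrableI_bounded) (use fin in \<open>auto simp: top.extremum_strict intro: le_less_trans\<close>)
  hence "integrable lborel (\<lambda>x. (conv r u x - u x) + u x)" by (intro Bochner_Integration.integrable_add u)
  thus "integrable lborel (conv r u)" by simp
  have "ennreal (\<integral>x. \<bar>conv r u x - u x\<bar> \<partial>lborel) \<le> ennreal d" using fin i2 by (subst nn_integral_eq_integral[symmetric]) auto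
  thus "(\<integral>x. \<bar>conv r u x - u x\<bar> \<partial>lborel) \<le> d" using d0 by simp
qed

text \<open>Only integrability is wanted here, so twice the L1 norm serves as the bound for all
  translations.\<close>

lemma mollifier_conv_integrable:
  fixes r u :: "real^'n \<Rightarrow> real"
  assumes r: "mollifier e r" and u: "integrable lborel u"
  shows "integrable lborel (conv r u)"
proof (rule nn_integral_conv_le(1)[OF r u])
  fix h :: "real^'n"
  have "(\<integral>x. \<bar>u (x - h) - u x\<bar> \<partial>lborel) \<le> (\<integral>x. \<bar>u (x - h)\<bar> + \<bar>u x\<bar> \<partial>lborel)" using u lborel_integrable_translate[OF u, of h] by (intro integral_mono) auto
  also have "... = 2 * (\<integral>x. \<bar>u x\<bar> \<partial>lborel)"
    using u lborel_integrable_translate[OF u, of h] lborel_integral_translate[of "\<lambda>x. \<bar>u x\<bar>" h] borel_measurable_integrable[OF u] by simp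
  finally show "(\<integral>x. \<bar>u (x - h) - u x\<bar> \<partial>lborel) \<le> 2 * (\<integral>x. \<bar>u x\<bar> \<partial>lborel)" .
qed

lemma conv_tendsto_L1:
  fixes u :: "real^'n \<Rightarrow> real"
  assumes u: "integrable lborel u" and r: "\<And>n. mollifier (e n) (r n)" and e: "e \<longlonglongrightarrow> 0"
  shows "(\<lambda>n. \<integral>x. \<bar>conv (r n) u x - u x\<bar> \<partial>lborel) \<longlonglongrightarrow> 0"
proof (rule LIMSEQ_I)
  fix d :: real assume "d > 0"
  then obtain e0 where e0: "e0 > 0" "\<And>h. norm h \<le> e0 \<Longrightarrow> (\<integral>x. \<bar>u (x - h) - u x\<bar> \<partial>lborel) < d / 2" using L1_translation_small[OF u, of "d / 2"] by auto
  have "eventually (\<lambda>n. e n < e0) sequentially" using e e0(1) by (rule order_tendstoD)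
  then obtain N where N: "\<And>n. n \<ge> N \<Longrightarrow> e n < e0" by (auto simp: eventually_sequentially)
  have "norm ((\<integral>x. \<bar>conv (r n) u x - u x\<bar> \<partial>lborel) - 0) < d" if "n \<ge> N" for n
  proof -
    have "(\<integral>x. \<bar>conv (r n) u x - u x\<bar> \<partial>lborel) \<le> d / 2" by (rule nn_integral_conv_le(2)[OF r u]) (use e0(2) N[OF that] in \<open>auto intro!: less_imp_le\<close>)
    thus ?thesis using \<open>d > 0\<close> by simp
  qed
  thus "\<exists>N. \<forall>n\<ge>N. norm ((\<integral>x. \<bar>conv (r n) u x - u x\<bar> \<partial>lborel) - 0) < d" by blast
qed

lemma conv_mollifier_const_le:
  fixes r u :: "real^'n \<Rightarrow> real"
  assumes r: "mollifier e r" and u: "integrable lborel u" and b: "\<And>y. norm (x - y) \<le> e \<Longrightarrow> u y \<le> c"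
  shows "conv r u x \<le> c"
proof -
  have rs: "smooth_ball e r" and r0: "\<And>x. r x \<ge> 0" and r1: "integral\<^sup>L lborel r = 1" using r unfolding mollifier_def by auto
  have "conv r u x \<le> (\<integral>y. r (x - y) * c \<partial>lborel)" unfolding conv_def
  proof (rule integral_mono)
    show "integrable lborel (\<lambda>y. r (x - y) * u y)" by (rule conv_integrable[OF rs u])
    show "integrable lborel (\<lambda>y. r (x - y) * c)" using lborel_integrable_reflect[OF smooth_ball_integrable[OF rs]] by auto
    fix y show "r (x - y) * u y \<le> r (x - y) * c" using b[of y] r0[of "x - y"] rs unfolding smooth_ball_def
      by (cases "norm (x - y) \<le> e") (auto intro: mult_left_mono)
  qed
  also have "... = c" using lborel_integral_reflect[of r x] smooth_ball_measurable[OF rs] r1 by simp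
  finally show ?thesis .
qed

lemma conv_mollifier_const_ge:
  fixes r u :: "real^'n \<Rightarrow> real"
  assumes r: "mollifier e r" and u: "integrable lborel u" and b: "\<And>y. norm (x - y) \<le> e \<Longrightarrow> c \<le> u y"
  shows "c \<le> conv r u x"
proof -
  have "conv r (\<lambda>y. - u y) x \<le> - c" using b by (intro conv_mollifier_const_le[OF r]) (use u in auto)
  thus ?thesis unfolding conv_def by simp
qed

subsection \<open>Test functions\<close>

lemma test_function_smooth_ball:
  assumes "test_function \<Omega> \<phi>" shows "\<exists>R. smooth_ball R \<phi>"
proof -
  have "bounded {x. \<phi> x \<noteq> 0}" using assms compact_imp_bounded bounded_subset[OF _ closure_subset] unfolding test_function_def by blast
  then obtain R where "\<And>x. \<phi> x \<noteq> 0 \<Longrightarrow> norm x \<le> R" unfolding bounded_iff by auto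
  thus ?thesis using assms unfolding test_function_def smooth_ball_def by (meson not_le)
qed

lemma test_functionI:
  assumes "\<And>k. C_k k \<phi>" "compact K" "K \<subseteq> \<Omega>" "\<And>x. x \<notin> K \<Longrightarrow> \<phi> x = 0"
  shows "test_function \<Omega> \<phi>"
proof -
  have "closure {x. \<phi> x \<noteq> 0} \<subseteq> K" using assms by (intro closure_minimal compact_imp_closed) auto
  thus ?thesis unfolding test_function_def
    using assms(1,3) compact_Int_closed[OF \<open>compact K\<close> closed_closure[of "{x. \<phi> x \<noteq> 0}"]] by (auto simp: Int_absorb1)
qed

lemma test_function_support:
  assumes "test_function \<Omega> \<phi>"
  obtains K where "compact K" "K \<subseteq> \<Omega>" "\<And>x. x \<notin> K \<Longrightarrow> \<phi> x = 0"
proof (rule that)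
  show "\<phi> x = 0" if "x \<notin> closure {x. \<phi> x \<noteq> 0}" for x using that closure_subset[of "{x. \<phi> x \<noteq> 0}"] by blast
qed (use assms in \<open>auto simp: test_function_def\<close>)

lemma test_function_mono: "test_function U \<phi> \<Longrightarrow> U \<subseteq> V \<Longrightarrow> test_function V \<phi>" unfolding test_function_def by blast

text \<open>The indicator of the \<open>e/3\<close>-neighbourhood of \<open>K\<close> is mollified
  with radius \<open>e/3\<close>: on \<open>K\<close> the average sees only 1, beyond distance
  \<open>2*e/3\<close> only 0, and the points at distance below \<open>e\<close> still lie in
  \<open>U\<close>.\<close>

lemma smooth_cutoff:
  fixes K U :: "(real^'n) set"
  assumes K: "compact K" "K \<subseteq> U" and U: "open U"
  obtains \<eta> where "test_function U \<eta>" "\<And>x. 0 \<le> \<eta> x" "\<And>x. \<eta> x \<le> 1" "\<And>x. x \<in> K \<Longrightarrow> \<eta> x = 1"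
proof -
  obtain e where e: "e > 0" "(\<Union>x\<in>K. ball x e) \<subseteq> U" using compact_subset_open_imp_ball_epsilon_subset[OF K(1) U K(2)] .
  define A where "A d = {x + y |x y. x \<in> K \<and> y \<in> cball 0 d}" for d :: real
  have Ac: "compact (A d)" for d unfolding A_def by (intro compact_sums K compact_cball)
  have AI: "x \<in> A d" if "y \<in> K" "norm (x - y) \<le> d" for x y d
  proof -
    have "x = y + (x - y)" "x - y \<in> cball 0 d" using that by auto
    thus ?thesis using that unfolding A_def by blast
  qed
  obtain r :: "real^'n \<Rightarrow> real" where r: "mollifier (e/3) r" using mollifier_exists[of "e/3"] e by auto
  hence rs: "smooth_ball (e/3) r" unfolding mollifier_def by auto
  define u :: "real^'n \<Rightarrow> real" where "u = indicator (A (e/3))"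
  have u: "integrable lborel u" unfolding u_def using Ac[of "e/3"] using emeasure_bounded_finite[OF compact_imp_bounded[OF Ac[of "e/3"]]]
    by (intro integrable_real_indicator) (auto simp: borel_compact)
  show ?thesis
  proof (rule that[of "conv r u"])
    show "test_function U (conv r u)"
    proof (rule test_functionI[OF C_k_conv[OF rs u] Ac[of "2*e/3"]])
      show "A (2*e/3) \<subseteq> U"
      proof
        fix x assume "x \<in> A (2*e/3)"
        then obtain y where "y \<in> K" "dist y x \<le> 2*e/3" unfolding A_def by (auto simp: dist_norm)
        hence "x \<in> (\<Union>x\<in>K. ball x e)" using e(1) by force
        thus "x \<in> U" using e(2) by blast
      qed
      fix x assume x: "x \<notin> A (2*e/3)"
      show "conv r u x = 0"
      proof (rule conv_eq_0[OF rs])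
        fix y assume xy: "norm (x - y) \<le> e/3"
        have "y \<notin> A (e/3)"
        proof
          assume "y \<in> A (e/3)"
          then obtain k where k: "k \<in> K" "norm (y - k) \<le> e/3" unfolding A_def by auto
          have "norm (x - k) \<le> 2*e/3" using norm_triangle_ineq[of "x - y" "y - k"] xy k by simp
          thus False using AI[OF k(1)] x by blast
        qed
        thus "u y = 0" by (simp add: u_def)
      qed
    qed
    show "0 \<le> conv r u x" for x by (rule conv_mollifier_const_ge[OF r u]) (simp add: u_def)
    show le: "conv r u x \<le> 1" for x by (rule conv_mollifier_const_le[OF r u]) (simp add: u_def indicator_def)
    show "conv r u x = 1" if "x \<in> K" for x
    proof (rule antisym[OF le])
      show "1 \<le> conv r u x" by (rule conv_mollifier_const_ge[OF r u]) (use AI[OF that] in \<open>auto simp: u_def norm_minus_commute\<close>)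
    qed
  qed
qed

lemma test_function_conv:
  fixes \<phi> :: "real^'n \<Rightarrow> real"
  assumes r: "smooth_ball e r" and p: "C_k 0 \<phi>" "compact K" "\<And>x. x \<notin> K \<Longrightarrow> \<phi> x = 0"
    and sub: "\<And>x y. y \<in> K \<Longrightarrow> norm (x - y) \<le> e \<Longrightarrow> x \<in> \<Omega>"
  shows "test_function \<Omega> (conv r \<phi>)"
proof -
  have "bounded K" using p(2) compact_imp_bounded by blast
  then obtain R where "\<And>x. x \<in> K \<Longrightarrow> norm x \<le> R" unfolding bounded_iff by auto
  hence i: "integrable lborel \<phi>" using p by (intro continuous_compact_support_integrable[where e=R]) (auto simp: not_le[symmetric])
  show ?thesis
  proof (rule test_functionI[OF C_k_conv[OF r i]])
    show "compact {y + h |y h. y \<in> K \<and> h \<in> cball 0 e}" by (intro compact_sums p compact_cball)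
    show "{y + h |y h. y \<in> K \<and> h \<in> cball 0 e} \<subseteq> \<Omega>" using sub by force
    fix x assume x: "x \<notin> {y + h |y h. y \<in> K \<and> h \<in> cball 0 e}"
    show "conv r \<phi> x = 0"
    proof (rule conv_eq_0[OF r], rule p(3))
      fix y assume n: "norm (x - y) \<le> e"
      show "y \<notin> K"
      proof
        assume "y \<in> K"
        moreover have "x = y + (x - y)" "x - y \<in> cball 0 e" using n by auto
        ultimately show False using x by blast
      qed
    qed
  qed
qed

subsection \<open>Polar decomposition of vector measures\<close>

lemma measurable_vec_component[measurable (raw)]:
  fixes f :: "'a \<Rightarrow> real^'n"
  assumes "f \<in> borel_measurable M" shows "(\<lambda>x. f x $ i) \<in> borel_measurable M"
  by (rule borel_measurable_continuous_on[OF _ assms, of "\<lambda>x. x $ i"]) (intro continuous_intros)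

lemma measurable_vecI:
  fixes f :: "'a \<Rightarrow> real^'n"
  assumes "\<And>i. (\<lambda>x. f x $ i) \<in> borel_measurable M" shows "f \<in> borel_measurable M" unfolding borel_measurable_euclidean_space[of f]
  using assms by (auto simp: Basis_vec_def inner_axis)

lemma integrable_vecI:
  fixes f :: "'a \<Rightarrow> real^'n"
  assumes "\<And>i. integrable M (\<lambda>x. f x $ i)" shows "integrable M f"
proof (rule Bochner_Integration.integrable_bound)
  show "integrable M (\<lambda>x. \<Sum>i\<in>UNIV. \<bar>f x $ i\<bar>)" using assms by auto
  show "f \<in> borel_measurable M" using assms by (intro measurable_vecI) auto
  show "AE x in M. norm (f x) \<le> norm (\<Sum>i\<in>UNIV. \<bar>f x $ i\<bar>)" by (intro always_eventually allI order_trans[OF norm_le_l1_cart]) simp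
qed

lemma integral_vec_component:
  fixes f :: "'a \<Rightarrow> real^'n"
  assumes "integrable M f" shows "(\<integral>x. f x \<partial>M) $ i = (\<integral>x. f x $ i \<partial>M)"
  using integral_bounded_linear[OF bounded_linear_vec_nth assms] by (metis (no_types, lifting))

lemma integrable_vec_component:
  fixes f :: "'a \<Rightarrow> real^'n"
  assumes "integrable M f" shows "integrable M (\<lambda>x. f x $ i)" using integrable_bounded_linear[OF bounded_linear_vec_nth assms] .

text \<open>The sum of the given measures. With it all parts of a decomposition get densities with
  respect to a single measure, and identities between them become pointwise.\<close>

lemma dominating_measure:
  assumes J: "finite J" and M: "\<And>j. j \<in> J \<Longrightarrow> finite_measure (M j)" "\<And>j. j \<in> J \<Longrightarrow> sets (M j) = sets N"
  obtains \<nu> where "finite_measure \<nu>" "sets \<nu> = sets N" "\<And>j. j \<in> J \<Longrightarrow> absolutely_continuous \<nu> (M j)"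
proof -
  define \<nu> where "\<nu> = measure_of (space N) (sets N) (\<lambda>A. \<Sum>j\<in>J. emeasure (M j) A)"
  have s: "sets \<nu> = sets N" "space \<nu> = space N" unfolding \<nu>_def by auto
  have e: "emeasure \<nu> A = (\<Sum>j\<in>J. emeasure (M j) A)" if "A \<in> sets N" for A unfolding \<nu>_def
  proof (rule emeasure_measure_of_sigma)
    show "countably_additive (sets N) (\<lambda>A. \<Sum>j\<in>J. emeasure (M j) A)"
    proof (rule countably_additiveI)
      fix A :: "nat \<Rightarrow> _" assume A: "range A \<subseteq> sets N" "disjoint_family A" "(\<Union>i. A i) \<in> sets N"
      have "(\<Sum>i. \<Sum>j\<in>J. emeasure (M j) (A i)) = (\<Sum>j\<in>J. \<Sum>i. emeasure (M j) (A i))" by (rule suminf_sum) auto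
      also have "... = (\<Sum>j\<in>J. emeasure (M j) (\<Union>i. A i))" using A M(2) by (intro sum.cong refl suminf_emeasure) auto
      finally show "(\<Sum>i. \<Sum>j\<in>J. emeasure (M j) (A i)) = (\<Sum>j\<in>J. emeasure (M j) (\<Union>i. A i))" .
    qed
  qed (use that in \<open>auto simp: positive_def sets.sigma_algebra_axioms\<close>)
  have "emeasure \<nu> (space \<nu>) \<noteq> \<infinity>"
  proof -
    have "emeasure (M j) (space N) < top" if "j \<in> J" for j using finite_measure.emeasure_finite[OF M(1)[OF that]] by (simp add: less_top)
    thus ?thesis using J less_top by (auto simp: e s)
  qed
  hence "finite_measure \<nu>" by (rule finite_measureI)
  moreover have "absolutely_continuous \<nu> (M j)" if "j \<in> J" for j unfolding absolutely_continuous_def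
  proof
    fix A assume "A \<in> null_sets \<nu>"
    hence "A \<in> sets N" "(\<Sum>j\<in>J. emeasure (M j) A) = 0" using e s by (auto simp: null_sets_def)
    thus "A \<in> null_sets (M j)" using J that M(2) by (auto simp: null_sets_def)
  qed
  ultimately show ?thesis using that s by blast
qed

lemma finite_measure_real_density:
  assumes l: "finite_measure \<nu>" and M: "finite_measure M" "sets M = sets \<nu>" and ac: "absolutely_continuous \<nu> M"
  obtains p where "integrable \<nu> p" "\<And>x. 0 \<le> p x" "M = density \<nu> (\<lambda>x. ennreal (p x))"
proof -
  interpret l: finite_measure \<nu> by fact
  obtain f where f: "f \<in> borel_measurable \<nu>" "density \<nu> f = M" using l.Radon_Nikodym[OF ac M(2)] by blast
  have sp: "space M = space \<nu>" using M(2) by (rule sets_eq_imp_space_eq)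
  have "(\<integral>\<^sup>+x. f x \<partial>\<nu>) = emeasure M (space M)" using f by (auto simp: emeasure_density sp intro!: nn_integral_cong)
  hence fin: "(\<integral>\<^sup>+x. f x \<partial>\<nu>) \<noteq> \<infinity>" using finite_measure.emeasure_finite[OF M(1)] by simp
  hence ae: "AE x in \<nu>. ennreal (enn2real (f x)) = f x" using nn_integral_noteq_infinite[OF f(1)] by (auto elim!: eventually_mono simp: less_top)
  have "integrable \<nu> (\<lambda>x. enn2real (f x))"
  proof (rule integrableI_nonneg)
    have "(\<integral>\<^sup>+x. ennreal (enn2real (f x)) \<partial>\<nu>) = (\<integral>\<^sup>+x. f x \<partial>\<nu>)" by (rule nn_integral_cong_AE[OF ae])
    thus "(\<integral>\<^sup>+x. ennreal (enn2real (f x)) \<partial>\<nu>) < \<infinity>" using fin by (simp add: less_top)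
  qed (use f in auto)
  moreover have "M = density \<nu> (\<lambda>x. ennreal (enn2real (f x)))" unfolding f(2)[symmetric] using f(1) ae by (intro density_cong) auto
  ultimately show ?thesis using that by (metis enn2real_nonneg)
qed

lemma density_integrals:
  assumes p: "integrable \<nu> p" "\<And>x. 0 \<le> p x" "M = density \<nu> (\<lambda>x. ennreal (p x))" and f: "(f :: _ \<Rightarrow> real) \<in> borel_measurable \<nu>"
  shows "integral\<^sup>L M f = (\<integral>x. p x * f x \<partial>\<nu>)" "integrable M f \<longleftrightarrow> integrable \<nu> (\<lambda>x. p x * f x)"
  unfolding p(3) using p f
  by (auto intro!: integral_real_density simp: integrable_real_density[OF borel_measurable_integrable[OF p(1)]])

lemma density_measure:
  assumes p: "integrable \<nu> p" "\<And>x. 0 \<le> p x" "M = density \<nu> (\<lambda>x. ennreal (p x))" and A: "A \<in> sets \<nu>"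
  shows "measure M A = (\<integral>x. p x * indicator A x \<partial>\<nu>)"
proof -
  have "measure M A = (\<integral>x. indicator A x \<partial>M)" unfolding p(3) using sets.sets_into_space[OF A] by (simp add: Int_absorb2)
  also have "... = (\<integral>x. p x * indicator A x \<partial>\<nu>)" using A by (intro density_integrals(1)[OF p]) simp
  finally show ?thesis .
qed

text \<open>This is what makes the choice in \<open>vm_integral\<close> harmless. Written as P + N'
  = P' + N, the hypothesis is an identity between densities with respect to a common measure; it
  holds almost everywhere and survives multiplication by \<open>f\<close>. The four measures are
  numbered 0 to 3 in order to apply \<open>dominating_measure\<close>.\<close>

lemma vm_decomposition_unique_integral:
  fixes P N P' N' :: "'a measure"
  and f :: "'a \<Rightarrow> real"
  assumes fin: "finite_measure P" "finite_measure N" "finite_measure P'" "finite_measure N'"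
    and sets: "sets P = sets S" "sets N = sets S" "sets P' = sets S" "sets N' = sets S"
    and eq: "\<And>A. A \<in> sets S \<Longrightarrow> measure P A - measure N A = measure P' A - measure N' A"
    and f: "f \<in> borel_measurable S" "\<And>x. \<bar>f x\<bar> \<le> B"
  shows "integral\<^sup>L P f - integral\<^sup>L N f = integral\<^sup>L P' f - integral\<^sup>L N' f"
proof -
  define M where "M j = (if j = 0 then P else if j = 1 then N else if j = 2 then P' else N')" for j :: nat
  have M: "finite_measure (M j)" "sets (M j) = sets S" for j using fin sets by (auto simp: M_def)
  obtain \<nu> where l: "finite_measure \<nu>" "sets \<nu> = sets S" "\<And>j. j \<in> {..<4} \<Longrightarrow> absolutely_continuous \<nu> (M j)"
    using dominating_measure[of "{..<4::nat}" M S] M by auto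
  have "\<exists>p. integrable \<nu> p \<and> (\<forall>x. 0 \<le> p x) \<and> M j = density \<nu> (\<lambda>x. ennreal (p x))" if "j < 4" for j
    using finite_measure_real_density[OF l(1) M(1), of j] M(2) l that by (metis lessThan_iff)
  then obtain p where p: "\<And>j. j < 4 \<Longrightarrow> integrable \<nu> (p j)" "\<And>j x. j < 4 \<Longrightarrow> 0 \<le> p j x"
    "\<And>j. j < 4 \<Longrightarrow> M j = density \<nu> (\<lambda>x. ennreal (p j x))" by metis
  have fm[measurable]: "f \<in> borel_measurable \<nu>" using f(1) l(2) by (simp cong: measurable_cong_sets)
  have int: "integral\<^sup>L (M j) f = (\<integral>x. p j x * f x \<partial>\<nu>)" if "j < 4" for j using density_integrals(1)[OF p(1)[OF that] p(2)[OF that] p(3)[OF that] fm] .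
  have meas: "measure (M j) A = (\<integral>x. p j x * indicator A x \<partial>\<nu>)" if "j < 4" "A \<in> sets S" for j A
    using density_measure[OF p(1)[OF that(1)] p(2)[OF that(1)] p(3)[OF that(1)]] that l(2) by simp
  have pi: "integrable \<nu> (\<lambda>x. p j x * indicator A x)" if "j < 4" "A \<in> sets S" for j A
    using p(1)[OF that(1)] that(2) l(2) by (intro integrable_real_mult_indicator) auto
  have "AE x in \<nu>. p 0 x + p 3 x = p 2 x + p 1 x"
  proof (rule density_unique_real)
    fix A assume "A \<in> sets \<nu>"
    hence A: "A \<in> sets S" using l by simp
    have "measure (M 0) A + measure (M 3) A = measure (M 2) A + measure (M 1) A" using eq[OF A] by (simp add: M_def)
    hence "(\<integral>x. p 0 x * indicator A x \<partial>\<nu>) + (\<integral>x. p 3 x * indicator A x \<partial>\<nu>) =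
       (\<integral>x. p 2 x * indicator A x \<partial>\<nu>) + (\<integral>x. p 1 x * indicator A x \<partial>\<nu>)" using meas A by simp
    thus "(\<integral>x\<in>A. p 0 x + p 3 x \<partial>\<nu>) = (\<integral>x\<in>A. p 2 x + p 1 x \<partial>\<nu>)" unfolding set_lebesgue_integral_def using pi A by (simp add: distrib_left mult.commute)
  qed (use p in auto)
  hence ae: "AE x in \<nu>. p 0 x * f x + p 3 x * f x = p 2 x * f x + p 1 x * f x" by eventually_elim (simp flip: distrib_right)
  have pf: "integrable \<nu> (\<lambda>x. p j x * f x)" if "j < 4" for j using integrable_bounded_mult[OF p(1)[OF that] fm f(2)] by (simp add: mult.commute)
  have "(\<integral>x. p 0 x * f x + p 3 x * f x \<partial>\<nu>) = (\<integral>x. p 2 x * f x + p 1 x * f x \<partial>\<nu>)" using pf by (intro integral_cong_AE ae borel_measurable_integrable) auto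
  hence "integral\<^sup>L (M 0) f + integral\<^sup>L (M 3) f = integral\<^sup>L (M 2) f + integral\<^sup>L (M 1) f" using pf int by simp
  thus ?thesis by (simp add: M_def)
qed

lemma vm_integral_eq:
  assumes d: "vm_decomposition \<Omega> \<mu> P N" and f: "f \<in> borel_measurable (restrict_space borel \<Omega>)" "\<And>x. \<bar>f x\<bar> \<le> B"
  shows "vm_integral \<Omega> \<mu> f = (\<chi> i. (\<integral>x. f x \<partial>P i) - (\<integral>x. f x \<partial>N i))"
proof -
  let ?Q = "\<lambda>v. \<exists>P N. vm_decomposition \<Omega> \<mu> P N \<and> v = (\<chi> i. (\<integral>x. f x \<partial>P i) - (\<integral>x. f x \<partial>N i))"
  have "?Q (vm_integral \<Omega> \<mu> f)" unfolding vm_integral_def by (rule someI_ex) (use d in blast)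
  then obtain P' N' where d': "vm_decomposition \<Omega> \<mu> P' N'"
    and v: "vm_integral \<Omega> \<mu> f = (\<chi> i. (\<integral>x. f x \<partial>P' i) - (\<integral>x. f x \<partial>N' i))" by blast
  have "(\<lambda>A. \<chi> i. measure (P i) A - measure (N i) A) = (\<lambda>A. \<chi> i. measure (P' i) A - measure (N' i) A)" using d d' unfolding vm_decomposition_def by metis
  hence "measure (P i) A - measure (N i) A = measure (P' i) A - measure (N' i) A" for i A by (metis (mono_tags, lifting) vec_lambda_beta)
  hence "(\<integral>x. f x \<partial>P i) - (\<integral>x. f x \<partial>N i) = (\<integral>x. f x \<partial>P' i) - (\<integral>x. f x \<partial>N' i)" for i using d d' f unfolding vm_decomposition_def
    by (intro vm_decomposition_unique_integral[where S="restrict_space borel \<Omega>" and B=B]) auto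
  thus ?thesis using v by simp
qed

text \<open>Preimages of the balls of radius \<open>e\<close> around a countable dense set, made
  disjoint.\<close>

lemma countable_partition_small:
  fixes g :: "'a \<Rightarrow> 'b::euclidean_space"
  assumes g: "g \<in> borel_measurable M" and e: "e > 0"
  obtains E :: "nat \<Rightarrow> 'a set" and q where "\<And>k. E k \<in> sets M" "disjoint_family E" "(\<Union>k. E k) = space M"
    "\<And>k x. x \<in> E k \<Longrightarrow> norm (g x - q k) < e"
proof -
  obtain D :: "'b set" where D: "countable D" "\<And>X. open X \<Longrightarrow> X \<noteq> {} \<Longrightarrow> \<exists>d\<in>D. d \<in> X" using countable_dense_setE by blast
  have "D \<noteq> {}" using D(2)[of UNIV] by auto
  define q where "q = from_nat_into D"
  define C where "C k = g -` ball (q k) e \<inter> space M" for k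
  have C: "C k \<in> sets M" for k unfolding C_def by (rule measurable_sets[OF g]) auto
  have U: "(\<Union>k. C k) = space M"
  proof
    show "space M \<subseteq> (\<Union>k. C k)"
    proof
      fix x assume x: "x \<in> space M"
      obtain d where d: "d \<in> D" "d \<in> ball (g x) e" using D(2)[of "ball (g x) e"] e by auto
      obtain k where "q k = d" using d(1) from_nat_into_surj[OF D(1)] unfolding q_def by metis
      hence "x \<in> C k" using d(2) x by (auto simp: C_def dist_commute)
      thus "x \<in> (\<Union>k. C k)" by blast
    qed
  qed (auto simp: C_def)
  show ?thesis
  proof (rule that[of "disjointed C" q])
    show "disjointed C k \<in> sets M" for k using sets.range_disjointed_sets[of C M] C by blast
    show "norm (g x - q k) < e" if "x \<in> disjointed C k" for k x using that disjointed_subset[of C k] by (auto simp: C_def dist_norm norm_minus_commute)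
  qed (auto simp: UN_disjointed_eq U disjoint_family_disjointed)
qed

text \<open>The variation of the measure \<open>g \<nu>\<close> is \<open>|g| \<nu>\<close>: on sets where \<open>g\<close> is almost constant, the
  triangle inequality for \<open>\<integral> g\<close> is almost an equality.\<close>

lemma vm_variation_density:
  fixes g :: "real^'n \<Rightarrow> real^'n"
  assumes l: "finite_measure \<nu>" "sets \<nu> = sets (restrict_space borel \<Omega>)" and g: "integrable \<nu> g"
    and mu: "\<And>A. A \<in> sets \<nu> \<Longrightarrow> \<mu> A = (\<integral>x. indicator A x *\<^sub>R g x \<partial>\<nu>)" and A: "A \<in> sets \<nu>"
  shows "vm_variation \<Omega> \<mu> A = emeasure (density \<nu> (\<lambda>x. ennreal (norm (g x)))) A"
proof (rule antisym)
  interpret l: finite_measure \<nu> by fact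
  let ?k = "density \<nu> (\<lambda>x. ennreal (norm (g x)))"
  have gm[measurable]: "g \<in> borel_measurable \<nu>" using g by auto
  have gi: "integrable \<nu> (\<lambda>x. indicator E x *\<^sub>R g x)" if "E \<in> sets \<nu>" for E using integrable_mult_indicator[OF that g] .
  have le: "ennreal (norm (\<mu> E)) \<le> emeasure ?k E" if E: "E \<in> sets \<nu>" for E
  proof -
    have "ennreal (norm (\<mu> E)) \<le> (\<integral>\<^sup>+x. ennreal (norm (indicator E x *\<^sub>R g x)) \<partial>\<nu>)" unfolding mu[OF E] by (rule integral_norm_bound_ennreal[OF gi[OF E]])
    also have "... = (\<integral>\<^sup>+x. ennreal (norm (g x)) * indicator E x \<partial>\<nu>)" by (intro nn_integral_cong) (auto split: split_indicator)
    also have "... = emeasure ?k E" using E by (subst emeasure_density) auto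
    finally show ?thesis .
  qed
  show "vm_variation \<Omega> \<mu> A \<le> emeasure ?k A" unfolding vm_variation_def
  proof (rule SUP_least)
    fix E :: "nat \<Rightarrow> (real^'n) set"
    assume "E \<in> {E. range E \<subseteq> sets (restrict_space borel \<Omega>) \<and> disjoint_family E \<and> \<Union> (range E) = A}"
    hence E: "range E \<subseteq> sets \<nu>" "disjoint_family E" "(\<Union>k. E k) = A" using l by auto
    have "(\<Sum>k. ennreal (norm (\<mu> (E k)))) \<le> (\<Sum>k. emeasure ?k (E k))" using E(1) by (intro suminf_le le) auto
    also have "... = emeasure ?k A" using suminf_emeasure[of E ?k] E by simp
    finally show "(\<Sum>k. ennreal (norm (\<mu> (E k)))) \<le> emeasure ?k A" .
  qed
  show "emeasure ?k A \<le> vm_variation \<Omega> \<mu> A"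
  proof (rule ennreal_le_epsilon)
    fix d :: real assume "d > 0"
    define T where "T = measure \<nu> (space \<nu>)"
    have "T \<ge> 0" unfolding T_def by simp
    \<comment> \<open>The error per unit of mass is \<open>2 * e\<close>, hence at most
      \<open>d\<close> in total; the summand 1 covers the case \<open>T = 0\<close>.\<close>
    define e where "e = d / (2 * (T + 1))"
    have e: "e > 0" using \<open>d > 0\<close> \<open>T \<ge> 0\<close> by (simp add: e_def)
    obtain C :: "nat \<Rightarrow> _" and q where C: "\<And>k. C k \<in> sets \<nu>" "disjoint_family C" "(\<Union>k. C k) = space \<nu>"
      "\<And>k x. x \<in> C k \<Longrightarrow> norm (g x - q k) < e" using countable_partition_small[OF gm e] by blast
    define E where "E k = A \<inter> C k" for k
    have E: "E k \<in> sets \<nu>" for k using A C unfolding E_def by auto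
    have Ed: "disjoint_family E" using C(2) unfolding E_def disjoint_family_on_def by blast
    have Er: "range E \<subseteq> sets \<nu>" using E by blast
    have EU: "(\<Union>k. E k) = A" using C(3) sets.sets_into_space[OF A] unfolding E_def by blast
    \<comment> \<open>The oscillation of \<open>g\<close> on the piece enters twice: when
      \<open>\<mu> (E k)\<close> is compared with \<open>?m *\<^sub>R q k\<close>, and when
      \<open>norm (g x)\<close> is compared with \<open>norm (q k)\<close>.\<close>
    have key: "emeasure ?k (E k) \<le> ennreal (norm (\<mu> (E k))) + ennreal (2 * e) * emeasure \<nu> (E k)" for k
    proof -
      let ?m = "measure \<nu> (E k)"
      have ci: "integrable \<nu> (\<lambda>x. indicator (E k) x *\<^sub>R c)" for c :: "real^'n" using E by (intro integrable_mult_indicator) auto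
      have ci': "integrable \<nu> (\<lambda>x. indicator (E k) x * c)" for c :: real
        using integrable_real_mult_indicator[OF E[of k], of "\<lambda>x. c"] by (simp add: mult.commute)
      have "(\<integral>x. indicator (E k) x *\<^sub>R q k \<partial>\<nu>) = ?m *\<^sub>R q k"
      proof -
        have "set_lebesgue_integral \<nu> (E k) (\<lambda>x. q k) = ?m *\<^sub>R q k" using E by (intro set_integral_const) (auto simp: l.emeasure_eq_measure)
        thus ?thesis unfolding set_lebesgue_integral_def .
      qed
      hence "norm (\<mu> (E k) - ?m *\<^sub>R q k) = norm (\<integral>x. indicator (E k) x *\<^sub>R g x - indicator (E k) x *\<^sub>R q k \<partial>\<nu>)"
        using gi[OF E] ci E mu[OF E] sets.sets_into_space[OF E]
        by (subst Bochner_Integration.integral_diff) (auto simp: Int_absorb2)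
      also have "... \<le> (\<integral>x. indicator (E k) x * e \<partial>\<nu>)"
      proof (rule Bochner_Integration.integral_norm_bound_integral)
        show "norm (indicator (E k) x *\<^sub>R g x - indicator (E k) x *\<^sub>R q k) \<le> indicator (E k) x * e" for x
          using C(4)[of x k] e by (auto simp: E_def split: split_indicator)
      qed (use gi[OF E] ci ci' in auto)
      also have "... = ?m * e" using E sets.sets_into_space[OF E] by (simp add: Int_absorb2)
      finally have "norm (?m *\<^sub>R q k) \<le> norm (\<mu> (E k)) + ?m * e" using norm_triangle_ineq2[of "?m *\<^sub>R q k" "\<mu> (E k)"] by (simp add: norm_minus_commute)
      hence q: "?m * norm (q k) + ?m * e \<le> norm (\<mu> (E k)) + 2 * e * ?m" by (simp add: mult.commute)
      have "emeasure ?k (E k) = (\<integral>\<^sup>+x. ennreal (norm (g x)) * indicator (E k) x \<partial>\<nu>)" using E by (subst emeasure_density) auto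
      also have "... \<le> (\<integral>\<^sup>+x. ennreal (norm (q k) + e) * indicator (E k) x \<partial>\<nu>)"
      proof (intro nn_integral_mono)
        fix x
        have "norm (g x) \<le> norm (q k) + e" if "x \<in> E k" using C(4)[of x k] that norm_triangle_ineq2[of "g x" "q k"] by (auto simp: E_def)
        thus "ennreal (norm (g x)) * indicator (E k) x \<le> ennreal (norm (q k) + e) * indicator (E k) x" by (auto split: split_indicator intro: ennreal_leI)
      qed
      also have "... = ennreal (norm (q k) + e) * ennreal ?m" using E by (simp add: nn_integral_cmult l.emeasure_eq_measure)
      also have "... = ennreal (?m * norm (q k) + ?m * e)" using e by (simp add: ennreal_mult[symmetric] distrib_left mult.commute)
      also have "... \<le> ennreal (norm (\<mu> (E k)) + 2 * e * ?m)" by (rule ennreal_leI[OF q])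
      also have "... = ennreal (norm (\<mu> (E k))) + ennreal (2 * e) * emeasure \<nu> (E k)" using e by (simp add: ennreal_mult l.emeasure_eq_measure)
      finally show ?thesis .
    qed
    have "emeasure ?k A = (\<Sum>k. emeasure ?k (E k))" using suminf_emeasure[of E ?k] Er Ed EU by simp
    also have "... \<le> (\<Sum>k. ennreal (norm (\<mu> (E k))) + ennreal (2 * e) * emeasure \<nu> (E k))" by (intro suminf_le key) auto
    also have "... = (\<Sum>k. ennreal (norm (\<mu> (E k)))) + (\<Sum>k. ennreal (2 * e) * emeasure \<nu> (E k))" by (rule suminf_add[symmetric]) auto
    also have "(\<Sum>k. ennreal (2 * e) * emeasure \<nu> (E k)) = ennreal (2 * e) * emeasure \<nu> A"
      using suminf_emeasure[of E \<nu>] Er Ed EU by (simp add: ennreal_suminf_cmult)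
    finally have sum_le: "emeasure ?k A \<le> (\<Sum>k. ennreal (norm (\<mu> (E k)))) + ennreal (2 * e) * emeasure \<nu> A" .
    have "ennreal (2 * e) * emeasure \<nu> A \<le> ennreal (2 * e) * ennreal T"
      unfolding T_def using A by (intro mult_left_mono) (auto simp: l.emeasure_eq_measure l.bounded_measure)
    also have "... \<le> ennreal d"
    proof -
      have "2 * e * T \<le> d" using \<open>T \<ge> 0\<close> \<open>d > 0\<close> by (simp add: e_def field_simps)
      thus ?thesis using e \<open>T \<ge> 0\<close> by (simp add: ennreal_mult[symmetric] ennreal_leI)
    qed
    finally have le: "ennreal (2 * e) * emeasure \<nu> A \<le> ennreal d" .
    have "(\<Sum>k. ennreal (norm (\<mu> (E k)))) \<le> vm_variation \<Omega> \<mu> A" unfolding vm_variation_def using Er Ed EU l by (intro SUP_upper) auto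
    thus "emeasure ?k A \<le> vm_variation \<Omega> \<mu> A + ennreal d" by (intro order_trans[OF sum_le] add_mono le)
  qed
qed

text \<open>\<open>\<kappa>\<close> stands for the variation of a vector measure and
  \<open>\<sigma>\<close> for its density with respect to \<open>\<kappa>\<close>. The measure is
  defined on the Borel sets of the whole space, without mass outside of \<Omega>, which keeps
  restricted sigma-algebras out of later arguments; the bound on \<open>\<sigma>\<close> at every
  point makes integrands bounded.\<close>

definition polar :: "(real^'n) set \<Rightarrow> (real^'n) measure \<Rightarrow> (real^'n \<Rightarrow> real^'n) \<Rightarrow> bool"
  where "polar \<Omega> \<kappa> \<sigma> \<longleftrightarrow> finite_measure \<kappa> \<and> sets \<kappa> = sets borel \<and> emeasure \<kappa> (- \<Omega>) = 0 \<and>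
    \<sigma> \<in> borel_measurable borel \<and> (\<forall>x. norm (\<sigma> x) \<le> 1) \<and> (AE x in \<kappa>. norm (\<sigma> x) = 1)"

text \<open>Densities of all components with respect to one dominating measure \<open>\<nu>\<close>
  give \<open>\<mu> = g \<nu>\<close>. Then \<open>\<kappa>\<close> is \<open>|g| \<nu>\<close>,
  transported to the Borel sets of the whole space, and \<open>\<sigma>\<close> is
  \<open>sgn g\<close>; the zeros of \<open>g\<close> carry no mass of
  \<open>\<kappa>\<close>.\<close>

lemma vector_measure_polar:
  fixes \<mu> :: "(real^'n) set \<Rightarrow> real^'n"
  assumes O: "\<Omega> \<in> sets borel" and vm: "vector_measure \<Omega> \<mu>"
  obtains \<kappa> \<sigma> where "polar \<Omega> \<kappa> \<sigma>"
    "\<And>A. A \<in> sets borel \<Longrightarrow> vm_variation \<Omega> \<mu> (A \<inter> \<Omega>) = emeasure \<kappa> A"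
    "\<And>f B i. f \<in> borel_measurable borel \<Longrightarrow> (\<And>x. \<bar>f x\<bar> \<le> B) \<Longrightarrow> vm_integral \<Omega> \<mu> f $ i = (\<integral>x. f x * \<sigma> x $ i \<partial>\<kappa>)"
proof -
  obtain P N where d: "vm_decomposition \<Omega> \<mu> P N" using vm unfolding vector_measure_def by blast
  let ?S = "restrict_space borel \<Omega>"
  have sp: "space ?S = \<Omega>" by (simp add: space_restrict_space)
  define M where "M = (\<lambda>(i, b). if b then P i else N i)"
  have M: "finite_measure (M j)" "sets (M j) = sets ?S" for j using d unfolding vm_decomposition_def M_def by (auto simp: case_prod_unfold)
  obtain \<nu> where l: "finite_measure \<nu>" "sets \<nu> = sets ?S" "\<And>j. j \<in> UNIV \<Longrightarrow> absolutely_continuous \<nu> (M j)"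
    using dominating_measure[of "UNIV :: ('n \<times> bool) set" M ?S] M by auto
  interpret l: finite_measure \<nu> by fact
  have spl: "space \<nu> = \<Omega>" using sets_eq_imp_space_eq[OF l(2)] sp by simp
  have "\<exists>p. integrable \<nu> p \<and> (\<forall>x. 0 \<le> p x) \<and> M j = density \<nu> (\<lambda>x. ennreal (p x))" for j
    using finite_measure_real_density[OF l(1) M(1), of j] M(2) l by (metis UNIV_I)
  then obtain p where p: "\<And>j. integrable \<nu> (p j)" "\<And>j x. 0 \<le> p j x"
    "\<And>j. M j = density \<nu> (\<lambda>x. ennreal (p j x))" by metis
  define g where "g x = (\<chi> i. p (i, True) x - p (i, False) x)" for x
  have g: "integrable \<nu> g" unfolding g_def by (rule integrable_vecI) (use p in auto)
  have gm[measurable]: "g \<in> borel_measurable \<nu>" using g by auto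
  have mu: "\<mu> A = (\<integral>x. indicator A x *\<^sub>R g x \<partial>\<nu>)" if A: "A \<in> sets \<nu>" for A
  proof -
    have pm: "measure (M j) A = (\<integral>x. p j x * indicator A x \<partial>\<nu>)" for j using density_measure[OF p A] .
    have pi: "integrable \<nu> (\<lambda>x. p j x * indicator A x)" for j using p(1) A by (intro integrable_real_mult_indicator) auto
    have "\<mu> A $ i = (\<integral>x. indicator A x *\<^sub>R g x \<partial>\<nu>) $ i" for i
    proof -
      have "\<mu> A $ i = measure (M (i, True)) A - measure (M (i, False)) A" using d unfolding vm_decomposition_def M_def by simp
      also have "... = (\<integral>x. (indicator A x *\<^sub>R g x) $ i \<partial>\<nu>)" using pi by (simp add: pm g_def right_diff_distrib mult.commute)
      finally show ?thesis using integral_vec_component[OF integrable_mult_indicator[OF A g]] by simp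
    qed
    thus ?thesis by (simp add: vec_eq_iff)
  qed
  have f_int: "vm_integral \<Omega> \<mu> f $ i = (\<integral>x. f x * g x $ i \<partial>\<nu>)"
    if f: "f \<in> borel_measurable borel" "\<And>x. \<bar>f x\<bar> \<le> B" for f B i
  proof -
    have fr: "f \<in> borel_measurable ?S" using f(1) by (rule measurable_restrict_space1)
    hence fm: "f \<in> borel_measurable \<nu>" using l(2) by (simp cong: measurable_cong_sets)
    have "vm_integral \<Omega> \<mu> f $ i = integral\<^sup>L (M (i, True)) f - integral\<^sup>L (M (i, False)) f" using vm_integral_eq[OF d fr f(2)] by (simp add: M_def)
    also have "... = (\<integral>x. p (i, True) x * f x \<partial>\<nu>) - (\<integral>x. p (i, False) x * f x \<partial>\<nu>)" using density_integrals(1)[OF p fm] by simp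
    also have "... = (\<integral>x. f x * g x $ i \<partial>\<nu>)"
    proof -
      have "integrable \<nu> (\<lambda>x. p j x * f x)" for j using integrable_bounded_mult[OF p(1) fm f(2)] by (simp add: mult.commute)
      thus ?thesis by (simp add: g_def right_diff_distrib mult.commute)
    qed
    finally show ?thesis .
  qed
  define \<kappa>0 where "\<kappa>0 = density \<nu> (\<lambda>x. ennreal (norm (g x)))"
  define \<kappa> where "\<kappa> = distr \<kappa>0 borel (\<lambda>x. x)"
  define \<sigma> where "\<sigma> x = (if x \<in> \<Omega> then sgn (g x) else 0)" for x
  have idm[measurable]: "(\<lambda>x. x) \<in> measurable \<nu> borel" using measurable_restrict_space1[of "\<lambda>x. x" borel borel \<Omega>] l(2) by (simp cong: measurable_cong_sets)
  have k0: "sets \<kappa>0 = sets \<nu>" "space \<kappa>0 = \<Omega>" unfolding \<kappa>0_def using spl by auto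
  have idk[measurable]: "(\<lambda>x. x) \<in> measurable \<kappa>0 borel" using idm unfolding \<kappa>0_def by simp
  have kA: "emeasure \<kappa> A = emeasure \<kappa>0 (A \<inter> \<Omega>)" if "A \<in> sets borel" for A unfolding \<kappa>_def using that by (subst emeasure_distr) (auto simp: k0)
  have fin0: "emeasure \<kappa>0 \<Omega> < \<infinity>"
  proof -
    have "emeasure \<kappa>0 \<Omega> = (\<integral>\<^sup>+x. ennreal (norm (g x)) * indicator \<Omega> x \<partial>\<nu>)" unfolding \<kappa>0_def using spl by (subst emeasure_density) auto
    also have "... \<le> (\<integral>\<^sup>+x. ennreal (norm (g x)) \<partial>\<nu>)" by (intro nn_integral_mono) (auto split: split_indicator)
    also have "... < \<infinity>" using g by (simp add: integrable_iff_bounded)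
    finally show ?thesis .
  qed
  have \<sigma>_lam: "\<sigma> \<in> borel_measurable ?S"
  proof -
    have "g \<in> borel_measurable ?S" using gm l(2) by (simp cong: measurable_cong_sets)
    hence "(\<lambda>x. sgn (g x)) \<in> borel_measurable ?S" by measurable
    thus ?thesis by (rule measurable_cong[THEN iffD1, rotated]) (auto simp: \<sigma>_def sp)
  qed
  have \<sigma>m[measurable]: "\<sigma> \<in> borel_measurable borel"
  proof -
    have "(\<lambda>x. if x \<in> \<Omega> then \<sigma> x else 0) \<in> borel_measurable borel" using \<sigma>_lam O by (subst measurable_restrict_space_iff[symmetric]) auto
    also have "(\<lambda>x. if x \<in> \<Omega> then \<sigma> x else 0) = \<sigma>" by (auto simp: \<sigma>_def)
    finally show ?thesis .
  qed
  have "polar \<Omega> \<kappa> \<sigma>" unfolding polar_def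
  proof (intro conjI)
    show "finite_measure \<kappa>" by (rule finite_measureI) (use kA[of UNIV] fin0 in \<open>auto simp: \<kappa>_def\<close>)
    show "emeasure \<kappa> (- \<Omega>) = 0" using kA[of "- \<Omega>"] O by simp
    show "\<forall>x. norm (\<sigma> x) \<le> 1" by (simp add: \<sigma>_def norm_sgn)
    have "AE x in \<nu>. 0 < ennreal (norm (g x)) \<longrightarrow> norm (\<sigma> x) = 1" using spl by (auto intro!: AE_I2 simp: \<sigma>_def norm_sgn)
    hence "AE x in \<kappa>0. norm (\<sigma> x) = 1" unfolding \<kappa>0_def by (subst AE_density) auto
    thus "AE x in \<kappa>. norm (\<sigma> x) = 1" unfolding \<kappa>_def by (subst AE_distr_iff) auto
  qed (auto simp: \<kappa>_def)
  moreover have "vm_variation \<Omega> \<mu> (A \<inter> \<Omega>) = emeasure \<kappa> A" if "A \<in> sets borel" for A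
  proof -
    have "A \<inter> \<Omega> \<in> sets \<nu>" using that O l(2) by (auto simp: sets_restrict_space_iff)
    thus ?thesis unfolding kA[OF that] \<kappa>0_def by (intro vm_variation_density[OF l(1,2) g mu])
  qed
  moreover have "vm_integral \<Omega> \<mu> f $ i = (\<integral>x. f x * \<sigma> x $ i \<partial>\<kappa>)"
    if f: "f \<in> borel_measurable borel" "\<And>x. \<bar>f x\<bar> \<le> B" for f B i
  proof -
    note [measurable] = f(1)
    have fr: "f \<in> borel_measurable ?S" using f(1) by (rule measurable_restrict_space1)
    have m: "(\<lambda>x. f x * \<sigma> x $ i) \<in> borel_measurable \<nu>" using fr measurable_vec_component[OF \<sigma>_lam, of i] l(2) by (simp cong: measurable_cong_sets)
    have "(\<integral>x. f x * \<sigma> x $ i \<partial>\<kappa>) = (\<integral>x. f x * \<sigma> x $ i \<partial>\<kappa>0)" unfolding \<kappa>_def by (subst integral_distr) auto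
    also have "... = (\<integral>x. norm (g x) * (f x * \<sigma> x $ i) \<partial>\<nu>)" unfolding \<kappa>0_def using m by (intro integral_real_density) auto
    also have "... = (\<integral>x. f x * g x $ i \<partial>\<nu>)"
    proof (intro Bochner_Integration.integral_cong refl)
      fix x assume "x \<in> space \<nu>"
      hence "\<sigma> x $ i = g x $ i / norm (g x)" unfolding \<sigma>_def spl sgn_div_norm by (simp add: divide_inverse)
      thus "norm (g x) * (f x * \<sigma> x $ i) = f x * g x $ i" by (cases "g x = 0") auto
    qed
    finally show ?thesis using f_int[OF f] by simp
  qed
  ultimately show ?thesis using that by blast
qed

lemma BV_polar:
  fixes u :: "real^'n \<Rightarrow> real"
  assumes O: "open \<Omega>" and u: "u \<in> BV \<Omega>"
  obtains \<kappa> \<sigma> where "polar \<Omega> \<kappa> \<sigma>" "\<And>A. A \<in> sets borel \<Longrightarrow> Dvar \<Omega> u A = enn2ereal (emeasure \<kappa> A)"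
    "\<And>\<phi> i. test_function \<Omega> \<phi> \<Longrightarrow> partial_pairing \<Omega> u i \<phi> = - (\<integral>x. \<phi> x * \<sigma> x $ i \<partial>\<kappa>)"
proof -
  have h: "has_gradient_measure \<Omega> u (gradient_measure \<Omega> u)"
    using u unfolding BV_def gradient_measure_def using someI_ex[of "has_gradient_measure \<Omega> u"] by blast
  hence v: "vector_measure \<Omega> (gradient_measure \<Omega> u)" unfolding has_gradient_measure_def by blast
  have Ob: "\<Omega> \<in> sets borel" using O by simp
  show ?thesis
  proof (rule vector_measure_polar[OF Ob v])
    fix \<kappa> \<sigma>
    assume p: "polar \<Omega> \<kappa> \<sigma>" and
      1: "\<And>A. A \<in> sets borel \<Longrightarrow> vm_variation \<Omega> (gradient_measure \<Omega> u) (A \<inter> \<Omega>) = emeasure \<kappa> A" and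
      2: "\<And>f B i. f \<in> borel_measurable borel \<Longrightarrow> (\<And>x. \<bar>f x\<bar> \<le> B) \<Longrightarrow> vm_integral \<Omega> (gradient_measure \<Omega> u) f $ i = (\<integral>x. f x * \<sigma> x $ i \<partial>\<kappa>)"
    show thesis
    proof (rule that[OF p])
      show "Dvar \<Omega> u A = enn2ereal (emeasure \<kappa> A)" if "A \<in> sets borel" for A unfolding Dvar_def using u 1[OF that] by simp
      fix \<phi> i assume t: "test_function \<Omega> \<phi>"
      then obtain R where R: "smooth_ball R \<phi>" using test_function_smooth_ball by blast
      obtain B where "\<And>x. \<bar>\<phi> x\<bar> \<le> B" using smooth_ball_bounded[OF R] by blast
      thus "partial_pairing \<Omega> u i \<phi> = - (\<integral>x. \<phi> x * \<sigma> x $ i \<partial>\<kappa>)" using h t 2[OF smooth_ball_measurable[OF R]] unfolding has_gradient_measure_def by metis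
    qed
  qed
qed

subsection \<open>Total variation on open subsets\<close>

definition test_field :: "(real^'n) set \<Rightarrow> (real^'n \<Rightarrow> real^'n) \<Rightarrow> bool"
  where "test_field \<Omega> \<phi> \<longleftrightarrow> (\<forall>i. test_function \<Omega> (\<lambda>x. \<phi> x $ i)) \<and> (\<forall>x. norm (\<phi> x) \<le> 1)"

lemma TV_test_field: "TV \<Omega> u = (SUP \<phi> \<in> Collect (test_field \<Omega>). ereal (div_pairing \<Omega> u \<phi>))" unfolding TV_def test_field_def by simp

lemma TV_upper: "test_field \<Omega> \<phi> \<Longrightarrow> ereal (div_pairing \<Omega> u \<phi>) \<le> TV \<Omega> u" unfolding TV_test_field by (rule SUP_upper) simp

lemma TV_least: "(\<And>\<phi>. test_field \<Omega> \<phi> \<Longrightarrow> ereal (div_pairing \<Omega> u \<phi>) \<le> c) \<Longrightarrow> TV \<Omega> u \<le> c" unfolding TV_test_field by (rule SUP_least) simp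

lemma test_function_zero: "test_function \<Omega> (\<lambda>x. 0)" by (rule test_functionI[of _ "{}"]) (auto intro: C_k_const)

lemma partial_deriv_zero: "partial_deriv i (\<lambda>x. 0) x = 0" by (subst partial_deriv_eq[OF has_derivative_const]) simp

lemma TV_nonneg: "0 \<le> TV \<Omega> u" using TV_upper[of \<Omega> "\<lambda>x. 0" u] unfolding test_field_def divergence_def
  by (simp add: test_function_zero partial_deriv_zero zero_ereal_def)

lemma test_function_partial_deriv:
  assumes "test_function \<Omega> \<phi>" shows "test_function \<Omega> (partial_deriv i \<phi>)"
proof -
  obtain K where K: "compact K" "K \<subseteq> \<Omega>" "\<And>x. x \<notin> K \<Longrightarrow> \<phi> x = 0" using test_function_support[OF assms] by blast
  show ?thesis
  proof (rule test_functionI[OF _ K(1,2)])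
    show "C_k k (partial_deriv i \<phi>)" for k using assms unfolding test_function_def by (metis C_k.simps(2))
    fix x assume "x \<notin> K"
    hence "partial_deriv i \<phi> x = partial_deriv i (\<lambda>x. 0) x" using K by (intro partial_deriv_transform[of "- K"]) (auto intro: compact_imp_closed)
    thus "partial_deriv i \<phi> x = 0" by (simp add: partial_deriv_zero)
  qed
qed

lemma test_function_outside: "test_function \<Omega> \<phi> \<Longrightarrow> x \<notin> \<Omega> \<Longrightarrow> \<phi> x = 0" using test_function_support by (metis subsetD)

lemma test_function_bounds:
  assumes "test_function \<Omega> \<phi>"
  shows "\<phi> \<in> borel_measurable borel" "\<exists>B>0. \<forall>x. \<bar>\<phi> x\<bar> \<le> B" "continuous_on UNIV \<phi>" "integrable lborel \<phi>"
  using test_function_smooth_ball[OF assms] smooth_ball_measurable smooth_ball_bounded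
    smooth_ball_continuous smooth_ball_integrable by blast+

lemma test_field_divergence:
  assumes "test_field \<Omega> \<phi>"
  shows "divergence \<phi> \<in> borel_measurable borel" "\<exists>B>0. \<forall>x. \<bar>divergence \<phi> x\<bar> \<le> B"
    "\<And>x. x \<notin> \<Omega> \<Longrightarrow> divergence \<phi> x = 0" "integrable lborel (divergence \<phi>)"
    "\<phi> \<in> borel_measurable borel" "\<And>x. x \<notin> \<Omega> \<Longrightarrow> \<phi> x = 0"
proof -
  have t: "test_function \<Omega> (\<lambda>x. \<phi> x $ i)" for i using assms unfolding test_field_def by blast
  have p: "test_function \<Omega> (partial_deriv i (\<lambda>x. \<phi> x $ i))" for i by (rule test_function_partial_deriv[OF t])
  have d: "divergence \<phi> = (\<lambda>x. \<Sum>i\<in>UNIV. partial_deriv i (\<lambda>x. \<phi> x $ i) x)" by (auto simp: divergence_def)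
  show "divergence \<phi> \<in> borel_measurable borel" unfolding d using test_function_bounds(1)[OF p] by measurable
  show "integrable lborel (divergence \<phi>)" unfolding d using test_function_bounds(4)[OF p] by simp
  have "\<forall>i. \<exists>B>0. \<forall>x. \<bar>partial_deriv i (\<lambda>x. \<phi> x $ i) x\<bar> \<le> B" using test_function_bounds(2)[OF p] by blast
  then obtain B where B: "\<And>i. B i > 0" "\<And>i x. \<bar>partial_deriv i (\<lambda>x. \<phi> x $ i) x\<bar> \<le> B i" by metis
  have "\<bar>divergence \<phi> x\<bar> \<le> (\<Sum>i\<in>UNIV. B i)" for x unfolding d by (intro order_trans[OF sum_abs] sum_mono B)
  moreover have "(\<Sum>i\<in>UNIV. B i) > 0" using B by (intro sum_pos) auto
  ultimately show "\<exists>B>0. \<forall>x. \<bar>divergence \<phi> x\<bar> \<le> B" by blast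
  show "divergence \<phi> x = 0" if "x \<notin> \<Omega>" for x unfolding d using test_function_outside[OF p that] by simp
  show "\<phi> \<in> borel_measurable borel" using test_function_bounds(1)[OF t] by (rule measurable_vecI)
  show "\<phi> x = 0" if "x \<notin> \<Omega>" for x using test_function_outside[OF t that] by (simp add: vec_eq_iff)
qed

lemma test_field_mono: "test_field U \<phi> \<Longrightarrow> U \<subseteq> V \<Longrightarrow> test_field V \<phi>" unfolding test_field_def using test_function_mono by blast

lemma test_function_uminus: "test_function \<Omega> \<phi> \<Longrightarrow> test_function \<Omega> (\<lambda>x. - \<phi> x)"
proof -
  assume t: "test_function \<Omega> \<phi>"
  obtain K where "compact K" "K \<subseteq> \<Omega>" "\<And>x. x \<notin> K \<Longrightarrow> \<phi> x = 0" using test_function_support[OF t] by blast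
  moreover have "C_k k (\<lambda>x. (-1) * \<phi> x)" for k using t unfolding test_function_def by (intro C_k_cmult) auto
  ultimately show ?thesis by (intro test_functionI[of _ K]) auto
qed

lemma test_field_uminus: "test_field \<Omega> \<phi> \<Longrightarrow> test_field \<Omega> (\<lambda>x. - \<phi> x)" unfolding test_field_def using test_function_uminus by auto

text \<open>The lower bound in the duality between vector measures and test fields. \<open>W\<close>
  is cut into pieces on which \<open>g\<close> is almost a constant \<open>q k\<close>; finitely
  many of them are approximated from inside by compact sets \<open>K k\<close>, and the field equals
  \<open>sgn (q k)\<close> on \<open>K k\<close>, with cutoffs supported in disjoint open sets so
  that its norm stays at most 1.\<close>

lemma test_field_approx:
  fixes g :: "real^'n \<Rightarrow> real^'n"
  assumes k: "finite_measure \<kappa>" "sets \<kappa> = sets borel" and g[measurable]: "g \<in> borel_measurable borel"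
    and B: "\<And>x. norm (g x) \<le> B" and W: "open W" and d: "d > 0"
  obtains \<phi> where "test_field W \<phi>" "(\<integral>x. indicator W x * norm (g x) \<partial>\<kappa>) - d \<le> (\<integral>x. \<phi> x \<bullet> g x \<partial>\<kappa>)"
proof -
  interpret k: finite_measure \<kappa> by fact
  note [measurable_cong] = k(2)
  have sp: "space \<kappa> = UNIV" using sets_eq_imp_space_eq[OF k(2)] by simp
  have B0: "B \<ge> 0" using B[of 0] norm_ge_zero order_trans by blast
  have Wm[measurable]: "W \<in> sets borel" using W by simp
  define T where "T = measure \<kappa> UNIV"
  have T0: "T \<ge> 0" unfolding T_def by simp
  \<comment> \<open>The oscillation \<open>e\<close> costs \<open>2 * e * T \<le> d / 4\<close>.
    Mass at most \<open>c\<close> is lost twice, by stopping at \<open>n\<close> pieces and by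
    passing to compact sets, which costs \<open>2 * B * (2 * c) \<le> d / 2\<close>.\<close>
  define e where "e = d / (8 * (T + 1))"
  define c where "c = d / (8 * (B + 1))"
  have e0: "e > 0" and c0: "c > 0" using d T0 B0 by (auto simp: e_def c_def)
  obtain C :: "nat \<Rightarrow> _" and q where C: "\<And>k. C k \<in> sets borel" "disjoint_family C" "(\<Union>k. C k) = UNIV"
    "\<And>k x. x \<in> C k \<Longrightarrow> norm (g x - q k) < e" using countable_partition_small[OF g e0] by (metis space_borel)
  define E where "E k = W \<inter> C k" for k
  have E[measurable]: "E k \<in> sets borel" for k using C W unfolding E_def by auto
  have Ed: "disjoint_family E" using C(2) unfolding E_def disjoint_family_on_def by blast
  have EU: "(\<Union>k. E k) = W" using C(3) unfolding E_def by blast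
  have "(\<lambda>n. measure \<kappa> (\<Union>k<n. E k)) \<longlonglongrightarrow> measure \<kappa> (\<Union>n. \<Union>k<n. E k)" by (rule k.finite_Lim_measure_incseq) (auto simp: incseq_def k(2) intro: less_le_trans)
  moreover have "(\<Union>n. \<Union>k<n. E k) = W" using EU by blast
  ultimately have "(\<lambda>n. measure \<kappa> (\<Union>k<n. E k)) \<longlonglongrightarrow> measure \<kappa> W" by simp
  hence "eventually (\<lambda>n. measure \<kappa> W - c < measure \<kappa> (\<Union>k<n. E k)) sequentially" using c0 by (intro order_tendstoD(1)) auto
  then obtain n where n: "measure \<kappa> W - c < measure \<kappa> (\<Union>k<n. E k)" by (auto simp: eventually_sequentially)
  have "\<exists>K. K \<subseteq> E k \<and> compact K \<and> measure \<kappa> (E k) - c / (n + 1) < measure \<kappa> K" for k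
  proof -
    have "emeasure \<kappa> (E k) = (SUP K \<in> {K. K \<subseteq> E k \<and> compact K}. emeasure \<kappa> K)" by (rule inner_regular) (auto simp: k(2))
    hence S: "ennreal (measure \<kappa> (E k)) = (SUP K \<in> {K. K \<subseteq> E k \<and> compact K}. emeasure \<kappa> K)" by (simp add: k.emeasure_eq_measure)
    show ?thesis
    proof (cases "measure \<kappa> (E k) - c / (n + 1) < 0")
      case True thus ?thesis by (intro exI[of _ "{}"]) auto
    next
      case False
      have "ennreal (measure \<kappa> (E k) - c / (n + 1)) < ennreal (measure \<kappa> (E k))"
      proof (rule ennreal_lessI)
        have "c / (n + 1) > 0" using c0 by simp
        thus "0 < measure \<kappa> (E k)" "measure \<kappa> (E k) - c / (n + 1) < measure \<kappa> (E k)" using False by linarith+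
      qed
      then obtain K where "K \<subseteq> E k" "compact K" "ennreal (measure \<kappa> (E k) - c / (n + 1)) < emeasure \<kappa> K" unfolding S less_SUP_iff by auto
      thus ?thesis using False by (intro exI[of _ K]) (auto simp: k.emeasure_eq_measure ennreal_less_iff)
    qed
  qed
  then obtain K where K: "\<And>k. K k \<subseteq> E k" "\<And>k. compact (K k)" "\<And>k. measure \<kappa> (E k) - c / (n + 1) < measure \<kappa> (K k)" by metis
  have Km[measurable]: "K k \<in> sets borel" for k using K(2) by (rule borel_compact)
  define J where "J = {k. k < n \<and> K k \<noteq> {}}"
  have J: "finite J" unfolding J_def by simp
  \<comment> \<open>Voronoi cells: the points strictly closer to \<open>K k\<close> than to the
    other compact sets. They are open and pairwise disjoint. Empty sets are kept out by
    \<open>J\<close>, as \<open>infdist\<close> to the empty set is 0.\<close>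
  define U where "U k = W \<inter> (\<Inter>l\<in>J - {k}. {x. infdist x (K k) < infdist x (K l)})" for k
  have Uo: "open (U k)" for k unfolding U_def using W J by (intro open_Int open_INT ballI open_Collect_less continuous_on_infdist continuous_on_id) auto
  have KU: "K k \<subseteq> U k" if "k \<in> J" for k
  proof
    fix x assume x: "x \<in> K k"
    have "infdist x (K k) < infdist x (K l)" if "l \<in> J - {k}" for l
    proof -
      have "x \<notin> K l" using x K(1)[of k] K(1)[of l] Ed that unfolding disjoint_family_on_def by blast
      hence "infdist x (K l) \<noteq> 0" using in_closed_iff_infdist_zero[of "K l" x] K(2)[of l] that by (auto simp: J_def compact_imp_closed)
      thus ?thesis using x infdist_nonneg[of x "K l"] by (simp add: order_less_le)
    qed
    thus "x \<in> U k" using x K(1)[of k] by (auto simp: U_def E_def)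
  qed
  have Ud: "U k \<inter> U l = {}" if "k \<in> J" "l \<in> J" "k \<noteq> l" for k l
  proof -
    have "infdist x (K k) < infdist x (K l)" "infdist x (K l) < infdist x (K k)" if "x \<in> U k" "x \<in> U l" for x
      using that \<open>k \<in> J\<close> \<open>l \<in> J\<close> \<open>k \<noteq> l\<close> unfolding U_def by auto
    thus ?thesis by fastforce
  qed
  have "\<exists>\<eta>. test_function (U k) \<eta> \<and> (\<forall>x. 0 \<le> \<eta> x \<and> \<eta> x \<le> 1) \<and> (\<forall>x\<in>K k. \<eta> x = 1)" if "k \<in> J" for k using smooth_cutoff[OF K(2) KU[OF that] Uo] by metis
  then obtain \<eta> where \<eta>: "\<And>k. k \<in> J \<Longrightarrow> test_function (U k) (\<eta> k)" "\<And>k x. k \<in> J \<Longrightarrow> 0 \<le> \<eta> k x"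
    "\<And>k x. k \<in> J \<Longrightarrow> \<eta> k x \<le> 1" "\<And>k x. k \<in> J \<Longrightarrow> x \<in> K k \<Longrightarrow> \<eta> k x = 1" by metis
  define \<phi> where "\<phi> x = (\<Sum>k\<in>J. \<eta> k x *\<^sub>R sgn (q k))" for x
  have \<phi>1: "\<phi> x = \<eta> k x *\<^sub>R sgn (q k)" if "k \<in> J" "x \<in> U k" for k x
  proof -
    have "\<eta> l x = 0" if "l \<in> J - {k}" for l using Ud[of l k] that \<open>k \<in> J\<close> \<open>x \<in> U k\<close> test_function_outside[OF \<eta>(1)[of l]] by blast
    thus ?thesis unfolding \<phi>_def by (subst sum.remove[OF J \<open>k \<in> J\<close>]) simp
  qed
  have \<phi>0: "\<phi> x = 0" if "\<And>k. k \<in> J \<Longrightarrow> x \<notin> U k" for x unfolding \<phi>_def using test_function_outside[OF \<eta>(1)] that by (intro sum.neutral) auto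
  have \<phi>n: "norm (\<phi> x) \<le> 1" for x
  proof (cases "\<exists>k\<in>J. x \<in> U k")
    case True
    then obtain k where k: "k \<in> J" "x \<in> U k" by blast
    have "norm (\<phi> x) = \<bar>\<eta> k x\<bar> * norm (sgn (q k))" by (simp add: \<phi>1[OF k])
    also have "... \<le> 1 * 1" using \<eta>(2,3)[OF k(1), of x] by (intro mult_mono) (auto simp: norm_sgn)
    finally show ?thesis by simp
  qed (use \<phi>0 in force)
  have tf: "test_field W \<phi>"
  proof -
    have "test_function W (\<lambda>x. \<phi> x $ i)" for i
    proof -
      have "\<forall>k\<in>J. \<exists>S. compact S \<and> S \<subseteq> U k \<and> (\<forall>x. x \<notin> S \<longrightarrow> \<eta> k x = 0)" using \<eta>(1) test_function_support by metis
      then obtain S where S: "\<And>k. k \<in> J \<Longrightarrow> compact (S k)" "\<And>k. k \<in> J \<Longrightarrow> S k \<subseteq> U k" "\<And>k x. k \<in> J \<Longrightarrow> x \<notin> S k \<Longrightarrow> \<eta> k x = 0" by metis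
      have "C_k m (\<lambda>x. \<Sum>k\<in>J. sgn (q k) $ i * \<eta> k x)" for m using \<eta>(1) unfolding test_function_def by (intro C_k_sum C_k_cmult) blast
      hence "C_k m (\<lambda>x. \<phi> x $ i)" for m unfolding \<phi>_def by (simp add: mult.commute)
      thus ?thesis
      proof (rule test_functionI)
        show "compact (\<Union>k\<in>J. S k)" using J S(1) by blast
        show "(\<Union>k\<in>J. S k) \<subseteq> W" using S(2) unfolding U_def by blast
        fix x assume "x \<notin> (\<Union>k\<in>J. S k)"
        thus "\<phi> x $ i = 0" using S(3) unfolding \<phi>_def by simp
      qed
    qed
    thus ?thesis using \<phi>n unfolding test_field_def by blast
  qed
  note [measurable] = test_field_divergence(5)[OF tf]
  define KK where "KK = (\<Union>k<n. K k)"
  have KK[measurable]: "KK \<in> sets borel" unfolding KK_def by measurable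
  have KKW: "KK \<subseteq> W" unfolding KK_def using K(1) unfolding E_def by blast
  \<comment> \<open>On \<open>KK\<close> the field is \<open>sgn (q k)\<close> and attains
    \<open>norm (g x)\<close> up to \<open>2 * e\<close>; on the rest of \<open>W\<close> the value
    may be as low as \<open>- norm (g x)\<close>, a loss of at most \<open>2 * B\<close>.\<close>
  have pw: "indicator W x * norm (g x) - 2 * e - 2 * B * indicator (W - KK) x \<le> \<phi> x \<bullet> g x" for x
  proof (cases "x \<in> W")
    case False
    hence "\<phi> x = 0" using test_field_divergence(6)[OF tf] by blast
    thus ?thesis using False e0 by simp
  next
    case xW: True
    show ?thesis
    proof (cases "x \<in> KK")
      case True
      then obtain k where k: "k < n" "x \<in> K k" unfolding KK_def by blast
      hence kJ: "k \<in> J" unfolding J_def by blast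
      have "\<phi> x = sgn (q k)" using \<phi>1[OF kJ] KU[OF kJ] k(2) \<eta>(4)[OF kJ k(2)] by auto
      moreover have "x \<in> C k" using K(1)[of k] k(2) unfolding E_def by blast
      hence gq: "norm (g x - q k) < e" using C(4) by blast
      moreover have "sgn (q k) \<bullet> g x \<ge> norm (g x) - 2 * e"
      proof -
        have "sgn (q k) \<bullet> q k = norm (q k)" by (cases "q k = 0") (auto simp: sgn_div_norm power2_norm_eq_inner[symmetric] power2_eq_square)
        moreover have "\<bar>sgn (q k) \<bullet> (g x - q k)\<bar> \<le> 1 * norm (g x - q k)"
          by (intro order_trans[OF Cauchy_Schwarz_ineq2] mult_right_mono) (auto simp: norm_sgn)
        moreover have "norm (g x) \<le> norm (q k) + norm (g x - q k)" by (metis add.commute norm_triangle_sub)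
        moreover have "sgn (q k) \<bullet> g x = sgn (q k) \<bullet> q k + sgn (q k) \<bullet> (g x - q k)" by (simp add: inner_diff_right)
        ultimately show ?thesis using gq by linarith
      qed
      ultimately show ?thesis using True xW by simp
    next
      case False
      have "\<bar>\<phi> x \<bullet> g x\<bar> \<le> 1 * norm (g x)" by (intro order_trans[OF Cauchy_Schwarz_ineq2] mult_right_mono \<phi>n) auto
      thus ?thesis using False xW B[of x] e0 by simp
    qed
  qed
  have mKK: "measure \<kappa> (W - KK) \<le> 2 * c"
  proof -
    have d1: "disjoint_family_on E {..<n}" "disjoint_family_on K {..<n}" using Ed K(1) unfolding disjoint_family_on_def by blast+
    have "measure \<kappa> (\<Union>k<n. E k) = (\<Sum>k<n. measure \<kappa> (E k))" by (rule k.finite_measure_finite_Union) (auto simp: d1 k(2))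
    also have "... \<le> (\<Sum>k<n. measure \<kappa> (K k) + c / (n + 1))" using K(3) by (intro sum_mono) (simp add: less_imp_le diff_le_eq[symmetric])
    also have "... = measure \<kappa> KK + n * (c / (n + 1))"
      unfolding KK_def using k.finite_measure_finite_Union[of "{..<n}" K] d1(2) by (simp add: sum.distrib k(2) image_subset_iff)
    also have "... \<le> measure \<kappa> KK + c" using c0 by (simp add: field_simps)
    finally have "measure \<kappa> W - measure \<kappa> KK \<le> 2 * c" using n by simp
    thus ?thesis using k.finite_measure_Diff[of W KK] KKW by (simp add: k(2))
  qed
  have bnd: "integrable \<kappa> f" if "f \<in> borel_measurable borel" "\<And>x. \<bar>f x\<bar> \<le> b" for f :: "_ \<Rightarrow> real" and b
    using that by (intro k.integrable_const_bound[where B=b]) auto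
  have i1: "integrable \<kappa> (\<lambda>x. indicator W x * norm (g x))" using B B0 by (intro bnd[where b=B]) (auto simp: indicator_def)
  have i2: "integrable \<kappa> (indicat_real (W - KK))" by (intro bnd[where b=1]) (auto simp: indicator_def)
  have i3: "integrable \<kappa> (\<lambda>x. \<phi> x \<bullet> g x)"
  proof (rule bnd[where b=B])
    show "\<bar>\<phi> x \<bullet> g x\<bar> \<le> B" for x using mult_mono[OF \<phi>n[of x] B[of x]] B0 by (intro order_trans[OF Cauchy_Schwarz_ineq2]) auto
  qed measurable
  have "(\<integral>x. indicator W x * norm (g x) \<partial>\<kappa>) - 2 * e * T - 2 * B * measure \<kappa> (W - KK)
     = (\<integral>x. indicator W x * norm (g x) - 2 * e - 2 * B * indicator (W - KK) x \<partial>\<kappa>)" using i1 i2 by (simp add: T_def sp Int_absorb2)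
  also have "... \<le> (\<integral>x. \<phi> x \<bullet> g x \<partial>\<kappa>)" using i1 i2 i3 pw by (intro integral_mono) auto
  finally have main: "(\<integral>x. indicator W x * norm (g x) \<partial>\<kappa>) - 2 * e * T - 2 * B * measure \<kappa> (W - KK) \<le> (\<integral>x. \<phi> x \<bullet> g x \<partial>\<kappa>)" .
  have "2 * e * T \<le> d / 4" using T0 d by (simp add: e_def field_simps)
  moreover have "2 * B * measure \<kappa> (W - KK) \<le> d / 2"
  proof -
    have "2 * B * measure \<kappa> (W - KK) \<le> 2 * B * (2 * c)" using mKK B0 by (intro mult_left_mono) auto
    also have "... \<le> d / 2" using B0 d by (simp add: c_def field_simps)
    finally show ?thesis .
  qed
  ultimately show ?thesis using main d by (intro that[OF tf]) linarith
qed

section \<open>Total variation as the mass of the weak gradient\<close>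

lemma integral_lebesgue_on:
  fixes f :: "'a::euclidean_space \<Rightarrow> real"
  assumes "S \<in> sets lebesgue"
  shows "integral\<^sup>L (lebesgue_on S) f = (\<integral>x. indicator S x * f x \<partial>lebesgue)"
  using integral_restrict_space[of S lebesgue f] assms by simp

lemma integral_lebesgue_on_subset:
  fixes f :: "'a::euclidean_space \<Rightarrow> real"
  assumes "S \<in> sets lebesgue" "T \<in> sets lebesgue" "S \<subseteq> T" "\<And>x. x \<in> T - S \<Longrightarrow> f x = 0"
  shows "integral\<^sup>L (lebesgue_on S) f = integral\<^sup>L (lebesgue_on T) f"
  unfolding integral_lebesgue_on[OF assms(1)] integral_lebesgue_on[OF assms(2)]
  using assms(3,4) by (intro Bochner_Integration.integral_cong refl) (auto split: split_indicator)

lemma borel_measurable_lebesgue_on: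
  "f \<in> borel_measurable borel \<Longrightarrow> f \<in> borel_measurable (lebesgue_on S)" by (intro measurable_restrict_space1 measurable_completion) simp

lemma L1_mult_bounded:
  assumes "u \<in> L1 \<Omega>" "g \<in> borel_measurable borel" "\<And>x. \<bar>g x\<bar> \<le> B"
  shows "integrable (lebesgue_on \<Omega>) (\<lambda>x. u x * g x)"
  by (subst mult.commute, rule integrable_bounded_mult[OF _ borel_measurable_lebesgue_on[OF assms(2)] assms(3)])
    (use assms(1) in \<open>simp add: L1_def\<close>)

lemma L1_integrable_divergence:
  assumes "u \<in> L1 \<Omega>" "test_field \<Omega>' \<phi>" shows "integrable (lebesgue_on \<Omega>) (\<lambda>x. u x * divergence \<phi> x)"
proof -
  obtain B where "\<And>x. \<bar>divergence \<phi> x\<bar> \<le> B" using test_field_divergence(2)[OF assms(2)] by blast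
  thus ?thesis by (rule L1_mult_bounded[OF assms(1) test_field_divergence(1)[OF assms(2)]])
qed

lemma L1_subset:
  assumes "u \<in> L1 \<Omega>" "W \<subseteq> \<Omega>" "open W" "open \<Omega>" shows "u \<in> L1 W"
proof -
  have "set_integrable lebesgue \<Omega> u" using assms by (simp add: L1_def integrable_restrict_space set_integrable_def)
  hence "set_integrable lebesgue W u" by (rule set_integrable_subset) (use assms in auto)
  thus ?thesis using assms by (simp add: L1_def integrable_restrict_space set_integrable_def)
qed

text \<open>If the weak gradient of \<open>u\<close> on \<open>W\<close> is
  \<open>g \<kappa>\<close>, the pairing with a test field is
  \<open>- \<integral> \<phi> \<bullet> g\<close>. One inequality is Cauchy-Schwarz, the other is
  \<open>test_field_approx\<close>. The form with a general bounded \<open>g\<close> covers both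
  polar decompositions and smooth gradients.\<close>

lemma TV_eq_integral:
  fixes u :: "real^'n \<Rightarrow> real"
  assumes W: "open W" and u: "u \<in> L1 W" and k: "finite_measure \<kappa>" "sets \<kappa> = sets borel"
    and g[measurable]: "g \<in> borel_measurable borel" and B: "\<And>x. norm (g x) \<le> B"
    and ibp: "\<And>\<phi> i. test_function W \<phi> \<Longrightarrow> partial_pairing W u i \<phi> = - (\<integral>x. \<phi> x * g x $ i \<partial>\<kappa>)"
  shows "TV W u = ereal (\<integral>x. indicator W x * norm (g x) \<partial>\<kappa>)"
proof -
  interpret k: finite_measure \<kappa> by fact
  note [measurable_cong] = k(2)
  have Wm[measurable]: "W \<in> sets borel" using W by simp
  have B0: "B \<ge> 0" using B[of 0] norm_ge_zero order_trans by blast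
  have div: "div_pairing W u \<phi> = - (\<integral>x. \<phi> x \<bullet> g x \<partial>\<kappa>)" if t: "test_field W \<phi>" for \<phi>
  proof -
    have ti: "test_function W (\<lambda>x. \<phi> x $ i)" for i using t unfolding test_field_def by blast
    have int1: "integrable (lebesgue_on W) (\<lambda>x. u x * partial_deriv i (\<lambda>x. \<phi> x $ i) x)" for i
    proof -
      have p: "test_function W (partial_deriv i (\<lambda>x. \<phi> x $ i))" by (rule test_function_partial_deriv[OF ti])
      obtain b where "\<And>x. \<bar>partial_deriv i (\<lambda>x. \<phi> x $ i) x\<bar> \<le> b" using test_function_bounds(2)[OF p] by blast
      thus ?thesis by (rule L1_mult_bounded[OF u test_function_bounds(1)[OF p]])
    qed
    have int2: "integrable \<kappa> (\<lambda>x. \<phi> x $ i * g x $ i)" for i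
    proof (rule k.integrable_const_bound[where B="1 * B"])
      have "\<bar>\<phi> x $ i * g x $ i\<bar> \<le> 1 * B" for x unfolding abs_mult using t B[of x] unfolding test_field_def
        by (intro mult_mono) (auto intro: order_trans[OF component_le_norm_cart])
      thus "AE x in \<kappa>. norm (\<phi> x $ i * g x $ i) \<le> 1 * B" by simp
    qed (use test_field_divergence(5)[OF t] in measurable)
    have "div_pairing W u \<phi> = (\<Sum>i\<in>UNIV. partial_pairing W u i (\<lambda>x. \<phi> x $ i))"
      unfolding divergence_def sum_distrib_left by (rule Bochner_Integration.integral_sum[OF int1])
    also have "... = - (\<Sum>i\<in>UNIV. \<integral>x. \<phi> x $ i * g x $ i \<partial>\<kappa>)" by (simp add: ibp[OF ti] sum_negf)
    also have "... = - (\<integral>x. \<phi> x \<bullet> g x \<partial>\<kappa>)" unfolding inner_vec_def inner_real_def using int2 by simp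
    finally show ?thesis .
  qed
  have bnd: "integrable \<kappa> f" if "f \<in> borel_measurable borel" "\<And>x. \<bar>f x\<bar> \<le> b" for f :: "_ \<Rightarrow> real" and b
    using that by (intro k.integrable_const_bound[where B=b]) auto
  have i1: "integrable \<kappa> (\<lambda>x. indicator W x * norm (g x))" using B B0 by (intro bnd[where b=B]) (auto simp: indicator_def)
  show ?thesis
  proof (rule antisym)
    show "TV W u \<le> ereal (\<integral>x. indicator W x * norm (g x) \<partial>\<kappa>)"
    proof (rule TV_least)
      fix \<phi> :: "real^'n \<Rightarrow> real^'n" assume t: "test_field W \<phi>"
      have pw: "\<bar>\<phi> x \<bullet> g x\<bar> \<le> indicator W x * norm (g x)" for x
      proof (cases "x \<in> W")
        case True
        have "norm (\<phi> x) * norm (g x) \<le> 1 * norm (g x)" using t unfolding test_field_def by (intro mult_right_mono) auto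
        thus ?thesis using True by (intro order_trans[OF Cauchy_Schwarz_ineq2]) simp
      qed (use test_field_divergence(6)[OF t] in simp)
      have "- (\<integral>x. \<phi> x \<bullet> g x \<partial>\<kappa>) \<le> norm (\<integral>x. \<phi> x \<bullet> g x \<partial>\<kappa>)" by simp
      also have "... \<le> (\<integral>x. indicator W x * norm (g x) \<partial>\<kappa>)"
      proof (rule Bochner_Integration.integral_norm_bound_integral[OF _ i1])
        show "integrable \<kappa> (\<lambda>x. \<phi> x \<bullet> g x)" by (rule Bochner_Integration.integrable_bound[OF i1])
            (use test_field_divergence(5)[OF t] pw in \<open>auto intro: order_trans[OF _ abs_ge_self]\<close>)
      qed (use pw in auto)
      finally show "ereal (div_pairing W u \<phi>) \<le> ereal (\<integral>x. indicator W x * norm (g x) \<partial>\<kappa>)" using div[OF t] by simp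
    qed
    show "ereal (\<integral>x. indicator W x * norm (g x) \<partial>\<kappa>) \<le> TV W u"
    proof (rule ereal_le_epsilon2)
      fix d :: real assume "0 < d"
      obtain \<phi> where t: "test_field W \<phi>" "(\<integral>x. indicator W x * norm (g x) \<partial>\<kappa>) - d \<le> (\<integral>x. \<phi> x \<bullet> g x \<partial>\<kappa>)" using test_field_approx[OF k g B W \<open>0 < d\<close>] .
      have t': "test_field W (\<lambda>x. - \<phi> x)" by (rule test_field_uminus[OF t(1)])
      have "ereal (\<integral>x. \<phi> x \<bullet> g x \<partial>\<kappa>) \<le> TV W u" using TV_upper[OF t', of u] by (simp add: div[OF t'])
      hence "ereal ((\<integral>x. indicator W x * norm (g x) \<partial>\<kappa>) - d) \<le> TV W u" using t(2) by (meson ereal_less_eq(3) order_trans)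
      thus "ereal (\<integral>x. indicator W x * norm (g x) \<partial>\<kappa>) \<le> TV W u + ereal d" by (cases "TV W u") auto
    qed
  qed
qed

text \<open>Test functions on \<open>W\<close> are test functions on \<Omega>, so the same pair
  represents the gradient on \<open>W\<close>. This determines \<open>\<kappa>\<close> on open sets
  by TV, from where outer regularity reaches Borel sets.\<close>

lemma polar_TV:
  fixes u :: "real^'n \<Rightarrow> real"
  assumes p: "polar \<Omega> \<kappa> \<sigma>" and O: "open \<Omega>" and u: "u \<in> L1 \<Omega>" and W: "open W" "W \<subseteq> \<Omega>"
    and ibp: "\<And>\<phi> i. test_function \<Omega> \<phi> \<Longrightarrow> partial_pairing \<Omega> u i \<phi> = - (\<integral>x. \<phi> x * \<sigma> x $ i \<partial>\<kappa>)"
  shows "TV W u = ereal (measure \<kappa> W)"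
proof -
  interpret k: finite_measure \<kappa> using p unfolding polar_def by blast
  have k: "finite_measure \<kappa>" "sets \<kappa> = sets borel" "\<sigma> \<in> borel_measurable borel" "\<And>x. norm (\<sigma> x) \<le> 1" "AE x in \<kappa>. norm (\<sigma> x) = 1"
    using p unfolding polar_def by auto
  note [measurable_cong] = k(2)
  note [measurable] = k(3)
  have [measurable]: "W \<in> sets borel" using W by simp
  have "TV W u = ereal (\<integral>x. indicator W x * norm (\<sigma> x) \<partial>\<kappa>)"
  proof (rule TV_eq_integral[OF W(1) L1_subset[OF u W(2,1) O] k(1,2,3,4)])
    fix \<phi> i assume t: "test_function W \<phi>"
    have "partial_pairing W u i \<phi> = partial_pairing \<Omega> u i \<phi>" using W O test_function_outside[OF test_function_partial_deriv[OF t]]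
      by (intro integral_lebesgue_on_subset) auto
    thus "partial_pairing W u i \<phi> = - (\<integral>x. \<phi> x * \<sigma> x $ i \<partial>\<kappa>)" using ibp test_function_mono[OF t W(2)] by simp
  qed
  also have "(\<integral>x. indicator W x * norm (\<sigma> x) \<partial>\<kappa>) = (\<integral>x. indicator W x \<partial>\<kappa>)" by (rule integral_cong_AE) (use k(5) in auto)
  also have "... = measure \<kappa> W" using sets_eq_imp_space_eq[OF k(2)] by simp
  finally show ?thesis .
qed

lemma BV_L1: "u \<in> BV \<Omega> \<Longrightarrow> u \<in> L1 \<Omega>" unfolding BV_def by simp

lemma BV_polar_full:
  fixes u :: "real^'n \<Rightarrow> real"
  assumes O: "open \<Omega>" and u: "u \<in> BV \<Omega>"
  obtains \<kappa> \<sigma> where "polar \<Omega> \<kappa> \<sigma>" "\<And>A. A \<in> sets borel \<Longrightarrow> Dvar \<Omega> u A = ereal (measure \<kappa> A)"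
    "\<And>W. open W \<Longrightarrow> W \<subseteq> \<Omega> \<Longrightarrow> TV W u = ereal (measure \<kappa> W)"
    "\<And>\<phi> i. test_function \<Omega> \<phi> \<Longrightarrow> partial_pairing \<Omega> u i \<phi> = - (\<integral>x. \<phi> x * \<sigma> x $ i \<partial>\<kappa>)"
proof -
  obtain \<kappa> \<sigma> where p: "polar \<Omega> \<kappa> \<sigma>" "\<And>A. A \<in> sets borel \<Longrightarrow> Dvar \<Omega> u A = enn2ereal (emeasure \<kappa> A)"
    "\<And>\<phi> i. test_function \<Omega> \<phi> \<Longrightarrow> partial_pairing \<Omega> u i \<phi> = - (\<integral>x. \<phi> x * \<sigma> x $ i \<partial>\<kappa>)" using BV_polar[OF O u] by blast
  interpret k: finite_measure \<kappa> using p unfolding polar_def by blast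
  show ?thesis
    by (rule that[OF p(1) _ polar_TV[OF p(1) O BV_L1[OF u] _ _ p(3)] p(3)])
       (use p(2) in \<open>auto simp: k.emeasure_eq_measure\<close>)
qed

lemma BV_TV: "open \<Omega> \<Longrightarrow> u \<in> BV \<Omega> \<Longrightarrow> TV \<Omega> u = Dvar \<Omega> u \<Omega>" by (rule BV_polar_full[of \<Omega> u]) auto

section \<open>Total variation as a functional on L1\<close>

lemma TV_cong_AE:
  assumes "u \<in> L1 \<Omega>" "v \<in> L1 \<Omega>" "AE x in lebesgue_on \<Omega>. u x = v x" shows "TV \<Omega> u = TV \<Omega> v"
proof -
  have "div_pairing \<Omega> u \<phi> = div_pairing \<Omega> v \<phi>" if "test_field \<Omega> \<phi>" for \<phi>
    using assms(3) by (intro integral_cong_AE borel_measurable_integrable L1_integrable_divergence[OF _ that] assms(1,2)) auto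
  thus ?thesis unfolding TV_test_field by (intro SUP_cong) auto
qed

lemma TV_convex:
  assumes "u \<in> L1 \<Omega>" "v \<in> L1 \<Omega>" "t \<in> {0..1}"
  shows "TV \<Omega> (\<lambda>x. (1 - t) * u x + t * v x) \<le> ereal (1 - t) * TV \<Omega> u + ereal t * TV \<Omega> v"
proof (rule TV_least)
  fix \<phi> assume p: "test_field \<Omega> \<phi>"
  note i = L1_integrable_divergence[OF assms(1) p] L1_integrable_divergence[OF assms(2) p]
  have "(\<integral>x. ((1 - t) * u x + t * v x) * divergence \<phi> x \<partial>lebesgue_on \<Omega>) =
     (1 - t) * div_pairing \<Omega> u \<phi> + t * div_pairing \<Omega> v \<phi>" using i by (simp add: distrib_right mult.assoc)
  hence "ereal (\<integral>x. ((1 - t) * u x + t * v x) * divergence \<phi> x \<partial>lebesgue_on \<Omega>) =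
     ereal (1 - t) * ereal (div_pairing \<Omega> u \<phi>) + ereal t * ereal (div_pairing \<Omega> v \<phi>)" by simp
  also have "... \<le> ereal (1 - t) * TV \<Omega> u + ereal t * TV \<Omega> v" using assms(3) by (intro add_mono ereal_mult_left_mono TV_upper[OF p]) auto
  finally show "ereal (\<integral>x. ((1 - t) * u x + t * v x) * divergence \<phi> x \<partial>lebesgue_on \<Omega>) \<le> ereal (1 - t) * TV \<Omega> u + ereal t * TV \<Omega> v" .
qed

lemma L1_divergence_tendsto:
  assumes us: "\<And>k. us k \<in> L1 \<Omega>" and u: "u \<in> L1 \<Omega>" and lim: "(\<lambda>k. norm_L1 \<Omega> (\<lambda>x. us k x - u x)) \<longlonglongrightarrow> 0"
    and p: "test_field \<Omega> \<phi>"
  shows "(\<lambda>k. div_pairing \<Omega> (us k) \<phi>) \<longlonglongrightarrow> div_pairing \<Omega> u \<phi>"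
proof -
  obtain B where B: "\<And>x. \<bar>divergence \<phi> x\<bar> \<le> B" "B > 0" using test_field_divergence(2)[OF p] by blast
  have "(\<lambda>k. div_pairing \<Omega> (us k) \<phi> - div_pairing \<Omega> u \<phi>) \<longlonglongrightarrow> 0"
  proof (rule Lim_null_comparison)
    show "(\<lambda>k. B * norm_L1 \<Omega> (\<lambda>x. us k x - u x)) \<longlonglongrightarrow> 0" using lim by (rule tendsto_mult_right_zero)
    show "eventually (\<lambda>k. norm (div_pairing \<Omega> (us k) \<phi> - div_pairing \<Omega> u \<phi>)
        \<le> B * norm_L1 \<Omega> (\<lambda>x. us k x - u x)) sequentially"
    proof (intro always_eventually allI)
      fix k
      have "div_pairing \<Omega> (us k) \<phi> - div_pairing \<Omega> u \<phi> =
         (\<integral>x. (us k x - u x) * divergence \<phi> x \<partial>lebesgue_on \<Omega>)"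
        using L1_integrable_divergence[OF us p] L1_integrable_divergence[OF u p] by (simp add: left_diff_distrib)
      also have "norm ... \<le> (\<integral>x. B * \<bar>us k x - u x\<bar> \<partial>lebesgue_on \<Omega>)"
      proof (rule Bochner_Integration.integral_norm_bound_integral)
        show "integrable (lebesgue_on \<Omega>) (\<lambda>x. (us k x - u x) * divergence \<phi> x)"
          using L1_integrable_divergence[OF us p] L1_integrable_divergence[OF u p] by (simp add: left_diff_distrib)
        show "integrable (lebesgue_on \<Omega>) (\<lambda>x. B * \<bar>us k x - u x\<bar>)" using us u by (auto simp: L1_def)
        show "norm ((us k x - u x) * divergence \<phi> x) \<le> B * \<bar>us k x - u x\<bar>" for x
          using mult_right_mono[OF B(1)[of x] abs_ge_zero[of "us k x - u x"]] by (simp add: abs_mult mult.commute)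
      qed
      finally show "norm (div_pairing \<Omega> (us k) \<phi> - div_pairing \<Omega> u \<phi>)
        \<le> B * norm_L1 \<Omega> (\<lambda>x. us k x - u x)" by (simp add: norm_L1_def)
    qed
  qed
  thus ?thesis by (simp add: LIM_zero_iff)
qed

text \<open>A supremum of functionals that are continuous in the L1 norm, as the divergence of a
  test field is bounded.\<close>

lemma TV_lsc:
  assumes us: "\<And>k. us k \<in> L1 \<Omega>" and u: "u \<in> L1 \<Omega>" and lim: "(\<lambda>k. norm_L1 \<Omega> (\<lambda>x. us k x - u x)) \<longlonglongrightarrow> 0"
  shows "TV \<Omega> u \<le> liminf (\<lambda>k. TV \<Omega> (us k))"
proof (rule TV_least)
  fix \<phi> assume p: "test_field \<Omega> \<phi>"
  have L: "(\<lambda>k. ereal (div_pairing \<Omega> (us k) \<phi>)) \<longlonglongrightarrow> ereal (div_pairing \<Omega> u \<phi>)" using L1_divergence_tendsto[OF us u lim p] by (intro tendsto_ereal)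
  have "ereal (div_pairing \<Omega> u \<phi>) = liminf (\<lambda>k. ereal (div_pairing \<Omega> (us k) \<phi>))" using lim_imp_Liminf[OF trivial_limit_sequentially L] by (rule sym)
  also have "... \<le> liminf (\<lambda>k. TV \<Omega> (us k))" by (intro Liminf_mono always_eventually allI TV_upper[OF p])
  finally show "ereal (div_pairing \<Omega> u \<phi>) \<le> liminf (\<lambda>k. TV \<Omega> (us k))" .
qed

text \<open>Elements of \<open>L1 \<Omega>\<close> are Lebesgue measurable and have arbitrary values
  outside of \<Omega>. Convolutions are integrals over \<open>lborel\<close> and use a Borel
  representative that is extended by zero.\<close>

lemma L1_borel_representative:
  fixes u :: "real^'n \<Rightarrow> real"
  assumes u: "u \<in> L1 \<Omega>" and O: "open \<Omega>"
  obtains v where "integrable lborel v" "\<And>x. x \<notin> \<Omega> \<Longrightarrow> v x = 0" "AE x in lebesgue_on \<Omega>. u x = v x" "v \<in> L1 \<Omega>"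
proof -
  have Ob: "\<Omega> \<in> sets borel" "\<Omega> \<in> sets lebesgue" using O by auto
  have i: "integrable lebesgue (\<lambda>x. indicator \<Omega> x * u x)" using u integrable_restrict_space[of \<Omega> lebesgue u] Ob by (simp add: L1_def)
  obtain w where w: "w \<in> borel_measurable lborel" "AE x in lborel. indicator \<Omega> x * u x = w x"
    using completion_ex_borel_measurable_real[OF borel_measurable_integrable[OF i]] by blast
  define v where "v x = indicator \<Omega> x * w x" for x
  have vm: "v \<in> borel_measurable lborel" unfolding v_def using w(1) Ob by measurable
  have ae: "AE x in lebesgue. indicator \<Omega> x * u x = v x"
    using w(2) unfolding v_def by (intro AE_completion) (auto elim!: eventually_mono split: split_indicator)
  have "integrable lebesgue v" using integrable_cong_AE[THEN iffD1, OF borel_measurable_integrable[OF i] measurable_completion[OF vm] ae i] .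
  hence "integrable lborel v" using vm integrable_completion by blast
  moreover have "AE x in lebesgue_on \<Omega>. u x = v x" using ae Ob by (subst AE_restrict_space_iff) (auto elim!: eventually_mono)
  moreover have "v \<in> L1 \<Omega>" unfolding L1_def using \<open>integrable lebesgue v\<close> Ob integrable_mult_indicator[of \<Omega> lebesgue v]
    by (simp add: integrable_restrict_space)
  ultimately show ?thesis using that by (simp add: v_def)
qed

subsection \<open>A space-filling curve\<close>

text \<open>Schoenberg's curve; \<open>schoenberg\<close> is 0 on \<open>[0, 1/3]\<close>, 1 on \<open>[2/3, 1]\<close> and has period 2, so that it
  reads off the leading digit of a ternary expansion with digits 0 and 2.\<close>

definition schoenberg :: "real \<Rightarrow> real"
  where "schoenberg t = min 1 (max 0 (1/2 - cos (pi * t)))"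

lemma schoenberg_bounds: "0 \<le> schoenberg t" "schoenberg t \<le> 1" by (auto simp: schoenberg_def)

lemma schoenberg_continuous: "continuous_on UNIV schoenberg" unfolding schoenberg_def by (intro continuous_intros)

lemma schoenberg_periodic: "schoenberg (2 * real k + t) = schoenberg t"
proof -
  have "cos (pi * (2 * real k + t)) = cos (pi * t)"
  proof (induction k)
    case (Suc k)
    have "pi * (2 * real (Suc k) + t) = pi * (2 * real k + t) + 2 * pi" by (simp add: algebra_simps)
    thus ?case using Suc by (metis cos_periodic)
  qed simp
  thus ?thesis by (simp add: schoenberg_def)
qed

lemma schoenberg_0: assumes "0 \<le> t" "t \<le> 1/3" shows "schoenberg t = 0"
proof -
  have "cos (pi / 3) \<le> cos (pi * t)" using assms by (intro cos_monotone_0_pi_le) (auto simp: field_simps)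
  thus ?thesis by (simp add: schoenberg_def cos_60)
qed

lemma schoenberg_1: assumes "2/3 \<le> t" "t \<le> 1" shows "schoenberg t = 1"
proof -
  have "cos (pi * t) \<le> cos (2 * pi / 3)" using assms by (intro cos_monotone_0_pi_le) (auto simp: field_simps)
  moreover have "cos (2 * pi / 3) = - 1 / 2" using cos_120 by (simp add: mult.commute)
  ultimately show ?thesis by (simp add: schoenberg_def)
qed

text \<open>The point of the Cantor set with ternary digits \<open>2 * b n\<close>.\<close>

definition cantor_sum :: "(nat \<Rightarrow> real) \<Rightarrow> real"
  where "cantor_sum b = (\<Sum>n. 2 * b n / 3 ^ Suc n)"

lemma cantor_sum:
  assumes b: "\<And>n. b n = 0 \<or> b n = 1"
  shows "cantor_sum b = (2 * b 0 + cantor_sum (\<lambda>n. b (Suc n))) / 3" "0 \<le> cantor_sum b" "cantor_sum b \<le> 1"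
proof -
  have g: "(\<lambda>n. 2 * (1/3) ^ Suc n) sums (1::real)" using sums_mult[OF geometric_sums[of "1/3::real"], of "2/3"] by simp
  have le: "norm (2 * b n / 3 ^ Suc n) \<le> 2 * (1/3) ^ Suc n" 
    if "\<And>n. b n = 0 \<or> b n = 1" for b :: "nat \<Rightarrow> real" and n using that[of n] by (auto simp: power_divide)
  have s: "summable (\<lambda>n. 2 * b n / 3 ^ Suc n)" if "\<And>n. b n = 0 \<or> b n = 1" for b :: "nat \<Rightarrow> real"
    by (rule summable_comparison_test'[OF sums_summable[OF g] le[OF that]])
  show "0 \<le> cantor_sum b" unfolding cantor_sum_def
    using b by (intro suminf_nonneg s[OF b]) (metis divide_nonneg_pos mult_nonneg_nonneg order_refl zero_le_numeral zero_le_one zero_less_numeral zero_less_power)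
  have "cantor_sum b \<le> (\<Sum>n. 2 * (1/3) ^ Suc n)" unfolding cantor_sum_def
    by (intro suminf_le s[OF b] sums_summable[OF g]) (rule order_trans[OF abs_ge_self le[OF b, unfolded real_norm_def]])
  thus "cantor_sum b \<le> 1" using sums_unique[OF g] by simp
  have "cantor_sum b = (\<Sum>n. 2 * b (Suc n) / 3 ^ Suc (Suc n)) + 2 * b 0 / 3" unfolding cantor_sum_def using suminf_split_head[OF s[of b, OF b]] by simp
  also have "(\<Sum>n. 2 * b (Suc n) / 3 ^ Suc (Suc n)) = (\<Sum>n. (2 * b (Suc n) / 3 ^ Suc n) / 3)" by (simp add: mult.commute)
  also have "... = cantor_sum (\<lambda>n. b (Suc n)) / 3" unfolding cantor_sum_def using b by (intro suminf_divide s) auto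
  finally show "cantor_sum b = (2 * b 0 + cantor_sum (\<lambda>n. b (Suc n))) / 3" by simp
qed

text \<open>Multiplication by 3 shifts the ternary expansion by one place. Since the digits are 0 or
  2, the integer part that appears is even, hence a multiple of the period.\<close>

lemma schoenberg_cantor_sum:
  assumes "\<And>n. b n = 0 \<or> b n = 1"
  shows "schoenberg (3 ^ n * cantor_sum b) = b n"
  using assms
proof (induction n arbitrary: b)
  case 0
  have b': "b (Suc n) = 0 \<or> b (Suc n) = 1" for n using 0 by blast
  note c = cantor_sum(1)[of b, OF 0] cantor_sum(2,3)[of "\<lambda>n. b (Suc n)", OF b']
  show ?case
  proof (cases "b 0 = 0")
    case True thus ?thesis using c schoenberg_0[of "cantor_sum b"] by simp
  next
    case False
    hence "b 0 = 1" using 0 by blast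
    thus ?thesis using c schoenberg_1[of "cantor_sum b"] by simp
  qed
next
  case (Suc n)
  have b': "b (Suc n) = 0 \<or> b (Suc n) = 1" for n using Suc.prems by blast
  have "3 ^ Suc n * cantor_sum b = 2 * (3 ^ n * b 0) + 3 ^ n * cantor_sum (\<lambda>n. b (Suc n))"
    by (subst cantor_sum(1)[of b, OF Suc.prems]) (simp add: algebra_simps)
  moreover have "\<exists>k. 3 ^ n * b 0 = real k" using Suc.prems[of 0] by (metis mult_zero_right mult_1_right of_nat_0 of_nat_numeral of_nat_power)
  ultimately obtain k where "3 ^ Suc n * cantor_sum b = 2 * real k + 3 ^ n * cantor_sum (\<lambda>n. b (Suc n))" by metis
  hence "schoenberg (3 ^ Suc n * cantor_sum b) = schoenberg (3 ^ n * cantor_sum (\<lambda>n. b (Suc n)))" using schoenberg_periodic by simp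
  thus ?case using Suc.IH[OF b'] by simp
qed

text \<open>The greedy expansion: \<open>r n\<close> is the remainder after \<open>n\<close> digits,
  rescaled to the unit interval. The value 1 reproduces itself, so both end points are
  included.\<close>

lemma binary_digits:
  fixes x :: real assumes x: "0 \<le> x" "x \<le> 1"
  obtains a :: "nat \<Rightarrow> real" where "\<And>n. a n = 0 \<or> a n = 1" "(\<lambda>n. a n * (1/2) ^ Suc n) sums x"
proof -
  define r where "r = rec_nat x (\<lambda>_ y. 2 * y - (if y \<ge> 1/2 then 1 else 0))"
  define a where "a n = (if r n \<ge> 1/2 then 1 else 0 :: real)" for n
  have r0: "r 0 = x" and rS: "r (Suc n) = 2 * r n - a n" for n by (auto simp: r_def a_def)
  have rb: "0 \<le> r n \<and> r n \<le> 1" for n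
  proof (induction n)
    case (Suc n) thus ?case by (auto simp: rS a_def)
  qed (use x r0 in simp)
  have part: "(\<Sum>k<n. a k * (1/2) ^ Suc k) = x - r n * (1/2) ^ n" for n by (induction n) (auto simp: r0 rS field_simps)
  have "(\<lambda>n. r n * (1/2) ^ n) \<longlonglongrightarrow> 0"
  proof (rule Lim_null_comparison[where g="\<lambda>n. (1/2::real) ^ n"])
    show "eventually (\<lambda>n. norm (r n * (1/2) ^ n) \<le> (1/2) ^ n) sequentially" using rb by (intro always_eventually allI) (simp add: mult_left_le_one_le)
  qed (rule LIMSEQ_power_zero, simp)
  hence "(\<lambda>n. x - r n * (1/2) ^ n) \<longlonglongrightarrow> x" using tendsto_diff[OF tendsto_const, of _ 0 sequentially x] by force
  hence "(\<lambda>n. a n * (1/2) ^ Suc n) sums x" unfolding sums_def part .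
  thus ?thesis using that[of a] by (simp add: a_def)
qed

text \<open>The binary digits of coordinate \<open>i\<close> sit at the ternary places of
  \<open>t\<close> congruent to \<open>h i\<close> modulo the dimension, so all coordinates can be
  prescribed at once. Each coordinate is a uniform limit of continuous functions, and the affine map
  at the end carries the unit cube onto a cube that contains the ball of radius
  \<open>R\<close>.\<close>

lemma space_filling_curve:
  fixes R :: real assumes "R > 0"
  obtains c :: "real \<Rightarrow> real^'n" where "continuous_on UNIV c" "\<And>x. norm x \<le> R \<Longrightarrow> \<exists>t\<in>{0..1}. c t = x"
proof -
  let ?m = "CARD('n)"
  obtain h :: "'n \<Rightarrow> nat" where h: "bij_betw h UNIV {..<?m}" using ex_bij_betw_finite_nat[of "UNIV::'n set"] by (auto simp: atLeast0LessThan)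
  hence hi: "inj h" and hl: "h i < ?m" for i by (auto simp: bij_betw_def)
  define c0 where "c0 i t = (\<Sum>k. schoenberg (3 ^ (?m * k + h i) * t) * (1/2) ^ Suc k)" for i t
  have sb: "norm (schoenberg t * (1/2) ^ Suc k) \<le> (1/2) ^ Suc k" for k t using schoenberg_bounds[of t] by (simp add: abs_mult mult_left_le_one_le)
  have sm: "summable (\<lambda>k. (1/2::real) ^ Suc k)" using summable_geometric[of "1/2::real"] by (simp only: summable_Suc_iff) simp
  have cont: "continuous_on UNIV (c0 i)" for i
  proof -
    have "uniform_limit UNIV (\<lambda>n t. \<Sum>k<n. schoenberg (3 ^ (?m * k + h i) * t) * (1/2) ^ Suc k)
      (\<lambda>t. \<Sum>k. schoenberg (3 ^ (?m * k + h i) * t) * (1/2) ^ Suc k) sequentially" by (rule Weierstrass_m_test[OF sb sm])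
    thus ?thesis unfolding c0_def[abs_def]
      by (rule uniform_limit_theorem[rotated])
        (auto intro!: always_eventually continuous_intros continuous_on_compose2[OF schoenberg_continuous])
  qed
  define c where "c t = (\<chi> i. R * (2 * c0 i t - 1))" for t :: real
  have "continuous_on UNIV c" unfolding c_def by (subst continuous_on_vec_lambda) (auto intro!: continuous_intros cont)
  moreover have "\<exists>t\<in>{0..1}. c t = x" if x: "norm x \<le> R" for x :: "real^'n"
  proof -
    have "\<exists>a :: nat \<Rightarrow> real. (\<forall>n. a n = 0 \<or> a n = 1) \<and> (\<lambda>n. a n * (1/2) ^ Suc n) sums ((x $ i / R + 1) / 2)" for i
    proof -
      have "\<bar>x $ i\<bar> \<le> R" using component_le_norm_cart[of x i] x by simp
      hence "0 \<le> (x $ i / R + 1) / 2" "(x $ i / R + 1) / 2 \<le> 1" using \<open>R > 0\<close> by (auto simp: field_simps abs_le_iff)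
      thus ?thesis using binary_digits by metis
    qed
    then obtain a :: "'n \<Rightarrow> nat \<Rightarrow> real" where a: "\<And>i n. a i n = 0 \<or> a i n = 1"
      "\<And>i. (\<lambda>n. a i n * (1/2) ^ Suc n) sums ((x $ i / R + 1) / 2)" by metis
    define b where "b n = a (inv h (n mod ?m)) (n div ?m)" for n
    have b: "b n = 0 \<or> b n = 1" for n using a unfolding b_def by blast
    have bv: "b (?m * k + h i) = a i k" for k i using hl[of i] hi unfolding b_def by simp
    have "c0 i (cantor_sum b) = (x $ i / R + 1) / 2" for i unfolding c0_def using schoenberg_cantor_sum[of b, OF b] bv a(2)[of i] by (simp add: sums_iff)
    hence "c (cantor_sum b) = x" using \<open>R > 0\<close> by (auto simp: c_def vec_eq_iff field_simps)
    thus ?thesis using cantor_sum(2,3)[of b, OF b] by auto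
  qed
  ultimately show ?thesis using that by blast
qed

subsection \<open>Weak compactness of measures on a ball\<close>

text \<open>The measures are moved to the unit interval by a Borel right inverse of a space-filling curve,
  where Helly's selection theorem applies; the limit is moved back by the (continuous) curve.\<close>

lemma weak_compactness:
  fixes M :: "nat \<Rightarrow> (real^'n) measure"
  assumes M: "\<And>k. prob_space (M k)" "\<And>k. sets (M k) = sets borel" "\<And>k. AE x in M k. norm x \<le> R"
  obtains r :: "nat \<Rightarrow> nat" and Q where "strict_mono r" "prob_space Q" "sets Q = sets borel"
    "\<And>f B. continuous_on UNIV f \<Longrightarrow> (\<And>x. \<bar>f x\<bar> \<le> B) \<Longrightarrow> (\<lambda>k. \<integral>x. f x \<partial>M (r k)) \<longlonglongrightarrow> (\<integral>x. (f x :: real) \<partial>Q)"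
proof -
  obtain c :: "real \<Rightarrow> real^'n" where c: "continuous_on UNIV c" "\<And>x. norm x \<le> max R 1 \<Longrightarrow> \<exists>t\<in>{0..1}. c t = x"
    by (rule space_filling_curve[of "max R 1", where ?'n='n]) auto
  have cm[measurable]: "c \<in> borel_measurable borel" using c(1) by (rule borel_measurable_continuous_onI)
  define S where "S x = {t \<in> {0..1}. c t = x}" for x
  \<comment> \<open>The least parameter at which the curve meets \<open>x\<close>. Its sublevel sets
    are images of compact intervals, joined by the complement of the range, where the default value
    is 0; this makes it a Borel function.\<close>
  define s where "s x = (if S x \<noteq> {} then Inf (S x) else 0)" for x
  have sin: "s x \<in> S x" if "S x \<noteq> {}" for x
  proof -
    have eq: "S x = {0..1} \<inter> c -` {x}" unfolding S_def by auto
    have "closed (S x)" unfolding eq by (intro closed_Int closed_atLeastAtMost continuous_closed_vimage) (use c(1) continuous_on_eq_continuous_at in auto)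
    moreover have "bdd_below (S x)" by (rule bdd_belowI[of _ 0]) (auto simp: S_def)
    ultimately show ?thesis using that closed_contains_Inf by (simp add: s_def)
  qed
  have sb: "0 \<le> s x \<and> s x \<le> 1" for x using sin[of x] by (cases "S x = {}") (auto simp: s_def S_def)
  have sle: "s x \<le> t" if "t \<in> S x" for x t using that by (auto simp: s_def intro!: cInf_lower bdd_belowI[of _ 0]) (auto simp: S_def)
  have sm[measurable]: "s \<in> borel_measurable borel"
  proof (rule borel_measurableI_le)
    fix t
    have "{x. s x \<le> t} = (if t < 0 then {} else c ` {0..min t 1} \<union> - (c ` {0..1}))"
    proof (cases "t < 0")
      case True thus ?thesis using sb by (auto simp: not_le intro: less_le_trans)
    next
      case False
      have "s x \<le> t \<longleftrightarrow> x \<in> c ` {0..min t 1} \<union> - (c ` {0..1})" for x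
      proof (cases "S x = {}")
        case True
        thus ?thesis using False by (auto simp: s_def S_def)
      next
        case ne: False
        have "x \<in> c ` {0..1}" using ne by (auto simp: S_def)
        moreover have "s x \<le> t \<Longrightarrow> x \<in> c ` {0..min t 1}" using sin[OF ne] by (intro image_eqI[of _ _ "s x"]) (auto simp: S_def)
        moreover have "x \<in> c ` {0..min t 1} \<Longrightarrow> s x \<le> t" using sle[of _ x] by (force simp: S_def)
        ultimately show ?thesis by blast
      qed
      thus ?thesis using False by auto
    qed
    moreover have "c ` {0..b} \<in> sets borel" for b :: real by (intro borel_compact compact_continuous_image continuous_on_subset[OF c(1)]) auto
    ultimately show "{x \<in> space borel. s x \<le> t} \<in> sets borel" by auto
  qed
  have cs: "c (s x) = x" if "norm x \<le> R" for x
  proof -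
    have "S x \<noteq> {}" using c(2)[of x] that by (force simp: S_def)
    thus ?thesis using sin by (auto simp: S_def)
  qed
  define N where "N k = distr (M k) borel s" for k
  have sM[measurable]: "s \<in> borel_measurable (M k)" for k using sm M(2) by (simp cong: measurable_cong_sets)
  have N: "real_distribution (N k)" for k unfolding N_def real_distribution_def real_distribution_axioms_def
    using prob_space.prob_space_distr[OF M(1) sM] by simp
  have "tight N" unfolding tight_def
  proof (intro conjI allI impI)
    fix e :: real assume "e > 0"
    have "measure (N k) {-1<..2} = 1" for k
    proof -
      have "measure (N k) {-1<..2} = measure (M k) (s -` {-1<..2} \<inter> space (M k))" unfolding N_def by (rule measure_distr) auto
      also have "s -` {-1<..2} \<inter> space (M k) = space (M k)"
      proof -
        have "s x \<in> {-1<..2}" for x using sb[of x] by auto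
        thus ?thesis by auto
      qed
      finally show ?thesis using prob_space.prob_space[OF M(1)] by simp
    qed
    thus "\<exists>a b. a < b \<and> (\<forall>n. 1 - e < measure (N n) {a<..b})" using \<open>e > 0\<close> by (intro exI[of _ "-1"] exI[of _ 2]) auto
  qed (rule N)
  then obtain r L where r: "strict_mono (r :: nat \<Rightarrow> nat)" "real_distribution L" "weak_conv_m (N \<circ> id \<circ> r) L"
    using tight_imp_convergent_subsubsequence[of N id] strict_mono_id by metis
  interpret L: real_distribution L by fact
  have cL[measurable]: "c \<in> borel_measurable L" using cm by simp
  define Q where "Q = distr L borel c"
  show ?thesis
  proof (rule that[OF r(1)])
    show "prob_space Q" unfolding Q_def by (rule L.prob_space_distr) simp
    show "sets Q = sets borel" by (simp add: Q_def)
    fix f :: "real^'n \<Rightarrow> real" and B assume f: "continuous_on UNIV f" "\<And>x. \<bar>f x\<bar> \<le> B"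
    have fm[measurable]: "f \<in> borel_measurable borel" using f(1) by (rule borel_measurable_continuous_onI)
    have "continuous_on UNIV (\<lambda>t. f (c t))" by (rule continuous_on_compose2[OF f(1) c(1)]) auto
    hence "(\<lambda>k. integral\<^sup>L ((N \<circ> id \<circ> r) k) (\<lambda>t. f (c t))) \<longlonglongrightarrow> integral\<^sup>L L (\<lambda>t. f (c t))"
      using f(2) N r by (intro weak_conv_imp_integral_bdd_continuous_conv[where B=B])
        (auto simp: continuous_on_eq_continuous_at comp_def)
    moreover have "integral\<^sup>L ((N \<circ> id \<circ> r) k) (\<lambda>t. f (c t)) = (\<integral>x. f x \<partial>M (r k))" for k
    proof -
      have "integral\<^sup>L (N (r k)) (\<lambda>t. f (c t)) = (\<integral>x. f (c (s x)) \<partial>M (r k))" unfolding N_def by (rule integral_distr) auto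
      also have "... = (\<integral>x. f x \<partial>M (r k))"
      proof (rule integral_cong_AE)
        show "AE x in M (r k). f (c (s x)) = f x" using M(3)[of "r k"] by eventually_elim (simp add: cs)
        show "(\<lambda>x. f x) \<in> borel_measurable (M (r k))" using fm M(2) by (simp cong: measurable_cong_sets)
        show "(\<lambda>x. f (c (s x))) \<in> borel_measurable (M (r k))" by measurable
      qed
      finally show ?thesis by simp
    qed
    moreover have "integral\<^sup>L L (\<lambda>t. f (c t)) = (\<integral>x. f x \<partial>Q)" unfolding Q_def by (rule integral_distr[symmetric]) auto
    ultimately show "(\<lambda>k. \<integral>x. f x \<partial>M (r k)) \<longlonglongrightarrow> (\<integral>x. f x \<partial>Q)" by simp
  qed
qed


subsection \<open>Functions of finite total variation\<close>

lemma divergence_conv: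
  assumes r: "smooth_ball e r" and p: "test_field W \<phi>"
  shows "divergence (\<lambda>x. \<chi> i. conv r (\<lambda>y. \<phi> y $ i) x) = conv r (divergence \<phi>)"
proof
  fix x
  have t: "test_function W (\<lambda>x. \<phi> x $ i)" for i using p unfolding test_field_def by blast
  have pi: "integrable lborel (partial_deriv i (\<lambda>x. \<phi> x $ i))" for i using test_function_bounds(4)[OF test_function_partial_deriv[OF t]] .
  have "partial_deriv i (conv r (\<lambda>y. \<phi> y $ i)) = conv r (partial_deriv i (\<lambda>y. \<phi> y $ i))" for i
    using test_function_smooth_ball[OF t] conv_partial_deriv[OF r] by metis
  hence "divergence (\<lambda>x. \<chi> i. conv r (\<lambda>y. \<phi> y $ i) x) x = (\<Sum>i\<in>UNIV. conv r (partial_deriv i (\<lambda>y. \<phi> y $ i)) x)" unfolding divergence_def by simp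
  also have "... = conv r (divergence \<phi>) x" unfolding conv_def divergence_def sum_distrib_left
    by (rule Bochner_Integration.integral_sum[symmetric]) (use conv_integrable[OF r pi] in simp)
  finally show "divergence (\<lambda>x. \<chi> i. conv r (\<lambda>y. \<phi> y $ i) x) x = conv r (divergence \<phi>) x" .
qed

text \<open>An average of vectors from the unit ball stays in the unit ball, and the support grows
  by at most \<open>e\<close>.\<close>

lemma test_field_conv:
  assumes r: "mollifier e r" and p: "test_field W \<phi>" and sub: "\<And>x y. y \<in> W \<Longrightarrow> norm (x - y) \<le> e \<Longrightarrow> x \<in> \<Omega>"
  shows "test_field \<Omega> (\<lambda>x. \<chi> i. conv r (\<lambda>y. \<phi> y $ i) x)"
proof -
  have rs: "smooth_ball e r" and r0: "\<And>x. r x \<ge> 0" and r1: "integral\<^sup>L lborel r = 1" using r unfolding mollifier_def by auto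
  have t: "test_function W (\<lambda>x. \<phi> x $ i)" for i using p unfolding test_field_def by blast
  have "test_function \<Omega> (conv r (\<lambda>y. \<phi> y $ i))" for i
  proof -
    obtain K where K: "compact K" "K \<subseteq> W" "\<And>x. x \<notin> K \<Longrightarrow> \<phi> x $ i = 0" using test_function_support[OF t] by blast
    show ?thesis
      by (rule test_function_conv[OF rs _ K(1,3)]) (use t[of i] K(2) sub in \<open>auto simp: test_function_def\<close>)
  qed
  moreover have "norm (\<chi> i. conv r (\<lambda>y. \<phi> y $ i) x) \<le> 1" for x
  proof -
    let ?F = "\<lambda>y. r (x - y) *\<^sub>R \<phi> y"
    have fi: "integrable lborel (\<lambda>y. r (x - y) * \<phi> y $ i)" for i using conv_integrable[OF rs test_function_bounds(4)[OF t]] .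
    have int: "integrable lborel ?F" by (rule integrable_vecI) (use fi in simp)
    have "(\<chi> i. conv r (\<lambda>y. \<phi> y $ i) x) = (\<integral>y. ?F y \<partial>lborel)" by (simp add: vec_eq_iff conv_def integral_vec_component[OF int])
    also have "norm ... \<le> (\<integral>y. r (x - y) \<partial>lborel)"
    proof (rule Bochner_Integration.integral_norm_bound_integral[OF int])
      show "integrable lborel (\<lambda>y. r (x - y))" using lborel_integrable_reflect[OF smooth_ball_integrable[OF rs]] .
      show "norm (?F y) \<le> r (x - y)" for y using r0[of "x - y"] p unfolding test_field_def by (simp add: mult_left_le)
    qed
    also have "... = 1" using lborel_integral_reflect[of r x] smooth_ball_measurable[OF rs] r1 by simp
    finally show ?thesis .
  qed
  ultimately show ?thesis unfolding test_field_def by simp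
qed

lemma integral_lebesgue_on_lborel:
  fixes f :: "'a::euclidean_space \<Rightarrow> real"
  assumes S: "S \<in> sets lebesgue" and f: "f \<in> borel_measurable borel" and 0: "\<And>x. x \<notin> S \<Longrightarrow> f x = 0"
  shows "integral\<^sup>L (lebesgue_on S) f = integral\<^sup>L lborel f"
proof -
  have "integral\<^sup>L (lebesgue_on S) f = (\<integral>x. indicator S x * f x \<partial>lebesgue)" by (rule integral_lebesgue_on[OF S])
  also have "(\<lambda>x. indicator S x * f x) = f" using 0 by (force simp: indicator_def)
  finally show ?thesis using f by (simp add: integral_completion)
qed

lemma integrable_lebesgue_on_lborel:
  fixes f :: "'a::euclidean_space \<Rightarrow> real"
  assumes S: "S \<in> sets lebesgue" and f: "integrable lborel f"
  shows "integrable (lebesgue_on S) f"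
proof -
  have "integrable lebesgue f" using f by (simp add: integrable_completion borel_measurable_integrable)
  thus ?thesis using S integrable_mult_indicator[of S lebesgue f] by (simp add: integrable_restrict_space)
qed

text \<open>As \<open>r\<close> is even, pairing \<open>conv r v\<close> with a test field on
  \<open>W\<close> amounts to pairing \<open>v\<close> with the mollified field, which competes in
  the supremum over \<Omega>.\<close>

lemma TV_conv_le:
  fixes v :: "real^'n \<Rightarrow> real"
  assumes r: "mollifier e r" and v: "integrable lborel v" "\<And>x. x \<notin> \<Omega> \<Longrightarrow> v x = 0" and O: "open \<Omega>" and W: "open W"
    and sub: "\<And>x y. y \<in> W \<Longrightarrow> norm (x - y) \<le> e \<Longrightarrow> x \<in> \<Omega>"
  shows "TV W (conv r v) \<le> TV \<Omega> v"
proof (rule TV_least)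
  fix \<phi> assume p: "test_field W \<phi>"
  have rs: "smooth_ball e r" and re: "\<And>x. r (- x) = r x" using r unfolding mollifier_def by auto
  let ?\<psi> = "\<lambda>x. \<chi> i. conv r (\<lambda>y. \<phi> y $ i) x"
  have psi: "test_field \<Omega> ?\<psi>" by (rule test_field_conv[OF r p sub])
  note div = divergence_conv[OF rs p]
  note [measurable] = borel_measurable_integrable[OF v(1), simplified] test_field_divergence(1)[OF p] test_field_divergence(1)[OF psi]
  have [measurable]: "conv r v \<in> borel_measurable borel" using conv_continuous[OF rs v(1)] borel_measurable_continuous_onI by blast
  have "div_pairing W (conv r v) \<phi> = (\<integral>x. conv r v x * divergence \<phi> x \<partial>lborel)"
    by (rule integral_lebesgue_on_lborel) (use W test_field_divergence(3)[OF p] in auto)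
  also have "... = (\<integral>x. v x * conv r (divergence \<phi>) x \<partial>lborel)" by (rule conv_symmetric[OF rs re v(1) test_field_divergence(4)[OF p]])
  also have "... = (\<integral>x. v x * divergence ?\<psi> x \<partial>lborel)" by (simp add: div)
  also have "... = (\<integral>x. v x * divergence ?\<psi> x \<partial>lebesgue_on \<Omega>)" by (rule integral_lebesgue_on_lborel[symmetric]) (use O v(2) in auto)
  finally show "ereal (div_pairing W (conv r v) \<phi>) \<le> TV \<Omega> v" using TV_upper[OF psi, of v] by simp
qed

text \<open>Integration by parts through Fubini: the derivative passes from \<open>\<phi>\<close> to
  the kernel, and the kernel's derivative is odd, which produces the sign.\<close>

lemma integral_conv_partial_deriv:
  fixes v :: "real^'n \<Rightarrow> real"
  assumes r: "mollifier e r" and v: "integrable lborel v" and p: "test_function W \<phi>"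
  shows "(\<integral>x. conv r v x * partial_deriv i \<phi> x \<partial>lborel) = - (\<integral>x. partial_deriv i (conv r v) x * \<phi> x \<partial>lborel)"
proof -
  have rs: "smooth_ball e r" and re: "\<And>x. r (- x) = r x" using r unfolding mollifier_def by auto
  note ps = smooth_ball_partial_deriv[OF rs, of i]
  note pint = test_function_bounds(4)[OF p]
  obtain R where R: "smooth_ball R \<phi>" using test_function_smooth_ball[OF p] by blast
  have odd: "partial_deriv i r (- x) = - partial_deriv i r x" for x
    using partial_deriv_reflect[of r 0 "x" i] smooth_ball_differentiable[OF rs, of "-x"] re by simp
  have "(\<integral>x. conv r v x * partial_deriv i \<phi> x \<partial>lborel) = (\<integral>x. v x * conv r (partial_deriv i \<phi>) x \<partial>lborel)"
    by (rule conv_symmetric[OF rs re v test_function_bounds(4)[OF test_function_partial_deriv[OF p]]])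
  also have "conv r (partial_deriv i \<phi>) = conv (partial_deriv i r) \<phi>" using conv_partial_deriv[OF rs R] partial_deriv_conv[OF rs pint] by metis
  also have "(\<integral>x. v x * conv (partial_deriv i r) \<phi> x \<partial>lborel) = (\<integral>x. (\<integral>y. partial_deriv i r (x - y) * (\<phi> y * v x) \<partial>lborel) \<partial>lborel)"
    unfolding conv_def by (simp flip: integral_mult_right_zero add: ac_simps)
  also have "... = (\<integral>y. (\<integral>x. partial_deriv i r (x - y) * (\<phi> y * v x) \<partial>lborel) \<partial>lborel)"
    using lborel_pair.Fubini_integral[OF integrable_conv_product[OF ps pint v]] by simp
  also have "... = (\<integral>y. - (conv (partial_deriv i r) v y * \<phi> y) \<partial>lborel)"
  proof (intro Bochner_Integration.integral_cong refl)
    fix y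
    have "partial_deriv i r (x - y) = - partial_deriv i r (y - x)" for x using odd[of "y - x"] by simp
    hence "(\<integral>x. partial_deriv i r (x - y) * (\<phi> y * v x) \<partial>lborel) = (\<integral>x. (partial_deriv i r (y - x) * v x) * (- \<phi> y) \<partial>lborel)" by (simp add: ac_simps)
    thus "(\<integral>x. partial_deriv i r (x - y) * (\<phi> y * v x) \<partial>lborel) = - (conv (partial_deriv i r) v y * \<phi> y)" unfolding conv_def by simp
  qed
  finally show ?thesis by (simp add: partial_deriv_conv[OF rs v])
qed

lemma conv_gradient_bounds:
  fixes v :: "real^'n \<Rightarrow> real"
  assumes rs: "smooth_ball e r" and v: "integrable lborel v"
  shows "(\<lambda>x. gradient (conv r v) x) \<in> borel_measurable borel"
    "\<exists>B>0. \<forall>x. norm (gradient (conv r v) x) \<le> B"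
proof -
  have "continuous_on UNIV (partial_deriv i (conv r v))" for i
    unfolding partial_deriv_conv[OF rs v] by (rule conv_continuous[OF smooth_ball_partial_deriv[OF rs] v])
  thus "(\<lambda>x. gradient (conv r v) x) \<in> borel_measurable borel" by (intro measurable_vecI) (simp add: borel_measurable_continuous_onI)
  have "\<forall>i. \<exists>B>0. \<forall>x. \<bar>partial_deriv i r x\<bar> \<le> B" using smooth_ball_bounded[OF smooth_ball_partial_deriv[OF rs]] by blast
  then obtain B where B: "\<And>i. B i > 0" "\<And>i x. \<bar>partial_deriv i r x\<bar> \<le> B i" by metis
  define N where "N = (\<integral>x. \<bar>v x\<bar> \<partial>lborel)"
  have "norm (gradient (conv r v) x) \<le> (\<Sum>i\<in>UNIV. B i * N) + 1" for x
  proof -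
    have "\<bar>partial_deriv i (conv r v) x\<bar> \<le> B i * N" for i
    proof -
      have "norm (\<integral>y. partial_deriv i r (x - y) * v y \<partial>lborel) \<le> (\<integral>y. B i * \<bar>v y\<bar> \<partial>lborel)"
        using v B(2)[of i] conv_integrable[OF smooth_ball_partial_deriv[OF rs] v]
        by (intro Bochner_Integration.integral_norm_bound_integral) (auto simp: abs_mult intro!: mult_right_mono)
      thus ?thesis unfolding partial_deriv_conv[OF rs v] conv_def N_def by simp
    qed
    hence "(\<Sum>i\<in>UNIV. \<bar>(gradient (conv r v) x) $ i\<bar>) \<le> (\<Sum>i\<in>UNIV. B i * N)" by (intro sum_mono) simp
    thus ?thesis using norm_le_l1_cart[of "gradient (conv r v) x"] by linarith
  qed
  moreover have "(\<Sum>i\<in>UNIV. B i * N) + 1 > 0" using B(1) unfolding N_def by (intro add_nonneg_pos sum_nonneg mult_nonneg_nonneg) (auto simp: less_imp_le)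
  ultimately show "\<exists>B>0. \<forall>x. norm (gradient (conv r v) x) \<le> B" by blast
qed

lemma finite_measure_density_indicator:
  assumes "bounded \<Omega>" "\<Omega> \<in> sets borel"
  shows "finite_measure (density lborel (indicator \<Omega> :: 'a::euclidean_space \<Rightarrow> ennreal))"
    "sets (density lborel (indicator \<Omega> :: 'a \<Rightarrow> ennreal)) = sets borel"
proof -
  have "emeasure (density lborel (indicator \<Omega>)) UNIV = emeasure lborel \<Omega>" using assms by (subst emeasure_density) auto
  also have "... < \<infinity>" using emeasure_bounded_finite[OF assms(1)] .
  finally show "finite_measure (density lborel (indicator \<Omega> :: 'a \<Rightarrow> ennreal))" by (intro finite_measureI) auto
qed auto

text \<open>\<open>TV_eq_integral\<close> for Lebesgue measure on \<open>W\<close>. It is encoded as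
  a density with respect to \<open>lborel\<close> in order to have the Borel sets of the whole
  space, and it is finite because \<open>W\<close> is bounded.\<close>

lemma TV_conv_eq:
  fixes v :: "real^'n \<Rightarrow> real"
  assumes r: "mollifier e r" and v: "integrable lborel v" and W: "open W" "bounded W"
  shows "TV W (conv r v) = ereal (\<integral>x. indicator W x * norm (gradient (conv r v) x) \<partial>lborel)"
proof -
  have rs: "smooth_ball e r" using r unfolding mollifier_def by auto
  have Wb[measurable]: "W \<in> sets borel" using W by simp
  let ?g = "\<lambda>x. gradient (conv r v) x"
  note gm[measurable] = conv_gradient_bounds(1)[OF rs v]
  have pm[measurable]: "partial_deriv i (conv r v) \<in> borel_measurable borel" for i using measurable_vec_component[OF gm, of i] by simp
  obtain B where B: "\<And>x. norm (?g x) \<le> B" using conv_gradient_bounds(2)[OF rs v] by blast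
  have cv: "integrable lborel (conv r v)" by (rule mollifier_conv_integrable[OF r v])
  have den: "(\<integral>x. f x \<partial>density lborel (indicator W)) = (\<integral>x. indicator W x * f x \<partial>lborel)" if [measurable]: "f \<in> borel_measurable borel" for f :: "real^'n \<Rightarrow> real"
    using integral_real_density[of "indicator W" lborel f] by (simp add: ennreal_indicator)
  have "TV W (conv r v) = ereal (\<integral>x. indicator W x * norm (?g x) \<partial>density lborel (indicator W))"
  proof (rule TV_eq_integral[OF W(1) _ finite_measure_density_indicator[OF W(2) Wb] gm B])
    show "conv r v \<in> L1 W" unfolding L1_def using integrable_lebesgue_on_lborel[OF _ cv] W by simp
    fix \<phi> i assume p: "test_function W \<phi>"
    note [measurable] = test_function_bounds(1)[OF p] test_function_bounds(1)[OF test_function_partial_deriv[OF p]]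
      borel_measurable_integrable[OF cv, simplified]
    have "partial_pairing W (conv r v) i \<phi> = (\<integral>x. conv r v x * partial_deriv i \<phi> x \<partial>lborel)"
      by (rule integral_lebesgue_on_lborel) (use W test_function_outside[OF test_function_partial_deriv[OF p]] in auto)
    also have "... = - (\<integral>x. partial_deriv i (conv r v) x * \<phi> x \<partial>lborel)" by (rule integral_conv_partial_deriv[OF r v p])
    also have "(\<integral>x. partial_deriv i (conv r v) x * \<phi> x \<partial>lborel) = (\<integral>x. indicator W x * (\<phi> x * ?g x $ i) \<partial>lborel)"
      using test_function_outside[OF p] by (intro Bochner_Integration.integral_cong refl) (auto simp: indicator_def)
    also have "... = (\<integral>x. \<phi> x * ?g x $ i \<partial>density lborel (indicator W))" by (rule den[symmetric]) measurable
    finally show "partial_pairing W (conv r v) i \<phi> = - (\<integral>x. \<phi> x * ?g x $ i \<partial>density lborel (indicator W))" .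
  qed
  also have "(\<integral>x. indicator W x * norm (?g x) \<partial>density lborel (indicator W)) = (\<integral>x. indicator W x * (indicator W x * norm (?g x)) \<partial>lborel)"
    by (rule den) measurable
  also have "... = (\<integral>x. indicator W x * norm (?g x) \<partial>lborel)" by (intro Bochner_Integration.integral_cong refl) (auto simp: indicator_def)
  finally show ?thesis .
qed

lemma infdist_less_imp_ball:
  fixes x y :: "real^'n"
  assumes "infdist y (- \<Omega>) > e" "norm (x - y) \<le> e" shows "x \<in> \<Omega>"
proof (rule ccontr)
  assume "x \<notin> \<Omega>"
  hence "infdist y (- \<Omega>) \<le> dist y x" by (intro infdist_le) auto
  thus False using assms by (simp add: dist_norm norm_minus_commute)
qed

lemma compact_subset_infdist:
  fixes K :: "(real^'n) set"
  assumes K: "compact K" "K \<subseteq> \<Omega>" and O: "open \<Omega>" "\<Omega> \<noteq> UNIV"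
  obtains d where "d > 0" "\<And>x. x \<in> K \<Longrightarrow> infdist x (- \<Omega>) > d"
proof -
  obtain d where d: "d > 0" "(\<Union>x\<in>K. ball x d) \<subseteq> \<Omega>" using compact_subset_open_imp_ball_epsilon_subset[OF K(1) O(1) K(2)] .
  have "infdist x (- \<Omega>) > d / 2" if x: "x \<in> K" for x
  proof -
    have ne: "- \<Omega> \<noteq> {}" using O(2) by blast
    have "d \<le> infdist x (- \<Omega>)" unfolding infdist_notempty[OF ne]
    proof (rule cINF_greatest[OF ne])
      fix y assume "y \<in> - \<Omega>"
      hence "y \<notin> ball x d" using d(2) x by blast
      thus "d \<le> dist x y" by simp
    qed
    thus ?thesis using d(1) by simp
  qed
  thus ?thesis using that[of "d / 2"] d(1) by auto
qed

text \<open>A ball \<open>B\<close> outside of the support takes the missing mass, so that all measures have mass 1.\<close>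

lemma density_weak_compactness:
  fixes p :: "nat \<Rightarrow> real^'n \<Rightarrow> real"
  assumes O: "open \<Omega>" "bounded \<Omega>" and p: "\<And>n. p n \<in> borel_measurable borel" "\<And>n x. 0 \<le> p n x" "\<And>n x. x \<notin> \<Omega> \<Longrightarrow> p n x = 0"
    and T: "\<And>n. integrable lborel (p n)" "\<And>n. (\<integral>x. p n x \<partial>lborel) \<le> T"
  obtains s :: "nat \<Rightarrow> nat" and P where "strict_mono s" "finite_measure P" "sets P = sets (restrict_space borel \<Omega>)"
    "\<And>\<phi>. test_function \<Omega> \<phi> \<Longrightarrow> (\<lambda>n. \<integral>x. \<phi> x * p (s n) x \<partial>lborel) \<longlonglongrightarrow> (\<integral>x. \<phi> x \<partial>P)"
proof -
  note [measurable] = p(1)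
  have Ob[measurable]: "\<Omega> \<in> sets borel" using O by simp
  obtain R where R: "R > 0" "\<And>x. x \<in> \<Omega> \<Longrightarrow> norm x \<le> R" using O(2) bounded_pos by metis
  obtain z :: "real^'n" where z: "norm z = R + 2" using R(1) vector_choose_size[of "R + 2"] by auto
  define B where "B = ball z 1"
  have Bb[measurable]: "B \<in> sets borel" by (simp add: B_def)
  have BO: "x \<notin> \<Omega>" "norm x \<le> R + 3" if "x \<in> B" for x
  proof -
    have d: "norm (x - z) < 1" using that by (simp add: B_def dist_norm norm_minus_commute)
    have "norm z \<le> norm x + norm (x - z)" by (metis norm_minus_commute norm_triangle_sub add.commute)
    moreover have "norm x \<le> norm z + norm (x - z)" by (metis norm_triangle_sub add.commute)
    ultimately have "norm x > R" and "norm x \<le> R + 3" using d z by linarith+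
    thus "x \<notin> \<Omega>" "norm x \<le> R + 3" using R(2)[of x] by auto
  qed
  have "B \<noteq> {}" "open B" by (auto simp: B_def)
  hence Bpos: "measure lborel B > 0" using open_not_negligible[of B] emeasure_bounded_finite[of B]
    by (auto simp: B_def negligible_iff_null_sets null_sets_def measure_def zero_less_measure_iff enn2real_positive_iff less_top zero_less_iff_neq_zero)
  have Bi: "integrable lborel (indicat_real B)" using emeasure_bounded_finite[of B] by (intro integrable_real_indicator) (auto simp: B_def)
  have T0: "T \<ge> 0" using T(2)[of 0] p(2)[of 0] by (meson Bochner_Integration.integral_nonneg order_trans)
  define m where "m n = (\<integral>x. p n x \<partial>lborel) / (T + 1)" for n
  have m: "0 \<le> m n" "m n \<le> 1" for n using T(2)[of n] T0 p(2)[of n] by (auto simp: m_def Bochner_Integration.integral_nonneg divide_le_eq)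
  define q where "q n x = p n x / (T + 1) + (1 - m n) / measure lborel B * indicator B x" for n x
  have q0: "0 \<le> q n x" for n x using p(2)[of n x] m[of n] T0 Bpos by (auto simp: q_def)
  have qm[measurable]: "q n \<in> borel_measurable borel" for n unfolding q_def by measurable
  have qi: "integrable lborel (q n)" for n unfolding q_def using T(1)[of n] Bi by auto
  have q1: "(\<integral>x. q n x \<partial>lborel) = 1" for n unfolding q_def using T(1)[of n] Bi Bpos by (simp add: m_def)
  define M where "M n = density lborel (\<lambda>x. ennreal (q n x))" for n
  have Mp: "prob_space (M n)" for n
  proof (rule prob_spaceI)
    have "emeasure (M n) (space (M n)) = (\<integral>\<^sup>+x. ennreal (q n x) \<partial>lborel)" unfolding M_def by (simp add: emeasure_density)
    thus "emeasure (M n) (space (M n)) = 1" using nn_integral_eq_integral[OF qi] q0 q1 by simp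
  qed
  have Ms: "sets (M n) = sets borel" for n unfolding M_def by simp
  have MR: "AE x in M n. norm x \<le> R + 3" for n unfolding M_def
  proof (subst AE_density)
    show "AE x in lborel. 0 < ennreal (q n x) \<longrightarrow> norm x \<le> R + 3"
    proof (intro AE_I2 impI)
      fix x assume "0 < ennreal (q n x)"
      hence "q n x \<noteq> 0" by auto
      hence "x \<in> \<Omega> \<or> x \<in> B" using p(3)[of x n] by (cases "x \<in> \<Omega>") (auto simp: q_def indicator_def)
      thus "norm x \<le> R + 3" using R(2)[of x] BO(2)[of x] by auto
    qed
  qed auto
  obtain s Q where s: "strict_mono (s :: nat \<Rightarrow> nat)" "prob_space Q" "sets Q = sets borel"
    "\<And>f B. continuous_on UNIV f \<Longrightarrow> (\<And>x. \<bar>f x\<bar> \<le> B) \<Longrightarrow> (\<lambda>k. \<integral>x. f x \<partial>M (s k)) \<longlonglongrightarrow> (\<integral>x. (f x :: real) \<partial>Q)"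
    using weak_compactness[of M "R + 3", OF Mp Ms MR] by blast
  interpret Q: prob_space Q by fact
  \<comment> \<open>Undoes the normalisation and drops the mass outside of \<Omega>: the part in
    \<open>B\<close>, and what may have moved to the boundary in the limit. Test functions on
    \<Omega> see neither.\<close>
  define P where "P = density (restrict_space Q \<Omega>) (\<lambda>x. ennreal (T + 1))"
  have OQ: "\<Omega> \<inter> space Q \<in> sets Q" using s(3) sets_eq_imp_space_eq[OF s(3)] by simp
  show ?thesis
  proof (rule that[OF s(1)])
    have "emeasure P (space P) = ennreal (T + 1) * emeasure (restrict_space Q \<Omega>) (space (restrict_space Q \<Omega>))"
      unfolding P_def by (simp add: emeasure_density)
    also have "... = ennreal (T + 1) * emeasure Q (\<Omega> \<inter> space Q)" using OQ by (simp add: emeasure_restrict_space space_restrict_space)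
    also have "... < \<infinity>" by (simp add: Q.emeasure_eq_measure ennreal_mult_less_top)
    finally show "finite_measure P" by (intro finite_measureI) auto
    show "sets P = sets (restrict_space borel \<Omega>)" unfolding P_def using s(3) by (simp add: sets_restrict_space)
    fix \<phi> assume t: "test_function \<Omega> \<phi>"
    note [measurable] = test_function_bounds(1)[OF t]
    obtain b where b: "\<And>x. \<bar>\<phi> x\<bar> \<le> b" using test_function_bounds(2)[OF t] by blast
    have "(\<integral>x. \<phi> x \<partial>M n) * (T + 1) = (\<integral>x. \<phi> x * p n x \<partial>lborel)" for n
    proof -
      have "(\<integral>x. \<phi> x \<partial>M n) = (\<integral>x. q n x * \<phi> x \<partial>lborel)" unfolding M_def by (rule integral_real_density) (use q0 in auto)
      also have "... = (\<integral>x. \<phi> x * p n x / (T + 1) \<partial>lborel)"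
      proof (intro Bochner_Integration.integral_cong refl)
        fix x show "q n x * \<phi> x = \<phi> x * p n x / (T + 1)" using BO(1)[of x] test_function_outside[OF t, of x] by (cases "x \<in> B") (auto simp: q_def)
      qed
      also have "... = (\<integral>x. \<phi> x * p n x \<partial>lborel) / (T + 1)" by simp
      finally show ?thesis using T0 by simp
    qed
    moreover have "(\<lambda>k. (\<integral>x. \<phi> x \<partial>M (s k)) * (T + 1)) \<longlonglongrightarrow> (\<integral>x. \<phi> x \<partial>Q) * (T + 1)"
      by (intro tendsto_mult tendsto_const s(4)[OF test_function_bounds(3)[OF t] b])
    moreover have "(\<integral>x. \<phi> x \<partial>P) = (\<integral>x. \<phi> x \<partial>Q) * (T + 1)"
    proof -
      have \<phi>Q: "\<phi> \<in> borel_measurable (restrict_space Q \<Omega>)" using s(3) by (intro measurable_restrict_space1) (simp cong: measurable_cong_sets)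
      have "(\<integral>x. \<phi> x \<partial>P) = (\<integral>x. (T + 1) * \<phi> x \<partial>restrict_space Q \<Omega>)" unfolding P_def using T0 \<phi>Q by (intro integral_real_density) auto
      also have "... = (T + 1) * (\<integral>x. \<phi> x \<partial>restrict_space Q \<Omega>)" by simp
      also have "(\<integral>x. \<phi> x \<partial>restrict_space Q \<Omega>) = (\<integral>x. indicator \<Omega> x * \<phi> x \<partial>Q)" using integral_restrict_space[OF OQ, of \<phi>] by simp
      also have "... = (\<integral>x. \<phi> x \<partial>Q)" using test_function_outside[OF t] by (intro Bochner_Integration.integral_cong refl) (auto simp: indicator_def)
      finally show ?thesis by simp
    qed
    ultimately show "(\<lambda>n. \<integral>x. \<phi> x * p (s n) x \<partial>lborel) \<longlonglongrightarrow> (\<integral>x. \<phi> x \<partial>P)" by simp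
  qed
qed

text \<open>Compactness is available for positive measures, so each partial derivative is split into
  its positive and negative parts, and the second subsequence is taken inside the first. The
  gradients of the mollifications are bounded in L1 only on the inner sets \<open>D n\<close>, whose
  points are farther from the boundary than the mollification radius; the support of any given test
  function lies in \<open>D n\<close> eventually.\<close>

lemma TV_finite_imp_BV:
  fixes u :: "real^'n \<Rightarrow> real"
  assumes O: "open \<Omega>" "bounded \<Omega>" and u: "u \<in> L1 \<Omega>" and T: "TV \<Omega> u < \<infinity>"
  shows "u \<in> BV \<Omega>"
proof -
  obtain v where v: "integrable lborel v" "\<And>x. x \<notin> \<Omega> \<Longrightarrow> v x = 0" "AE x in lebesgue_on \<Omega>. u x = v x" "v \<in> L1 \<Omega>"
    using L1_borel_representative[OF u O(1)] by blast
  have Tv: "TV \<Omega> v = TV \<Omega> u" using TV_cong_AE[OF u v(4,3)] by simp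
  obtain t where t: "TV \<Omega> u = ereal t" "t \<ge> 0" using T TV_nonneg[of \<Omega> u] by (cases "TV \<Omega> u") auto
  have OU: "\<Omega> \<noteq> UNIV" using O(2) not_bounded_UNIV by blast
  have "\<exists>r :: real^'n \<Rightarrow> real. mollifier (1 / real (Suc n)) r" for n by (rule mollifier_exists) simp
  then obtain r :: "nat \<Rightarrow> real^'n \<Rightarrow> real" where r: "\<And>n. mollifier (1 / real (Suc n)) (r n)" by metis
  have rs: "smooth_ball (1 / real (Suc n)) (r n)" for n using r unfolding mollifier_def by blast
  define D where "D n = {x. infdist x (- \<Omega>) > 1 / real (Suc n)}" for n
  have Do: "open (D n)" for n unfolding D_def by (intro open_Collect_less continuous_intros continuous_on_infdist)
  have Db[measurable]: "D n \<in> sets borel" for n using Do by simp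
  have DO: "D n \<subseteq> \<Omega>" for n using infdist_less_imp_ball[of "1 / real (Suc n)" _ \<Omega>] unfolding D_def by force
  have Dbd: "bounded (D n)" for n using bounded_subset[OF O(2) DO] .
  let ?G = "\<lambda>n x. gradient (conv (r n) v) x"
  note gm[measurable] = conv_gradient_bounds(1)[OF rs v(1)]
  have pm[measurable]: "partial_deriv i (conv (r n) v) \<in> borel_measurable borel" for i n using measurable_vec_component[OF gm, of n i] by simp
  have Gle: "(\<integral>x. indicator (D n) x * norm (?G n x) \<partial>lborel) \<le> t" for n
  proof -
    have "TV (D n) (conv (r n) v) \<le> TV \<Omega> v" by (rule TV_conv_le[OF r v(1,2) O(1) Do]) (use infdist_less_imp_ball in \<open>auto simp: D_def\<close>)
    thus ?thesis using TV_conv_eq[OF r v(1) Do Dbd] t Tv by simp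
  qed
  have Gi: "integrable lborel (\<lambda>x. indicator (D n) x * norm (?G n x))" for n
  proof -
    obtain B where B: "\<And>x. norm (?G n x) \<le> B" using conv_gradient_bounds(2)[OF rs v(1)] by blast
    have "integrable lborel (indicat_real (D n))" using emeasure_bounded_finite[OF Dbd] by (intro integrable_real_indicator) auto
    hence "integrable lborel (\<lambda>x. norm (?G n x) * indicat_real (D n) x)" by (rule integrable_bounded_mult[where B=B]) (use B in auto)
    thus ?thesis by (simp add: mult.commute)
  qed
  define good where "good i P N \<longleftrightarrow> finite_measure P \<and> sets P = sets (restrict_space borel \<Omega>) \<and>
     finite_measure N \<and> sets N = sets (restrict_space borel \<Omega>) \<and>
     (\<forall>\<phi>. test_function \<Omega> \<phi> \<longrightarrow> (partial_pairing \<Omega> u i \<phi>) = - ((\<integral>x. \<phi> x \<partial>P) - (\<integral>x. \<phi> x \<partial>N)))" for i P N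
  have "\<exists>P N. good i P N" for i
  proof -
    \<comment> \<open>\<open>b = 1\<close> is the positive part and \<open>b = - 1\<close> the
      negative part.\<close>
    define p where "p b n x = indicator (D n) x * max 0 (b * partial_deriv i (conv (r n) v) x)" for b :: real and n x
    have p1[measurable]: "p b n \<in> borel_measurable borel" for b n unfolding p_def by measurable
    have p2: "0 \<le> p b n x" for b n x by (simp add: p_def)
    have p3: "p b n x = 0" if "x \<notin> \<Omega>" for b n x using DO[of n] that by (auto simp: p_def indicator_def)
    have pG: "p b n x \<le> indicator (D n) x * norm (?G n x)" if "\<bar>b\<bar> = 1" for b n x
    proof -
      have "b * partial_deriv i (conv (r n) v) x \<le> \<bar>partial_deriv i (conv (r n) v) x\<bar>"
        using that abs_ge_self[of "b * partial_deriv i (conv (r n) v) x"] by (simp add: abs_mult)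
      also have "... \<le> norm (?G n x)" using component_le_norm_cart[of "?G n x" i] by simp
      finally show ?thesis unfolding p_def by (intro mult_left_mono) auto
    qed
    have p4: "integrable lborel (p b n)" if "\<bar>b\<bar> = 1" for b n by (rule Bochner_Integration.integrable_bound[OF Gi[of n]])
        (use pG[OF that] p2 in \<open>auto intro!: AE_I2 order_trans[OF _ abs_ge_self]\<close>)
    have p5: "(\<integral>x. p b n x \<partial>lborel) \<le> t" if "\<bar>b\<bar> = 1" for b n using integral_mono[OF p4[OF that] Gi pG[OF that]] Gle by (rule order_trans)
    obtain s1 P where s1: "strict_mono (s1 :: nat \<Rightarrow> nat)" "finite_measure P" "sets P = sets (restrict_space borel \<Omega>)"
      "\<And>\<phi>. test_function \<Omega> \<phi> \<Longrightarrow> (\<lambda>n. \<integral>x. \<phi> x * p 1 (s1 n) x \<partial>lborel) \<longlonglongrightarrow> (\<integral>x. \<phi> x \<partial>P)"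
      using density_weak_compactness[OF O, of "p 1" t, OF p1 p2 p3 p4 p5] by auto
    obtain s2 N where s2: "strict_mono (s2 :: nat \<Rightarrow> nat)" "finite_measure N" "sets N = sets (restrict_space borel \<Omega>)"
      "\<And>\<phi>. test_function \<Omega> \<phi> \<Longrightarrow> (\<lambda>n. \<integral>x. \<phi> x * p (-1) (s1 (s2 n)) x \<partial>lborel) \<longlonglongrightarrow> (\<integral>x. \<phi> x \<partial>N)"
      using density_weak_compactness[OF O, of "\<lambda>n. p (-1) (s1 n)" t, OF p1 p2 p3 p4 p5] by auto
    have "partial_pairing \<Omega> u i \<phi> = - ((\<integral>x. \<phi> x \<partial>P) - (\<integral>x. \<phi> x \<partial>N))" if p: "test_function \<Omega> \<phi>" for \<phi>
    proof -
      note pp = test_function_partial_deriv[OF p, of i]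
      note [measurable] = test_function_bounds(1)[OF p] test_function_bounds(1)[OF pp] borel_measurable_integrable[OF v(1), simplified]
      obtain b where b: "\<And>x. \<bar>partial_deriv i \<phi> x\<bar> \<le> b" "b > 0" using test_function_bounds(2)[OF pp] by blast
      obtain b' where b': "\<And>x. \<bar>\<phi> x\<bar> \<le> b'" using test_function_bounds(2)[OF p] by blast
      obtain K where K: "compact K" "K \<subseteq> \<Omega>" "\<And>x. x \<notin> K \<Longrightarrow> \<phi> x = 0" using test_function_support[OF p] by blast
      obtain d where d: "d > 0" "\<And>x. x \<in> K \<Longrightarrow> infdist x (- \<Omega>) > d" using compact_subset_infdist[OF K(1,2) O(1) OU] by blast
      define s where "s n = s1 (s2 n)" for n
      have sm: "strict_mono s" using strict_mono_o[OF s1(1) s2(1)] by (simp add: s_def[abs_def] comp_def)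
      have cu: "integrable lborel (conv (r n) v)" for n by (rule mollifier_conv_integrable[OF r v(1)])
      have e0: "(\<lambda>n. 1 / real (Suc n)) \<longlonglongrightarrow> 0" using LIMSEQ_Suc[OF lim_const_over_n[of "1::real"]] by simp
      have i1: "integrable lborel (\<lambda>x. conv (r n) v x * partial_deriv i \<phi> x)" for n using integrable_bounded_mult[OF cu _ b(1)] by (simp add: mult.commute)
      have i2: "integrable lborel (\<lambda>x. v x * partial_deriv i \<phi> x)" using integrable_bounded_mult[OF v(1) _ b(1)] by (simp add: mult.commute)
      have lim1: "(\<lambda>n. \<integral>x. conv (r n) v x * partial_deriv i \<phi> x \<partial>lborel) \<longlonglongrightarrow> (\<integral>x. v x * partial_deriv i \<phi> x \<partial>lborel)"
      proof (rule LIM_zero_cancel, rule Lim_null_comparison)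
        show "(\<lambda>n. b * (\<integral>x. \<bar>conv (r n) v x - v x\<bar> \<partial>lborel)) \<longlonglongrightarrow> 0" by (rule tendsto_mult_right_zero[OF conv_tendsto_L1[OF v(1) r e0]])
        show "eventually (\<lambda>n. norm ((\<integral>x. conv (r n) v x * partial_deriv i \<phi> x \<partial>lborel) - (\<integral>x. v x * partial_deriv i \<phi> x \<partial>lborel))
          \<le> b * (\<integral>x. \<bar>conv (r n) v x - v x\<bar> \<partial>lborel)) sequentially"
        proof (intro always_eventually allI)
          fix n
          have "(\<integral>x. conv (r n) v x * partial_deriv i \<phi> x \<partial>lborel) - (\<integral>x. v x * partial_deriv i \<phi> x \<partial>lborel)
            = (\<integral>x. (conv (r n) v x - v x) * partial_deriv i \<phi> x \<partial>lborel)" using i1[of n] i2 by (simp add: left_diff_distrib)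
          also have "norm ... \<le> (\<integral>x. b * \<bar>conv (r n) v x - v x\<bar> \<partial>lborel)"
          proof (rule Bochner_Integration.integral_norm_bound_integral)
            show "integrable lborel (\<lambda>x. (conv (r n) v x - v x) * partial_deriv i \<phi> x)" using i1[of n] i2 by (simp add: left_diff_distrib)
            show "integrable lborel (\<lambda>x. b * \<bar>conv (r n) v x - v x\<bar>)" using cu[of n] v(1) by auto
            show "norm ((conv (r n) v x - v x) * partial_deriv i \<phi> x) \<le> b * \<bar>conv (r n) v x - v x\<bar>" for x
              using mult_right_mono[OF b(1)[of x] abs_ge_zero[of "conv (r n) v x - v x"]] by (simp add: abs_mult mult.commute)
          qed
          finally show "norm ((\<integral>x. conv (r n) v x * partial_deriv i \<phi> x \<partial>lborel) - (\<integral>x. v x * partial_deriv i \<phi> x \<partial>lborel))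
          \<le> b * (\<integral>x. \<bar>conv (r n) v x - v x\<bar> \<partial>lborel)" by simp
        qed
      qed
      have eqn: "(\<integral>x. conv (r n) v x * partial_deriv i \<phi> x \<partial>lborel) = - ((\<integral>x. \<phi> x * p 1 n x \<partial>lborel) - (\<integral>x. \<phi> x * p (-1) n x \<partial>lborel))"
        if n: "1 / real (Suc n) < d" for n
      proof -
        have "K \<subseteq> D n" using d(2) n unfolding D_def by force
        hence pw: "partial_deriv i (conv (r n) v) x * \<phi> x = \<phi> x * p 1 n x - \<phi> x * p (-1) n x" for x
          using K(3)[of x] by (cases "x \<in> K") (auto simp: p_def subset_iff max_def)
        have "integrable lborel (\<lambda>x. \<phi> x * p c n x)" if "\<bar>c\<bar> = 1" for c using integrable_bounded_mult[OF p4[OF that] _ b'] by simp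
        thus ?thesis unfolding integral_conv_partial_deriv[OF r v(1) p] pw by simp
      qed
      have ev: "eventually (\<lambda>n. 1 / real (Suc (s n)) < d) sequentially"
      proof -
        have "(\<lambda>n. 1 / real (Suc (s n))) \<longlonglongrightarrow> 0" using LIMSEQ_subseq_LIMSEQ[OF e0 sm] by (simp add: comp_def)
        thus ?thesis using d(1) by (rule order_tendstoD)
      qed
      have l1: "(\<lambda>n. \<integral>x. conv (r (s n)) v x * partial_deriv i \<phi> x \<partial>lborel) \<longlonglongrightarrow> (\<integral>x. v x * partial_deriv i \<phi> x \<partial>lborel)"
        using LIMSEQ_subseq_LIMSEQ[OF lim1 sm] by (simp add: comp_def)
      have l2: "(\<lambda>n. \<integral>x. \<phi> x * p 1 (s n) x \<partial>lborel) \<longlonglongrightarrow> (\<integral>x. \<phi> x \<partial>P)" using LIMSEQ_subseq_LIMSEQ[OF s1(4)[OF p] s2(1)] by (simp add: comp_def s_def)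
      have l3: "(\<lambda>n. \<integral>x. \<phi> x * p (-1) (s n) x \<partial>lborel) \<longlonglongrightarrow> (\<integral>x. \<phi> x \<partial>N)" using s2(4)[OF p] by (simp add: s_def)
      have "(\<lambda>n. \<integral>x. conv (r (s n)) v x * partial_deriv i \<phi> x \<partial>lborel) \<longlonglongrightarrow> - ((\<integral>x. \<phi> x \<partial>P) - (\<integral>x. \<phi> x \<partial>N))"
        by (rule Lim_transform_eventually[OF tendsto_minus[OF tendsto_diff[OF l2 l3]]]) (use ev eqn in \<open>auto elim!: eventually_mono\<close>)
      hence lim: "(\<integral>x. v x * partial_deriv i \<phi> x \<partial>lborel) = - ((\<integral>x. \<phi> x \<partial>P) - (\<integral>x. \<phi> x \<partial>N))" using l1 LIMSEQ_unique by blast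
      have "partial_pairing \<Omega> u i \<phi> = partial_pairing \<Omega> v i \<phi>" using v(3) L1_mult_bounded[OF u test_function_bounds(1)[OF pp] b(1)]
          L1_mult_bounded[OF v(4) test_function_bounds(1)[OF pp] b(1)]
        by (intro integral_cong_AE) auto
      also have "... = (\<integral>x. v x * partial_deriv i \<phi> x \<partial>lborel)" by (rule integral_lebesgue_on_lborel) (use O v(2) in auto)
      finally show ?thesis using lim by simp
    qed
    thus ?thesis using s1(2,3) s2(2,3) unfolding good_def by blast
  qed
  then obtain P N where "\<And>i. good i (P i) (N i)" by metis
  hence PN: "\<And>i. finite_measure (P i)" "\<And>i. sets (P i) = sets (restrict_space borel \<Omega>)"
    "\<And>i. finite_measure (N i)" "\<And>i. sets (N i) = sets (restrict_space borel \<Omega>)"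
    "\<And>i \<phi>. test_function \<Omega> \<phi> \<Longrightarrow> partial_pairing \<Omega> u i \<phi> = - ((\<integral>x. \<phi> x \<partial>P i) - (\<integral>x. \<phi> x \<partial>N i))" unfolding good_def by blast+
  define \<mu> where "\<mu> = (\<lambda>A. \<chi> i. measure (P i) A - measure (N i) A)"
  have d: "vm_decomposition \<Omega> \<mu> P N" unfolding vm_decomposition_def \<mu>_def using PN by blast
  have "has_gradient_measure \<Omega> u \<mu>" unfolding has_gradient_measure_def
  proof (intro conjI allI impI)
    show "vector_measure \<Omega> \<mu>" using d unfolding vector_measure_def by blast
    fix \<phi> i assume p: "test_function \<Omega> \<phi>"
    obtain b where b: "\<And>x. \<bar>\<phi> x\<bar> \<le> b" using test_function_bounds(2)[OF p] by blast
    have "vm_integral \<Omega> \<mu> \<phi> = (\<chi> i. (\<integral>x. \<phi> x \<partial>P i) - (\<integral>x. \<phi> x \<partial>N i))"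
      by (rule vm_integral_eq[OF d measurable_restrict_space1[OF test_function_bounds(1)[OF p]] b])
    thus "partial_pairing \<Omega> u i \<phi> = - (vm_integral \<Omega> \<mu> \<phi> $ i)" using PN(5)[OF p] by simp
  qed
  thus ?thesis using u unfolding BV_def by blast
qed

theorem TV_eq_Dvar:
  assumes "open \<Omega>" "bounded \<Omega>" "u \<in> L1 \<Omega>" shows "TV \<Omega> u = Dvar \<Omega> u \<Omega>"
proof (cases "u \<in> BV \<Omega>")
  case False
  hence "TV \<Omega> u = \<infinity>" using TV_finite_imp_BV[OF assms] by (meson ereal_infty_less(1))
  thus ?thesis using False by (simp add: Dvar_def)
qed (use BV_TV assms in blast)

subsection \<open>Lipschitz functions of one variable\<close>

text \<open>The intervals with the assumed comparison cover \<open>S\<close> in the sense of Vitali;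
  a countable disjoint subfamily misses only a Lebesgue null set, which \<open>M1\<close> does not
  charge, and on that family the inequality is summed inside \<open>G\<close>.\<close>

lemma vitali_compare:
  fixes M1 M2 :: "real measure"
  assumes sets: "sets M1 = sets borel" "sets M2 = sets borel" and S: "S \<in> sets borel" "S \<subseteq> G" and G: "open G"
    and cover: "\<And>x d. x \<in> S \<Longrightarrow> d > 0 \<Longrightarrow> \<exists>a b. a < x \<and> x < b \<and> b - a < d \<and> emeasure M1 {a<..<b} \<le> c * emeasure M2 {a<..<b}"
    and ac: "\<And>N. N \<in> sets borel \<Longrightarrow> negligible N \<Longrightarrow> emeasure M1 N = 0"
  shows "emeasure M1 S \<le> c * emeasure M2 G"
proof -
  define K where "K = {(a, b). a < b \<and> {a<..<b} \<subseteq> G \<and> emeasure M1 {a<..<b} \<le> c * emeasure M2 {a<..<b}}"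
  define ce where "ce = (\<lambda>(a, b). (a + b) / 2 :: real)"
  define ra where "ra = (\<lambda>(a, b). (b - a) / 2 :: real)"
  have bl: "ball (ce i) (ra i) = {fst i<..<snd i}" for i
    by (cases i) (simp add: ce_def ra_def ball_eq_greaterThanLessThan diff_divide_distrib add_divide_distrib)
  have cov: "\<exists>i. i \<in> K \<and> x \<in> ball (ce i) (ra i) \<and> ra i < d" if x: "x \<in> S" and d: "0 < d" for x d
  proof -
    obtain e where e: "e > 0" "ball x e \<subseteq> G" using G S(2) x open_contains_ball by blast
    obtain a b where ab: "a < x" "x < b" "b - a < min d e" "emeasure M1 {a<..<b} \<le> c * emeasure M2 {a<..<b}" using cover[OF x, of "min d e"] d e(1) by auto
    have "{a<..<b} \<subseteq> ball x e" using ab by (auto simp: dist_real_def)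
    hence "(a, b) \<in> K" using ab e(2) by (auto simp: K_def)
    moreover have "x \<in> ball (ce (a, b)) (ra (a, b))" using ab by (simp add: bl)
    moreover have "ra (a, b) < d" using ab d by (simp add: ra_def)
    ultimately show ?thesis by blast
  qed
  obtain C where C: "countable C" "C \<subseteq> K" "pairwise (\<lambda>i j. disjnt (ball (ce i) (ra i)) (ball (ce j) (ra j))) C"
     "negligible (S - (\<Union>i \<in> C. ball (ce i) (ra i)))" using Vitali_covering_theorem_balls[OF cov] by blast
  define I where "I i = {fst i<..<snd i}" for i :: "real \<times> real"
  have Ib: "I i \<in> sets borel" for i unfolding I_def by simp
  have disj: "disjoint_family_on I C" using C(3) unfolding disjoint_family_on_def pairwise_def disjnt_def bl I_def by blast
  have UI[measurable]: "(\<Union>i\<in>C. I i) \<in> sets borel" by (rule sets.countable_UN'[OF C(1)]) (use Ib in auto)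
  have "S - (\<Union>i\<in>C. I i) \<in> sets borel" using S by auto
  hence z: "emeasure M1 (S - (\<Union>i\<in>C. I i)) = 0" using ac C(4) unfolding bl I_def by blast
  have m1: "emeasure M1 S \<le> emeasure M1 ((\<Union>i\<in>C. I i) \<union> (S - (\<Union>i\<in>C. I i)))" using S sets UI by (intro emeasure_mono) auto
  have m2: "emeasure M1 ((\<Union>i\<in>C. I i) \<union> (S - (\<Union>i\<in>C. I i))) \<le> emeasure M1 (\<Union>i\<in>C. I i) + emeasure M1 (S - (\<Union>i\<in>C. I i))"
    using S sets UI by (intro emeasure_subadditive) auto
  have "emeasure M1 S \<le> emeasure M1 (\<Union>i\<in>C. I i)" using order_trans[OF m1 m2] by (simp add: z)
  also have "... = (\<integral>\<^sup>+i. emeasure M1 (I i) \<partial>count_space C)" by (rule emeasure_UN_countable) (use Ib C(1) disj sets in auto)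
  also have "... \<le> (\<integral>\<^sup>+i. c * emeasure M2 (I i) \<partial>count_space C)" by (intro nn_integral_mono) (use C(2) in \<open>auto simp: K_def I_def\<close>)
  also have "... = c * (\<integral>\<^sup>+i. emeasure M2 (I i) \<partial>count_space C)" by (rule nn_integral_cmult) simp
  also have "(\<integral>\<^sup>+i. emeasure M2 (I i) \<partial>count_space C) = emeasure M2 (\<Union>i\<in>C. I i)" by (rule emeasure_UN_countable[symmetric]) (use Ib C(1) disj sets in auto)
  also have "c * ... \<le> c * emeasure M2 G"
  proof (intro mult_left_mono emeasure_mono)
    have "I i \<subseteq> G" if "i \<in> C" for i using C(2) that by (cases i) (auto simp: K_def I_def)
    thus "(\<Union>i\<in>C. I i) \<subseteq> G" by blast
  qed (use G sets in auto)
  finally show ?thesis .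
qed

text \<open>Both \<open>p\<close>-small and \<open>q\<close>-large difference quotients at arbitrarily small scales, \<open>p < q\<close>, force
  \<open>|S| \<le> (p/q) |S|\<close> by comparing \<open>|S|\<close> with the measure of the image of \<open>S\<close>.\<close>

lemma bilipschitz_real_derivates_negligible:
  fixes g :: "real \<Rightarrow> real"
  assumes lip: "K-lipschitz_on UNIV g" and exp: "\<And>x y. x \<le> y \<Longrightarrow> y - x \<le> g y - g x"
    and S: "S \<in> sets borel" "bounded S" and pq: "0 < p" "p < q"
    and P: "\<And>x d. x \<in> S \<Longrightarrow> d > 0 \<Longrightarrow> \<exists>a b. a < x \<and> x < b \<and> b - a < d \<and> g b - g a < p * (b - a)"
    and Q: "\<And>x d. x \<in> S \<Longrightarrow> d > 0 \<Longrightarrow> \<exists>a b. a < x \<and> x < b \<and> b - a < d \<and> q * (b - a) < g b - g a"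
  shows "negligible S"
proof -
  have gc: "continuous_on UNIV g" using lip by (rule lipschitz_on_continuous_on)
  have sm: "strict_mono g" unfolding strict_mono_def using exp by (smt (verit))
  have inj: "inj g" using sm by (rule strict_mono_imp_inj_on)
  have surj: "\<exists>x. g x = y" for y
  proof -
    have a: "g (- \<bar>y - g 0\<bar>) \<le> y" using exp[of "- \<bar>y - g 0\<bar>" 0] by linarith
    have b: "y \<le> g \<bar>y - g 0\<bar>" using exp[of 0 "\<bar>y - g 0\<bar>"] by linarith
    show ?thesis using IVT'[OF a b _ continuous_on_subset[OF gc]] by auto
  qed
  define h where "h = inv g"
  have gh: "g (h y) = y" for y unfolding h_def using surj by (metis f_inv_into_f rangeI)
  have hg: "h (g x) = x" for x unfolding h_def using inj by simp
  have "1-lipschitz_on UNIV h"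
  proof (rule lipschitz_onI)
    fix x y show "dist (h x) (h y) \<le> 1 * dist x y" using exp[of "h x" "h y"] exp[of "h y" "h x"] by (cases "h x \<le> h y") (auto simp: gh dist_real_def)
  qed simp
  hence hc: "continuous_on UNIV h" by (rule lipschitz_on_continuous_on)
  have hm[measurable]: "h \<in> borel_measurable borel" using hc by (rule borel_measurable_continuous_onI)
  have gm[measurable]: "g \<in> borel_measurable borel" using gc by (rule borel_measurable_continuous_onI)
  have im: "h -` A = g ` A" for A using gh hg by (auto simp: image_iff) metis
  have gb: "g ` A \<in> sets borel" if "A \<in> sets borel" for A using measurable_sets[OF hm that] by (simp add: im)
  \<comment> \<open>As \<open>h\<close> is the inverse of \<open>g\<close>, this is the Lebesgue
    measure of the image under \<open>g\<close>; on an interval it is the increment of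
    \<open>g\<close>.\<close>
  define \<nu> where "\<nu> = distr lborel borel h"
  have nus: "sets \<nu> = sets borel" unfolding \<nu>_def by simp
  have nu: "emeasure \<nu> A = emeasure lborel (g ` A)" if "A \<in> sets borel" for A unfolding \<nu>_def using that by (subst emeasure_distr) (auto simp: im)
  have nuI: "emeasure \<nu> {a<..<b} = ennreal (g b - g a)" if "a < b" for a b
  proof -
    have "g ` {a<..<b} = {g a<..<g b}"
    proof (intro equalityI subsetI)
      fix y assume "y \<in> {g a<..<g b}"
      hence "h y \<in> {a<..<b}" using strict_mono_less[OF sm, of a "h y"] strict_mono_less[OF sm, of "h y" b] by (simp add: gh)
      thus "y \<in> g ` {a<..<b}" using gh by (metis imageI)
    qed (use strict_mono_less[OF sm] in auto)
    thus ?thesis using that exp[of a b] by (subst nu) auto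
  qed
  have gneg: "negligible (g ` N)" if "negligible N" for N
  proof (rule negligible_locally_Lipschitz_image[OF order_refl that])
    fix x
    have "\<forall>y\<in>N \<inter> UNIV. norm (g y - g x) \<le> K * norm (y - x)" using lipschitz_onD[OF lip] by (auto simp: dist_norm)
    thus "\<exists>T B. open T \<and> x \<in> T \<and> (\<forall>y\<in>N \<inter> T. norm (g y - g x) \<le> B * norm (y - x))" by blast
  qed
  have bl: "emeasure lborel N = 0" if "N \<in> sets borel" "negligible N" for N :: "real set" using that by (simp add: negligible_iff_null_sets null_sets_def)
  have acn: "emeasure \<nu> N = 0" if "N \<in> sets borel" "negligible N" for N using that gneg[OF that(2)] gb[OF that(1)] by (simp add: nu bl)
  have finS: "emeasure lborel S < \<infinity>" using emeasure_bounded_finite[OF S(2)] .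
  have fin\<nu>: "emeasure \<nu> S < \<infinity>"
  proof -
    have "bounded (g ` S)" using lip S(2) bounded_uniformly_continuous_image lipschitz_on_uniformly_continuous lipschitz_on_subset by (metis subset_UNIV)
    thus ?thesis using nu[OF S(1)] emeasure_bounded_finite by metis
  qed
  have 1: "emeasure \<nu> S \<le> ennreal p * emeasure lborel S"
  proof (rule ennreal_le_epsilon)
    fix e :: real assume "e > 0"
    obtain U where U: "open U" "S \<subseteq> U" "emeasure lborel (U - S) < ennreal (e / p)" using outer_regular_lborel[OF S(1), of "e / p"] \<open>e > 0\<close> pq by auto
    have "emeasure \<nu> S \<le> ennreal p * emeasure lborel U"
    proof (rule vitali_compare[OF _ _ S(1) U(2,1)])
      fix x d :: real assume "x \<in> S" "d > 0"
      from P[OF this] obtain a b where "a < x" "x < b" "b - a < d" "g b - g a < p * (b - a)" by blast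
      thus "\<exists>a b. a < x \<and> x < b \<and> b - a < d \<and> emeasure \<nu> {a<..<b} \<le> ennreal p * emeasure lborel {a<..<b}"
        using pq by (intro exI[of _ a] exI[of _ b]) (auto simp: nuI ennreal_mult[symmetric] ennreal_leI)
    qed (auto simp: nus acn)
    also have "emeasure lborel U \<le> emeasure lborel S + emeasure lborel (U - S)"
      using U S emeasure_subadditive[of S lborel "U - S"] by (auto simp: Un_absorb1)
    also have "... \<le> emeasure lborel S + ennreal (e / p)" using U(3) by (intro add_left_mono) simp
    also have "ennreal p * (emeasure lborel S + ennreal (e / p)) = ennreal p * emeasure lborel S + ennreal e"
      using pq \<open>e > 0\<close> by (simp add: distrib_left ennreal_mult[symmetric])
    finally show "emeasure \<nu> S \<le> ennreal p * emeasure lborel S + ennreal e" by (simp add: mult_left_mono)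
  qed
  have 2: "emeasure lborel S \<le> ennreal (1 / q) * emeasure \<nu> S"
  proof (rule ennreal_le_epsilon)
    fix e :: real assume "e > 0"
    have q0: "q > 0" using pq by simp
    \<comment> \<open>Here the open superset has to be close to \<open>S\<close> with respect to
      \<open>\<nu>\<close>, so it is chosen around the image of \<open>S\<close> and pulled back by
      \<open>g\<close>.\<close>
    obtain V where V: "open V" "g ` S \<subseteq> V" "emeasure lborel (V - g ` S) < ennreal (e * q)"
      using outer_regular_lborel[OF gb[OF S(1)], of "e * q"] \<open>e > 0\<close> pq by auto
    define U where "U = g -` V"
    have U: "open U" "S \<subseteq> U" unfolding U_def using V gc by (auto intro!: open_vimage)
    have gU: "g ` U \<subseteq> V" unfolding U_def by auto
    have "emeasure lborel S \<le> ennreal (1 / q) * emeasure \<nu> U"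
    proof (rule vitali_compare[OF _ _ S(1) U(2,1)])
      fix x d :: real assume "x \<in> S" "d > 0"
      from Q[OF this] obtain a b where ab: "a < x" "x < b" "b - a < d" "q * (b - a) < g b - g a" by blast
      have "b - a \<le> 1 / q * (g b - g a)" using ab q0 by (simp add: field_simps)
      thus "\<exists>a b. a < x \<and> x < b \<and> b - a < d \<and> emeasure lborel {a<..<b} \<le> ennreal (1 / q) * emeasure \<nu> {a<..<b}"
        using ab q0 by (intro exI[of _ a] exI[of _ b]) (auto simp: nuI ennreal_mult'[symmetric] ennreal_leI)
    qed (auto simp: bl nus)
    also have "emeasure \<nu> U \<le> emeasure \<nu> S + ennreal (e * q)"
    proof -
      have "emeasure \<nu> U \<le> emeasure lborel V" using U gU V by (subst nu) (auto intro: emeasure_mono)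
      also have "... \<le> emeasure lborel (g ` S) + emeasure lborel (V - g ` S)"
        using V gb[OF S(1)] emeasure_subadditive[of "g ` S" lborel "V - g ` S"] by (auto simp: Un_absorb1)
      also have "... \<le> emeasure \<nu> S + ennreal (e * q)" using V(3) nu[OF S(1)] by (simp add: add_left_mono)
      finally show ?thesis .
    qed
    also have "ennreal (1 / q) * (emeasure \<nu> S + ennreal (e * q)) = ennreal (1 / q) * emeasure \<nu> S + ennreal e"
      using q0 \<open>e > 0\<close> by (simp add: distrib_left ennreal_mult[symmetric])
    finally show "emeasure lborel S \<le> ennreal (1 / q) * emeasure \<nu> S + ennreal e" by (simp add: mult_left_mono)
  qed
  define l where "l = measure lborel S"
  define n where "n = measure \<nu> S"
  have l: "emeasure lborel S = ennreal l" using finS by (simp add: l_def measure_def less_top)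
  have n: "emeasure \<nu> S = ennreal n" using fin\<nu> by (simp add: n_def measure_def less_top)
  have ln: "l \<ge> 0" "n \<ge> 0" by (auto simp: l_def n_def)
  have "n \<le> p * l" using 1 ln pq unfolding l n by (simp add: ennreal_mult[symmetric])
  moreover have "l \<le> 1 / q * n" using 2 ln pq unfolding l n by (simp add: ennreal_mult[symmetric])
  ultimately have "q * l \<le> p * l" using pq by (simp add: field_simps)
  hence "l = 0" using pq ln by (smt (verit) mult_strict_right_mono)
  thus ?thesis using l S by (simp add: negligible_iff_null_sets null_sets_def)
qed

text \<open>Adding \<open>(L + 1) * x\<close> makes all slopes at least 1, so the comparison of
  image measures applies with positive \<open>p < q\<close>. Away from the null sets
  \<open>A p \<inter> B q\<close> for rational \<open>p < q\<close>, the slopes over short intervals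
  around \<open>x\<close> have a single limit, which is then the derivative.\<close>

lemma lipschitz_real_differentiable_AE:
  fixes f :: "real \<Rightarrow> real"
  assumes lip: "L-lipschitz_on UNIV f"
  shows "negligible {x. \<not> (\<exists>D. (f has_real_derivative D) (at x))}"
proof -
  define g where "g x = f x + (L + 1) * x" for x
  have L0: "L \<ge> 0" using lip by (rule lipschitz_on_nonneg)
  have fb: "\<bar>f y - f x\<bar> \<le> L * \<bar>y - x\<bar>" for x y using lipschitz_onD[OF lip, of y x] by (simp add: dist_real_def)
  have exp: "y - x \<le> g y - g x" if "x \<le> y" for x y using fb[of y x] that by (simp add: g_def algebra_simps abs_le_iff)
  have gup: "g y - g x \<le> (2 * L + 1) * (y - x)" if "x \<le> y" for x y using fb[of y x] that by (simp add: g_def algebra_simps abs_le_iff)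
  have glip: "(2 * L + 1)-lipschitz_on UNIV g"
  proof (rule lipschitz_onI)
    fix x y show "dist (g x) (g y) \<le> (2 * L + 1) * dist x y"
      using exp[of x y] exp[of y x] gup[of x y] gup[of y x] by (cases "x \<le> y") (auto simp: dist_real_def abs_if)
  qed (use L0 in simp)
  have gcont: "isCont g x" for x using lipschitz_on_continuous_on[OF glip] by (simp add: continuous_on_eq_continuous_at)
  \<comment> \<open>The intervals contain \<open>x\<close> in their interior instead of having it as
    an end point. The sets become countable intersections of open sets, hence Borel.\<close>
  define A where "A p = {x. \<forall>n. \<exists>a b. a < x \<and> x < b \<and> b - a < 1 / real (Suc n) \<and> g b - g a < p * (b - a)}" for p
  define B where "B q = {x. \<forall>n. \<exists>a b. a < x \<and> x < b \<and> b - a < 1 / real (Suc n) \<and> q * (b - a) < g b - g a}" for q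
  have Ab: "A p \<in> sets borel" for p
  proof -
    have eq: "A p = (\<Inter>n. \<Union>(a, b)\<in>{(a, b). b - a < 1 / real (Suc n) \<and> g b - g a < p * (b - a)}. {a<..<b})" unfolding A_def by (auto; blast)
    show ?thesis unfolding eq by (intro sets.countable_INT'') (auto intro!: borel_open open_UN)
  qed
  have Bb: "B p \<in> sets borel" for p
  proof -
    have eq: "B p = (\<Inter>n. \<Union>(a, b)\<in>{(a, b). b - a < 1 / real (Suc n) \<and> p * (b - a) < g b - g a}. {a<..<b})" unfolding B_def by (auto; blast)
    show ?thesis unfolding eq by (intro sets.countable_INT'') (auto intro!: borel_open open_UN)
  qed
  have small: "\<exists>n. 1 / real (Suc n) < d" if "d > 0" for d using reals_Archimedean[OF that] by (simp add: inverse_eq_divide)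
  have neg: "negligible (A p \<inter> B q \<inter> ball 0 (real N))" if pq: "0 < p" "p < q" for p q N
  proof (rule bilipschitz_real_derivates_negligible[OF glip exp _ _ pq])
    show "A p \<inter> B q \<inter> ball 0 (real N) \<in> sets borel" using Ab Bb by auto
    fix x d assume x: "x \<in> A p \<inter> B q \<inter> ball 0 (real N)" and d: "(0::real) < d"
    obtain n where n: "1 / real (Suc n) < d" using small[OF d] by blast
    show "\<exists>a b. a < x \<and> x < b \<and> b - a < d \<and> g b - g a < p * (b - a)" using x n unfolding A_def by (blast intro: less_trans)
    show "\<exists>a b. a < x \<and> x < b \<and> b - a < d \<and> q * (b - a) < g b - g a" using x n unfolding B_def by (blast intro: less_trans)
  qed auto
  have neg2: "negligible (A p \<inter> B q)" if pq: "0 < p" "p < q" for p q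
  proof -
    have "A p \<inter> B q = (\<Union>N. A p \<inter> B q \<inter> ball 0 (real N))" using reals_Archimedean2 by (force simp: dist_real_def)
    thus ?thesis using negligible_countable_Union[of "range (\<lambda>N. A p \<inter> B q \<inter> ball 0 (real N))"] neg[OF pq] by auto
  qed
  define Z where "Z = (\<Union>(p, q)\<in>{(p, q). p \<in> \<rat> \<and> q \<in> \<rat> \<and> 0 < p \<and> p < q}. A p \<inter> B q)"
  have "negligible Z" unfolding Z_def
  proof (intro negligible_countable_Union)
    have "countable {(p, q). p \<in> \<rat> \<and> q \<in> \<rat> \<and> 0 < p \<and> (p::real) < q}" by (rule countable_subset[of _ "\<rat> \<times> \<rat>"]) (auto intro: countable_rat)
    thus "countable ((\<lambda>(p, q). A p \<inter> B q) ` {(p, q). p \<in> \<rat> \<and> q \<in> \<rat> \<and> 0 < p \<and> p < q})" by simp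
  qed (use neg2 in auto)
  moreover have "\<exists>D. (f has_real_derivative D) (at x)" if xZ: "x \<notin> Z" for x
  proof -
    \<comment> \<open>\<open>A\<close> grows and \<open>B\<close> shrinks with the parameter, so
      rational parameters between \<open>p\<close> and \<open>q\<close> exclude the real ones as
      well.\<close>
    have AB: "\<not> (x \<in> A p \<and> x \<in> B q)" if "0 < p" "p < q" for p q
    proof
      assume x: "x \<in> A p \<and> x \<in> B q"
      obtain p' q' where r: "p' \<in> \<rat>" "p < p'" "p' < q" "q' \<in> \<rat>" "p' < q'" "q' < q" using Rats_dense_in_real[OF \<open>p < q\<close>] Rats_dense_in_real by metis
      have "x \<in> A p'" using x r unfolding A_def mem_Collect_eq by (smt (verit) mult_right_mono)
      moreover have "x \<in> B q'" using x r unfolding B_def mem_Collect_eq by (smt (verit) mult_right_mono)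
      ultimately have "x \<in> Z" using r that unfolding Z_def by (intro UN_I[of "(p', q')"]) auto
      thus False using xZ by blast
    qed
    have half: "x \<in> B (1/2)" unfolding B_def
    proof (intro CollectI allI)
      fix n
      define d where "d = 1 / (3 * real (Suc n))"
      have d: "d > 0" "1 / real (Suc n) = 3 * d" by (auto simp: d_def field_simps)
      show "\<exists>a b. a < x \<and> x < b \<and> b - a < 1 / real (Suc n) \<and> 1/2 * (b - a) < g b - g a"
        unfolding d(2) using exp[of "x - d" "x + d"] d(1) by (intro exI[of _ "x - d"] exI[of _ "x + d"]) auto
    qed
    have Bup: "q \<le> 2 * L + 1" if xq: "x \<in> B q" for q
    proof -
      obtain a b where "a < x" "x < b" "q * (b - a) < g b - g a" using xq unfolding B_def by blast
      hence "q * (b - a) \<le> (2 * L + 1) * (b - a)" "b - a > 0" using gup[of a b] by linarith+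
      thus ?thesis by (rule mult_right_le_imp_le)
    qed
    \<comment> \<open>The upper derivate at \<open>x\<close>. It is at least 1/2, and
      \<open>e' \<le> 1/4\<close> below then keeps \<open>s - e'\<close> positive, as
      \<open>AB\<close> requires.\<close>
    define s where "s = Sup {q. x \<in> B q}"
    have bdd: "bdd_above {q. x \<in> B q}" using Bup by (intro bdd_aboveI) auto
    have s12: "1/2 \<le> s" unfolding s_def using half bdd by (intro cSup_upper) auto
    have "(g has_real_derivative s) (at x)" unfolding has_field_derivative_def has_derivative_at_alt
    proof (intro conjI allI impI)
      fix e :: real assume "e > 0"
      define e' where "e' = min e (1/4)"
      have e': "e' > 0" "e' \<le> e" "e' \<le> 1/4" using \<open>e > 0\<close> by (auto simp: e'_def)
      have "s + e' \<notin> {q. x \<in> B q}" using cSup_upper[OF _ bdd, of "s + e'"] e' unfolding s_def by fastforce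
      hence "\<not> (\<forall>n. \<exists>a b. a < x \<and> x < b \<and> b - a < 1 / real (Suc n) \<and> (s + e') * (b - a) < g b - g a)" unfolding B_def by blast
      then obtain n where n: "\<And>a b. a < x \<Longrightarrow> x < b \<Longrightarrow> b - a < 1 / real (Suc n) \<Longrightarrow> g b - g a \<le> (s + e') * (b - a)" by (meson not_less)
      have "\<exists>q\<in>{q. x \<in> B q}. s - e' < q" using less_cSupE[of "s - e'" "{q. x \<in> B q}"] half e' unfolding s_def by auto
      hence "x \<notin> A (s - e')" using AB[of "s - e'"] s12 e' by auto
      hence "\<not> (\<forall>n. \<exists>a b. a < x \<and> x < b \<and> b - a < 1 / real (Suc n) \<and> g b - g a < (s - e') * (b - a))" unfolding A_def by blast
      then obtain m where m: "\<And>a b. a < x \<Longrightarrow> x < b \<Longrightarrow> b - a < 1 / real (Suc m) \<Longrightarrow> (s - e') * (b - a) \<le> g b - g a" by (meson not_less)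
      define d where "d = min (1 / real (Suc n)) (1 / real (Suc m))"
      have d: "d > 0" by (simp add: d_def)
      have in1: "\<bar>g b - g a - s * (b - a)\<bar> \<le> e' * (b - a)" if "a < x" "x < b" "b - a < d" for a b
        using n[OF that(1,2)] m[OF that(1,2)] that(3) by (auto simp: d_def abs_le_iff algebra_simps)
      \<comment> \<open>The left end point is moved to \<open>x\<close>, using continuity of
        \<open>g\<close>; this turns intervals around \<open>x\<close> into difference quotients at
        \<open>x\<close>.\<close>
      have in2: "\<bar>g y - g x - s * (y - x)\<bar> \<le> e' * (y - x)" if "x < y" "y - x < d" for y
      proof -
        have "((\<lambda>a. e' * (y - a) - \<bar>g y - g a - s * (y - a)\<bar>) \<longlongrightarrow> e' * (y - x) - \<bar>g y - g x - s * (y - x)\<bar>) (at_left x)"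
          by (intro tendsto_intros) (use gcont in \<open>auto simp: isCont_def intro: filterlim_at_within_not_equal tendsto_within_subset[of _ _ _ UNIV]\<close>)
        moreover have "eventually (\<lambda>a. 0 \<le> e' * (y - a) - \<bar>g y - g a - s * (y - a)\<bar>) (at_left x)" unfolding eventually_at_left_field using in1 that
          by (intro exI[of _ "y - d"]) auto
        ultimately show ?thesis using tendsto_lowerbound[of _ _ "at_left x" 0] by force
      qed
      have in3: "\<bar>g x - g y - s * (x - y)\<bar> \<le> e' * (x - y)" if "y < x" "x - y < d" for y
      proof -
        have "((\<lambda>b. e' * (b - y) - \<bar>g b - g y - s * (b - y)\<bar>) \<longlongrightarrow> e' * (x - y) - \<bar>g x - g y - s * (x - y)\<bar>) (at_right x)"
          by (intro tendsto_intros) (use gcont in \<open>auto simp: isCont_def intro: filterlim_at_within_not_equal tendsto_within_subset[of _ _ _ UNIV]\<close>)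
        moreover have "eventually (\<lambda>b. 0 \<le> e' * (b - y) - \<bar>g b - g y - s * (b - y)\<bar>) (at_right x)" unfolding eventually_at_right_field using in1 that
          by (intro exI[of _ "y + d"]) auto
        ultimately show ?thesis using tendsto_lowerbound[of _ _ "at_right x" 0] by force
      qed
      have "norm (g y - g x - s * (y - x)) \<le> e * norm (y - x)" if "norm (y - x) < d" for y
      proof -
        consider "y = x" | "x < y" | "y < x" by linarith
        hence "\<bar>g y - g x - s * (y - x)\<bar> \<le> e' * \<bar>y - x\<bar>"
        proof cases
          case 2 thus ?thesis using in2[of y] that by simp
        next
          case 3
          hence "\<bar>g x - g y - s * (x - y)\<bar> \<le> e' * (x - y)" using in3[of y] that by simp
          moreover have "g x - g y - s * (x - y) = - (g y - g x - s * (y - x))" by (simp add: algebra_simps)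
          ultimately show ?thesis using 3 by simp
        qed simp
        also have "... \<le> e * \<bar>y - x\<bar>" using e' by (intro mult_right_mono) auto
        finally show ?thesis by simp
      qed
      thus "\<exists>d>0. \<forall>y. norm (y - x) < d \<longrightarrow> norm (g y - g x - s * (y - x)) \<le> e * norm (y - x)" using d by blast
    qed (rule bounded_linear_mult_right)
    hence "((\<lambda>x. g x - (L + 1) * x) has_real_derivative s - (L + 1)) (at x)" by (auto intro!: derivative_eq_intros)
    thus ?thesis unfolding g_def by auto
  qed
  ultimately show ?thesis using negligible_subset by (metis (mono_tags, lifting) mem_Collect_eq subsetI)
qed

subsection \<open>Rademacher's theorem\<close>

lemma AE_lborel_negligible: "(AE x in lborel. P x) \<Longrightarrow> negligible {x. \<not> P x}"
proof -
  assume "AE x in lborel. P x"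
  then obtain N where N: "N \<in> null_sets lborel" "{x \<in> space lborel. \<not> P x} \<subseteq> N" unfolding eventually_ae_filter by blast
  have "negligible N" unfolding negligible_iff_null_sets using N(1) by (rule null_sets_completionI)
  thus ?thesis by (rule negligible_subset) (use N(2) in simp)
qed

text \<open>On each line in direction \<open>v\<close> the function is Lipschitz in one variable, so
  the limit exists at almost all points of the line, and Fubini gives almost all points of the
  space. For Fubini the set of good points must be Borel: \<open>E\<close> is the Cauchy condition
  for rational increments, which continuity of \<open>f\<close> extends to real ones.\<close>

lemma directional_limit_AE:
  fixes f :: "real^'n \<Rightarrow> real"
  assumes lip: "L-lipschitz_on UNIV f"
  shows "AE x in lborel. \<exists>D. ((\<lambda>t. (f (x + t *\<^sub>R v) - f x) / t) \<longlongrightarrow> D) (at 0)"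
proof -
  have fc: "continuous_on UNIV f" using lip by (rule lipschitz_on_continuous_on)
  have fm[measurable]: "f \<in> borel_measurable borel" using fc by (rule borel_measurable_continuous_onI)
  define q where "q t x = (f (x + t *\<^sub>R v) - f x) / t" for t :: real and x
  have qm[measurable]: "q t \<in> borel_measurable borel" for t unfolding q_def by measurable
  define E where "E = {x. \<forall>n::nat. \<exists>m::nat. \<forall>s::rat. \<forall>t::rat. s \<noteq> 0 \<longrightarrow> t \<noteq> 0 \<longrightarrow> \<bar>real_of_rat s\<bar> < 1 / Suc m \<longrightarrow> \<bar>real_of_rat t\<bar> < 1 / Suc m \<longrightarrow>
      \<bar>q (real_of_rat s) x - q (real_of_rat t) x\<bar> \<le> 1 / Suc n}"
  have Eb[measurable]: "E \<in> sets borel"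
  proof -
    have "Measurable.pred borel (\<lambda>x. \<forall>n::nat. \<exists>m::nat. \<forall>s::rat. \<forall>t::rat. s \<noteq> 0 \<longrightarrow> t \<noteq> 0 \<longrightarrow> \<bar>real_of_rat s\<bar> < 1 / Suc m \<longrightarrow> \<bar>real_of_rat t\<bar> < 1 / Suc m \<longrightarrow>
      \<bar>q (real_of_rat s) x - q (real_of_rat t) x\<bar> \<le> 1 / Suc n)" by measurable
    thus ?thesis unfolding E_def by (simp add: pred_def)
  qed
  have small: "\<exists>m. 1 / real (Suc m) < d" if "d > 0" for d using reals_Archimedean[OF that] by (simp add: inverse_eq_divide)
  have E1: "x \<in> E" if D: "((\<lambda>t. q t x) \<longlongrightarrow> D) (at 0)" for x D
  proof -
    have "\<exists>m::nat. \<forall>s::rat. \<forall>t::rat. s \<noteq> 0 \<longrightarrow> t \<noteq> 0 \<longrightarrow> \<bar>real_of_rat s\<bar> < 1 / Suc m \<longrightarrow> \<bar>real_of_rat t\<bar> < 1 / Suc m \<longrightarrow>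
      \<bar>q (real_of_rat s) x - q (real_of_rat t) x\<bar> \<le> 1 / Suc n" for n :: nat
    proof -
      have "1 / (2 * real (Suc n)) > 0" by simp
      then obtain d where d: "d > 0" "\<And>t. t \<noteq> 0 \<Longrightarrow> \<bar>t\<bar> < d \<Longrightarrow> \<bar>q t x - D\<bar> < 1 / (2 * real (Suc n))"
        using D unfolding LIM_eq by (metis diff_zero real_norm_def)
      obtain m where m: "1 / real (Suc m) < d" using small[OF d(1)] by blast
      have "\<bar>q a x - q b x\<bar> \<le> 1 / Suc n" if "a \<noteq> 0" "b \<noteq> 0" "\<bar>a\<bar> < 1 / Suc m" "\<bar>b\<bar> < 1 / Suc m" for a b
      proof -
        have "\<bar>q a x - D\<bar> < 1 / (2 * real (Suc n))" "\<bar>q b x - D\<bar> < 1 / (2 * real (Suc n))" using d(2) that m by auto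
        hence "\<bar>q a x - q b x\<bar> \<le> 2 * (1 / (2 * real (Suc n)))" by linarith
        thus ?thesis by (simp add: field_simps)
      qed
      thus ?thesis by (metis of_rat_eq_0_iff)
    qed
    thus ?thesis unfolding E_def by blast
  qed
  have E2: "\<exists>D. ((\<lambda>t. q t x) \<longlongrightarrow> D) (at 0)" if x: "x \<in> E" for x
  proof -
    have qc: "isCont (\<lambda>t. q t x) t" if "t \<noteq> 0" for t unfolding q_def using that fc
      by (intro continuous_intros continuous_at_compose[of t "\<lambda>t. x + t *\<^sub>R v" f, unfolded comp_def])
         (auto simp: continuous_on_eq_continuous_at intro!: continuous_intros)
    have rat: "\<exists>s :: nat \<Rightarrow> rat. (\<lambda>k. real_of_rat (s k)) \<longlonglongrightarrow> a" for a :: real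
    proof -
      have "\<exists>s. \<bar>real_of_rat s - a\<bar> < 1 / Suc k" for k
        using of_rat_dense[of "a - 1 / Suc k" "a + 1 / Suc k"] by (auto simp: abs_less_iff) (metis add_diff_cancel_left' diff_less_eq less_diff_eq minus_diff_eq neg_less_iff_less add.commute)
      then obtain s where s: "\<And>k. \<bar>real_of_rat (s k) - a\<bar> < 1 / Suc k" by metis
      have "(\<lambda>k. real_of_rat (s k) - a) \<longlonglongrightarrow> 0" by (rule Lim_null_comparison[OF _ LIMSEQ_Suc[OF lim_const_over_n[of 1]]])
          (auto intro!: always_eventually less_imp_le[OF s, unfolded of_nat_Suc add.commute[of _ 1]] simp: add.commute)
      thus ?thesis by (auto simp: LIM_zero_iff)
    qed
    have ca: "\<exists>m::nat. \<forall>a b. a \<noteq> 0 \<longrightarrow> b \<noteq> 0 \<longrightarrow> \<bar>a\<bar> < 1 / Suc m \<longrightarrow> \<bar>b\<bar> < 1 / Suc m \<longrightarrow> \<bar>q a x - q b x\<bar> \<le> 1 / Suc n" for n :: nat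
    proof -
      obtain m where m: "\<And>s t. s \<noteq> 0 \<Longrightarrow> t \<noteq> 0 \<Longrightarrow> \<bar>real_of_rat s\<bar> < 1 / Suc m \<Longrightarrow> \<bar>real_of_rat t\<bar> < 1 / Suc m \<Longrightarrow>
        \<bar>q (real_of_rat s) x - q (real_of_rat t) x\<bar> \<le> 1 / Suc n" using x unfolding E_def by blast
      have "\<bar>q a x - q b x\<bar> \<le> 1 / Suc n" if ab: "a \<noteq> 0" "b \<noteq> 0" "\<bar>a\<bar> < 1 / Suc m" "\<bar>b\<bar> < 1 / Suc m" for a b
      proof -
        obtain s t where s: "(\<lambda>k. real_of_rat (s k)) \<longlonglongrightarrow> a" and t: "(\<lambda>k. real_of_rat (t k)) \<longlonglongrightarrow> b" using rat by metis
        have "(\<lambda>k. \<bar>q (real_of_rat (s k)) x - q (real_of_rat (t k)) x\<bar>) \<longlonglongrightarrow> \<bar>q a x - q b x\<bar>"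
          by (intro tendsto_intros isCont_tendsto_compose[OF qc[OF ab(1)] s] isCont_tendsto_compose[OF qc[OF ab(2)] t])
        moreover have "eventually (\<lambda>k. \<bar>q (real_of_rat (s k)) x - q (real_of_rat (t k)) x\<bar> \<le> 1 / Suc n) sequentially"
        proof -
          have "eventually (\<lambda>k. \<bar>real_of_rat (s k)\<bar> < 1 / Suc m) sequentially" "eventually (\<lambda>k. \<bar>real_of_rat (t k)\<bar> < 1 / Suc m) sequentially"
            using order_tendstoD(2)[OF tendsto_rabs[OF s] ab(3)] order_tendstoD(2)[OF tendsto_rabs[OF t] ab(4)] by auto
          moreover have "eventually (\<lambda>k. real_of_rat (s k) \<noteq> 0) sequentially" "eventually (\<lambda>k. real_of_rat (t k) \<noteq> 0) sequentially"
            using tendsto_imp_eventually_ne[OF s ab(1)] tendsto_imp_eventually_ne[OF t ab(2)] by auto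
          ultimately show ?thesis by eventually_elim (use m in auto)
        qed
        ultimately show ?thesis by (rule tendsto_upperbound) simp
      qed
      thus ?thesis by blast
    qed
    define z where "z k = q (1 / real (Suc k)) x" for k
    have "Cauchy z" unfolding Cauchy_def
    proof (intro allI impI)
      fix e :: real assume "e > 0"
      then obtain n where n: "1 / real (Suc n) < e" using small by blast
      obtain m where m: "\<And>a b. a \<noteq> 0 \<Longrightarrow> b \<noteq> 0 \<Longrightarrow> \<bar>a\<bar> < 1 / Suc m \<Longrightarrow> \<bar>b\<bar> < 1 / Suc m \<Longrightarrow> \<bar>q a x - q b x\<bar> \<le> 1 / Suc n" using ca[of n] by blast
      have "dist (z i) (z j) < e" if "i \<ge> Suc m" "j \<ge> Suc m" for i j
      proof -
        have "\<bar>z i - z j\<bar> \<le> 1 / Suc n" unfolding z_def using that by (intro m) (auto simp: field_simps)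
        thus ?thesis using n by (simp add: dist_real_def)
      qed
      thus "\<exists>M. \<forall>i\<ge>M. \<forall>j\<ge>M. dist (z i) (z j) < e" by blast
    qed
    then obtain D where D: "z \<longlonglongrightarrow> D" using Cauchy_convergent convergent_def by blast
    have "((\<lambda>t. q t x) \<longlongrightarrow> D) (at 0)"
    proof (rule LIM_I)
      fix e :: real assume "e > 0"
      then obtain n where n: "1 / real (Suc n) < e / 2" using small[of "e / 2"] by auto
      obtain m where m: "\<And>a b. a \<noteq> 0 \<Longrightarrow> b \<noteq> 0 \<Longrightarrow> \<bar>a\<bar> < 1 / Suc m \<Longrightarrow> \<bar>b\<bar> < 1 / Suc m \<Longrightarrow> \<bar>q a x - q b x\<bar> \<le> 1 / Suc n" using ca[of n] by blast
      have "\<bar>q t x - D\<bar> < e" if t: "t \<noteq> 0" "\<bar>t\<bar> < 1 / Suc m" for t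
      proof -
        have "(\<lambda>k. \<bar>q t x - z k\<bar>) \<longlonglongrightarrow> \<bar>q t x - D\<bar>" by (intro tendsto_intros D)
        moreover have "eventually (\<lambda>k. \<bar>q t x - z k\<bar> \<le> 1 / Suc n) sequentially"
          unfolding z_def by (rule eventually_sequentiallyI[of "Suc m"], rule m) (use t in \<open>auto simp: field_simps\<close>)
        ultimately have "\<bar>q t x - D\<bar> \<le> 1 / Suc n" by (rule tendsto_upperbound) simp
        thus ?thesis using n \<open>e > 0\<close> by linarith
      qed
      thus "\<exists>s>0. \<forall>t. t \<noteq> 0 \<and> norm (t - 0) < s \<longrightarrow> norm (q t x - D) < e" by (intro exI[of _ "1 / real (Suc m)"]) auto
    qed
    thus ?thesis by blast
  qed
  have slice: "AE t in lborel. x + t *\<^sub>R v \<in> E" for x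
  proof -
    have "(L * norm v)-lipschitz_on UNIV (\<lambda>t. f (x + t *\<^sub>R v))"
    proof (rule lipschitz_onI)
      show "dist (f (x + s *\<^sub>R v)) (f (x + t *\<^sub>R v)) \<le> L * norm v * dist s t" for s t using lipschitz_onD[OF lip, of "x + s *\<^sub>R v" "x + t *\<^sub>R v"]
        by (simp add: dist_norm flip: scaleR_left_diff_distrib) (simp add: algebra_simps)
      show "0 \<le> L * norm v" using lipschitz_on_nonneg[OF lip] by simp
    qed
    hence "negligible {t. \<not> (\<exists>D. ((\<lambda>t. f (x + t *\<^sub>R v)) has_real_derivative D) (at t))}" by (rule lipschitz_real_differentiable_AE)
    moreover have "{t. x + t *\<^sub>R v \<notin> E} \<subseteq> {t. \<not> (\<exists>D. ((\<lambda>t. f (x + t *\<^sub>R v)) has_real_derivative D) (at t))}"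
    proof clarify
      fix t D assume t: "x + t *\<^sub>R v \<notin> E" and "((\<lambda>t. f (x + t *\<^sub>R v)) has_real_derivative D) (at t)"
      hence "((\<lambda>h. (f (x + (t + h) *\<^sub>R v) - f (x + t *\<^sub>R v)) / h) \<longlongrightarrow> D) (at 0)" by (simp add: DERIV_def)
      hence "((\<lambda>h. q h (x + t *\<^sub>R v)) \<longlongrightarrow> D) (at 0)" unfolding q_def by (simp add: scaleR_left_distrib add.assoc)
      thus False using E1 t by blast
    qed
    ultimately have "negligible {t. x + t *\<^sub>R v \<notin> E}" by (rule negligible_subset)
    moreover have "{t. x + t *\<^sub>R v \<notin> E} \<in> sets borel"
    proof -
      have "(\<lambda>t. x + t *\<^sub>R v) -` (- E) \<inter> space borel \<in> sets borel" by (rule measurable_sets[of _ borel borel]) auto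
      moreover have "(\<lambda>t. x + t *\<^sub>R v) -` (- E) \<inter> space borel = {t. x + t *\<^sub>R v \<notin> E}" by auto
      ultimately show ?thesis by simp
    qed
    ultimately have "{t. x + t *\<^sub>R v \<notin> E} \<in> null_sets lborel" by (auto simp: negligible_iff_null_sets null_sets_def)
    thus ?thesis by (rule AE_I') auto
  qed
  \<comment> \<open>Fubini with an auxiliary parameter: the indicator of the complement at
    \<open>x + t *\<^sub>R v\<close> is integrated over \<open>x\<close> and over \<open>t\<close>
    in the unit interval. One order gives 0 by \<open>slice\<close>, the other the measure of the
    complement, and no coordinates adapted to \<open>v\<close> have to be chosen.\<close>
  have "emeasure lborel (- E) = 0"
  proof -
    have "(\<integral>\<^sup>+x. (\<integral>\<^sup>+t. indicator {0..1} t * indicator (- E) (x + t *\<^sub>R v) \<partial>lborel) \<partial>(lborel :: (real^'n) measure)) = (\<integral>\<^sup>+x. 0 \<partial>(lborel :: (real^'n) measure))"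
    proof (intro nn_integral_cong)
      fix x
      have "(\<integral>\<^sup>+t. indicator {0..1} t * indicator (- E) (x + t *\<^sub>R v) \<partial>lborel) = (\<integral>\<^sup>+t. 0 \<partial>(lborel :: real measure))"
        by (rule nn_integral_cong_AE) (use slice[of x] in \<open>auto elim!: eventually_mono\<close>)
      thus "(\<integral>\<^sup>+t. indicator {0..1::real} t * indicator (- E) (x + t *\<^sub>R v) \<partial>lborel) = (0::ennreal)" by simp
    qed
    hence "(\<integral>\<^sup>+t. (\<integral>\<^sup>+x. indicator {0..1} t * indicator (- E) (x + t *\<^sub>R v) \<partial>(lborel :: (real^'n) measure)) \<partial>(lborel :: real measure)) = 0"
      by (subst lborel_pair.Fubini') auto
    moreover have "(\<integral>\<^sup>+x. indicator {0..1} t * indicator (- E) (x + t *\<^sub>R v) \<partial>(lborel :: (real^'n) measure)) = indicator {0..1} t * emeasure lborel (- E)" for t :: real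
    proof -
      have "(\<integral>\<^sup>+x. indicator (- E) (x + t *\<^sub>R v) \<partial>lborel) = (\<integral>\<^sup>+x. indicator (- E) x \<partial>distr lborel borel (\<lambda>x. x - (- t *\<^sub>R v)))"
        by (subst nn_integral_distr) auto
      thus ?thesis unfolding lborel_distr_minus by (simp add: nn_integral_cmult)
    qed
    ultimately have "(\<integral>\<^sup>+t. indicator {0..1} t * emeasure lborel (- E) \<partial>(lborel :: real measure)) = 0" by simp
    thus ?thesis by (subst (asm) nn_integral_multc) auto
  qed
  hence "- E \<in> null_sets lborel" by (auto simp: null_sets_def)
  hence "AE x in lborel. x \<in> E" by (rule AE_I') auto
  thus ?thesis by eventually_elim (use E2 in \<open>auto simp: q_def\<close>)
qed

lemma test_function_lipschitz:
  assumes "test_function \<Omega> (\<phi> :: real^'n \<Rightarrow> real)" obtains C where "C-lipschitz_on UNIV \<phi>"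
proof -
  have "\<forall>i. \<exists>B>0. \<forall>x. \<bar>partial_deriv i \<phi> x\<bar> \<le> B" using test_function_bounds(2)[OF test_function_partial_deriv[OF assms]] by blast
  then obtain B where B: "\<And>i. B i > 0" "\<And>i x. \<bar>partial_deriv i \<phi> x\<bar> \<le> B i" by metis
  obtain R where R: "smooth_ball R \<phi>" using test_function_smooth_ball[OF assms] by blast
  have "norm (\<phi> x - \<phi> y) \<le> (\<Sum>i\<in>UNIV. B i) * norm (x - y)" for x y
  proof (rule differentiable_bound[of UNIV _ "\<lambda>x h. \<Sum>i\<in>UNIV. h $ i * partial_deriv i \<phi> x"])
    fix x
    show "(\<phi> has_derivative (\<lambda>h. \<Sum>i\<in>UNIV. h $ i * partial_deriv i \<phi> x)) (at x within UNIV)"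
      using has_derivative_partial_deriv[OF smooth_ball_differentiable[OF R]] by simp
    show "onorm (\<lambda>h. \<Sum>i\<in>UNIV. h $ i * partial_deriv i \<phi> x) \<le> (\<Sum>i\<in>UNIV. B i)"
    proof (rule onorm_le)
      fix h
      have "norm (\<Sum>i\<in>UNIV. h $ i * partial_deriv i \<phi> x) \<le> (\<Sum>i\<in>UNIV. \<bar>h $ i\<bar> * \<bar>partial_deriv i \<phi> x\<bar>)" by (simp add: abs_mult[symmetric])
      also have "... \<le> (\<Sum>i\<in>UNIV. norm h * B i)" by (intro sum_mono mult_mono component_le_norm_cart B) auto
      finally show "norm (\<Sum>i\<in>UNIV. h $ i * partial_deriv i \<phi> x) \<le> (\<Sum>i\<in>UNIV. B i) * norm h" by (simp add: sum_distrib_right mult.commute[of "norm h"])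
    qed
  qed auto
  hence "(\<Sum>i\<in>UNIV. B i)-lipschitz_on UNIV \<phi>" using B(1) by (intro lipschitz_onI sum_nonneg) (auto simp: dist_norm less_imp_le)
  thus ?thesis using that by blast
qed

text \<open>A translation moves the difference quotient from \<open>f\<close> to
  \<open>\<phi>\<close>. Both sides converge by dominated convergence, the majorants coming from the
  Lipschitz constants of \<open>f\<close> and of \<open>\<phi>\<close>.\<close>

lemma lipschitz_integral_by_parts_direction:
  fixes f :: "real^'n \<Rightarrow> real"
  assumes lip: "L-lipschitz_on UNIV f" and p: "test_function UNIV \<phi>"
    and D: "D \<in> borel_measurable borel" "AE x in lborel. ((\<lambda>t. (f (x + t *\<^sub>R v) - f x) / t) \<longlongrightarrow> D x) (at 0)"
  shows "(\<integral>x. D x * \<phi> x \<partial>lborel) = - (\<integral>x. f x * (\<Sum>i\<in>UNIV. v $ i * partial_deriv i \<phi> x) \<partial>lborel)"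
proof -
  have fc: "continuous_on UNIV f" using lip by (rule lipschitz_on_continuous_on)
  note [measurable] = borel_measurable_continuous_onI[OF fc] test_function_bounds(1)[OF p] D(1)
    test_function_bounds(1)[OF test_function_partial_deriv[OF p]]
  have fb: "\<bar>f y - f x\<bar> \<le> L * norm (y - x)" for x y using lipschitz_onD[OF lip, of y x] by (simp add: dist_norm)
  have L0: "L \<ge> 0" using lip by (rule lipschitz_on_nonneg)
  obtain R where R: "smooth_ball R \<phi>" using test_function_smooth_ball[OF p] by blast
  have R0: "\<phi> x = 0" if "norm x > R" for x using R that unfolding smooth_ball_def by blast
  note pc = test_function_bounds(3)[OF p]
  obtain C where C: "C-lipschitz_on UNIV \<phi>" using test_function_lipschitz[OF p] .
  have Cb: "\<bar>\<phi> y - \<phi> x\<bar> \<le> C * norm (y - x)" for x y using lipschitz_onD[OF C, of y x] by (simp add: dist_norm)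
  define h where "h n = 1 / real (Suc n)" for n
  have h0: "h n > 0" "h n \<le> 1" for n by (auto simp: h_def)
  have hl: "h \<longlonglongrightarrow> 0" unfolding h_def using LIMSEQ_Suc[OF lim_const_over_n[of "1::real"]] by simp
  have hat: "filterlim h (at 0) sequentially" using hl h0(1) by (auto simp: filterlim_at intro!: always_eventually less_imp_neq[THEN not_sym])
  let ?d = "\<lambda>x. \<Sum>i\<in>UNIV. v $ i * partial_deriv i \<phi> x"
  have i1: "integrable lborel (\<lambda>x. f x * \<phi> x)" by (rule continuous_compact_support_integrable[where e=R]) (auto intro!: continuous_intros fc pc simp: R0)
  have i2: "integrable lborel (\<lambda>x. f (x + h n *\<^sub>R v) * \<phi> x)" for n
    by (rule continuous_compact_support_integrable[where e=R]) (auto intro!: continuous_intros continuous_on_compose2[OF fc] pc simp: R0)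
  have i3: "integrable lborel (\<lambda>x. f x * \<phi> (x - h n *\<^sub>R v))" for n using lborel_integrable_translate[OF i2[of n], of "h n *\<^sub>R v"] by simp
  have A: "(\<lambda>n. \<integral>x. (f (x + h n *\<^sub>R v) - f x) / h n * \<phi> x \<partial>lborel) \<longlonglongrightarrow> (\<integral>x. D x * \<phi> x \<partial>lborel)"
  proof (rule integral_dominated_convergence[where w="\<lambda>x. L * norm v * \<bar>\<phi> x\<bar>"])
    show "AE x in lborel. (\<lambda>n. (f (x + h n *\<^sub>R v) - f x) / h n * \<phi> x) \<longlonglongrightarrow> D x * \<phi> x"
      using D(2) by eventually_elim (intro tendsto_mult tendsto_const filterlim_compose[OF _ hat])
    show "AE x in lborel. norm ((f (x + h n *\<^sub>R v) - f x) / h n * \<phi> x) \<le> L * norm v * \<bar>\<phi> x\<bar>" for n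
    proof (intro AE_I2)
      fix x
      have "\<bar>f (x + h n *\<^sub>R v) - f x\<bar> \<le> L * (h n * norm v)" using fb[of "x + h n *\<^sub>R v" x] h0(1)[of n] by simp
      hence "\<bar>(f (x + h n *\<^sub>R v) - f x) / h n\<bar> \<le> L * norm v" using h0(1)[of n] by (simp add: field_simps)
      thus "norm ((f (x + h n *\<^sub>R v) - f x) / h n * \<phi> x) \<le> L * norm v * \<bar>\<phi> x\<bar>" unfolding real_norm_def abs_mult by (intro mult_right_mono) auto
    qed
    show "integrable lborel (\<lambda>x. L * norm v * \<bar>\<phi> x\<bar>)" using test_function_bounds(4)[OF p] by auto
  qed measurable
  have B: "(\<lambda>n. \<integral>x. f x * ((\<phi> (x - h n *\<^sub>R v) - \<phi> x) / h n) \<partial>lborel) \<longlonglongrightarrow> (\<integral>x. f x * - ?d x \<partial>lborel)"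
  proof (rule integral_dominated_convergence[where w="\<lambda>x. indicator (cball 0 (R + norm v)) x *\<^sub>R (C * norm v * \<bar>f x\<bar>)"])
    show "AE x in lborel. (\<lambda>n. f x * ((\<phi> (x - h n *\<^sub>R v) - \<phi> x) / h n)) \<longlonglongrightarrow> f x * - ?d x"
    proof (intro AE_I2 tendsto_mult tendsto_const)
      fix x
      have "(\<phi> has_derivative (\<lambda>k. \<Sum>i\<in>UNIV. k $ i * partial_deriv i \<phi> x)) (at (x + 0 *\<^sub>R (- v)))"
        using has_derivative_partial_deriv[OF smooth_ball_differentiable[OF R]] by simp
      hence "((\<lambda>t. \<phi> (x + t *\<^sub>R (- v))) has_derivative (\<lambda>s. \<Sum>i\<in>UNIV. (s *\<^sub>R (- v)) $ i * partial_deriv i \<phi> x)) (at 0)"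
        by (intro has_derivative_compose[where g=\<phi> and f="\<lambda>t. x + t *\<^sub>R (- v)"]) (auto intro!: derivative_eq_intros)
      hence "((\<lambda>t. \<phi> (x + t *\<^sub>R (- v))) has_real_derivative (- ?d x)) (at 0)"
        unfolding has_field_derivative_def by (rule has_derivative_eq_rhs) (auto simp: fun_eq_iff sum_distrib_left sum_negf algebra_simps)
      hence "((\<lambda>t. (\<phi> (x - t *\<^sub>R v) - \<phi> x) / t) \<longlongrightarrow> - ?d x) (at 0)" by (simp add: DERIV_def)
      thus "(\<lambda>n. (\<phi> (x - h n *\<^sub>R v) - \<phi> x) / h n) \<longlonglongrightarrow> - ?d x" by (rule filterlim_compose[OF _ hat])
    qed
    show "integrable lborel (\<lambda>x. indicator (cball 0 (R + norm v)) x *\<^sub>R (C * norm v * \<bar>f x\<bar>))"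
      by (rule borel_integrable_compact) (auto intro!: continuous_intros continuous_on_subset[OF fc])
    show "AE x in lborel. norm (f x * ((\<phi> (x - h n *\<^sub>R v) - \<phi> x) / h n)) \<le> indicator (cball 0 (R + norm v)) x *\<^sub>R (C * norm v * \<bar>f x\<bar>)" for n
    proof (intro AE_I2)
      fix x
      have "\<bar>\<phi> (x - h n *\<^sub>R v) - \<phi> x\<bar> \<le> C * (h n * norm v)" using Cb[of "x - h n *\<^sub>R v" x] h0(1)[of n] by simp
      hence "\<bar>(\<phi> (x - h n *\<^sub>R v) - \<phi> x) / h n\<bar> \<le> C * norm v" using h0(1)[of n] by (simp add: field_simps)
      hence le: "norm (f x * ((\<phi> (x - h n *\<^sub>R v) - \<phi> x) / h n)) \<le> C * norm v * \<bar>f x\<bar>"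
        unfolding real_norm_def abs_mult by (subst mult.commute) (intro mult_right_mono, auto)
      show "norm (f x * ((\<phi> (x - h n *\<^sub>R v) - \<phi> x) / h n)) \<le> indicator (cball 0 (R + norm v)) x *\<^sub>R (C * norm v * \<bar>f x\<bar>)"
      proof (cases "norm x \<le> R + norm v")
        case False
        have "norm (h n *\<^sub>R v) \<le> norm v" using h0[of n] by (simp add: mult_left_le_one_le)
        hence "norm (x - h n *\<^sub>R v) > R" using norm_triangle_ineq2[of x "h n *\<^sub>R v"] False by linarith
        moreover have "norm x > R" using False norm_ge_zero[of v] by linarith
        ultimately show ?thesis using R0 False by simp
      qed (use le in simp)
    qed
  qed measurable
  have eq: "(\<integral>x. (f (x + h n *\<^sub>R v) - f x) / h n * \<phi> x \<partial>lborel) = (\<integral>x. f x * ((\<phi> (x - h n *\<^sub>R v) - \<phi> x) / h n) \<partial>lborel)" for n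
  proof -
    have "(\<integral>x. (f (x + h n *\<^sub>R v) - f x) / h n * \<phi> x \<partial>lborel) = (\<integral>x. (f (x + h n *\<^sub>R v) * \<phi> x - f x * \<phi> x) / h n \<partial>lborel)"
      by (intro Bochner_Integration.integral_cong) (auto simp: field_simps)
    also have "... = ((\<integral>x. f (x + h n *\<^sub>R v) * \<phi> x \<partial>lborel) - (\<integral>x. f x * \<phi> x \<partial>lborel)) / h n" using i1 i2[of n] by simp
    also have "(\<integral>x. f (x + h n *\<^sub>R v) * \<phi> x \<partial>lborel) = (\<integral>x. f x * \<phi> (x - h n *\<^sub>R v) \<partial>lborel)"
      using lborel_integral_translate[of "\<lambda>x. f (x + h n *\<^sub>R v) * \<phi> x" "h n *\<^sub>R v"] by simp
    also have "(... - (\<integral>x. f x * \<phi> x \<partial>lborel)) / h n = (\<integral>x. (f x * \<phi> (x - h n *\<^sub>R v) - f x * \<phi> x) / h n \<partial>lborel)" using i1 i3[of n] by simp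
    also have "... = (\<integral>x. f x * ((\<phi> (x - h n *\<^sub>R v) - \<phi> x) / h n) \<partial>lborel)" by (intro Bochner_Integration.integral_cong) (auto simp: field_simps)
    finally show ?thesis .
  qed
  have "(\<integral>x. D x * \<phi> x \<partial>lborel) = (\<integral>x. f x * - ?d x \<partial>lborel)" using LIMSEQ_unique[OF A[unfolded eq] B] .
  thus ?thesis by simp
qed

text \<open>The reflected and translated mollifiers are test functions, so the mollifications of a
  cut-off of \<open>h\<close> vanish on a ball, while they converge to the cut-off in L1.\<close>

lemma fundamental_lemma_calculus_of_variations:
  fixes h :: "real^'n \<Rightarrow> real"
  assumes hm[measurable]: "h \<in> borel_measurable borel" and b: "\<And>x. \<bar>h x\<bar> \<le> B"
    and 0: "\<And>\<phi>. test_function UNIV \<phi> \<Longrightarrow> (\<integral>x. h x * \<phi> x \<partial>lborel) = 0"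
  shows "AE x in lborel. h x = 0"
proof -
  have "AE x in lborel. x \<in> ball 0 (real R) \<longrightarrow> h x = 0" for R :: nat
  proof -
    \<comment> \<open>The margin 1 is at least every mollification radius used, so at points of the
      smaller ball the cut-off is not felt.\<close>
    define w where "w x = h x * indicator (ball 0 (real R + 1)) x" for x
    have wi: "integrable lborel w" unfolding w_def
      by (rule integrable_bounded_mult[where B=B]) (use b emeasure_bounded_finite[of "ball (0::real^'n) (real R + 1)"] in auto)
    have "\<exists>r :: real^'n \<Rightarrow> real. mollifier (1 / real (Suc n)) r" for n by (rule mollifier_exists) simp
    then obtain r :: "nat \<Rightarrow> real^'n \<Rightarrow> real" where r: "\<And>n. mollifier (1 / real (Suc n)) (r n)" by metis
    have e0: "(\<lambda>n. 1 / real (Suc n)) \<longlonglongrightarrow> 0" using LIMSEQ_Suc[OF lim_const_over_n[of "1::real"]] by simp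
    have c0: "conv (r n) w x = 0" if x: "x \<in> ball 0 (real R)" for n x
    proof -
      have rs: "smooth_ball (1 / real (Suc n)) (r n)" using r unfolding mollifier_def by blast
      have y: "r n (x - y) = 0" if "y \<notin> cball x 1" for y
      proof -
        have "1 / real (Suc n) \<le> 1" by simp
        hence "norm (x - y) > 1 / real (Suc n)" using that unfolding mem_cball dist_norm by linarith
        thus ?thesis using rs unfolding smooth_ball_def by blast
      qed
      have t: "test_function UNIV (\<lambda>y. r n (x - y))"
        by (rule test_functionI[of _ "cball x 1"]) (use rs y in \<open>auto simp: smooth_ball_def intro!: C_k_reflect[of _ "r n" x]\<close>)
      have "r n (x - y) * w y = h y * r n (x - y)" for y
      proof (cases "y \<in> cball x 1")
        case True
        have "norm y \<le> norm x + norm (x - y)" by (metis add.commute norm_minus_commute norm_triangle_sub)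
        hence "y \<in> ball 0 (real R + 1)" using True x by (simp add: dist_norm)
        thus ?thesis by (simp add: w_def)
      qed (use y in simp)
      hence "(\<lambda>y. r n (x - y) * w y) = (\<lambda>y. h y * r n (x - y))" by blast
      thus ?thesis unfolding conv_def using 0[OF t] by simp
    qed
    have i: "integrable lborel (\<lambda>x. indicator (ball 0 (real R)) x * \<bar>w x\<bar>)"
      using integrable_mult_indicator[of "ball 0 (real R)" lborel "\<lambda>x. \<bar>w x\<bar>"] wi by simp
    have le: "indicator (ball 0 (real R)) x * \<bar>w x\<bar> \<le> \<bar>conv (r n) w x - w x\<bar>" for n x using c0[of x n] by (cases "x \<in> ball 0 (real R)") auto
    have "(\<integral>x. indicator (ball 0 (real R)) x * \<bar>w x\<bar> \<partial>lborel) \<le> (\<integral>x. \<bar>conv (r n) w x - w x\<bar> \<partial>lborel)" for n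
      using wi mollifier_conv_integrable[OF r wi, of n] by (intro integral_mono i le) auto
    hence "(\<integral>x. indicator (ball 0 (real R)) x * \<bar>w x\<bar> \<partial>lborel) \<le> 0" by (intro tendsto_lowerbound[OF conv_tendsto_L1[OF wi r e0]]) auto
    hence "(\<integral>x. indicator (ball 0 (real R)) x * \<bar>w x\<bar> \<partial>lborel) = 0" by (intro antisym Bochner_Integration.integral_nonneg) auto
    hence "AE x in lborel. indicator (ball 0 (real R)) x * \<bar>w x\<bar> = 0" using integral_nonneg_eq_0_iff_AE[OF i] by auto
    thus ?thesis by eventually_elim (auto simp: w_def)
  qed
  hence "AE x in lborel. \<forall>R::nat. x \<in> ball 0 (real R) \<longrightarrow> h x = 0" unfolding AE_all_countable by blast
  thus ?thesis
  proof eventually_elim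
    case (elim x)
    obtain R :: nat where "norm x < real R" using reals_Archimedean2 by blast
    thus ?case using elim by auto
  qed
qed

lemma directional_derivative_borel:
  fixes f :: "real^'n \<Rightarrow> real"
  assumes lip: "L-lipschitz_on UNIV f"
  obtains D where "D \<in> borel_measurable borel" "\<And>x. \<bar>D x\<bar> \<le> L * norm v"
    "AE x in lborel. ((\<lambda>t. (f (x + t *\<^sub>R v) - f x) / t) \<longlongrightarrow> D x) (at 0)"
proof -
  have fc: "continuous_on UNIV f" using lip by (rule lipschitz_on_continuous_on)
  note [measurable] = borel_measurable_continuous_onI[OF fc]
  have fb: "\<bar>f y - f x\<bar> \<le> L * norm (y - x)" for x y using lipschitz_onD[OF lip, of y x] by (simp add: dist_norm)
  have L0: "L \<ge> 0" using lip by (rule lipschitz_on_nonneg)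
  define h where "h n = 1 / real (Suc n)" for n
  have h0: "h n > 0" for n by (auto simp: h_def)
  have hl: "h \<longlonglongrightarrow> 0" unfolding h_def using LIMSEQ_Suc[OF lim_const_over_n[of "1::real"]] by simp
  have hat: "filterlim h (at 0) sequentially" using hl h0(1) by (auto simp: filterlim_at intro!: always_eventually less_imp_neq[THEN not_sym])
  define c where "c = L * norm v"
  have c0: "c \<ge> 0" using L0 by (simp add: c_def)
  \<comment> \<open>Clamping to \<open>[- c, c]\<close> gives the bound at every point, including
    those where the sequence diverges and \<open>lim\<close> is arbitrary.\<close>
  define D where "D x = max (- c) (min c (lim (\<lambda>n. (f (x + h n *\<^sub>R v) - f x) / h n)))" for x
  show ?thesis
  proof (rule that[of D])
    show "D \<in> borel_measurable borel" unfolding D_def by measurable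
    show "\<bar>D x\<bar> \<le> L * norm v" for x using c0 unfolding c_def[symmetric] D_def by auto
    show "AE x in lborel. ((\<lambda>t. (f (x + t *\<^sub>R v) - f x) / t) \<longlongrightarrow> D x) (at 0)" using directional_limit_AE[OF lip, of v]
    proof eventually_elim
      case (elim x)
      then obtain d where d: "((\<lambda>t. (f (x + t *\<^sub>R v) - f x) / t) \<longlongrightarrow> d) (at 0)" by blast
      have l: "(\<lambda>n. (f (x + h n *\<^sub>R v) - f x) / h n) \<longlonglongrightarrow> d" by (rule filterlim_compose[OF d hat])
      have "\<bar>(f (x + h n *\<^sub>R v) - f x) / h n\<bar> \<le> c" for n using fb[of "x + h n *\<^sub>R v" x] h0[of n] by (simp add: c_def field_simps)
      hence "\<bar>d\<bar> \<le> c" by (intro tendsto_upperbound[OF tendsto_rabs[OF l]]) auto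
      hence "D x = d" unfolding D_def limI[OF l] by auto
      thus ?case using d by simp
    qed
  qed
qed

text \<open>After integration by parts the direction acts on the smooth function
  \<open>\<phi>\<close>, where linearity is evident. Both sides therefore have the same integrals
  against test functions and agree almost everywhere.\<close>

lemma directional_derivatives_linear:
  fixes f :: "real^'n \<Rightarrow> real"
  assumes lip: "L-lipschitz_on UNIV f"
    and d: "\<And>i. d i \<in> borel_measurable borel" "\<And>i x. \<bar>d i x\<bar> \<le> L * norm (axis i 1 :: real^'n)"
      "\<And>i. AE x in lborel. ((\<lambda>t. (f (x + t *\<^sub>R axis i 1) - f x) / t) \<longlongrightarrow> d i x) (at 0)"
  shows "AE x in lborel. ((\<lambda>t. (f (x + t *\<^sub>R v) - f x) / t) \<longlongrightarrow> (\<Sum>i\<in>UNIV. v $ i * d i x)) (at 0)"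
proof -
  obtain D where D: "D \<in> borel_measurable borel" "\<And>x. \<bar>D x\<bar> \<le> L * norm v"
    "AE x in lborel. ((\<lambda>t. (f (x + t *\<^sub>R v) - f x) / t) \<longlongrightarrow> D x) (at 0)" using directional_derivative_borel[OF lip] by blast
  note [measurable] = D(1) d(1)
  let ?h = "\<lambda>x. D x - (\<Sum>i\<in>UNIV. v $ i * d i x)"
  have "AE x in lborel. ?h x = 0"
  proof (rule fundamental_lemma_calculus_of_variations)
    show "\<bar>?h x\<bar> \<le> L * norm v + (\<Sum>i\<in>UNIV. \<bar>v $ i\<bar> * (L * norm (axis i 1 :: real^'n)))" for x
    proof -
      have "\<bar>\<Sum>i\<in>UNIV. v $ i * d i x\<bar> \<le> (\<Sum>i\<in>UNIV. \<bar>v $ i\<bar> * (L * norm (axis i 1 :: real^'n)))"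
        by (rule order_trans[OF sum_abs]) (auto simp: abs_mult intro!: sum_mono mult_left_mono d(2)[simplified])
      thus ?thesis using D(2)[of x] by linarith
    qed
    fix \<phi> assume p: "test_function UNIV (\<phi> :: real^'n \<Rightarrow> real)"
    note pint = test_function_bounds(4)[OF p]
    have i1: "integrable lborel (\<lambda>x. D x * \<phi> x)" by (rule integrable_bounded_mult[OF pint _ D(2)]) measurable
    have i2: "integrable lborel (\<lambda>x. d i x * \<phi> x)" for i by (rule integrable_bounded_mult[OF pint _ d(2)]) measurable
    have i3: "integrable lborel (\<lambda>x. f x * partial_deriv i \<phi> x)" for i
    proof -
      note pp = test_function_partial_deriv[OF p, of i]
      obtain R where R: "smooth_ball R (partial_deriv i \<phi>)" using test_function_smooth_ball[OF pp] by blast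
      have R0: "partial_deriv i \<phi> x = 0" if "norm x > R" for x using R that unfolding smooth_ball_def by blast
      show ?thesis
        by (rule continuous_compact_support_integrable[where e=R])
          (auto intro!: continuous_intros lipschitz_on_continuous_on[OF lip] test_function_bounds(3)[OF pp] simp: R0)
    qed
    have ax: "(\<Sum>j\<in>UNIV. (axis i 1 :: real^'n) $ j * partial_deriv j \<phi> x) = partial_deriv i \<phi> x" for i x
    proof -
      have "(\<Sum>j\<in>UNIV. (axis i 1 :: real^'n) $ j * partial_deriv j \<phi> x) = (\<Sum>j\<in>UNIV. if j = i then partial_deriv j \<phi> x else 0)"
        by (intro sum.cong) (auto simp: axis_def)
      thus ?thesis by simp
    qed
    have "(\<integral>x. d i x * \<phi> x \<partial>lborel) = - (\<integral>x. f x * partial_deriv i \<phi> x \<partial>lborel)" for i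
      using lipschitz_integral_by_parts_direction[OF lip p d(1) d(3), of i] by (simp only: ax)
    hence "(\<Sum>i\<in>UNIV. v $ i * (\<integral>x. d i x * \<phi> x \<partial>lborel)) = - (\<integral>x. (\<Sum>i\<in>UNIV. v $ i * (f x * partial_deriv i \<phi> x)) \<partial>lborel)" using i3 by (simp add: sum_negf)
    also have "... = (\<integral>x. D x * \<phi> x \<partial>lborel)" unfolding lipschitz_integral_by_parts_direction[OF lip p D(1,3)] by (simp add: sum_distrib_left ac_simps)
    finally have "(\<integral>x. D x * \<phi> x \<partial>lborel) = (\<integral>x. (\<Sum>i\<in>UNIV. v $ i * (d i x * \<phi> x)) \<partial>lborel)" using i2 by simp
    hence "(\<integral>x. D x * \<phi> x - (\<Sum>i\<in>UNIV. v $ i * (d i x * \<phi> x)) \<partial>lborel) = 0" using i1 i2 by (subst Bochner_Integration.integral_diff) auto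
    thus "(\<integral>x. ?h x * \<phi> x \<partial>lborel) = 0" by (simp add: left_diff_distrib sum_distrib_right mult.assoc)
  qed measurable
  with D(3) show ?thesis by eventually_elim simp
qed

text \<open>Outside of one null set the derivatives along a countable dense set of directions are
  given by the candidate gradient. By compactness, finitely many of these directions come close to
  every unit vector, and the Lipschitz condition carries the estimate over to all directions
  uniformly.\<close>

lemma rademacher_UNIV:
  fixes f :: "real^'n \<Rightarrow> real"
  assumes lip: "L-lipschitz_on UNIV f"
  obtains d where "\<And>i. d i \<in> borel_measurable borel" "\<And>i x. \<bar>d i x\<bar> \<le> L"
    "AE x in lborel. (f has_derivative (\<lambda>h. \<Sum>i\<in>UNIV. h $ i * d i x)) (at x)"
    "\<And>\<phi> i. test_function UNIV \<phi> \<Longrightarrow> (\<integral>x. f x * partial_deriv i \<phi> x \<partial>lborel) = - (\<integral>x. d i x * \<phi> x \<partial>lborel)"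
proof -
  have "\<exists>D. D \<in> borel_measurable borel \<and> (\<forall>x. \<bar>D x\<bar> \<le> L * norm (axis i 1 :: real^'n)) \<and>
    (AE x in lborel. ((\<lambda>t. (f (x + t *\<^sub>R axis i 1) - f x) / t) \<longlongrightarrow> D x) (at 0))" for i by (rule directional_derivative_borel[OF lip, of "axis i 1"]) blast
  hence "\<forall>i. \<exists>D. D \<in> borel_measurable borel \<and> (\<forall>x. \<bar>D x\<bar> \<le> L * norm (axis i 1 :: real^'n)) \<and>
    (AE x in lborel. ((\<lambda>t. (f (x + t *\<^sub>R axis i 1) - f x) / t) \<longlongrightarrow> D x) (at 0))" by blast
  from choice[OF this] obtain d where d: "\<And>i. d i \<in> borel_measurable borel" "\<And>i x. \<bar>d i x\<bar> \<le> L * norm (axis i 1 :: real^'n)"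
    "\<And>i. AE x in lborel. ((\<lambda>t. (f (x + t *\<^sub>R axis i 1) - f x) / t) \<longlongrightarrow> d i x) (at 0)" by blast
  have fb: "\<bar>f y - f x\<bar> \<le> L * norm (y - x)" for x y using lipschitz_onD[OF lip, of y x] by (simp add: dist_norm)
  have L0: "L \<ge> 0" using lip by (rule lipschitz_on_nonneg)
  obtain V :: "(real^'n) set" where V: "countable V" "\<And>X. open X \<Longrightarrow> X \<noteq> {} \<Longrightarrow> \<exists>v\<in>V. v \<in> X" using countable_dense_setE by blast
  have "AE x in lborel. \<forall>v\<in>V. ((\<lambda>t. (f (x + t *\<^sub>R v) - f x) / t) \<longlongrightarrow> (\<Sum>i\<in>UNIV. v $ i * d i x)) (at 0)"
    using directional_derivatives_linear[OF lip d] V(1) by (simp add: AE_ball_countable)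
  hence "AE x in lborel. (f has_derivative (\<lambda>h. \<Sum>i\<in>UNIV. h $ i * d i x)) (at x)"
  proof eventually_elim
    case (elim x)
    define N where "N = (\<Sum>i\<in>UNIV. \<bar>d i x\<bar>)"
    have N0: "N \<ge> 0" unfolding N_def by (intro sum_nonneg) auto
    have lb: "\<bar>\<Sum>i\<in>UNIV. h $ i * d i x\<bar> \<le> N * norm h" for h
    proof -
      have "\<bar>\<Sum>i\<in>UNIV. h $ i * d i x\<bar> \<le> (\<Sum>i\<in>UNIV. \<bar>d i x\<bar> * norm h)"
        by (rule order_trans[OF sum_abs]) (auto simp: abs_mult mult.commute[of "\<bar>d _ x\<bar>"] intro!: sum_mono mult_right_mono component_le_norm_cart)
      thus ?thesis by (simp add: N_def sum_distrib_right)
    qed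
    show ?case unfolding has_derivative_at_alt
    proof (intro conjI allI impI)
      show "bounded_linear (\<lambda>h. \<Sum>i\<in>UNIV. h $ i * d i x)"
        by (intro bounded_linear_sum bounded_linear_mult_left[THEN bounded_linear_compose] bounded_linear_vec_nth)
      fix e :: real assume "e > 0"
      \<comment> \<open>Replacing the direction by a near one costs \<open>L * c\<close> in
        \<open>f\<close> and \<open>N * c\<close> in the linear map; the difference quotient itself
        contributes \<open>c\<close>.\<close>
      define c where "c = e / (L + N + 1)"
      have c: "c > 0" using \<open>e > 0\<close> L0 N0 by (simp add: c_def)
      have "compact (sphere (0::real^'n) 1)" by simp
      moreover have "sphere (0::real^'n) 1 \<subseteq> (\<Union>v\<in>V. ball v c)"
      proof
        fix w :: "real^'n"
        obtain v where "v \<in> V" "v \<in> ball w c" using V(2)[of "ball w c"] c by auto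
        thus "w \<in> (\<Union>v\<in>V. ball v c)" by (auto simp: dist_commute)
      qed
      ultimately obtain F where F: "F \<subseteq> V" "finite F" "sphere (0::real^'n) 1 \<subseteq> (\<Union>v\<in>F. ball v c)"
        using compactE_image[of "sphere (0::real^'n) 1" V "\<lambda>v. ball v c"] by auto
      have "\<forall>v\<in>F. \<exists>s>0. \<forall>t. t \<noteq> 0 \<and> \<bar>t\<bar> < s \<longrightarrow> \<bar>(f (x + t *\<^sub>R v) - f x) / t - (\<Sum>i\<in>UNIV. v $ i * d i x)\<bar> < c"
        using elim F(1) c unfolding LIM_eq by (auto simp: subset_iff)
      from bchoice[OF this] obtain s where s: "\<And>v. v \<in> F \<Longrightarrow> s v > 0"
        "\<And>v t. v \<in> F \<Longrightarrow> t \<noteq> 0 \<Longrightarrow> \<bar>t\<bar> < s v \<Longrightarrow> \<bar>(f (x + t *\<^sub>R v) - f x) / t - (\<Sum>i\<in>UNIV. v $ i * d i x)\<bar> < c" by blast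
      define m where "m = Min (insert 1 (s ` F))"
      have m: "m > 0" "\<And>v. v \<in> F \<Longrightarrow> m \<le> s v" using F(2) s(1) by (auto simp: m_def)
      have "norm (f y - f x - (\<Sum>i\<in>UNIV. (y - x) $ i * d i x)) \<le> e * norm (y - x)" if y: "norm (y - x) < m" for y
      proof (cases "y = x")
        case False
        define t where "t = norm (y - x)"
        have t: "t > 0" "t < m" using False y by (auto simp: t_def)
        define w where "w = (1 / t) *\<^sub>R (y - x)"
        have w: "norm w = 1" "y = x + t *\<^sub>R w" using t by (auto simp: w_def t_def)
        then obtain v where v: "v \<in> F" "norm (v - w) < c" using F(3) by (auto simp: dist_norm subset_iff)
        have yx: "y - x = t *\<^sub>R w" using w by simp
        have 1: "\<bar>f y - f (x + t *\<^sub>R v)\<bar> \<le> L * (t * c)"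
        proof -
          have "norm (y - (x + t *\<^sub>R v)) = t * norm (w - v)" using t by (simp add: w(2) flip: scaleR_right_diff_distrib)
          hence "norm (y - (x + t *\<^sub>R v)) \<le> t * c" using v(2) t by (simp add: norm_minus_commute less_imp_le)
          thus ?thesis using fb[of y "x + t *\<^sub>R v"] L0 by (meson mult_left_mono order_trans)
        qed
        have 2: "\<bar>f (x + t *\<^sub>R v) - f x - t * (\<Sum>i\<in>UNIV. v $ i * d i x)\<bar> \<le> t * c"
        proof -
          have "\<bar>(f (x + t *\<^sub>R v) - f x) / t - (\<Sum>i\<in>UNIV. v $ i * d i x)\<bar> \<le> c" using s(2)[OF v(1), of t] m(2)[OF v(1)] t by simp
          moreover have "f (x + t *\<^sub>R v) - f x - t * (\<Sum>i\<in>UNIV. v $ i * d i x) = t * ((f (x + t *\<^sub>R v) - f x) / t - (\<Sum>i\<in>UNIV. v $ i * d i x))"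
            using t by (simp add: field_simps)
          ultimately show ?thesis using t by (simp add: abs_mult)
        qed
        have 3: "\<bar>t * (\<Sum>i\<in>UNIV. v $ i * d i x) - (\<Sum>i\<in>UNIV. (y - x) $ i * d i x)\<bar> \<le> t * (N * c)"
        proof -
          have "t * (\<Sum>i\<in>UNIV. v $ i * d i x) - (\<Sum>i\<in>UNIV. (y - x) $ i * d i x) = t * (\<Sum>i\<in>UNIV. (v - w) $ i * d i x)"
            unfolding yx by (simp add: sum_distrib_left sum_subtractf algebra_simps)
          also have "\<bar>...\<bar> \<le> t * (N * norm (v - w))" using lb[of "v - w"] t by (simp add: abs_mult)
          also have "... \<le> t * (N * c)" using v(2) t N0 by (intro mult_left_mono) auto
          finally show ?thesis .
        qed
        have "\<bar>f y - f x - (\<Sum>i\<in>UNIV. (y - x) $ i * d i x)\<bar> \<le> L * (t * c) + t * c + t * (N * c)" using 1 2 3 by linarith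
        also have "... = ((L + N + 1) * c) * t" by (simp add: algebra_simps)
        also have "(L + N + 1) * c = e" using L0 N0 by (simp add: c_def)
        finally show ?thesis by (simp add: t_def)
      qed simp
      thus "\<exists>m>0. \<forall>y. norm (y - x) < m \<longrightarrow> norm (f y - f x - (\<Sum>i\<in>UNIV. (y - x) $ i * d i x)) \<le> e * norm (y - x)" using m(1) by blast
    qed
  qed
  moreover have "(\<integral>x. f x * partial_deriv i \<phi> x \<partial>lborel) = - (\<integral>x. d i x * \<phi> x \<partial>lborel)" if p: "test_function UNIV \<phi>" for \<phi> i
  proof -
    have "(\<Sum>j\<in>UNIV. (axis i 1 :: real^'n) $ j * partial_deriv j \<phi> x) = partial_deriv i \<phi> x" for x
    proof -
      have "(\<Sum>j\<in>UNIV. (axis i 1 :: real^'n) $ j * partial_deriv j \<phi> x) = (\<Sum>j\<in>UNIV. if j = i then partial_deriv j \<phi> x else 0)"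
        by (intro sum.cong) (auto simp: axis_def)
      thus ?thesis by simp
    qed
    thus ?thesis using lipschitz_integral_by_parts_direction[OF lip p d(1) d(3), of i] by simp
  qed
  ultimately show ?thesis using that[of d] d(1,2) by simp
qed

text \<open>McShane's extension: the lower envelope of the cones \<open>f y + L * dist x y\<close>
  with vertices over \<open>S\<close>.\<close>

lemma lipschitz_extension:
  fixes f :: "'a::metric_space \<Rightarrow> real"
  assumes lip: "L-lipschitz_on S f" and "S \<noteq> {}"
  obtains g where "L-lipschitz_on UNIV g" "\<And>x. x \<in> S \<Longrightarrow> g x = f x"
proof -
  have L0: "L \<ge> 0" using lip by (rule lipschitz_on_nonneg)
  have fb: "f x - f y \<le> L * dist x y" if "x \<in> S" "y \<in> S" for x y using lipschitz_onD[OF lip that] by (simp add: dist_real_def)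
  define g where "g x = (INF y\<in>S. f y + L * dist x y)" for x
  obtain s where s: "s \<in> S" using \<open>S \<noteq> {}\<close> by blast
  have low: "f s - L * dist s x \<le> f y + L * dist x y" if "y \<in> S" for x y
  proof -
    have "L * dist s y \<le> L * (dist s x + dist x y)" using L0 by (intro mult_left_mono dist_triangle)
    thus ?thesis using fb[OF s that] by (simp add: algebra_simps)
  qed
  have bdd: "bdd_below ((\<lambda>y. f y + L * dist x y) ` S)" for x using low[of _ x] by (intro bdd_belowI2[where m="f s - L * dist s x"]) auto
  have le: "g x \<le> g z + L * dist x z" for x z
  proof -
    have "g x - L * dist x z \<le> g z" unfolding g_def[of z]
    proof (rule cINF_greatest[OF \<open>S \<noteq> {}\<close>])
      fix y assume y: "y \<in> S"
      have "g x \<le> f y + L * dist x y" unfolding g_def by (rule cINF_lower[OF bdd y])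
      also have "L * dist x y \<le> L * (dist x z + dist z y)" using L0 by (intro mult_left_mono dist_triangle)
      finally show "g x - L * dist x z \<le> f y + L * dist z y" by (simp add: algebra_simps)
    qed
    thus ?thesis by simp
  qed
  have "L-lipschitz_on UNIV g"
  proof (rule lipschitz_onI)
    fix x y show "dist (g x) (g y) \<le> L * dist x y" using le[of x y] le[of y x] by (auto simp: dist_real_def abs_le_iff dist_commute)
  qed (rule L0)
  moreover have "g x = f x" if x: "x \<in> S" for x
  proof (rule antisym)
    show "g x \<le> f x" unfolding g_def using cINF_lower[OF bdd x, of x] by simp
    show "f x \<le> g x" unfolding g_def by (rule cINF_greatest[OF \<open>S \<noteq> {}\<close>]) (use fb[OF x] in \<open>simp add: diff_le_eq add.commute\<close>)
  qed
  ultimately show ?thesis using that by blast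
qed

text \<open>The global result is applied to an extension of \<open>f\<close>. At points of the open
  set both functions have the same derivative, and test functions on \<Omega> only see
  \<Omega>.\<close>

lemma lipschitz_open_derivative:
  fixes f :: "real^'n \<Rightarrow> real"
  assumes lip: "L-lipschitz_on \<Omega> f" and O: "open \<Omega>" "\<Omega> \<noteq> {}"
  obtains d where "\<And>i. d i \<in> borel_measurable borel" "\<And>i x. \<bar>d i x\<bar> \<le> L"
    "AE x in lborel. x \<in> \<Omega> \<longrightarrow> (f has_derivative (\<lambda>h. \<Sum>i\<in>UNIV. h $ i * d i x)) (at x)"
    "\<And>\<phi> i. test_function \<Omega> \<phi> \<Longrightarrow> partial_pairing \<Omega> f i \<phi> = - (\<integral>x. d i x * \<phi> x \<partial>lborel)"
proof -
  obtain g where g: "L-lipschitz_on UNIV g" "\<And>x. x \<in> \<Omega> \<Longrightarrow> g x = f x" using lipschitz_extension[OF lip O(2)] by blast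
  obtain d where d: "\<And>i. d i \<in> borel_measurable borel" "\<And>i x. \<bar>d i x\<bar> \<le> L"
    "AE x in lborel. (g has_derivative (\<lambda>h. \<Sum>i\<in>UNIV. h $ i * d i x)) (at x)"
    "\<And>\<phi> i. test_function UNIV \<phi> \<Longrightarrow> (\<integral>x. g x * partial_deriv i \<phi> x \<partial>lborel) = - (\<integral>x. d i x * \<phi> x \<partial>lborel)" using rademacher_UNIV[OF g(1)] by blast
  note [measurable] = borel_measurable_continuous_onI[OF lipschitz_on_continuous_on[OF g(1)]]
  show ?thesis
  proof (rule that[OF d(1,2)])
    show "AE x in lborel. x \<in> \<Omega> \<longrightarrow> (f has_derivative (\<lambda>h. \<Sum>i\<in>UNIV. h $ i * d i x)) (at x)"
      using d(3) by eventually_elim (use has_derivative_transform_within_open[OF _ O(1)] g(2) in blast)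
    fix \<phi> i assume t: "test_function \<Omega> \<phi>"
    note [measurable] = test_function_bounds(1)[OF test_function_partial_deriv[OF t]]
    have "partial_pairing \<Omega> f i \<phi> = partial_pairing \<Omega> g i \<phi>" using g(2) by (intro Bochner_Integration.integral_cong refl) auto
    also have "... = (\<integral>x. g x * partial_deriv i \<phi> x \<partial>lborel)"
      by (rule integral_lebesgue_on_lborel) (use O test_function_outside[OF test_function_partial_deriv[OF t]] in auto)
    also have "... = - (\<integral>x. d i x * \<phi> x \<partial>lborel)" by (rule d(4)[OF test_function_mono[OF t subset_UNIV]])
    finally show "partial_pairing \<Omega> f i \<phi> = - (\<integral>x. d i x * \<phi> x \<partial>lborel)" .
  qed
qed

theorem rademacher:
  fixes \<gamma> :: "real^'n \<Rightarrow> real^'m"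
  assumes lip: "L-lipschitz_on \<Omega> \<gamma>" and O: "open \<Omega>"
  shows "negligible {x \<in> \<Omega>. \<not> \<gamma> differentiable (at x)}"
proof (cases "\<Omega> = {}")
  case False
  have "AE x in lborel. x \<in> \<Omega> \<longrightarrow> (\<lambda>x. \<gamma> x $ i) differentiable (at x)" for i
  proof -
    have l: "L-lipschitz_on \<Omega> (\<lambda>x. \<gamma> x $ i)"
      by (rule lipschitz_onI) (auto intro: order_trans[OF dist_vec_nth_le lipschitz_onD[OF lip]] lipschitz_on_nonneg[OF lip])
    obtain d where "AE x in lborel. x \<in> \<Omega> \<longrightarrow> ((\<lambda>x. \<gamma> x $ i) has_derivative (\<lambda>h. \<Sum>j\<in>UNIV. h $ j * d j x)) (at x)"
      by (rule lipschitz_open_derivative[OF l O False]) blast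
    thus ?thesis by eventually_elim (auto simp: differentiable_def)
  qed
  hence "AE x in lborel. \<forall>i. x \<in> \<Omega> \<longrightarrow> (\<lambda>x. \<gamma> x $ i) differentiable (at x)" unfolding AE_all_countable by blast
  hence "AE x in lborel. x \<in> \<Omega> \<longrightarrow> \<gamma> differentiable (at x)"
    by eventually_elim (auto simp: differentiable_componentwise_within[of \<gamma>] Basis_vec_def inner_axis)
  from AE_lborel_negligible[OF this] show ?thesis by (rule negligible_subset) auto
qed simp

subsection \<open>Change of variables\<close>

text \<open>The change of variables theorem of the library is restricted to index types of class
  \<open>wellorder\<close>; every finite type is in bijection with such a type.\<close>

typedef (overloaded) ('n::finite) ordered_index = "{..<CARD('n)}" by (rule exI[of _ 0]) simp

instance ordered_index :: (finite) finite
proof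
  have "(UNIV :: 'a ordered_index set) = Abs_ordered_index ` {..<CARD('a)}" by (metis type_definition.Abs_image type_definition_ordered_index)
  thus "finite (UNIV :: 'a ordered_index set)" by (metis finite_imageI finite_lessThan)
qed

instantiation ordered_index :: (finite) wellorder
begin

definition "x \<le> y \<longleftrightarrow> Rep_ordered_index x \<le> Rep_ordered_index y"
definition "x < y \<longleftrightarrow> Rep_ordered_index x < Rep_ordered_index y"

instance
proof
  fix P :: "'a ordered_index \<Rightarrow> bool" and a
  assume step: "\<And>x. (\<And>y. y < x \<Longrightarrow> P y) \<Longrightarrow> P x"
  show "P a"
  proof (induction "Rep_ordered_index a" arbitrary: a rule: less_induct)
    case less thus ?case using step by (simp add: less_ordered_index_def)
  qed
qed (auto simp: less_eq_ordered_index_def less_ordered_index_def Rep_ordered_index_inject)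

end

lemma ordered_index_bij: "\<exists>h :: 'n::finite ordered_index \<Rightarrow> 'n. bij h"
proof -
  have "bij_betw Rep_ordered_index (UNIV :: 'n ordered_index set) {..<CARD('n)}"
    by (metis Rep_ordered_index_inject bij_betw_def injI type_definition.Rep_range type_definition_ordered_index)
  hence "CARD('n ordered_index) = CARD('n)" by (simp add: bij_betw_same_card)
  thus ?thesis using bij_betw_iff_card[of "UNIV :: 'n ordered_index set" "UNIV :: 'n set"] by simp
qed

text \<open>Conjugation by \<open>h\<close> maps a product of transpositions to a product of the
  same number of transpositions.\<close>

lemma sign_conjugate:
  fixes h :: "'a::finite \<Rightarrow> 'b::finite"
  assumes h: "bij h" and p: "permutation p"
  shows "sign (h \<circ> p \<circ> inv h) = sign p"
proof -
  have hi: "inv h \<circ> h = id" "h \<circ> inv h = id" using h by (auto simp: fun_eq_iff bij_is_inj bij_is_surj surj_f_inv_f)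
  have tr: "h \<circ> Transposition.transpose a b \<circ> inv h = Transposition.transpose (h a) (h b)" for a b
  proof
    fix x
    obtain y where "x = h y" using h by (metis bij_pointE)
    thus "(h \<circ> Transposition.transpose a b \<circ> inv h) x = Transposition.transpose (h a) (h b) x"
      using h by (auto simp: Transposition.transpose_def bij_is_inj inj_eq)
  qed
  have sw: "swapidseq n q \<Longrightarrow> swapidseq n (h \<circ> q \<circ> inv h)" for n q
  proof (induction n q rule: swapidseq.induct)
    case id
    show ?case by (simp only: comp_id hi(2) swapidseq.id)
  next
    case (comp_Suc n q a b)
    have "h \<circ> (Transposition.transpose a b \<circ> q) \<circ> inv h = (h \<circ> Transposition.transpose a b \<circ> inv h) \<circ> (h \<circ> q \<circ> inv h)"
      using hi by (metis comp_assoc comp_id)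
    also have "... = Transposition.transpose (h a) (h b) \<circ> (h \<circ> q \<circ> inv h)" by (simp only: tr)
    finally show ?case using comp_Suc h by (metis bij_is_inj inj_eq swapidseq.comp_Suc)
  qed
  obtain n where n: "swapidseq n p" using p unfolding permutation_def by blast
  have "evenperm (h \<circ> p \<circ> inv h) = even n" by (rule evenperm_unique[OF sw[OF n]]) simp
  moreover have "evenperm p = even n" by (rule evenperm_unique[OF n]) simp
  ultimately show ?thesis by (simp add: sign_def)
qed

lemma det_reindex:
  fixes A :: "real^'b^'b" and h :: "'a::finite \<Rightarrow> 'b::finite"
  assumes h: "bij h"
  shows "det (\<chi> i j. A $ h i $ h j) = det A"
proof -
  have hi: "inv h (h x) = x" "h (inv h y) = y" for x y using h by (auto simp: bij_is_inj bij_is_surj surj_f_inv_f)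
  have hb: "bij (inv h)" using h by (rule bij_imp_bij_inv)
  have pb: "p permutes (UNIV :: 'c set) \<longleftrightarrow> bij p" for p :: "'c \<Rightarrow> 'c" by (auto intro: permutes_bij bij_imp_permutes)
  have "det A = (\<Sum>p\<in>{p. p permutes (UNIV :: 'a set)}. of_int (sign (h \<circ> p \<circ> inv h)) * (\<Prod>i\<in>UNIV. A $ i $ ((h \<circ> p \<circ> inv h) i)))" unfolding det_def
  proof (rule sum.reindex_bij_witness[where i="\<lambda>p. h \<circ> p \<circ> inv h" and j="\<lambda>q. inv h \<circ> q \<circ> h"])
    fix q :: "'b \<Rightarrow> 'b" assume "q \<in> {p. p permutes UNIV}"
    thus "inv h \<circ> q \<circ> h \<in> {p. p permutes UNIV}" using h hb by (simp add: pb bij_comp)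
    show "h \<circ> (inv h \<circ> q \<circ> h) \<circ> inv h = q" by (auto simp: hi)
    thus "of_int (sign (h \<circ> (inv h \<circ> q \<circ> h) \<circ> inv h)) * (\<Prod>i\<in>UNIV. A $ i $ (h \<circ> (inv h \<circ> q \<circ> h) \<circ> inv h) i) = of_int (sign q) * (\<Prod>i\<in>UNIV. A $ i $ q i)"
      by simp
  next
    fix p :: "'a \<Rightarrow> 'a" assume "p \<in> {p. p permutes UNIV}"
    thus "h \<circ> p \<circ> inv h \<in> {p. p permutes UNIV}" using h hb by (simp add: pb bij_comp)
    show "inv h \<circ> (h \<circ> p \<circ> inv h) \<circ> h = p" by (auto simp: hi)
  qed
  also have "... = det (\<chi> i j. A $ h i $ h j)" unfolding det_def
  proof (intro sum.cong refl)
    fix p :: "'a \<Rightarrow> 'a" assume p: "p \<in> {p. p permutes UNIV}"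
    hence "permutation p" by (auto simp: permutation_permutes)
    hence s: "sign (h \<circ> p \<circ> inv h) = sign p" by (rule sign_conjugate[OF h])
    have "(\<Prod>i\<in>UNIV. A $ i $ ((h \<circ> p \<circ> inv h) i)) = (\<Prod>i\<in>UNIV. A $ h i $ h (p i))"
      by (rule prod.reindex_bij_witness[where i=h and j="inv h"]) (auto simp: hi)
    thus "of_int (sign (h \<circ> p \<circ> inv h)) * (\<Prod>i\<in>UNIV. A $ i $ ((h \<circ> p \<circ> inv h) i)) =
      of_int (sign p) * (\<Prod>i\<in>UNIV. (\<chi> i j. A $ h i $ h j) $ i $ p i)" by (simp add: s)
  qed
  finally show ?thesis by simp
qed

definition reindex :: "('a \<Rightarrow> 'b) \<Rightarrow> real^'b \<Rightarrow> real^'a"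
  where "reindex h x = (\<chi> i. x $ h i)"

lemma prod_Basis_vec: "(\<Prod>b\<in>(Basis :: (real^'n) set). f b) = (\<Prod>i\<in>UNIV. f (axis i 1))"
proof -
  have B: "(Basis :: (real^'n) set) = range (\<lambda>i. axis i 1)" by (auto simp: Basis_vec_def)
  have "inj (\<lambda>i::'n. axis i (1::real))" by (auto simp: inj_on_def axis_eq_axis)
  thus ?thesis unfolding B by (subst prod.reindex) auto
qed

lemma reindex_bounded_linear: "bounded_linear (reindex h)"
proof -
  have "linear (reindex h)" by (rule linearI) (auto simp: reindex_def vec_eq_iff)
  thus ?thesis by (rule linear_conv_bounded_linear[THEN iffD1])
qed

lemma reindex_inverse:
  assumes "bij h" shows "reindex (inv h) (reindex h x) = x" "reindex h (reindex (inv h) y) = y"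
  using assms by (auto simp: reindex_def vec_eq_iff bij_is_inj bij_is_surj surj_f_inv_f)

text \<open>Boxes correspond to boxes with the same side lengths in another order.\<close>

lemma lborel_distr_reindex:
  fixes h :: "'a::finite \<Rightarrow> 'b::finite"
  assumes h: "bij h"
  shows "distr lborel borel (reindex h) = (lborel :: (real^'a) measure)"
proof (rule lborel_eqI[symmetric])
  have m[measurable]: "reindex h \<in> borel_measurable borel" by (rule borel_measurable_continuous_onI[OF linear_continuous_on[OF reindex_bounded_linear]])
  fix l u :: "real^'a" assume lu: "\<And>b. b \<in> Basis \<Longrightarrow> l \<bullet> b \<le> u \<bullet> b"
  have lu': "l $ i \<le> u $ i" for i using lu[of "axis i 1"] by (auto simp: inner_axis)
  have hi: "inv h (h x) = x" "h (inv h y) = y" for x y using h by (auto simp: bij_is_inj bij_is_surj surj_f_inv_f)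
  have "reindex h -` box l u = box (reindex (inv h) l) (reindex (inv h) u)" unfolding mem_box_cart set_eq_iff vimage_eq
    by (auto simp: reindex_def) (metis hi)+
  hence "emeasure (distr lborel borel (reindex h)) (box l u) = emeasure lborel (box (reindex (inv h) l) (reindex (inv h) u))"
    by (subst emeasure_distr) auto
  also have "... = (\<Prod>b\<in>Basis. (reindex (inv h) u - reindex (inv h) l) \<bullet> b)"
    by (rule emeasure_lborel_box) (auto simp: Basis_vec_def inner_axis reindex_def lu')
  also have "(\<Prod>b\<in>Basis. (reindex (inv h) u - reindex (inv h) l) \<bullet> b) = (\<Prod>i\<in>UNIV. u $ inv h i - l $ inv h i)"
    by (simp add: prod_Basis_vec inner_axis reindex_def)
  also have "... = (\<Prod>i\<in>UNIV. u $ i - l $ i)" by (rule prod.reindex_bij_witness[where i=h and j="inv h"]) (auto simp: hi)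
  also have "... = (\<Prod>b\<in>Basis. (u - l) \<bullet> b)" by (simp add: prod_Basis_vec inner_axis)
  finally show "emeasure (distr lborel borel (reindex h)) (box l u) = (\<Prod>b\<in>Basis. (u - l) \<bullet> b)" .
qed simp

lemma lebesgue_distr_reindex:
  fixes h :: "'a::finite \<Rightarrow> 'b::finite"
  assumes h: "bij h"
  shows "distr lebesgue lebesgue (reindex h) = (lebesgue :: (real^'a) measure)" "reindex h \<in> lebesgue \<rightarrow>\<^sub>M lebesgue"
proof -
  have m: "reindex h \<in> borel_measurable borel" by (rule borel_measurable_continuous_onI[OF linear_continuous_on[OF reindex_bounded_linear]])
  hence ml: "reindex h \<in> lebesgue \<rightarrow>\<^sub>M lborel" by (simp add: measurable_completion)
  have eq: "distr lebesgue lborel (reindex h) = (lborel :: (real^'a) measure)"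
    using lborel_distr_reindex[OF h] m by (simp add: distr_completion cong: distr_cong)
  have "completion (distr lebesgue lborel (reindex h)) = distr lebesgue (completion lborel) (reindex h)"
    by (rule completion.completion_distr_eq[OF ml]) (simp add: eq)
  thus "distr lebesgue lebesgue (reindex h) = (lebesgue :: (real^'a) measure)" by (simp add: eq)
  show "reindex h \<in> lebesgue \<rightarrow>\<^sub>M lebesgue" by (rule completion.measurable_completion2[OF ml]) (simp add: eq)
qed

lemma integrable_reindex:
  fixes h :: "'a::finite \<Rightarrow> 'b::finite" and f :: "real^'a \<Rightarrow> real"
  assumes h: "bij h" and f: "integrable lebesgue f"
  shows "integrable lebesgue (\<lambda>x. f (reindex h x))" "(\<integral>x. f (reindex h x) \<partial>lebesgue) = (\<integral>x. f x \<partial>lebesgue)"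
  using integrable_distr[OF lebesgue_distr_reindex(2)[OF h], of f] integral_distr[OF lebesgue_distr_reindex(2)[OF h], of f]
    f borel_measurable_integrable[OF f] by (auto simp: lebesgue_distr_reindex(1)[OF h])

lemma integrable_reindex_iff:
  fixes h :: "'a::finite \<Rightarrow> 'b::finite" and f :: "real^'a \<Rightarrow> real"
  assumes h: "bij h"
  shows "integrable lebesgue (\<lambda>x. f (reindex h x)) \<longleftrightarrow> integrable lebesgue f"
  using integrable_reindex(1)[OF h, of f] integrable_reindex(1)[OF bij_imp_bij_inv[OF h], of "\<lambda>x. f (reindex h x)"]
  by (auto simp: reindex_inverse(2)[OF h])

lemma change_of_variables_wellorder:
  fixes f :: "real^'m::{finite,wellorder} \<Rightarrow> real" and g :: "(real, 'm) vec \<Rightarrow> (real, 'm) vec"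
  assumes S: "S \<in> sets lebesgue" and der: "\<And>x. x \<in> S \<Longrightarrow> (g has_derivative g' x) (at x within S)" and inj: "inj_on g S"
  shows "integrable lebesgue (\<lambda>x. indicator S x * (\<bar>det (matrix (g' x))\<bar> * f (g x))) \<longleftrightarrow> integrable lebesgue (\<lambda>y. indicator (g ` S) y * f y)"
    "integrable lebesgue (\<lambda>y. indicator (g ` S) y * f y) \<Longrightarrow>
      (\<integral>x. indicator S x * (\<bar>det (matrix (g' x))\<bar> * f (g x)) \<partial>lebesgue) = (\<integral>y. indicator (g ` S) y * f y \<partial>lebesgue)"
proof -
  \<comment> \<open>The change of variables for vector-valued integrands is used with values in the
    one-dimensional space.\<close>
  define F :: "(real, 'm) vec \<Rightarrow> real^1" where "F y = (\<chi> i. f y)" for y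
  have abs_iff: "(\<lambda>x. (\<chi> i. k x) :: real^1) absolutely_integrable_on A \<longleftrightarrow> integrable lebesgue (\<lambda>x. indicator A x * k x)" for k :: "(real, 'm) vec \<Rightarrow> real" and A
  proof
    assume "(\<lambda>x. (\<chi> i. k x) :: real^1) absolutely_integrable_on A"
    hence "integrable lebesgue (\<lambda>x. (indicator A x *\<^sub>R (\<chi> i. k x) :: real^1) $ 1)" unfolding set_integrable_def by (rule integrable_vec_component)
    thus "integrable lebesgue (\<lambda>x. indicator A x * k x)" by simp
  qed (auto simp: set_integrable_def intro!: integrable_vecI)
  have int_eq: "integral A (\<lambda>x. (\<chi> i. k x) :: real^1) $ 1 = (\<integral>x. indicator A x * k x \<partial>lebesgue)"
    if "integrable lebesgue (\<lambda>x. indicator A x * k x)" for k :: "(real, 'm) vec \<Rightarrow> real" and A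
  proof -
    have s: "set_integrable lebesgue A (\<lambda>x. (\<chi> i. k x) :: real^1)" using that abs_iff by blast
    have "integral A (\<lambda>x. (\<chi> i. k x) :: real^1) $ 1 = (\<integral>x. indicator A x *\<^sub>R ((\<chi> i. k x) :: real^1) \<partial>lebesgue) $ 1"
      using set_lebesgue_integral_eq_integral(2)[OF s] by (simp add: set_lebesgue_integral_def)
    thus ?thesis using integral_vec_component[OF s[unfolded set_integrable_def], of 1] by simp
  qed
  have e: "(\<lambda>x. \<bar>det (matrix (g' x))\<bar> *\<^sub>R F (g x)) = (\<lambda>x. \<chi> i. \<bar>det (matrix (g' x))\<bar> * f (g x))" by (auto simp: F_def vec_eq_iff)
  have eF: "F = (\<lambda>y. \<chi> i. f y)" by (auto simp: F_def)
  show 1: "integrable lebesgue (\<lambda>x. indicator S x * (\<bar>det (matrix (g' x))\<bar> * f (g x))) \<longleftrightarrow> integrable lebesgue (\<lambda>y. indicator (g ` S) y * f y)"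
    using absolutely_integrable_change_of_variables[OF S der inj, of F] unfolding e unfolding eF abs_iff by simp
  assume i: "integrable lebesgue (\<lambda>y. indicator (g ` S) y * f y)"
  hence "integral (g ` S) F = integral S (\<lambda>x. \<bar>det (matrix (g' x))\<bar> *\<^sub>R F (g x))"
    by (intro integral_change_of_variables[OF S der inj]) (auto simp: eF abs_iff)
  thus "(\<integral>x. indicator S x * (\<bar>det (matrix (g' x))\<bar> * f (g x)) \<partial>lebesgue) = (\<integral>y. indicator (g ` S) y * f y \<partial>lebesgue)"
    unfolding e unfolding eF using int_eq[OF i] int_eq[OF 1[THEN iffD2, OF i]] by simp
qed

text \<open>The situation is conjugated with the renaming of coordinates \<open>?P\<close>, which
  preserves Lebesgue measure and, by \<open>det_reindex\<close>, the Jacobian determinant.\<close>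

lemma change_of_variables:
  fixes f :: "real^'n \<Rightarrow> real" and g :: "real^'n \<Rightarrow> real^'n"
  assumes S: "S \<in> sets lebesgue" and der: "\<And>x. x \<in> S \<Longrightarrow> (g has_derivative g' x) (at x within S)" and inj: "inj_on g S"
  shows "integrable lebesgue (\<lambda>x. indicator S x * (\<bar>det (matrix (g' x))\<bar> * f (g x))) \<longleftrightarrow> integrable lebesgue (\<lambda>y. indicator (g ` S) y * f y)"
    "integrable lebesgue (\<lambda>y. indicator (g ` S) y * f y) \<Longrightarrow>
      (\<integral>x. indicator S x * (\<bar>det (matrix (g' x))\<bar> * f (g x)) \<partial>lebesgue) = (\<integral>y. indicator (g ` S) y * f y \<partial>lebesgue)"
proof -
  obtain h :: "'n ordered_index \<Rightarrow> 'n" where h: "bij h" using ordered_index_bij by blast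
  let ?P = "reindex h :: real^'n \<Rightarrow> real^('n ordered_index)" and ?Q = "reindex (inv h) :: real^('n ordered_index) \<Rightarrow> real^'n"
  have PQ: "?P (?Q y) = y" and QP: "?Q (?P x) = x" for x y using reindex_inverse[OF h] by auto
  have hb: "bij (inv h)" using h by (rule bij_imp_bij_inv)
  define S' where "S' = ?P ` S"
  define G where "G y = ?P (g (?Q y))" for y
  define G' where "G' y k = ?P (g' (?Q y) (?Q k))" for y k
  define F where "F y = f (?Q y)" for y
  have Pinj: "x = z" if "?P x = ?P z" for x z using arg_cong[OF that, of ?Q] by (simp only: QP)
  have inS: "?P x \<in> S' \<longleftrightarrow> x \<in> S" for x
  proof
    assume "?P x \<in> S'"
    then obtain z where "z \<in> S" "?P x = ?P z" unfolding S'_def by blast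
    thus "x \<in> S" using Pinj by blast
  qed (simp add: S'_def)
  have inGS: "?P x \<in> G ` S' \<longleftrightarrow> x \<in> g ` S" for x
  proof -
    have GP: "G (?P z) = ?P (g z)" for z unfolding G_def by (simp only: QP)
    have eq: "G ` S' = ?P ` g ` S" unfolding S'_def image_image GP ..
    show ?thesis unfolding eq
    proof
      assume "?P x \<in> ?P ` g ` S"
      then obtain z where "z \<in> g ` S" "?P x = ?P z" by blast
      thus "x \<in> g ` S" using Pinj by blast
    qed simp
  qed
  have S'l: "S' \<in> sets lebesgue"
  proof -
    have "y \<in> S' \<longleftrightarrow> ?Q y \<in> S" for y using inS[of "?Q y"] by (simp only: PQ)
    hence "S' = ?Q -` S \<inter> space lebesgue" by auto
    thus ?thesis using measurable_sets[OF lebesgue_distr_reindex(2)[OF hb] S] by simp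
  qed
  have der': "(G has_derivative G' y) (at y within S')" if y: "y \<in> S'" for y
  proof -
    have "?Q y \<in> S" using y QP unfolding S'_def by auto
    hence d: "(g has_derivative g' (?Q y)) (at (?Q y) within S)" by (rule der)
    have im: "?Q ` S' \<subseteq> S" unfolding S'_def using QP by auto
    have q: "(?Q has_derivative ?Q) (at y within S')" by (rule bounded_linear_imp_has_derivative) (rule reindex_bounded_linear)
    have d2: "(g has_derivative g' (?Q y)) (at (?Q y) within ?Q ` S')" using d im by (rule has_derivative_subset)
    have gq: "((\<lambda>y. g (?Q y)) has_derivative (\<lambda>k. g' (?Q y) (?Q k))) (at y within S')" using q d2 by (rule has_derivative_in_compose)
    have p: "(?P has_derivative ?P) (at (g (?Q y)))" by (rule bounded_linear_imp_has_derivative) (rule reindex_bounded_linear)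
    show ?thesis unfolding G_def[abs_def] G'_def[abs_def] using gq p by (rule has_derivative_compose)
  qed
  have inj': "inj_on G S'"
  proof (rule inj_onI)
    fix y z assume yz: "y \<in> S'" "z \<in> S'" "G y = G z"
    then obtain a b where ab: "y = ?P a" "z = ?P b" "a \<in> S" "b \<in> S" unfolding S'_def by blast
    hence "?P (g a) = ?P (g b)" using yz(3) unfolding G_def by (simp only: QP)
    hence "g a = g b" using Pinj by blast
    thus "y = z" using ab inj by (auto simp: inj_on_def)
  qed
  have hi: "inv h (h x) = x" "h (inv h y) = y" for x y using h by (auto simp: bij_is_inj bij_is_surj surj_f_inv_f)
  have ax: "?Q (axis j 1) = axis (h j) 1" for j unfolding reindex_def axis_def vec_eq_iff by (auto simp: hi)
  have dt: "det (matrix (G' (?P x))) = det (matrix (g' x))" for x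
  proof -
    have "matrix (G' (?P x)) = (\<chi> i j. matrix (g' x) $ h i $ h j)" unfolding matrix_def G'_def by (simp add: QP ax) (simp add: reindex_def vec_eq_iff)
    thus ?thesis using det_reindex[OF h] by simp
  qed
  have cv: "integrable lebesgue (\<lambda>x. indicator S' x * (\<bar>det (matrix (G' x))\<bar> * F (G x))) \<longleftrightarrow> integrable lebesgue (\<lambda>y. indicator (G ` S') y * F y)"
    "integrable lebesgue (\<lambda>y. indicator (G ` S') y * F y) \<Longrightarrow>
      (\<integral>x. indicator S' x * (\<bar>det (matrix (G' x))\<bar> * F (G x)) \<partial>lebesgue) = (\<integral>y. indicator (G ` S') y * F y \<partial>lebesgue)"
    by (rule change_of_variables_wellorder[OF S'l _ inj'], erule der')
      (rule change_of_variables_wellorder[OF S'l _ inj'], erule der', assumption)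
  have e1: "indicator S' (?P x) * (\<bar>det (matrix (G' (?P x)))\<bar> * F (G (?P x))) = indicator S x * (\<bar>det (matrix (g' x))\<bar> * f (g x))" for x
    by (simp add: indicator_def inS dt F_def G_def QP)
  have e2: "indicator (G ` S') (?P x) * F (?P x) = indicator (g ` S) x * f x" for x by (simp add: indicator_def inGS F_def QP)
  have i1: "integrable lebesgue (\<lambda>x. indicator S x * (\<bar>det (matrix (g' x))\<bar> * f (g x))) \<longleftrightarrow>
     integrable lebesgue (\<lambda>y. indicator S' y * (\<bar>det (matrix (G' y))\<bar> * F (G y)))"
    using integrable_reindex_iff[OF h, of "\<lambda>y. indicator S' y * (\<bar>det (matrix (G' y))\<bar> * F (G y))"] by (simp only: e1)
  have i2: "integrable lebesgue (\<lambda>x. indicator (g ` S) x * f x) \<longleftrightarrow> integrable lebesgue (\<lambda>y. indicator (G ` S') y * F y)"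
    using integrable_reindex_iff[OF h, of "\<lambda>y. indicator (G ` S') y * F y"] by (simp only: e2)
  show "integrable lebesgue (\<lambda>x. indicator S x * (\<bar>det (matrix (g' x))\<bar> * f (g x))) \<longleftrightarrow> integrable lebesgue (\<lambda>y. indicator (g ` S) y * f y)"
    using cv(1) i1 i2 by simp
  assume "integrable lebesgue (\<lambda>y. indicator (g ` S) y * f y)"
  hence i: "integrable lebesgue (\<lambda>y. indicator (G ` S') y * F y)" using i2 by simp
  have "(\<integral>x. indicator S x * (\<bar>det (matrix (g' x))\<bar> * f (g x)) \<partial>lebesgue) = (\<integral>y. indicator S' y * (\<bar>det (matrix (G' y))\<bar> * F (G y)) \<partial>lebesgue)"
    using integrable_reindex(2)[OF h cv(1)[THEN iffD2, OF i]] by (simp only: e1)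
  also have "... = (\<integral>y. indicator (G ` S') y * F y \<partial>lebesgue)" by (rule cv(2)[OF i])
  also have "... = (\<integral>y. indicator (g ` S) y * f y \<partial>lebesgue)" using integrable_reindex(2)[OF h i] by (simp only: e2)
  finally show "(\<integral>x. indicator S x * (\<bar>det (matrix (g' x))\<bar> * f (g x)) \<partial>lebesgue) = (\<integral>y. indicator (g ` S) y * f y \<partial>lebesgue)" .
qed

subsection \<open>Lipschitz transformations\<close>

lemma lip_transD:
  assumes "\<gamma> \<in> lip_trans \<Omega>"
  shows "bij_betw \<gamma> \<Omega> \<Omega>" "\<exists>L. L-lipschitz_on \<Omega> \<gamma>" "\<exists>L. L-lipschitz_on \<Omega> (inv_into \<Omega> \<gamma>)"
    "\<And>S. S \<subseteq> \<Omega> \<Longrightarrow> negligible S \<Longrightarrow> negligible (\<gamma> ` S)" "\<And>S. S \<subseteq> \<Omega> \<Longrightarrow> negligible S \<Longrightarrow> negligible (inv_into \<Omega> \<gamma> ` S)"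
    "inj_on \<gamma> \<Omega>" "\<gamma> ` \<Omega> = \<Omega>" "\<And>x. x \<in> \<Omega> \<Longrightarrow> inv_into \<Omega> \<gamma> (\<gamma> x) = x" "\<And>x. x \<in> \<Omega> \<Longrightarrow> \<gamma> (inv_into \<Omega> \<gamma> x) = x"
    "\<And>x. x \<in> \<Omega> \<Longrightarrow> \<gamma> x \<in> \<Omega>" "\<And>x. x \<in> \<Omega> \<Longrightarrow> inv_into \<Omega> \<gamma> x \<in> \<Omega>"
    "continuous_on \<Omega> \<gamma>" "continuous_on \<Omega> (inv_into \<Omega> \<gamma>)"
proof -
  show b: "bij_betw \<gamma> \<Omega> \<Omega>" and l: "\<exists>L. L-lipschitz_on \<Omega> \<gamma>" "\<exists>L. L-lipschitz_on \<Omega> (inv_into \<Omega> \<gamma>)"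
    "\<And>S. S \<subseteq> \<Omega> \<Longrightarrow> negligible S \<Longrightarrow> negligible (\<gamma> ` S)" "\<And>S. S \<subseteq> \<Omega> \<Longrightarrow> negligible S \<Longrightarrow> negligible (inv_into \<Omega> \<gamma> ` S)"
    using assms unfolding lip_trans_def by blast+
  show i: "inj_on \<gamma> \<Omega>" and s: "\<gamma> ` \<Omega> = \<Omega>" using b unfolding bij_betw_def by auto
  show "inv_into \<Omega> \<gamma> (\<gamma> x) = x" if "x \<in> \<Omega>" for x using i that by simp
  show "\<gamma> (inv_into \<Omega> \<gamma> x) = x" if "x \<in> \<Omega>" for x using s that by (simp add: f_inv_into_f)
  show "\<gamma> x \<in> \<Omega>" if "x \<in> \<Omega>" for x using s that by blast
  show "inv_into \<Omega> \<gamma> x \<in> \<Omega>" if "x \<in> \<Omega>" for x using s that by (simp add: inv_into_into)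
  show "continuous_on \<Omega> \<gamma>" "continuous_on \<Omega> (inv_into \<Omega> \<gamma>)" using l(1,2) lipschitz_on_continuous_on by blast+
qed

text \<open>The points where \<open>A_mat\<close> is a product of actual derivatives; for two
  transformations, the common ones are the index set of \<open>G_dist\<close>.\<close>

definition good_pts :: "(real^'n) set \<Rightarrow> (real^'n \<Rightarrow> real^'n) \<Rightarrow> (real^'n) set"
  where "good_pts \<Omega> \<gamma> = diff_pts \<Omega> \<gamma> \<inter> inv_diff_pts \<Omega> \<gamma>"

text \<open>Rademacher's theorem for \<open>\<gamma>\<close> and for its inverse. The exceptional
  set of the inverse lies on the image side and is brought back by the condition on null
  sets.\<close>

lemma negligible_bad_pts:
  fixes \<gamma> :: "real^'n \<Rightarrow> real^'n"
  assumes g: "\<gamma> \<in> lip_trans \<Omega>" and O: "open \<Omega>"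
  shows "negligible (\<Omega> - good_pts \<Omega> \<gamma>)" "negligible (\<Omega> - \<gamma> ` good_pts \<Omega> \<gamma>)" "negligible (\<Omega> - diff_pts \<Omega> \<gamma>)"
proof -
  note D = lip_transD[OF g]
  have n1: "negligible {x \<in> \<Omega>. \<not> \<gamma> differentiable (at x)}" using D(2) rademacher O by blast
  thus n1': "negligible (\<Omega> - diff_pts \<Omega> \<gamma>)" by (rule negligible_subset) (auto simp: diff_pts_def)
  have n2: "negligible {x \<in> \<Omega>. \<not> inv_into \<Omega> \<gamma> differentiable (at x)}" using D(3) rademacher O by blast
  have "\<Omega> - inv_diff_pts \<Omega> \<gamma> \<subseteq> inv_into \<Omega> \<gamma> ` {x \<in> \<Omega>. \<not> inv_into \<Omega> \<gamma> differentiable (at x)}"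
  proof
    fix x assume x: "x \<in> \<Omega> - inv_diff_pts \<Omega> \<gamma>"
    hence "\<gamma> x \<in> {x \<in> \<Omega>. \<not> inv_into \<Omega> \<gamma> differentiable (at x)}" using D(10) by (auto simp: inv_diff_pts_def)
    moreover have "x = inv_into \<Omega> \<gamma> (\<gamma> x)" using D(8) x by simp
    ultimately show "x \<in> inv_into \<Omega> \<gamma> ` {x \<in> \<Omega>. \<not> inv_into \<Omega> \<gamma> differentiable (at x)}" by blast
  qed
  hence n3: "negligible (\<Omega> - inv_diff_pts \<Omega> \<gamma>)" using D(5)[OF _ n2] negligible_subset by blast
  show n4: "negligible (\<Omega> - good_pts \<Omega> \<gamma>)" by (rule negligible_subset[OF negligible_Un[OF n1' n3]]) (auto simp: good_pts_def)
  have "\<Omega> - \<gamma> ` good_pts \<Omega> \<gamma> \<subseteq> \<gamma> ` (\<Omega> - good_pts \<Omega> \<gamma>)" using D(7) by blast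
  thus "negligible (\<Omega> - \<gamma> ` good_pts \<Omega> \<gamma>)" using D(4)[OF Diff_subset n4] negligible_subset by blast
qed

lemma negligible_AE: "negligible N \<Longrightarrow> AE x in lebesgue. x \<notin> N" unfolding negligible_iff_null_sets by (rule AE_not_in)

text \<open>The classical formula is applied on the set of points of differentiability. That set and
  its image both exhaust \<Omega> up to null sets.\<close>

lemma lip_trans_change_of_variables:
  fixes \<gamma> :: "real^'n \<Rightarrow> real^'n" and f :: "real^'n \<Rightarrow> real"
  assumes g: "\<gamma> \<in> lip_trans \<Omega>" and O: "open \<Omega>"
  shows "integrable (lebesgue_on \<Omega>) (\<lambda>x. Jac \<gamma> x * f (\<gamma> x)) \<longleftrightarrow> integrable (lebesgue_on \<Omega>) f"
    "integrable (lebesgue_on \<Omega>) f \<Longrightarrow> (\<integral>x. Jac \<gamma> x * f (\<gamma> x) \<partial>lebesgue_on \<Omega>) = (\<integral>y. f y \<partial>lebesgue_on \<Omega>)"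
proof -
  note D = lip_transD[OF g]
  note N = negligible_bad_pts[OF g O]
  define S where "S = diff_pts \<Omega> \<gamma>"
  have SO: "S \<subseteq> \<Omega>" by (auto simp: S_def diff_pts_def)
  have Ol: "\<Omega> \<in> sets lebesgue" using O by simp
  have "\<Omega> - S \<in> sets lebesgue" using N(3) negligible_imp_sets by (simp add: S_def)
  hence Sl: "S \<in> sets lebesgue" using Ol SO by (metis double_diff order_refl sets.Diff)
  have der: "(\<gamma> has_derivative frechet_derivative \<gamma> (at x)) (at x within S)" if "x \<in> S" for x
    using that unfolding S_def diff_pts_def by (simp add: frechet_derivative_works has_derivative_at_withinI)
  have inj: "inj_on \<gamma> S" using D(6) SO inj_on_subset by blast
  have J: "\<bar>det (matrix (frechet_derivative \<gamma> (at x)))\<bar> = Jac \<gamma> x" for x by (simp add: Jac_def grad_def jacobian_def det_transpose)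
  have cv: "integrable lebesgue (\<lambda>x. indicator S x * (Jac \<gamma> x * f (\<gamma> x))) \<longleftrightarrow> integrable lebesgue (\<lambda>y. indicator (\<gamma> ` S) y * f y)"
    "integrable lebesgue (\<lambda>y. indicator (\<gamma> ` S) y * f y) \<Longrightarrow>
      (\<integral>x. indicator S x * (Jac \<gamma> x * f (\<gamma> x)) \<partial>lebesgue) = (\<integral>y. indicator (\<gamma> ` S) y * f y \<partial>lebesgue)" unfolding J[symmetric]
    by (rule change_of_variables[OF Sl _ inj], erule der)
      (rule change_of_variables[OF Sl _ inj], erule der, assumption)
  have gS: "\<Omega> - \<gamma> ` S \<subseteq> \<gamma> ` (\<Omega> - S)" using D(7) by blast
  have nS: "negligible (\<Omega> - S)" using N(3) by (simp add: S_def)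
  have nG: "negligible (\<Omega> - \<gamma> ` S)" using D(4)[OF Diff_subset nS] gS negligible_subset by blast
  have gSl: "\<gamma> ` S \<in> sets lebesgue"
  proof -
    have "\<gamma> ` S \<subseteq> \<Omega>" using SO D(7) by blast
    thus ?thesis using negligible_imp_sets[OF nG] Ol by (metis double_diff order_refl sets.Diff)
  qed
  have spike: "integrable lebesgue (\<lambda>x. indicator A x * k x) \<longleftrightarrow> integrable lebesgue (\<lambda>x. indicator \<Omega> x * k x)"
    "integrable lebesgue (\<lambda>x. indicator A x * k x) \<Longrightarrow> (\<integral>x. indicator A x * k x \<partial>lebesgue) = (\<integral>x. indicator \<Omega> x * k x \<partial>lebesgue)"
    if A: "A \<subseteq> \<Omega>" "negligible (\<Omega> - A)" for A and k :: "real^'n \<Rightarrow> real"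
  proof -
    have "k absolutely_integrable_on A \<longleftrightarrow> k absolutely_integrable_on \<Omega>"
    proof (rule absolutely_integrable_spike_set_eq)
      have "{x \<in> A - \<Omega>. k x \<noteq> 0} = {}" using A(1) by auto
      thus "negligible {x \<in> A - \<Omega>. k x \<noteq> 0}" by (metis negligible_empty)
      show "negligible {x \<in> \<Omega> - A. k x \<noteq> 0}" by (rule negligible_subset[OF A(2)]) auto
    qed
    thus i: "integrable lebesgue (\<lambda>x. indicator A x * k x) \<longleftrightarrow> integrable lebesgue (\<lambda>x. indicator \<Omega> x * k x)" by (simp add: set_integrable_def)
    have "AE x in lebesgue. indicator A x * k x = indicator \<Omega> x * k x"
      using negligible_AE[OF A(2)] by eventually_elim (use A(1) in \<open>auto simp: indicator_def\<close>)
    thus "integrable lebesgue (\<lambda>x. indicator A x * k x) \<Longrightarrow> (\<integral>x. indicator A x * k x \<partial>lebesgue) = (\<integral>x. indicator \<Omega> x * k x \<partial>lebesgue)"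
      using i by (intro integral_cong_AE) auto
  qed
  have gSO: "\<gamma> ` S \<subseteq> \<Omega>" using SO D(7) by blast
  have rs: "integrable (lebesgue_on \<Omega>) k \<longleftrightarrow> integrable lebesgue (\<lambda>x. indicator \<Omega> x * k x)" for k :: "real^'n \<Rightarrow> real"
    using integrable_restrict_space[of \<Omega> lebesgue k] Ol by simp
  show "integrable (lebesgue_on \<Omega>) (\<lambda>x. Jac \<gamma> x * f (\<gamma> x)) \<longleftrightarrow> integrable (lebesgue_on \<Omega>) f"
    unfolding rs using cv(1) spike(1)[OF SO nS] spike(1)[OF gSO nG] by simp
  assume "integrable (lebesgue_on \<Omega>) f"
  hence i: "integrable lebesgue (\<lambda>x. indicator (\<gamma> ` S) x * f x)" unfolding rs using spike(1)[OF gSO nG] by simp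
  from cv(2)[OF i] show "(\<integral>x. Jac \<gamma> x * f (\<gamma> x) \<partial>lebesgue_on \<Omega>) = (\<integral>y. f y \<partial>lebesgue_on \<Omega>)"
    unfolding integral_lebesgue_on[OF Ol] using spike(2)[OF SO nS cv(1)[THEN iffD2, OF i]] spike(2)[OF gSO nG i] by simp
qed

lemma lipschitz_derivative_bound:
  fixes \<gamma> :: "'a::real_normed_vector \<Rightarrow> 'b::real_normed_vector"
  assumes lip: "L-lipschitz_on \<Omega> \<gamma>" and O: "open \<Omega>" "x \<in> \<Omega>" and D: "(\<gamma> has_derivative D) (at x)"
  shows "norm (D h) \<le> L * norm h"
proof (rule field_le_epsilon)
  fix e :: real assume "e > 0"
  define e' where "e' = e / (norm h + 1)"
  have e': "e' > 0" using \<open>e > 0\<close> by (simp add: e'_def add_nonneg_pos)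
  obtain d where d: "d > 0" "\<And>y. norm (y - x) < d \<Longrightarrow> norm (\<gamma> y - \<gamma> x - D (y - x)) \<le> e' * norm (y - x)" using D e' unfolding has_derivative_at_alt by meson
  obtain d2 where d2: "d2 > 0" "ball x d2 \<subseteq> \<Omega>" using O open_contains_ball by blast
  define n1 where "n1 = norm h + 1"
  have h1: "norm h + 1 > 0" by (simp add: add_nonneg_pos)
  hence n1: "n1 > 0" by (simp add: n1_def)
  define t where "t = min d d2 / (2 * n1)"
  have t: "t > 0" using d(1) d2(1) n1 by (simp add: t_def)
  have "t * norm h \<le> t * (norm h + 1)" using t by simp
  also have "... = min d d2 / 2" using n1 unfolding n1_def[symmetric] by (simp add: t_def)
  also have "... < min d d2" using d(1) d2(1) by (simp add: min_def)
  finally have th: "t * norm h < d" "t * norm h < d2" by auto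
  define y where "y = x + t *\<^sub>R h"
  have yx: "y - x = t *\<^sub>R h" by (simp add: y_def)
  have nyx: "norm (y - x) = t * norm h" using t by (simp add: yx)
  have "y \<in> \<Omega>" using d2(2) th nyx by (auto simp: dist_norm norm_minus_commute)
  hence 1: "norm (\<gamma> y - \<gamma> x) \<le> L * (t * norm h)" using lipschitz_onD[OF lip _ O(2), of y] nyx by (simp add: dist_norm)
  have 2: "norm (\<gamma> y - \<gamma> x - D (y - x)) \<le> e' * (t * norm h)" using d(2)[of y] th nyx by simp
  have 3: "norm (D (y - x)) \<le> norm (\<gamma> y - \<gamma> x) + norm (\<gamma> y - \<gamma> x - D (y - x))"
    using norm_triangle_ineq4[of "\<gamma> y - \<gamma> x" "\<gamma> y - \<gamma> x - D (y - x)"] by (simp del: diff_diff_eq)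
  have 4: "norm (D (y - x)) = t * norm (D h)" unfolding yx using has_derivative_linear[OF D] t by (simp add: linear_scale)
  have "t * norm (D h) \<le> L * (t * norm h) + e' * (t * norm h)" using 1 2 3 4 by linarith
  hence "t * norm (D h) \<le> t * ((L + e') * norm h)" by (simp add: algebra_simps)
  hence "norm (D h) \<le> (L + e') * norm h" using t by simp
  also have "... \<le> L * norm h + e"
  proof -
    have "e' * norm h \<le> e" using h1 \<open>e > 0\<close> by (simp add: e'_def field_simps)
    thus ?thesis by (simp add: distrib_right)
  qed
  finally show "norm (D h) \<le> L * norm h + e" .
qed

lemma grad_entry_bound:
  fixes \<gamma> :: "real^'n \<Rightarrow> real^'n"
  assumes lip: "L-lipschitz_on \<Omega> \<gamma>" and O: "open \<Omega>" "x \<in> \<Omega>" and d: "\<gamma> differentiable (at x)"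
  shows "\<bar>grad \<gamma> x $ i $ j\<bar> \<le> L"
proof -
  have D: "(\<gamma> has_derivative frechet_derivative \<gamma> (at x)) (at x)" using d frechet_derivative_works by blast
  have "grad \<gamma> x $ i $ j = frechet_derivative \<gamma> (at x) (axis i 1) $ j" by (simp add: grad_def jacobian_def transpose_def matrix_def)
  also have "\<bar>...\<bar> \<le> norm (frechet_derivative \<gamma> (at x) (axis i 1))" by (rule component_le_norm_cart)
  also have "... \<le> L * norm (axis i 1 :: real^'n)" by (rule lipschitz_derivative_bound[OF lip O D])
  finally show ?thesis by simp
qed

text \<open>A crude bound by the Leibniz formula. Its size is immaterial: it serves the
  integrability of push-forwards and the boundedness of the suprema in
  \<open>T_dist\<close>.\<close>

lemma det_bound:
  fixes M :: "real^'n^'n"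
  assumes "\<And>i j. \<bar>M $ i $ j\<bar> \<le> L"
  shows "\<bar>det M\<bar> \<le> real (card {p. p permutes (UNIV :: 'n set)}) * L ^ CARD('n)"
proof -
  have "\<bar>det M\<bar> \<le> (\<Sum>p\<in>{p. p permutes (UNIV :: 'n set)}. \<bar>of_int (sign p) * (\<Prod>i\<in>UNIV. M $ i $ p i)\<bar>)" unfolding det_def by (rule sum_abs)
  also have "... \<le> (\<Sum>p\<in>{p. p permutes (UNIV :: 'n set)}. L ^ CARD('n))"
  proof (rule sum_mono)
    fix p :: "'n \<Rightarrow> 'n"
    have "\<bar>of_int (sign p) * (\<Prod>i\<in>UNIV. M $ i $ p i)\<bar> = (\<Prod>i\<in>UNIV. \<bar>M $ i $ p i\<bar>)" by (simp add: abs_mult abs_prod sign_def)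
    also have "... \<le> (\<Prod>i\<in>(UNIV :: 'n set). L)" by (intro prod_mono) (auto simp: assms)
    finally show "\<bar>of_int (sign p) * (\<Prod>i\<in>UNIV. M $ i $ p i)\<bar> \<le> L ^ CARD('n)" by simp
  qed
  finally show ?thesis by simp
qed

lemma matrix_vector_bound:
  fixes M :: "real^'n^'n"
  assumes "\<And>i j. \<bar>M $ i $ j\<bar> \<le> L"
  shows "norm (M *v x) \<le> (real CARD('n) * real CARD('n) * L) * norm x"
proof -
  have "norm (M *v x) \<le> (\<Sum>i\<in>UNIV. \<bar>(M *v x) $ i\<bar>)" by (rule norm_le_l1_cart)
  also have "... \<le> (\<Sum>i\<in>(UNIV::'n set). \<Sum>j\<in>(UNIV::'n set). L * norm x)"
  proof (rule sum_mono)
    fix i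
    have "\<bar>(M *v x) $ i\<bar> \<le> (\<Sum>j\<in>UNIV. \<bar>M $ i $ j * x $ j\<bar>)" unfolding matrix_vector_mult_def by (simp add: sum_abs)
    also have "... \<le> (\<Sum>j\<in>(UNIV::'n set). L * norm x)" unfolding abs_mult using assms[of i] component_le_norm_cart[of x] abs_ge_zero[of "M $ i $ i"]
      by (intro sum_mono mult_mono) (auto intro: order_trans[OF abs_ge_zero])
    finally show "\<bar>(M *v x) $ i\<bar> \<le> (\<Sum>j\<in>(UNIV::'n set). L * norm x)" .
  qed
  finally show ?thesis by simp
qed

lemma Jac_nonneg: "Jac \<gamma> x \<ge> 0" by (simp add: Jac_def)

lemma Jac_bound:
  fixes \<gamma> :: "real^'n \<Rightarrow> real^'n"
  assumes g: "\<gamma> \<in> lip_trans \<Omega>" and O: "open \<Omega>"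
  obtains C where "C > 0" "\<And>x. x \<in> diff_pts \<Omega> \<gamma> \<Longrightarrow> Jac \<gamma> x \<le> C"
proof -
  obtain L where L: "L-lipschitz_on \<Omega> \<gamma>" using lip_transD(2)[OF g] by blast
  define C where "C = real (card {p. p permutes (UNIV :: 'n set)}) * L ^ CARD('n) + 1"
  have "C > 0" unfolding C_def using lipschitz_on_nonneg[OF L] by (simp add: add_nonneg_pos)
  moreover have "Jac \<gamma> x \<le> C" if "x \<in> diff_pts \<Omega> \<gamma>" for x
  proof -
    have x: "x \<in> \<Omega>" "\<gamma> differentiable (at x)" using that by (auto simp: diff_pts_def)
    show ?thesis using det_bound[OF grad_entry_bound[OF L O x]] by (simp add: Jac_def C_def)
  qed
  ultimately show ?thesis using that by blast
qed

lemma A_mat_vector: "A_mat \<Omega> \<gamma> x *v q = Jac \<gamma> x *\<^sub>R (grad (inv_into \<Omega> \<gamma>) (\<gamma> x) *v q)" unfolding A_mat_def by (rule scaleR_matrix_vector_assoc[symmetric])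

lemma A_mat_bound:
  fixes \<gamma> :: "real^'n \<Rightarrow> real^'n"
  assumes g: "\<gamma> \<in> lip_trans \<Omega>" and O: "open \<Omega>"
  obtains C where "C > 0" "\<And>x q. x \<in> good_pts \<Omega> \<gamma> \<Longrightarrow> norm (A_mat \<Omega> \<gamma> x *v q) \<le> C * norm q"
proof -
  obtain C1 where C1: "C1 > 0" "\<And>x. x \<in> diff_pts \<Omega> \<gamma> \<Longrightarrow> Jac \<gamma> x \<le> C1" using Jac_bound[OF g O] by blast
  obtain L where L: "L-lipschitz_on \<Omega> (inv_into \<Omega> \<gamma>)" using lip_transD(3)[OF g] by blast
  define C2 where "C2 = real CARD('n) * real CARD('n) * L + 1"
  have C2: "C2 > 0" unfolding C2_def using lipschitz_on_nonneg[OF L] by (simp add: add_nonneg_pos)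
  have "norm (A_mat \<Omega> \<gamma> x *v q) \<le> (C1 * C2) * norm q" if x: "x \<in> good_pts \<Omega> \<gamma>" for x q
  proof -
    have xd: "x \<in> diff_pts \<Omega> \<gamma>" "inv_into \<Omega> \<gamma> differentiable (at (\<gamma> x))" "x \<in> \<Omega>" using x by (auto simp: good_pts_def inv_diff_pts_def diff_pts_def)
    have "norm (grad (inv_into \<Omega> \<gamma>) (\<gamma> x) *v q) \<le> (real CARD('n) * real CARD('n) * L) * norm q"
      by (rule matrix_vector_bound[OF grad_entry_bound[OF L O lip_transD(10)[OF g xd(3)] xd(2)]])
    also have "... \<le> C2 * norm q" unfolding C2_def by (intro mult_right_mono) auto
    finally have "Jac \<gamma> x * norm (grad (inv_into \<Omega> \<gamma>) (\<gamma> x) *v q) \<le> C1 * (C2 * norm q)" using C1(2)[OF xd(1)] C1(1) C2 by (intro mult_mono) auto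
    thus ?thesis by (simp add: A_mat_vector Jac_nonneg mult.assoc)
  qed
  thus ?thesis using that[of "C1 * C2"] C1(1) C2 by simp
qed

lemma AE_lebesgue_on_negligible:
  assumes "negligible (\<Omega> - S)" "open \<Omega>" shows "AE x in lebesgue_on \<Omega>. x \<in> S"
  using negligible_AE[OF assms(1)] assms(2) by (subst AE_restrict_space_iff) (auto elim!: eventually_mono)

lemma push_eq: "push \<Omega> \<gamma> u y = u (inv_into \<Omega> \<gamma> y)" by (simp add: push_def)

lemma push_comp: "\<gamma> \<in> lip_trans \<Omega> \<Longrightarrow> x \<in> \<Omega> \<Longrightarrow> push \<Omega> \<gamma> u (\<gamma> x) = u x" by (simp add: push_eq lip_transD(8))

lemma push_L1:
  fixes \<gamma> :: "real^'n \<Rightarrow> real^'n"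
  assumes g: "\<gamma> \<in> lip_trans \<Omega>" and O: "open \<Omega>" "bounded \<Omega>" and C: "\<And>x. x \<in> diff_pts \<Omega> \<gamma> \<Longrightarrow> Jac \<gamma> x \<le> C" and u: "u \<in> L1 \<Omega>"
  shows "push \<Omega> \<gamma> u \<in> L1 \<Omega>" "norm_L1 \<Omega> (push \<Omega> \<gamma> u) \<le> C * norm_L1 \<Omega> u"
proof -
  have Ol: "\<Omega> \<in> sets lebesgue" using O by simp
  have spO: "space (lebesgue_on \<Omega>) = \<Omega>" by (simp add: space_restrict_space)
  \<comment> \<open>The change of variables for the constant 1 yields the measurability of
    \<open>Jac \<gamma>\<close>.\<close>
  have "integrable (lebesgue_on \<Omega>) (\<lambda>x. 1 :: real)"
  proof -
    have "integrable lborel (indicat_real \<Omega>)" using O emeasure_bounded_finite[OF O(2)] by (intro integrable_real_indicator) auto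
    from integrable_lebesgue_on_lborel[OF Ol this] show ?thesis
      by (rule iffD1[OF Bochner_Integration.integrable_cong[OF refl], rotated]) (simp add: spO)
  qed
  hence "integrable (lebesgue_on \<Omega>) (\<lambda>x. Jac \<gamma> x * 1)" using lip_trans_change_of_variables(1)[OF g O(1), of "\<lambda>x. 1"] by simp
  hence Jm[measurable]: "Jac \<gamma> \<in> borel_measurable (lebesgue_on \<Omega>)" using borel_measurable_integrable by force
  have ae: "AE x in lebesgue_on \<Omega>. Jac \<gamma> x \<le> C" using AE_lebesgue_on_negligible[OF negligible_bad_pts(3)[OF g O(1)] O(1)] by eventually_elim (rule C)
  have ui[measurable]: "integrable (lebesgue_on \<Omega>) u" using u by (simp add: L1_def)
  have le: "AE x in lebesgue_on \<Omega>. \<bar>Jac \<gamma> x * u x\<bar> \<le> C * \<bar>u x\<bar>" using ae by eventually_elim (simp add: abs_mult Jac_nonneg mult_right_mono)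
  have Ju: "integrable (lebesgue_on \<Omega>) (\<lambda>x. Jac \<gamma> x * u x)"
  proof (rule Bochner_Integration.integrable_bound)
    show "integrable (lebesgue_on \<Omega>) (\<lambda>x. C * \<bar>u x\<bar>)" using ui by auto
    show "AE x in lebesgue_on \<Omega>. norm (Jac \<gamma> x * u x) \<le> norm (C * \<bar>u x\<bar>)" using le by eventually_elim (auto intro: order_trans[OF _ abs_ge_self])
  qed (use ui in auto)
  have cong: "integrable (lebesgue_on \<Omega>) (\<lambda>x. Jac \<gamma> x * push \<Omega> \<gamma> u (\<gamma> x)) \<longleftrightarrow> integrable (lebesgue_on \<Omega>) (\<lambda>x. Jac \<gamma> x * u x)"
    by (intro Bochner_Integration.integrable_cong refl) (simp add: spO push_comp[OF g])
  show p: "push \<Omega> \<gamma> u \<in> L1 \<Omega>" using lip_trans_change_of_variables(1)[OF g O(1), of "push \<Omega> \<gamma> u"] cong Ju by (simp add: L1_def)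
  have "norm_L1 \<Omega> (push \<Omega> \<gamma> u) = (\<integral>x. Jac \<gamma> x * \<bar>push \<Omega> \<gamma> u (\<gamma> x)\<bar> \<partial>lebesgue_on \<Omega>)"
    unfolding norm_L1_def using p lip_trans_change_of_variables(2)[OF g O(1), of "\<lambda>y. \<bar>push \<Omega> \<gamma> u y\<bar>"] by (simp add: L1_def)
  also have "... = (\<integral>x. \<bar>Jac \<gamma> x * u x\<bar> \<partial>lebesgue_on \<Omega>)"
    by (intro Bochner_Integration.integral_cong refl) (simp add: spO push_comp[OF g] abs_mult Jac_nonneg)
  also have "... \<le> (\<integral>x. C * \<bar>u x\<bar> \<partial>lebesgue_on \<Omega>)" using Ju ui le by (intro integral_mono_AE) auto
  finally show "norm_L1 \<Omega> (push \<Omega> \<gamma> u) \<le> C * norm_L1 \<Omega> u" by (simp add: norm_L1_def)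
qed

section \<open>Push-forwards of mollifications\<close>

lemma conv_lipschitz:
  fixes v :: "real^'n \<Rightarrow> real"
  assumes rs: "smooth_ball e r" and v: "integrable lborel v"
  obtains C where "C-lipschitz_on UNIV (conv r v)"
proof -
  obtain B where B: "B > 0" "\<And>x. norm (gradient (conv r v) x) \<le> B" using conv_gradient_bounds(2)[OF rs v] by blast
  have "norm (conv r v x - conv r v y) \<le> B * norm (x - y)" for x y
  proof (rule differentiable_bound[of UNIV _ "\<lambda>x h. \<Sum>i\<in>UNIV. h $ i * partial_deriv i (conv r v) x"])
    fix x
    show "(conv r v has_derivative (\<lambda>h. \<Sum>i\<in>UNIV. h $ i * partial_deriv i (conv r v) x)) (at x within UNIV)"
      unfolding partial_deriv_conv[OF rs v] using conv_has_derivative[OF rs v] by simp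
    show "onorm (\<lambda>h. \<Sum>i\<in>UNIV. h $ i * partial_deriv i (conv r v) x) \<le> B"
    proof (rule onorm_le)
      fix h :: "real^'n"
      have "(\<Sum>i\<in>UNIV. h $ i * partial_deriv i (conv r v) x) = h \<bullet> (gradient (conv r v) x)" by (simp add: inner_vec_def)
      also have "\<bar>...\<bar> \<le> norm h * B" by (intro order_trans[OF Cauchy_Schwarz_ineq2] mult_left_mono B) auto
      finally show "norm (\<Sum>i\<in>UNIV. h $ i * partial_deriv i (conv r v) x) \<le> B * norm h" by (simp add: mult.commute)
    qed
  qed auto
  hence "B-lipschitz_on UNIV (conv r v)" using B(1) by (intro lipschitz_onI) (auto simp: dist_norm)
  thus ?thesis using that by blast
qed

text \<open>Integration by parts with the almost everywhere gradient \<open>d\<close> and a field of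
  norm at most 1. The indicator remembers where the field lives; it will confine the estimate to a
  compact set.\<close>

lemma lipschitz_divergence_le:
  fixes p :: "real^'n \<Rightarrow> real"
  assumes lip: "L-lipschitz_on \<Omega> p" and O: "open \<Omega>" "bounded \<Omega>" "\<Omega> \<noteq> {}" and \<phi>: "test_field \<Omega> \<phi>"
  obtains d where "d \<in> borel_measurable borel" "\<And>x i. \<bar>d x $ i\<bar> \<le> L"
    "AE x in lborel. x \<in> \<Omega> \<longrightarrow> (p has_derivative (\<lambda>h. \<Sum>i\<in>UNIV. h $ i * d x $ i)) (at x)"
    "integrable (lebesgue_on \<Omega>) (\<lambda>y. indicator {y. \<phi> y \<noteq> 0} y * norm (d y))"
    "div_pairing \<Omega> p \<phi> \<le> (\<integral>y. indicator {y. \<phi> y \<noteq> 0} y * norm (d y) \<partial>lebesgue_on \<Omega>)"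
proof -
  obtain d0 where d0: "\<And>i. d0 i \<in> borel_measurable borel" "\<And>i x. \<bar>d0 i x\<bar> \<le> L"
    "AE x in lborel. x \<in> \<Omega> \<longrightarrow> (p has_derivative (\<lambda>h. \<Sum>i\<in>UNIV. h $ i * d0 i x)) (at x)"
    "\<And>\<phi> i. test_function \<Omega> \<phi> \<Longrightarrow> partial_pairing \<Omega> p i \<phi> = - (\<integral>x. d0 i x * \<phi> x \<partial>lborel)" using lipschitz_open_derivative[OF lip O(1,3)] by blast
  define d where "d x = (\<chi> i. d0 i x)" for x
  have dm[measurable]: "d \<in> borel_measurable borel" unfolding d_def by (rule measurable_vecI) (use d0(1) in simp)
  have Ob[measurable]: "\<Omega> \<in> sets borel" using O by simp
  note [measurable] = d0(1) test_field_divergence(5)[OF \<phi>]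
  have \<phi>1: "norm (\<phi> x) \<le> 1" for x using \<phi> unfolding test_field_def by blast
  have t: "test_function \<Omega> (\<lambda>x. \<phi> x $ i)" for i using \<phi> unfolding test_field_def by blast
  let ?f = "\<lambda>y. indicator {y. \<phi> y \<noteq> 0} y * norm (d y)"
  have fm[measurable]: "?f \<in> borel_measurable borel" by measurable
  have f0: "?f y = 0" if "y \<notin> \<Omega>" for y using test_field_divergence(6)[OF \<phi> that] by simp
  have L0: "L \<ge> 0" using lipschitz_on_nonneg[OF lip] .
  have nd: "norm (d y) \<le> real CARD('n) * L" for y
  proof -
    have "norm (d y) \<le> (\<Sum>i\<in>UNIV. \<bar>d y $ i\<bar>)" by (rule norm_le_l1_cart)
    also have "... \<le> (\<Sum>i\<in>(UNIV::'n set). L)" by (intro sum_mono) (simp add: d_def d0(2))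
    finally show ?thesis by simp
  qed
  have fi: "integrable lborel ?f"
  proof (rule Bochner_Integration.integrable_bound)
    show "integrable lborel (\<lambda>y. (real CARD('n) * L) * indicat_real \<Omega> y)" using emeasure_bounded_finite[OF O(2)] by auto
    show "AE y in lborel. norm (?f y) \<le> norm ((real CARD('n) * L) * indicat_real \<Omega> y)" using nd f0 L0 by (intro AE_I2) (auto simp: indicator_def)
  qed measurable
  have pL1: "p \<in> L1 \<Omega>"
  proof -
    obtain g where g: "L-lipschitz_on UNIV g" "\<And>x. x \<in> \<Omega> \<Longrightarrow> g x = p x" using lipschitz_extension[OF lip O(3)] by blast
    have gc: "continuous_on UNIV g" using g(1) by (rule lipschitz_on_continuous_on)
    have "compact (closure \<Omega>)" using O(2) by (simp add: compact_closure)
    hence "integrable lborel (\<lambda>x. indicator (closure \<Omega>) x *\<^sub>R g x)" by (rule borel_integrable_compact) (rule continuous_on_subset[OF gc subset_UNIV])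
    hence "integrable (lebesgue_on \<Omega>) (\<lambda>x. indicator (closure \<Omega>) x *\<^sub>R g x)" using O by (intro integrable_lebesgue_on_lborel) auto
    also have "integrable (lebesgue_on \<Omega>) (\<lambda>x. indicator (closure \<Omega>) x *\<^sub>R g x) \<longleftrightarrow> integrable (lebesgue_on \<Omega>) p"
      using g(2) closure_subset[of \<Omega>] by (intro Bochner_Integration.integrable_cong refl) (auto simp: space_restrict_space)
    finally show ?thesis by (simp add: L1_def)
  qed
  have int1: "integrable (lebesgue_on \<Omega>) (\<lambda>x. p x * partial_deriv i (\<lambda>x. \<phi> x $ i) x)" for i
  proof -
    have pp: "test_function \<Omega> (partial_deriv i (\<lambda>x. \<phi> x $ i))" by (rule test_function_partial_deriv[OF t])
    obtain b where "\<And>x. \<bar>partial_deriv i (\<lambda>x. \<phi> x $ i) x\<bar> \<le> b" using test_function_bounds(2)[OF pp] by blast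
    thus ?thesis by (rule L1_mult_bounded[OF pL1 test_function_bounds(1)[OF pp]])
  qed
  have int2: "integrable lborel (\<lambda>x. d0 i x * \<phi> x $ i)" for i
    by (rule integrable_bounded_mult[OF test_function_bounds(4)[OF t] _ d0(2)]) measurable
  have "div_pairing \<Omega> p \<phi> = (\<Sum>i\<in>UNIV. partial_pairing \<Omega> p i (\<lambda>x. \<phi> x $ i))"
    unfolding divergence_def sum_distrib_left by (rule Bochner_Integration.integral_sum[OF int1])
  also have "... = - (\<integral>x. (\<Sum>i\<in>UNIV. d0 i x * \<phi> x $ i) \<partial>lborel)" using int2 by (simp add: d0(4)[OF t] sum_negf)
  also have "... \<le> norm (\<integral>x. (\<Sum>i\<in>UNIV. d0 i x * \<phi> x $ i) \<partial>lborel)" by simp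
  also have "... \<le> (\<integral>x. ?f x \<partial>lborel)"
  proof (rule Bochner_Integration.integral_norm_bound_integral[OF _ fi])
    show "integrable lborel (\<lambda>x. \<Sum>i\<in>UNIV. d0 i x * \<phi> x $ i)" using int2 by auto
    fix x
    have "(\<Sum>i\<in>UNIV. d0 i x * \<phi> x $ i) = d x \<bullet> \<phi> x" by (simp add: d_def inner_vec_def)
    also have "\<bar>...\<bar> \<le> norm (d x) * norm (\<phi> x)" by (rule Cauchy_Schwarz_ineq2)
    also have "... \<le> ?f x" using \<phi>1[of x] by (cases "\<phi> x = 0") (auto intro: mult_left_le)
    finally show "norm (\<Sum>i\<in>UNIV. d0 i x * \<phi> x $ i) \<le> ?f x" by simp
  qed
  also have "... = (\<integral>x. ?f x \<partial>lebesgue_on \<Omega>)" by (rule integral_lebesgue_on_lborel[symmetric]) (use O f0 in auto)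
  finally have le: "div_pairing \<Omega> p \<phi> \<le> (\<integral>x. ?f x \<partial>lebesgue_on \<Omega>)" .
  show ?thesis
    by (rule that[OF dm _ _ integrable_lebesgue_on_lborel[OF _ fi] le]) (use d0(2,3) O in \<open>auto simp: d_def\<close>)
qed

text \<open>The push-forward of a mollification is Lipschitz. By the chain rule its gradient at
  \<open>\<gamma> x\<close> is the transposed Jacobian of the inverse applied to the gradient at
  \<open>x\<close>, and the substitution \<open>y = \<gamma> x\<close> contributes the Jacobian
  determinant: together this is \<open>A_mat\<close>. Integrability is stated for \<open>F\<close>,
  which inherits it from the change of variables.\<close>

lemma push_conv_divergence_le:
  fixes \<gamma> :: "real^'n \<Rightarrow> real^'n"
  assumes g: "\<gamma> \<in> lip_trans \<Omega>" and O: "open \<Omega>" "bounded \<Omega>" "\<Omega> \<noteq> {}" and rs: "smooth_ball e r" and v: "integrable lborel v"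
    and \<phi>: "test_field \<Omega> \<phi>"
  obtains F where "integrable (lebesgue_on \<Omega>) F"
    "AE x in lebesgue_on \<Omega>. F x = indicator {x. \<phi> (\<gamma> x) \<noteq> 0} x * norm (A_mat \<Omega> \<gamma> x *v gradient (conv r v) x)"
    "(\<integral>y. push \<Omega> \<gamma> (conv r v) y * divergence \<phi> y \<partial>lebesgue_on \<Omega>) \<le> (\<integral>x. F x \<partial>lebesgue_on \<Omega>)"
proof -
  note D = lip_transD[OF g]
  let ?w = "conv r v" and ?\<delta> = "inv_into \<Omega> \<gamma>"
  obtain C where C: "C-lipschitz_on UNIV ?w" using conv_lipschitz[OF rs v] .
  obtain L where L: "L-lipschitz_on \<Omega> ?\<delta>" using D(3) by blast
  have lip: "(C * L)-lipschitz_on \<Omega> (push \<Omega> \<gamma> ?w)" unfolding push_def by (rule lipschitz_on_compose[OF L lipschitz_on_subset[OF C]]) auto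
  obtain d where d: "d \<in> borel_measurable borel" "\<And>x i. \<bar>d x $ i\<bar> \<le> C * L"
    "AE x in lborel. x \<in> \<Omega> \<longrightarrow> (push \<Omega> \<gamma> ?w has_derivative (\<lambda>h. \<Sum>i\<in>UNIV. h $ i * d x $ i)) (at x)"
    "integrable (lebesgue_on \<Omega>) (\<lambda>y. indicator {y. \<phi> y \<noteq> 0} y * norm (d y))"
    "(\<integral>y. push \<Omega> \<gamma> ?w y * divergence \<phi> y \<partial>lebesgue_on \<Omega>) \<le> (\<integral>y. indicator {y. \<phi> y \<noteq> 0} y * norm (d y) \<partial>lebesgue_on \<Omega>)"
    using lipschitz_divergence_le[OF lip O \<phi>] by blast
  let ?f = "\<lambda>y. indicator {y. \<phi> y \<noteq> 0} y * norm (d y)"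
  define F where "F x = Jac \<gamma> x * ?f (\<gamma> x)" for x
  show ?thesis
  proof (rule that[of F])
    show "integrable (lebesgue_on \<Omega>) F" unfolding F_def using lip_trans_change_of_variables(1)[OF g O(1), of ?f] d(4) by simp
    show "(\<integral>y. push \<Omega> \<gamma> ?w y * divergence \<phi> y \<partial>lebesgue_on \<Omega>) \<le> (\<integral>x. F x \<partial>lebesgue_on \<Omega>)"
      unfolding F_def lip_trans_change_of_variables(2)[OF g O(1) d(4)] by (rule d(5))
    define N where "N = {y \<in> \<Omega>. \<not> (push \<Omega> \<gamma> ?w has_derivative (\<lambda>h. \<Sum>i\<in>UNIV. h $ i * d y $ i)) (at y)}"
    have "negligible N" by (rule negligible_subset[OF AE_lborel_negligible[OF d(3)]]) (auto simp: N_def)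
    hence "negligible (?\<delta> ` N)" using D(5)[of N] by (auto simp: N_def)
    hence "negligible (\<Omega> - (good_pts \<Omega> \<gamma> - ?\<delta> ` N))" by (rule negligible_subset[OF negligible_Un[OF negligible_bad_pts(1)[OF g O(1)]]]) auto
    from AE_lebesgue_on_negligible[OF this O(1)]
    show "AE x in lebesgue_on \<Omega>. F x = indicator {x. \<phi> (\<gamma> x) \<noteq> 0} x * norm (A_mat \<Omega> \<gamma> x *v gradient ?w x)"
    proof eventually_elim
      case (elim x)
      hence x: "x \<in> \<Omega>" "?\<delta> differentiable (at (\<gamma> x))" "x \<notin> ?\<delta> ` N" by (auto simp: good_pts_def diff_pts_def inv_diff_pts_def)
      have gx: "\<gamma> x \<in> \<Omega>" "?\<delta> (\<gamma> x) = x" using D x by auto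
      have "\<gamma> x \<notin> N" using x(3) gx(2) by (metis imageI)
      hence p1: "(push \<Omega> \<gamma> ?w has_derivative (\<lambda>h. \<Sum>i\<in>UNIV. h $ i * d (\<gamma> x) $ i)) (at (\<gamma> x))" using gx by (auto simp: N_def)
      let ?D = "frechet_derivative ?\<delta> (at (\<gamma> x))"
      have D1: "(?\<delta> has_derivative ?D) (at (\<gamma> x))" using x(2) frechet_derivative_works by blast
      have D2: "(?w has_derivative (\<lambda>h. \<Sum>i\<in>UNIV. h $ i * partial_deriv i ?w x)) (at (?\<delta> (\<gamma> x)))"
        unfolding partial_deriv_conv[OF rs v] gx(2) by (rule conv_has_derivative[OF rs v])
      have "((\<lambda>y. ?w (?\<delta> y)) has_derivative (\<lambda>h. \<Sum>i\<in>UNIV. ?D h $ i * partial_deriv i ?w x)) (at (\<gamma> x))" by (rule has_derivative_compose[OF D1 D2])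
      hence p2: "(push \<Omega> \<gamma> ?w has_derivative (\<lambda>h. \<Sum>i\<in>UNIV. ?D h $ i * partial_deriv i ?w x)) (at (\<gamma> x))" by (simp add: push_def comp_def)
      have eq: "(\<Sum>i\<in>UNIV. h $ i * d (\<gamma> x) $ i) = (\<Sum>i\<in>UNIV. ?D h $ i * partial_deriv i ?w x)" for h using has_derivative_unique[OF p1 p2] by meson
      have "d (\<gamma> x) = grad ?\<delta> (\<gamma> x) *v gradient ?w x"
      proof -
        have "d (\<gamma> x) $ j = (grad ?\<delta> (\<gamma> x) *v gradient ?w x) $ j" for j
        proof -
          have "d (\<gamma> x) $ j = (\<Sum>i\<in>UNIV. (axis j 1 :: real^'n) $ i * d (\<gamma> x) $ i)"
          proof -
            have "(\<Sum>i\<in>UNIV. (axis j 1 :: real^'n) $ i * d (\<gamma> x) $ i) = (\<Sum>i\<in>UNIV. if i = j then d (\<gamma> x) $ i else 0)"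
              by (intro sum.cong) (auto simp: axis_def)
            thus ?thesis by simp
          qed
          also have "... = (\<Sum>i\<in>UNIV. ?D (axis j 1) $ i * partial_deriv i ?w x)" by (rule eq)
          also have "... = (grad ?\<delta> (\<gamma> x) *v gradient ?w x) $ j"
            by (simp add: grad_def jacobian_def transpose_def matrix_def matrix_vector_mult_def)
          finally show ?thesis .
        qed
        thus ?thesis by (simp add: vec_eq_iff)
      qed
      thus ?case unfolding F_def A_mat_vector by (simp add: Jac_nonneg indicator_def)
    qed
  qed
qed

section \<open>The quantities controlled by a pair of transformations\<close>

lemma G_dist_eq:
  "G_dist \<Omega> \<gamma>1 \<gamma>2 = (SUP z \<in> (good_pts \<Omega> \<gamma>1 \<inter> good_pts \<Omega> \<gamma>2) \<times> {v. norm v = 1}.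
     norm (A_mat \<Omega> \<gamma>1 (fst z) *v snd z) + norm (A_mat \<Omega> \<gamma>2 (fst z) *v snd z) - 2 * norm (snd z))"
proof -
  have "diff_pts \<Omega> \<gamma>1 \<inter> diff_pts \<Omega> \<gamma>2 \<inter> inv_diff_pts \<Omega> \<gamma>1 \<inter> inv_diff_pts \<Omega> \<gamma>2 = good_pts \<Omega> \<gamma>1 \<inter> good_pts \<Omega> \<gamma>2" by (auto simp: good_pts_def)
  thus ?thesis unfolding G_dist_def by (simp add: case_prod_unfold)
qed

text \<open>By homogeneity the case of unit vectors suffices; as \<open>G_dist\<close> is a supremum
  of real numbers, boundedness has to be checked before it dominates its terms.\<close>

lemma A_mat_sum_bound:
  fixes \<gamma>1 \<gamma>2 :: "real^'n \<Rightarrow> real^'n"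
  assumes g: "\<gamma>1 \<in> lip_trans \<Omega>" "\<gamma>2 \<in> lip_trans \<Omega>" and O: "open \<Omega>" and x: "x \<in> good_pts \<Omega> \<gamma>1" "x \<in> good_pts \<Omega> \<gamma>2"
  shows "norm (A_mat \<Omega> \<gamma>1 x *v q) + norm (A_mat \<Omega> \<gamma>2 x *v q) \<le> (2 + G_dist \<Omega> \<gamma>1 \<gamma>2) * norm q"
proof (cases "q = 0")
  case False
  obtain C1 where "C1 > 0" and C1: "\<And>x q. x \<in> good_pts \<Omega> \<gamma>1 \<Longrightarrow> norm (A_mat \<Omega> \<gamma>1 x *v q) \<le> C1 * norm q" using A_mat_bound[OF g(1) O] by blast
  obtain C2 where "C2 > 0" and C2: "\<And>x q. x \<in> good_pts \<Omega> \<gamma>2 \<Longrightarrow> norm (A_mat \<Omega> \<gamma>2 x *v q) \<le> C2 * norm q" using A_mat_bound[OF g(2) O] by blast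
  let ?g = "\<lambda>z. norm (A_mat \<Omega> \<gamma>1 (fst z) *v snd z) + norm (A_mat \<Omega> \<gamma>2 (fst z) *v snd z) - 2 * norm (snd z)"
  let ?S = "(good_pts \<Omega> \<gamma>1 \<inter> good_pts \<Omega> \<gamma>2) \<times> {v::real^'n. norm v = 1}"
  have bdd: "bdd_above (?g ` ?S)"
  proof (rule bdd_aboveI2[of _ _ "C1 + C2"])
    fix z assume z: "z \<in> ?S"
    thus "?g z \<le> C1 + C2" using C1[of "fst z" "snd z"] C2[of "fst z" "snd z"] by auto
  qed
  define w where "w = (1 / norm q) *\<^sub>R q"
  have w: "norm w = 1" "q = norm q *\<^sub>R w" using False by (auto simp: w_def)
  have "?g (x, w) \<le> G_dist \<Omega> \<gamma>1 \<gamma>2" unfolding G_dist_eq by (rule cSUP_upper[OF _ bdd]) (use x w in auto)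
  hence "norm (A_mat \<Omega> \<gamma>1 x *v w) + norm (A_mat \<Omega> \<gamma>2 x *v w) \<le> 2 + G_dist \<Omega> \<gamma>1 \<gamma>2" using w by simp
  hence "norm q * (norm (A_mat \<Omega> \<gamma>1 x *v w) + norm (A_mat \<Omega> \<gamma>2 x *v w)) \<le> norm q * (2 + G_dist \<Omega> \<gamma>1 \<gamma>2)" by (rule mult_left_mono) simp
  moreover have "norm (M *v q) = norm q * norm (M *v w)" for M :: "real^'n^'n"
    using arg_cong[OF w(2), of "\<lambda>q. norm (M *v q)"] linear_scale[OF matrix_vector_mul_linear[of M], of "norm q" w] by simp
  ultimately show ?thesis by (simp add: algebra_simps)
qed simp

lemma good_pts_nonempty:
  assumes g: "\<gamma>1 \<in> lip_trans \<Omega>" "\<gamma>2 \<in> lip_trans \<Omega>" and O: "open \<Omega>" "\<Omega> \<noteq> {}"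
  obtains x where "x \<in> good_pts \<Omega> \<gamma>1" "x \<in> good_pts \<Omega> \<gamma>2"
proof -
  have "negligible (\<Omega> - good_pts \<Omega> \<gamma>1 \<inter> good_pts \<Omega> \<gamma>2)"
    by (rule negligible_subset[OF negligible_Un[OF negligible_bad_pts(1)[OF g(1) O(1)] negligible_bad_pts(1)[OF g(2) O(1)]]]) auto
  hence "\<Omega> - good_pts \<Omega> \<gamma>1 \<inter> good_pts \<Omega> \<gamma>2 \<noteq> \<Omega>" using open_not_negligible[OF O] by metis
  thus ?thesis using that by auto
qed

text \<open>The weight of the estimate on cl U has to be nonnegative. For \<open>G_dist\<close>
  itself this is shown later only if part of \<Omega> lies outside of cl U.\<close>

lemma G_dist_ge:
  fixes \<gamma>1 \<gamma>2 :: "real^'n \<Rightarrow> real^'n"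
  assumes g: "\<gamma>1 \<in> lip_trans \<Omega>" "\<gamma>2 \<in> lip_trans \<Omega>" and O: "open \<Omega>" "\<Omega> \<noteq> {}"
  shows "0 \<le> 2 + G_dist \<Omega> \<gamma>1 \<gamma>2"
proof -
  obtain x where x: "x \<in> good_pts \<Omega> \<gamma>1" "x \<in> good_pts \<Omega> \<gamma>2" using good_pts_nonempty[OF g O] .
  obtain w :: "real^'n" where w: "norm w = 1" using vector_choose_size[of 1] by auto
  have "0 \<le> norm (A_mat \<Omega> \<gamma>1 x *v w) + norm (A_mat \<Omega> \<gamma>2 x *v w)" by simp
  also have "... \<le> 2 + G_dist \<Omega> \<gamma>1 \<gamma>2" using A_mat_sum_bound[OF g O(1) x, of w] w by simp
  finally show ?thesis .
qed

text \<open>The other summands are nonnegative. For \<open>J_dist\<close> this takes boundedness and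
  a point of the index set, as a real supremum says nothing without them.\<close>

lemma T_dist_ge_G_dist:
  fixes \<gamma>1 \<gamma>2 :: "real^'n \<Rightarrow> real^'n"
  assumes g: "\<gamma>1 \<in> lip_trans \<Omega>" "\<gamma>2 \<in> lip_trans \<Omega>" and O: "open \<Omega>" "\<Omega> \<noteq> {}"
  shows "G_dist \<Omega> \<gamma>1 \<gamma>2 \<le> T_dist \<Omega> \<gamma>1 \<gamma>2"
proof -
  obtain C1 where "C1 > 0" and C1: "\<And>x. x \<in> diff_pts \<Omega> \<gamma>1 \<Longrightarrow> Jac \<gamma>1 x \<le> C1" using Jac_bound[OF g(1) O(1)] by blast
  obtain C2 where "C2 > 0" and C2: "\<And>x. x \<in> diff_pts \<Omega> \<gamma>2 \<Longrightarrow> Jac \<gamma>2 x \<le> C2" using Jac_bound[OF g(2) O(1)] by blast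
  obtain x where x: "x \<in> good_pts \<Omega> \<gamma>1" "x \<in> good_pts \<Omega> \<gamma>2" using good_pts_nonempty[OF g O] .
  let ?S = "diff_pts \<Omega> \<gamma>1 \<inter> diff_pts \<Omega> \<gamma>2"
  have "bdd_above ((\<lambda>x. \<bar>Jac \<gamma>1 x + Jac \<gamma>2 x - 2\<bar>) ` ?S)"
  proof (rule bdd_aboveI2[of _ _ "C1 + C2 + 2"])
    fix z assume "z \<in> ?S"
    thus "\<bar>Jac \<gamma>1 z + Jac \<gamma>2 z - 2\<bar> \<le> C1 + C2 + 2" using C1[of z] C2[of z] Jac_nonneg[of \<gamma>1 z] Jac_nonneg[of \<gamma>2 z] by (auto simp: abs_if)
  qed
  hence "0 \<le> J_dist \<Omega> \<gamma>1 \<gamma>2" unfolding J_dist_def using x by (intro cSUP_upper2[of _ _ x]) (auto simp: good_pts_def)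
  thus ?thesis unfolding T_dist_def by simp
qed

text \<open>Such a point has a neighbourhood on which \<open>\<gamma>\<close>, and with it the
  inverse, is the identity.\<close>

lemma A_mat_outside_closure:
  fixes \<gamma> :: "real^'n \<Rightarrow> real^'n"
  assumes g: "\<gamma> \<in> lip_trans_on \<Omega> U" and O: "open \<Omega>" and x: "x \<in> \<Omega>" "x \<notin> closure U"
  shows "x \<in> good_pts \<Omega> \<gamma>" "A_mat \<Omega> \<gamma> x = mat 1"
proof -
  have gl: "\<gamma> \<in> lip_trans \<Omega>" and gi: "\<And>y. y \<in> \<Omega> - U \<Longrightarrow> \<gamma> y = y" using g by (auto simp: lip_trans_on_def)
  let ?V = "\<Omega> - closure U" and ?d = "inv_into \<Omega> \<gamma>"
  have V: "open ?V" "x \<in> ?V" using O x by (auto intro: open_Diff)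
  have VU: "y \<in> \<Omega> - U" if "y \<in> ?V" for y using that closure_subset by blast
  have 1: "\<gamma> y = y" if "y \<in> ?V" for y using gi[OF VU[OF that]] .
  have 2: "?d y = y" if "y \<in> ?V" for y using lip_transD(8)[OF gl, of y] 1[OF that] that by auto
  have D: "(\<gamma> has_derivative (\<lambda>h. h)) (at x)" "(?d has_derivative (\<lambda>h. h)) (at x)"
    by (rule has_derivative_transform_within_open[OF has_derivative_ident V]; simp add: 1 2)+
  have gx: "\<gamma> x = x" using 1 V by blast
  show "x \<in> good_pts \<Omega> \<gamma>" using D x gx by (auto simp: good_pts_def diff_pts_def inv_diff_pts_def differentiable_def)
  have m: "matrix (\<lambda>h. h) = (mat 1 :: real^'n^'n)" by (simp add: matrix_def mat_def axis_def vec_eq_iff)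
  have "frechet_derivative \<gamma> (at x) = (\<lambda>h. h)" "frechet_derivative ?d (at x) = (\<lambda>h. h)" using D by (auto intro: frechet_derivative_at[symmetric])
  hence "grad \<gamma> x = mat 1" "grad ?d x = mat 1" by (auto simp: grad_def jacobian_def m transpose_mat)
  thus "A_mat \<Omega> \<gamma> x = mat 1" by (simp add: A_mat_def Jac_def gx)
qed

lemma shrinking_mollifiers:
  assumes "d > 0"
  obtains e and r :: "nat \<Rightarrow> real^'n \<Rightarrow> real" where "\<And>n. e n \<le> d" "e \<longlonglongrightarrow> 0" "\<And>n. mollifier (e n) (r n)"
proof -
  define e where "e n = d / real (Suc n)" for n
  have e: "e n > 0" "e n \<le> d" for n using assms by (simp_all add: e_def divide_le_eq)
  have "e \<longlonglongrightarrow> 0" unfolding e_def using lim_const_over_n[of d] by (rule LIMSEQ_Suc)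
  moreover have "\<exists>r. \<forall>n. mollifier (e n) (r n :: real^'n \<Rightarrow> real)" using mollifier_exists[OF e(1)] by (intro choice) blast
  ultimately show ?thesis using that e(2) by blast
qed

lemma mollifier_nn_integral:
  fixes r :: "real^'n \<Rightarrow> real"
  assumes r: "mollifier e r" and c: "c \<ge> 0"
  shows "(\<integral>\<^sup>+x. ennreal (c * r (x - y)) \<partial>lborel) = ennreal c"
proof -
  have rs: "smooth_ball e r" and r0: "\<And>x. 0 \<le> r x" and re: "\<And>x. r (- x) = r x" and r1: "integral\<^sup>L lborel r = 1" using r unfolding mollifier_def by auto
  have e: "r (x - y) = r (y - x)" for x using re[of "x - y"] by simp
  have i: "integrable lborel (\<lambda>x. c * r (y - x))" using lborel_integrable_reflect[OF smooth_ball_integrable[OF rs], of y] by simp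
  have "(\<integral>\<^sup>+x. ennreal (c * r (y - x)) \<partial>lborel) = ennreal (\<integral>x. c * r (y - x) \<partial>lborel)" by (rule nn_integral_eq_integral[OF i]) (use c r0 in auto)
  also have "(\<integral>x. c * r (y - x) \<partial>lborel) = c" using lborel_integral_reflect[OF smooth_ball_measurable[OF rs], of y] r1 by simp
  finally show ?thesis by (simp add: e)
qed

text \<open>Exchanging the integrals leaves the local averages \<open>g n y\<close> of
  \<open>k\<close>, whose upper limit is at most \<open>k y\<close> by semicontinuity; the reverse
  Fatou lemma applies with a constant majorant. Semicontinuity in the exact form
  \<open>k x \<le> k y\<close> suits weights with finitely many values.\<close>

lemma mollified_limsup_le:
  fixes k :: "real^'n \<Rightarrow> real"
  assumes \<kappa>: "finite_measure \<kappa>" "sets \<kappa> = sets borel" and ae: "AE y in \<kappa>. y \<in> \<Omega>" and km[measurable]: "k \<in> borel_measurable borel"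
    and k: "\<And>x. 0 \<le> k x" "\<And>x. k x \<le> B" and usc: "\<And>y. y \<in> \<Omega> \<Longrightarrow> \<exists>d>0. \<forall>x. norm (x - y) < d \<longrightarrow> k x \<le> k y"
    and r: "\<And>n. mollifier (e n) (r n)" and e: "e \<longlonglongrightarrow> 0"
  shows "limsup (\<lambda>n. \<integral>\<^sup>+x. (\<integral>\<^sup>+y. ennreal (k x * r n (x - y)) \<partial>\<kappa>) \<partial>lborel) \<le> (\<integral>\<^sup>+y. ennreal (k y) \<partial>\<kappa>)"
proof -
  interpret finite_measure \<kappa> by fact
  interpret P: pair_sigma_finite \<kappa> "lborel :: (real^'n) measure" by (rule pair_sigma_finite.intro; unfold_locales)
  note [measurable_cong] = \<kappa>(2)
  have rs: "smooth_ball (e n) (r n)" and r0: "0 \<le> r n x" for n x using r unfolding mollifier_def by auto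
  note [measurable] = smooth_ball_measurable[OF rs]
  define g where "g n y = (\<integral>\<^sup>+x. ennreal (k x * r n (x - y)) \<partial>lborel)" for n y
  have gm[measurable]: "g n \<in> borel_measurable \<kappa>" for n unfolding g_def by measurable
  have le: "g n y \<le> ennreal c" if c: "c \<ge> 0" "\<And>x. norm (x - y) \<le> e n \<Longrightarrow> k x \<le> c" for n y c
  proof -
    have "g n y \<le> (\<integral>\<^sup>+x. ennreal (c * r n (x - y)) \<partial>lborel)" unfolding g_def
    proof (intro nn_integral_mono ennreal_leI)
      fix x
      show "k x * r n (x - y) \<le> c * r n (x - y)"
      proof (cases "norm (x - y) \<le> e n")
        case False thus ?thesis using rs[of n] unfolding smooth_ball_def by auto
      qed (use c r0 in \<open>auto intro: mult_right_mono\<close>)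
    qed
    thus ?thesis using mollifier_nn_integral[OF r c(1)] by simp
  qed
  have B: "0 \<le> B" using k(1)[of 0] k(2)[of 0] by linarith
  have F: "(\<integral>\<^sup>+x. (\<integral>\<^sup>+y. ennreal (k x * r n (x - y)) \<partial>\<kappa>) \<partial>lborel) = (\<integral>\<^sup>+y. g n y \<partial>\<kappa>)" for n unfolding g_def by (rule P.Fubini') measurable
  have "limsup (\<lambda>n. \<integral>\<^sup>+y. g n y \<partial>\<kappa>) \<le> (\<integral>\<^sup>+y. limsup (\<lambda>n. g n y) \<partial>\<kappa>)"
  proof (rule nn_integral_limsup[OF gm])
    show "(\<lambda>y. ennreal B) \<in> borel_measurable \<kappa>" by simp
    show "AE y in \<kappa>. g i y \<le> ennreal B" for i using le[OF B k(2)] by simp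
    show "(\<integral>\<^sup>+y. ennreal B \<partial>\<kappa>) < \<infinity>" using emeasure_finite[of "space \<kappa>"] by (simp add: ennreal_mult_eq_top_iff less_top[symmetric])
  qed
  also have "... \<le> (\<integral>\<^sup>+y. ennreal (k y) \<partial>\<kappa>)"
  proof (rule nn_integral_mono_AE)
    show "AE y in \<kappa>. limsup (\<lambda>n. g n y) \<le> ennreal (k y)" using ae
    proof eventually_elim
      case (elim y)
      then obtain d where d: "d > 0" "\<And>x. norm (x - y) < d \<Longrightarrow> k x \<le> k y" using usc by blast
      have "eventually (\<lambda>n. e n < d) sequentially" using e d(1) by (rule order_tendstoD(2))
      hence "eventually (\<lambda>n. g n y \<le> ennreal (k y)) sequentially" by eventually_elim (intro le k(1) d(2), simp)
      thus ?case by (rule Limsup_bounded)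
    qed
  qed
  finally show ?thesis by (simp add: F)
qed

text \<open>Up to sign, a partial derivative of the mollification at \<open>x\<close> is the pairing
  of \<open>u\<close> with the derivative of the test function \<open>\<lambda>y. r (x - y)\<close>,
  hence an integral of this function against \<open>\<sigma> \<kappa>\<close>. The condition on the
  ball places its support in \<Omega>.\<close>

lemma norm_gradient_conv_le:
  fixes u v :: "real^'n \<Rightarrow> real"
  assumes p: "polar \<Omega> \<kappa> \<sigma>" and O: "open \<Omega>" and u: "u \<in> L1 \<Omega>"
    and ibp: "\<And>\<phi> i. test_function \<Omega> \<phi> \<Longrightarrow> partial_pairing \<Omega> u i \<phi> = - (\<integral>x. \<phi> x * \<sigma> x $ i \<partial>\<kappa>)"
    and v: "integrable lborel v" "\<And>x. x \<notin> \<Omega> \<Longrightarrow> v x = 0" "AE x in lebesgue_on \<Omega>. u x = v x"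
    and r: "mollifier e r" and x: "cball x e \<subseteq> \<Omega>"
  shows "ennreal (norm (gradient (conv r v) x)) \<le> (\<integral>\<^sup>+y. ennreal (r (x - y)) \<partial>\<kappa>)"
proof -
  have \<kappa>: "finite_measure \<kappa>" "sets \<kappa> = sets borel" and \<sigma>: "\<sigma> \<in> borel_measurable borel" "\<And>x. norm (\<sigma> x) \<le> 1" using p unfolding polar_def by auto
  interpret finite_measure \<kappa> by fact
  note [measurable_cong] = \<kappa>(2) note [measurable] = \<sigma>(1)
  have rs: "smooth_ball e r" and r0: "\<And>x. 0 \<le> r x" using r unfolding mollifier_def by auto
  note [measurable] = smooth_ball_measurable[OF rs]
  have vm[measurable]: "v \<in> borel_measurable borel" using borel_measurable_integrable[OF v(1)] by simp
  let ?p = "\<lambda>y. r (x - y)"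
  have t: "test_function \<Omega> ?p"
  proof (rule test_functionI[OF _ compact_cball x])
    show "C_k k ?p" for k using rs C_k_reflect unfolding smooth_ball_def by blast
    show "?p y = 0" if "y \<notin> cball x e" for y using rs that unfolding smooth_ball_def by (auto simp: dist_norm)
  qed
  have pm[measurable]: "partial_deriv i ?p \<in> borel_measurable borel" for i by (rule test_function_bounds(1)[OF test_function_partial_deriv[OF t]])
  have d: "partial_deriv i (conv r v) x = (\<integral>y. r (x - y) * \<sigma> y $ i \<partial>\<kappa>)" for i
  proof -
    have "partial_deriv i (conv r v) x = - (\<integral>y. v y * partial_deriv i ?p y \<partial>lborel)"
      unfolding partial_deriv_conv[OF rs v(1)] conv_def partial_deriv_reflect[OF smooth_ball_differentiable[OF rs]] by (simp add: mult.commute)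
    also have "(\<integral>y. v y * partial_deriv i ?p y \<partial>lborel) = (\<integral>y. v y * partial_deriv i ?p y \<partial>lebesgue_on \<Omega>)"
      by (rule integral_lebesgue_on_lborel[symmetric]) (use O v(2) in auto)
    also have "... = (\<integral>y. u y * partial_deriv i ?p y \<partial>lebesgue_on \<Omega>)"
    proof (rule integral_cong_AE)
      show "AE y in lebesgue_on \<Omega>. v y * partial_deriv i ?p y = u y * partial_deriv i ?p y" using v(3) by eventually_elim simp
      show "(\<lambda>y. v y * partial_deriv i ?p y) \<in> borel_measurable (lebesgue_on \<Omega>)" by (rule borel_measurable_lebesgue_on) measurable
      show "(\<lambda>y. u y * partial_deriv i ?p y) \<in> borel_measurable (lebesgue_on \<Omega>)"
        using u borel_measurable_lebesgue_on[OF pm] by (intro borel_measurable_times) (auto simp: L1_def)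
    qed
    also have "... = - (\<integral>y. r (x - y) * \<sigma> y $ i \<partial>\<kappa>)" by (rule ibp[OF t])
    finally show ?thesis by simp
  qed
  obtain B where B: "\<And>x. \<bar>r x\<bar> \<le> B" using smooth_ball_bounded[OF rs] by blast
  have i: "integrable \<kappa> (\<lambda>y. r (x - y) *\<^sub>R \<sigma> y)"
  proof (rule integrable_const_bound[of _ "B * 1"])
    show "AE y in \<kappa>. norm (r (x - y) *\<^sub>R \<sigma> y) \<le> B * 1" using B \<sigma>(2) order_trans[OF abs_ge_zero B]
      by (intro AE_I2) (simp only: norm_scaleR, intro mult_mono, auto)
  qed measurable
  have "(gradient (conv r v) x) = (\<integral>y. r (x - y) *\<^sub>R \<sigma> y \<partial>\<kappa>)" by (simp add: vec_eq_iff d integral_vec_component[OF i])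
  hence "ennreal (norm (gradient (conv r v) x)) \<le> (\<integral>\<^sup>+y. ennreal (norm (r (x - y) *\<^sub>R \<sigma> y)) \<partial>\<kappa>)" using integral_norm_bound_ennreal[OF i] by simp
  also have "... \<le> (\<integral>\<^sup>+y. ennreal (r (x - y)) \<partial>\<kappa>)" using r0 \<sigma>(2) by (intro nn_integral_mono ennreal_leI) (simp add: mult_left_le)
  finally show ?thesis .
qed

lemma conv_L1_approximation:
  fixes u v :: "real^'n \<Rightarrow> real"
  assumes O: "open \<Omega>" and u: "u \<in> L1 \<Omega>" and v: "integrable lborel v" "AE x in lebesgue_on \<Omega>. u x = v x"
    and r: "\<And>n. mollifier (e n) (r n)" and e: "e \<longlonglongrightarrow> 0"
  shows "\<And>n. conv (r n) v \<in> L1 \<Omega>" "(\<lambda>n. norm_L1 \<Omega> (\<lambda>x. conv (r n) v x - u x)) \<longlonglongrightarrow> 0"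
proof -
  have Ol: "\<Omega> \<in> sets lebesgue" using O by simp
  have rs: "smooth_ball (e n) (r n)" for n using r unfolding mollifier_def by auto
  have ci: "integrable lborel (conv (r n) v)" for n by (rule mollifier_conv_integrable[OF r v(1)])
  show cL: "conv (r n) v \<in> L1 \<Omega>" for n using integrable_lebesgue_on_lborel[OF Ol ci] by (simp add: L1_def)
  show "(\<lambda>n. norm_L1 \<Omega> (\<lambda>x. conv (r n) v x - u x)) \<longlonglongrightarrow> 0"
  proof (rule tendsto_sandwich[OF _ _ tendsto_const conv_tendsto_L1[OF v(1) r e]])
    show "\<forall>\<^sub>F n in sequentially. 0 \<le> norm_L1 \<Omega> (\<lambda>x. conv (r n) v x - u x)" by (simp add: norm_L1_def)
    show "\<forall>\<^sub>F n in sequentially. norm_L1 \<Omega> (\<lambda>x. conv (r n) v x - u x) \<le> (\<integral>x. \<bar>conv (r n) v x - v x\<bar> \<partial>lborel)"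
    proof (intro always_eventually allI)
      fix n
      have i: "integrable lborel (\<lambda>x. \<bar>conv (r n) v x - v x\<bar>)" using ci v(1) by auto
      have vL: "integrable (lebesgue_on \<Omega>) v" by (rule integrable_lebesgue_on_lborel[OF Ol v(1)])
      have "norm_L1 \<Omega> (\<lambda>x. conv (r n) v x - u x) = (\<integral>x. \<bar>conv (r n) v x - v x\<bar> \<partial>lebesgue_on \<Omega>)" unfolding norm_L1_def
      proof (rule integral_cong_AE)
        show "AE x in lebesgue_on \<Omega>. \<bar>conv (r n) v x - u x\<bar> = \<bar>conv (r n) v x - v x\<bar>" using v(2) by eventually_elim simp
      qed (use cL u vL in \<open>auto simp: L1_def\<close>)
      also have "... = (\<integral>x. indicator \<Omega> x * \<bar>conv (r n) v x - v x\<bar> \<partial>lebesgue)" by (rule integral_lebesgue_on[OF Ol])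
      also have "... = (\<integral>x. indicator \<Omega> x * \<bar>conv (r n) v x - v x\<bar> \<partial>lborel)" using O borel_measurable_integrable[OF i] by (intro integral_completion) auto
      also have "... \<le> (\<integral>x. \<bar>conv (r n) v x - v x\<bar> \<partial>lborel)"
      proof (rule integral_mono)
        show "integrable lborel (\<lambda>x. indicator \<Omega> x * \<bar>conv (r n) v x - v x\<bar>)" using O by (intro integrable_bounded_mult[OF i, of _ 1]) auto
      qed (auto simp: i indicator_def)
      finally show "norm_L1 \<Omega> (\<lambda>x. conv (r n) v x - u x) \<le> (\<integral>x. \<bar>conv (r n) v x - v x\<bar> \<partial>lborel)" .
    qed
  qed
qed

text \<open>Pushing forward is bounded in L1, since the Jacobian is bounded.\<close>

lemma push_divergence_tendsto:
  fixes \<gamma> :: "real^'n \<Rightarrow> real^'n"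
  assumes g: "\<gamma> \<in> lip_trans \<Omega>" and O: "open \<Omega>" "bounded \<Omega>" and us: "\<And>n. us n \<in> L1 \<Omega>" and u: "u \<in> L1 \<Omega>"
    and lim: "(\<lambda>n. norm_L1 \<Omega> (\<lambda>x. us n x - u x)) \<longlonglongrightarrow> 0" and \<phi>: "test_field \<Omega> \<phi>"
  shows "(\<lambda>n. div_pairing \<Omega> (push \<Omega> \<gamma> (us n)) \<phi>) \<longlonglongrightarrow> div_pairing \<Omega> (push \<Omega> \<gamma> u) \<phi>"
proof -
  obtain C where "C > 0" and C: "\<And>x. x \<in> diff_pts \<Omega> \<gamma> \<Longrightarrow> Jac \<gamma> x \<le> C" using Jac_bound[OF g O(1)] by blast
  show ?thesis
  proof (rule L1_divergence_tendsto[OF _ _ _ \<phi>])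
    show "push \<Omega> \<gamma> (us n) \<in> L1 \<Omega>" for n by (rule push_L1(1)[OF g O _ us]) (rule C)
    show "push \<Omega> \<gamma> u \<in> L1 \<Omega>" by (rule push_L1(1)[OF g O _ u]) (rule C)
    show "(\<lambda>n. norm_L1 \<Omega> (\<lambda>x. push \<Omega> \<gamma> (us n) x - push \<Omega> \<gamma> u x)) \<longlonglongrightarrow> 0"
    proof (rule tendsto_sandwich[OF _ _ tendsto_const tendsto_mult_right_zero[OF lim, of C]])
      show "\<forall>\<^sub>F n in sequentially. 0 \<le> norm_L1 \<Omega> (\<lambda>x. push \<Omega> \<gamma> (us n) x - push \<Omega> \<gamma> u x)" by (simp add: norm_L1_def)
      have d: "(\<lambda>x. us n x - u x) \<in> L1 \<Omega>" for n using us u by (auto simp: L1_def)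
      have "norm_L1 \<Omega> (\<lambda>x. push \<Omega> \<gamma> (us n) x - push \<Omega> \<gamma> u x) \<le> C * norm_L1 \<Omega> (\<lambda>x. us n x - u x)" for n
        using push_L1(2)[OF g O C d, of n] by (simp add: push_def comp_def)
      thus "\<forall>\<^sub>F n in sequentially. norm_L1 \<Omega> (\<lambda>x. push \<Omega> \<gamma> (us n) x - push \<Omega> \<gamma> u x) \<le> C * norm_L1 \<Omega> (\<lambda>x. us n x - u x)" by simp
    qed
  qed
qed

lemma test_field_support:
  assumes "test_field W \<phi>"
  obtains K where "compact K" "K \<subseteq> W" "\<And>x. x \<notin> K \<Longrightarrow> \<phi> x = 0"
proof (rule that)
  let ?K = "\<Union>i. closure {x. \<phi> x $ i \<noteq> 0}"
  have t: "test_function W (\<lambda>x. \<phi> x $ i)" for i using assms unfolding test_field_def by blast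
  show "compact ?K" using t unfolding test_function_def by (intro compact_UN) auto
  show "?K \<subseteq> W" using t unfolding test_function_def by blast
  show "\<phi> x = 0" if "x \<notin> ?K" for x
  proof -
    have "\<phi> x $ i = 0" for i using that closure_subset[of "{x. \<phi> x $ i \<noteq> 0}"] by auto
    thus ?thesis by (simp add: vec_eq_iff)
  qed
qed

text \<open>Points mapped into the support of one of the fields form a compact set \<open>K\<close>
  in \<open>W\<close>. For mollifications with radius below its distance from the boundary, the two
  pairings add up to at most the integral over \<open>K\<close> of
  \<open>|A1 \<nabla>w| + |A2 \<nabla>w|\<close>, hence of \<open>H\<close> times the mollified
  variation measure, and \<open>mollified_limsup_le\<close> passes to the limit. The weight is kept
  abstract here; it is chosen in \<open>TV_push_sum_le\<close>.\<close>

lemma push_divergence_sum_le: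
  fixes \<gamma>1 \<gamma>2 :: "real^'n \<Rightarrow> real^'n"
  assumes g: "\<gamma>1 \<in> lip_trans \<Omega>" "\<gamma>2 \<in> lip_trans \<Omega>" and O: "open \<Omega>" "bounded \<Omega>" "\<Omega> \<noteq> {}"
    and p: "polar \<Omega> \<kappa> \<sigma>" and u: "u \<in> L1 \<Omega>"
    and ibp: "\<And>\<phi> i. test_function \<Omega> \<phi> \<Longrightarrow> partial_pairing \<Omega> u i \<phi> = - (\<integral>x. \<phi> x * \<sigma> x $ i \<partial>\<kappa>)"
    and H: "\<And>x q. x \<in> good_pts \<Omega> \<gamma>1 \<Longrightarrow> x \<in> good_pts \<Omega> \<gamma>2 \<Longrightarrow> norm (A_mat \<Omega> \<gamma>1 x *v q) + norm (A_mat \<Omega> \<gamma>2 x *v q) \<le> H x * norm q"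
    and Hm[measurable]: "H \<in> borel_measurable borel" and H0: "\<And>x. 0 \<le> H x" and HB: "\<And>x. H x \<le> B"
    and usc: "\<And>y. y \<in> \<Omega> \<Longrightarrow> \<exists>d>0. \<forall>x\<in>\<Omega>. norm (x - y) < d \<longrightarrow> H x \<le> H y"
    and W: "open W" "W \<subseteq> \<Omega>" and \<phi>: "test_field (\<gamma>1 ` W) \<phi>1" "test_field (\<gamma>2 ` W) \<phi>2"
  shows "div_pairing \<Omega> (push \<Omega> \<gamma>1 u) \<phi>1 + div_pairing \<Omega> (push \<Omega> \<gamma>2 u) \<phi>2
    \<le> (\<integral>y. indicator W y * H y \<partial>\<kappa>)"
proof -
  have \<kappa>: "finite_measure \<kappa>" "sets \<kappa> = sets borel" and \<kappa>0: "emeasure \<kappa> (- \<Omega>) = 0" using p unfolding polar_def by auto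
  interpret finite_measure \<kappa> by fact
  note [measurable_cong] = \<kappa>(2)
  have aeO: "AE y in \<kappa>. y \<in> \<Omega>" by (rule AE_I[OF _ \<kappa>0]) (use O(1) \<kappa>(2) in auto)
  have gW: "\<gamma>1 ` W \<subseteq> \<Omega>" "\<gamma>2 ` W \<subseteq> \<Omega>" using lip_transD(10)[OF g(1)] lip_transD(10)[OF g(2)] W(2) by blast+
  note \<phi>' = test_field_mono[OF \<phi>(1) gW(1)] test_field_mono[OF \<phi>(2) gW(2)]
  obtain K1 where K1: "compact K1" "K1 \<subseteq> \<gamma>1 ` W" "\<And>x. x \<notin> K1 \<Longrightarrow> \<phi>1 x = 0" using test_field_support[OF \<phi>(1)] by blast
  obtain K2 where K2: "compact K2" "K2 \<subseteq> \<gamma>2 ` W" "\<And>x. x \<notin> K2 \<Longrightarrow> \<phi>2 x = 0" using test_field_support[OF \<phi>(2)] by blast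
  define K where "K = inv_into \<Omega> \<gamma>1 ` K1 \<union> inv_into \<Omega> \<gamma>2 ` K2"
  have Kc: "compact K" unfolding K_def using K1 K2 gW
    by (intro compact_Un compact_continuous_image continuous_on_subset[OF lip_transD(13)[OF g(1)]] continuous_on_subset[OF lip_transD(13)[OF g(2)]]) auto
  have KW: "K \<subseteq> W"
  proof -
    have "inv_into \<Omega> \<gamma>1 ` K1 \<subseteq> W" using K1(2) W(2) lip_transD(8)[OF g(1)] by fastforce
    moreover have "inv_into \<Omega> \<gamma>2 ` K2 \<subseteq> W" using K2(2) W(2) lip_transD(8)[OF g(2)] by fastforce
    ultimately show ?thesis unfolding K_def by blast
  qed
  have KO: "K \<subseteq> \<Omega>" using KW W(2) by blast
  have K1': "x \<in> K" if "x \<in> \<Omega>" "\<phi>1 (\<gamma>1 x) \<noteq> 0" for x using that K1(3)[of "\<gamma>1 x"] lip_transD(8)[OF g(1) that(1)] unfolding K_def by (metis UnI1 imageI)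
  have K2': "x \<in> K" if "x \<in> \<Omega>" "\<phi>2 (\<gamma>2 x) \<noteq> 0" for x using that K2(3)[of "\<gamma>2 x"] lip_transD(8)[OF g(2) that(1)] unfolding K_def by (metis UnI2 imageI)
  have "\<Omega> \<noteq> UNIV" using O(2) not_bounded_UNIV by blast
  then obtain d where d: "d > 0" "\<And>x. x \<in> K \<Longrightarrow> infdist x (- \<Omega>) > d" using compact_subset_infdist[OF Kc KO O(1)] by blast
  obtain e and r :: "nat \<Rightarrow> real^'n \<Rightarrow> real" where ed: "\<And>n. e n \<le> d" and elim: "e \<longlonglongrightarrow> 0" and r: "\<And>n. mollifier (e n) (r n)"
    using shrinking_mollifiers[OF d(1)] by blast
  have cb: "cball x (e n) \<subseteq> \<Omega>" if "x \<in> K" for x n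
  proof
    fix z assume "z \<in> cball x (e n)"
    hence "norm (z - x) \<le> d" using ed[of n] by (simp add: dist_norm norm_minus_commute)
    thus "z \<in> \<Omega>" by (rule infdist_less_imp_ball[OF d(2)[OF that]])
  qed
  have rs: "smooth_ball (e n) (r n)" and r0: "0 \<le> r n x" for n x using r unfolding mollifier_def by auto
  note [measurable] = smooth_ball_measurable[OF rs]
  obtain v where v: "integrable lborel v" "\<And>x. x \<notin> \<Omega> \<Longrightarrow> v x = 0" "AE x in lebesgue_on \<Omega>. u x = v x" using L1_borel_representative[OF u O(1)] by blast
  \<comment> \<open>Cutting a nonnegative weight off to a closed set preserves upper semicontinuity.
    It also restricts the estimate to points whose mollification ball lies in \<Omega>, as
    \<open>norm_gradient_conv_le\<close> demands.\<close>
  define k where "k x = indicator K x * H x" for x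
  have Kb[measurable]: "K \<in> sets borel" using Kc by (simp add: borel_compact)
  have km[measurable]: "k \<in> borel_measurable borel" unfolding k_def by measurable
  have k0: "0 \<le> k x" for x using H0 by (simp add: k_def)
  have kB: "k x \<le> B" for x using HB[of x] H0[of x] by (auto simp: k_def indicator_def)
  have kusc: "\<exists>d>0. \<forall>x. norm (x - y) < d \<longrightarrow> k x \<le> k y" if y: "y \<in> \<Omega>" for y
  proof (cases "y \<in> K")
    case True
    obtain d1 where d1: "d1 > 0" "\<And>x. x \<in> \<Omega> \<Longrightarrow> norm (x - y) < d1 \<Longrightarrow> H x \<le> H y" using usc[OF y] by blast
    have "k x \<le> k y" if "norm (x - y) < d1" for x using d1(2)[OF _ that] KO True H0 by (auto simp: k_def indicator_def)
    thus ?thesis using d1(1) by blast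
  next
    case False
    moreover have "open (- K)" using compact_imp_closed[OF Kc] by (rule open_Compl)
    ultimately obtain d1 where d1: "d1 > 0" "ball y d1 \<subseteq> - K" using open_contains_ball[of "- K"] by auto
    have "k x \<le> k y" if "norm (x - y) < d1" for x
    proof -
      have "x \<in> ball y d1" using that by (simp add: dist_norm norm_minus_commute)
      thus ?thesis using d1(2) k0[of y] by (auto simp: k_def)
    qed
    thus ?thesis using d1(1) by blast
  qed
  define I where "I w = div_pairing \<Omega> (push \<Omega> \<gamma>1 w) \<phi>1 + div_pairing \<Omega> (push \<Omega> \<gamma>2 w) \<phi>2" for w
  have Ilim: "(\<lambda>n. I (conv (r n) v)) \<longlonglongrightarrow> I u" unfolding I_def using conv_L1_approximation[OF O(1) u v(1,3) r elim] \<phi>'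
    by (intro tendsto_add push_divergence_tendsto g O(1,2) u) auto
  define \<Phi> where "\<Phi> n x = (\<integral>\<^sup>+y. ennreal (k x * r n (x - y)) \<partial>\<kappa>)" for n x
  have \<Phi>m[measurable]: "\<Phi> n \<in> borel_measurable borel" for n unfolding \<Phi>_def by measurable
  have In: "ennreal (I (conv (r n) v)) \<le> (\<integral>\<^sup>+x. \<Phi> n x \<partial>lborel)" for n
  proof -
    let ?D = "\<lambda>x. gradient (conv (r n) v) x"
    obtain F1 where F1: "integrable (lebesgue_on \<Omega>) F1"
      "AE x in lebesgue_on \<Omega>. F1 x = indicator {x. \<phi>1 (\<gamma>1 x) \<noteq> 0} x * norm (A_mat \<Omega> \<gamma>1 x *v ?D x)"
      "(\<integral>y. push \<Omega> \<gamma>1 (conv (r n) v) y * divergence \<phi>1 y \<partial>lebesgue_on \<Omega>) \<le> (\<integral>x. F1 x \<partial>lebesgue_on \<Omega>)"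
      using push_conv_divergence_le[OF g(1) O rs v(1) \<phi>'(1)] by blast
    obtain F2 where F2: "integrable (lebesgue_on \<Omega>) F2"
      "AE x in lebesgue_on \<Omega>. F2 x = indicator {x. \<phi>2 (\<gamma>2 x) \<noteq> 0} x * norm (A_mat \<Omega> \<gamma>2 x *v ?D x)"
      "(\<integral>y. push \<Omega> \<gamma>2 (conv (r n) v) y * divergence \<phi>2 y \<partial>lebesgue_on \<Omega>) \<le> (\<integral>x. F2 x \<partial>lebesgue_on \<Omega>)"
      using push_conv_divergence_le[OF g(2) O rs v(1) \<phi>'(2)] by blast
    have F: "integrable (lebesgue_on \<Omega>) (\<lambda>x. F1 x + F2 x)" using F1 F2 by simp
    have "I (conv (r n) v) \<le> (\<integral>x. F1 x + F2 x \<partial>lebesgue_on \<Omega>)" unfolding I_def using F1 F2 by simp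
    hence "ennreal (I (conv (r n) v)) \<le> ennreal (\<integral>x. F1 x + F2 x \<partial>lebesgue_on \<Omega>)" by (rule ennreal_leI)
    also have "... = (\<integral>\<^sup>+x. ennreal (F1 x + F2 x) \<partial>lebesgue_on \<Omega>)"
    proof (rule nn_integral_eq_integral[OF F, symmetric])
      show "AE x in lebesgue_on \<Omega>. 0 \<le> F1 x + F2 x" using F1(2) F2(2) by eventually_elim simp
    qed
    also have "... \<le> (\<integral>\<^sup>+x. \<Phi> n x \<partial>lebesgue_on \<Omega>)"
    proof (rule nn_integral_mono_AE)
      have s: "AE x in lebesgue_on \<Omega>. x \<in> \<Omega>" by (rule AE_I2) (simp add: space_restrict_space)
      show "AE x in lebesgue_on \<Omega>. ennreal (F1 x + F2 x) \<le> \<Phi> n x"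
        using F1(2) F2(2) s AE_lebesgue_on_negligible[OF negligible_bad_pts(1)[OF g(1) O(1)] O(1)]
          AE_lebesgue_on_negligible[OF negligible_bad_pts(1)[OF g(2) O(1)] O(1)]
      proof eventually_elim
        case (elim x)
        show ?case
        proof (cases "x \<in> K")
          case True
          have "F1 x + F2 x \<le> norm (A_mat \<Omega> \<gamma>1 x *v ?D x) + norm (A_mat \<Omega> \<gamma>2 x *v ?D x)" unfolding elim(1,2) by (intro add_mono) (auto simp: indicator_def)
          also have "... \<le> H x * norm (?D x)" by (rule H[OF elim(4,5)])
          also have "... = k x * norm (?D x)" using True by (simp add: k_def)
          finally have "ennreal (F1 x + F2 x) \<le> ennreal (k x) * ennreal (norm (?D x))" using k0[of x] by (simp add: ennreal_mult[symmetric] ennreal_leI)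
          also have "... \<le> ennreal (k x) * (\<integral>\<^sup>+y. ennreal (r n (x - y)) \<partial>\<kappa>)"
            by (intro mult_left_mono norm_gradient_conv_le[OF p O(1) u ibp v r cb[OF True]]) auto
          also have "... = \<Phi> n x" unfolding \<Phi>_def using k0[of x] r0 by (subst nn_integral_cmult[symmetric]) (auto simp: ennreal_mult)
          finally show ?thesis .
        next
          case False
          hence "\<phi>1 (\<gamma>1 x) = 0" "\<phi>2 (\<gamma>2 x) = 0" using K1'[OF elim(3)] K2'[OF elim(3)] by blast+
          hence "F1 x + F2 x = 0" unfolding elim(1,2) by simp
          thus ?thesis by simp
        qed
      qed
    qed
    also have "... = (\<integral>\<^sup>+x. \<Phi> n x * indicator \<Omega> x \<partial>lebesgue)" using O(1) by (simp add: nn_integral_restrict_space)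
    also have "... \<le> (\<integral>\<^sup>+x. \<Phi> n x \<partial>lebesgue)" by (intro nn_integral_mono) (auto simp: indicator_def)
    also have "... = (\<integral>\<^sup>+x. \<Phi> n x \<partial>lborel)" by (simp add: nn_integral_completion)
    finally show ?thesis .
  qed
  have "ennreal (I u) = limsup (\<lambda>n. ennreal (I (conv (r n) v)))" using lim_imp_Limsup[OF trivial_limit_sequentially tendsto_ennrealI[OF Ilim]] by simp
  also have "... \<le> limsup (\<lambda>n. \<integral>\<^sup>+x. \<Phi> n x \<partial>lborel)" by (intro Limsup_mono always_eventually allI In)
  also have "... \<le> (\<integral>\<^sup>+y. ennreal (k y) \<partial>\<kappa>)" unfolding \<Phi>_def by (rule mollified_limsup_le[OF \<kappa> aeO km k0 kB kusc r elim])
  also have "... \<le> (\<integral>\<^sup>+y. ennreal (indicator W y * H y) \<partial>\<kappa>)" using KW H0 by (intro nn_integral_mono ennreal_leI) (auto simp: k_def indicator_def)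
  also have "... = ennreal (\<integral>y. indicator W y * H y \<partial>\<kappa>)"
  proof (rule nn_integral_eq_integral)
    have "W \<in> sets borel" using W(1) by simp
    thus "integrable \<kappa> (\<lambda>y. indicator W y * H y)" using HB H0
      by (intro integrable_const_bound[of _ B]) (auto simp: indicator_def intro: order_trans[OF H0])
  qed (use H0 in auto)
  finally have "I u \<le> (\<integral>y. indicator W y * H y \<partial>\<kappa>)" using H0 by (subst (asm) ennreal_le_iff) auto
  thus ?thesis by (simp add: I_def)
qed

lemma lip_trans_open_image:
  assumes g: "\<gamma> \<in> lip_trans \<Omega>" and O: "open \<Omega>" and W: "open W" "W \<subseteq> \<Omega>"
  shows "open (\<gamma> ` W)"
proof -
  have "\<gamma> ` W = \<Omega> \<inter> inv_into \<Omega> \<gamma> -` W"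
  proof (intro equalityI subsetI)
    fix y assume "y \<in> \<Omega> \<inter> inv_into \<Omega> \<gamma> -` W"
    thus "y \<in> \<gamma> ` W" using lip_transD(9)[OF g, of y] by (auto intro: image_eqI[of _ _ "inv_into \<Omega> \<gamma> y"])
  qed (use W(2) lip_transD(8,10)[OF g] in auto)
  moreover have "open (\<Omega> \<inter> inv_into \<Omega> \<gamma> -` W)" by (rule continuous_open_preimage[OF lip_transD(13)[OF g] O W(1)])
  ultimately show ?thesis by simp
qed

lemma TV_push_sum_le:
  fixes \<gamma>1 \<gamma>2 :: "real^'n \<Rightarrow> real^'n"
  assumes g: "\<gamma>1 \<in> lip_trans_on \<Omega> U" "\<gamma>2 \<in> lip_trans_on \<Omega> U" and O: "open \<Omega>" "bounded \<Omega>" "\<Omega> \<noteq> {}"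
    and p: "polar \<Omega> \<kappa> \<sigma>" and u: "u \<in> L1 \<Omega>"
    and ibp: "\<And>\<phi> i. test_function \<Omega> \<phi> \<Longrightarrow> partial_pairing \<Omega> u i \<phi> = - (\<integral>x. \<phi> x * \<sigma> x $ i \<partial>\<kappa>)"
    and W: "open W" "W \<subseteq> \<Omega>"
  shows "TV (\<gamma>1 ` W) (push \<Omega> \<gamma>1 u) + TV (\<gamma>2 ` W) (push \<Omega> \<gamma>2 u)
    \<le> ereal (2 * measure \<kappa> W + G_dist \<Omega> \<gamma>1 \<gamma>2 * measure \<kappa> (W \<inter> closure U))"
    and "\<not> \<Omega> \<subseteq> closure U \<Longrightarrow> 0 \<le> G_dist \<Omega> \<gamma>1 \<gamma>2"
proof -
  have gl: "\<gamma>1 \<in> lip_trans \<Omega>" "\<gamma>2 \<in> lip_trans \<Omega>" using g by (auto simp: lip_trans_on_def)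
  let ?G = "G_dist \<Omega> \<gamma>1 \<gamma>2"
  have G2: "0 \<le> 2 + ?G" by (rule G_dist_ge[OF gl O(1,3)])
  show Gpos: "0 \<le> ?G" if ne: "\<not> \<Omega> \<subseteq> closure U"
  proof -
    obtain x where x: "x \<in> \<Omega>" "x \<notin> closure U" using ne by blast
    obtain w :: "real^'n" where w: "norm w = 1" using vector_choose_size[of 1] by auto
    note o1 = A_mat_outside_closure[OF g(1) O(1) x] and o2 = A_mat_outside_closure[OF g(2) O(1) x]
    show ?thesis using A_mat_sum_bound[OF gl O(1) o1(1) o2(1), of w] w by (simp add: o1(2) o2(2))
  qed
  have \<kappa>: "finite_measure \<kappa>" "sets \<kappa> = sets borel" using p unfolding polar_def by auto
  interpret finite_measure \<kappa> by fact
  note [measurable_cong] = \<kappa>(2)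
  define H where "H x = (if x \<in> closure U then 2 + ?G else 2)" for x
  have Hm: "H \<in> borel_measurable borel" unfolding H_def by measurable
  have H0: "0 \<le> H x" for x using G2 by (simp add: H_def)
  have HB: "H x \<le> 2 + \<bar>?G\<bar>" for x unfolding H_def using abs_ge_self[of ?G] by auto
  have Hq: "norm (A_mat \<Omega> \<gamma>1 x *v q) + norm (A_mat \<Omega> \<gamma>2 x *v q) \<le> H x * norm q" if "x \<in> good_pts \<Omega> \<gamma>1" "x \<in> good_pts \<Omega> \<gamma>2" for x q
  proof (cases "x \<in> closure U")
    case False
    have "x \<in> \<Omega>" using that by (auto simp: good_pts_def diff_pts_def)
    thus ?thesis using False by (simp add: H_def A_mat_outside_closure(2)[OF g(1) O(1)] A_mat_outside_closure(2)[OF g(2) O(1)])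
  qed (use A_mat_sum_bound[OF gl O(1) that] in \<open>simp add: H_def\<close>)
  have usc: "\<exists>d>0. \<forall>x\<in>\<Omega>. norm (x - y) < d \<longrightarrow> H x \<le> H y" if y: "y \<in> \<Omega>" for y
  proof (cases "y \<in> closure U")
    case True
    hence "H x \<le> H y" if "x \<in> \<Omega>" for x using Gpos that unfolding H_def by (cases "\<Omega> \<subseteq> closure U") auto
    thus ?thesis using zero_less_one by blast
  next
    case False
    then obtain d where d: "d > 0" "ball y d \<subseteq> - closure U" using open_contains_ball[of "- closure U"] by auto
    have "H x \<le> H y" if "norm (x - y) < d" for x
    proof -
      have "x \<in> ball y d" using that by (simp add: dist_norm norm_minus_commute)
      thus ?thesis using d(2) False by (auto simp: H_def)
    qed
    thus ?thesis using d(1) by blast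
  qed
  let ?c = "2 * measure \<kappa> W + ?G * measure \<kappa> (W \<inter> closure U)"
  have Wb: "W \<in> sets borel" using W(1) by simp
  have "(\<integral>y. indicator W y * H y \<partial>\<kappa>) = (\<integral>y. 2 * indicator W y + ?G * indicator (W \<inter> closure U) y \<partial>\<kappa>)"
    by (intro Bochner_Integration.integral_cong refl) (auto simp: H_def indicator_def)
  also have "... = ?c"
  proof -
    have i: "integrable \<kappa> (indicat_real W)" "integrable \<kappa> (indicat_real (W \<inter> closure U))"
      using Wb \<kappa>(2) emeasure_finite by (auto intro!: integrable_real_indicator simp: less_top[symmetric])
    show ?thesis using i sets_eq_imp_space_eq[OF \<kappa>(2)] by simp
  qed
  finally have c: "(\<integral>y. indicator W y * H y \<partial>\<kappa>) = ?c" .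
  define I where "I \<gamma> \<phi> = div_pairing (\<gamma> ` W) (push \<Omega> \<gamma> u) \<phi>" for \<gamma> \<phi>
  have sub: "I \<gamma> \<phi> = div_pairing \<Omega> (push \<Omega> \<gamma> u) \<phi>" if "\<gamma> \<in> lip_trans \<Omega>" "test_field (\<gamma> ` W) \<phi>" for \<gamma> \<phi> unfolding I_def
  proof (rule integral_lebesgue_on_subset)
    show "\<gamma> ` W \<subseteq> \<Omega>" using lip_transD(10)[OF that(1)] W(2) by blast
    show "\<gamma> ` W \<in> sets lebesgue" using lip_trans_open_image[OF that(1) O(1) W] by simp
  qed (use O test_field_divergence(3)[OF that(2)] in auto)
  have II: "I \<gamma>1 \<phi>1 + I \<gamma>2 \<phi>2 \<le> ?c" if "test_field (\<gamma>1 ` W) \<phi>1" "test_field (\<gamma>2 ` W) \<phi>2" for \<phi>1 \<phi>2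
    unfolding sub[OF gl(1) that(1)] sub[OF gl(2) that(2)] c[symmetric]
    by (rule push_divergence_sum_le[OF gl O p u ibp Hq Hm H0 HB usc W that])
  have z: "test_field S (\<lambda>x. 0)" for S :: "(real^'n) set" by (simp add: test_field_def test_function_zero)
  \<comment> \<open>A bound for the sum of two pairings becomes a bound for the sum of two suprema:
    the first field is varied for a fixed second one, then the second. The zero field shows that the
    first supremum is finite.\<close>
  have 1: "TV (\<gamma>1 ` W) (push \<Omega> \<gamma>1 u) \<le> ereal (?c - I \<gamma>2 \<phi>2)" if "test_field (\<gamma>2 ` W) \<phi>2" for \<phi>2
    by (rule TV_least) (use II[OF _ that] in \<open>simp add: I_def algebra_simps\<close>)
  obtain t1 where t1: "TV (\<gamma>1 ` W) (push \<Omega> \<gamma>1 u) = ereal t1" using 1[OF z] TV_nonneg[of "\<gamma>1 ` W" "push \<Omega> \<gamma>1 u"] by (cases "TV (\<gamma>1 ` W) (push \<Omega> \<gamma>1 u)") auto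
  have "TV (\<gamma>2 ` W) (push \<Omega> \<gamma>2 u) \<le> ereal (?c - t1)"
  proof (rule TV_least)
    fix \<phi>2 assume "test_field (\<gamma>2 ` W) \<phi>2"
    from 1[OF this] show "ereal (div_pairing (\<gamma>2 ` W) (push \<Omega> \<gamma>2 u) \<phi>2) \<le> ereal (?c - t1)" by (simp add: t1 I_def[symmetric])
  qed
  thus "TV (\<gamma>1 ` W) (push \<Omega> \<gamma>1 u) + TV (\<gamma>2 ` W) (push \<Omega> \<gamma>2 u) \<le> ereal ?c" unfolding t1 by (cases "TV (\<gamma>2 ` W) (push \<Omega> \<gamma>2 u)") auto
qed

lemma lip_trans_borel_image:
  fixes \<gamma> :: "real^'n \<Rightarrow> real^'n"
  assumes g: "\<gamma> \<in> lip_trans \<Omega>" and O: "open \<Omega>" and B: "B \<in> sets borel" "B \<subseteq> \<Omega>"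
  shows "\<gamma> ` B \<in> sets borel"
proof -
  have "inv_into \<Omega> \<gamma> \<in> measurable (restrict_space borel \<Omega>) borel" by (rule borel_measurable_continuous_on_restrict[OF lip_transD(13)[OF g]])
  from measurable_sets[OF this B(1)] have "inv_into \<Omega> \<gamma> -` B \<inter> \<Omega> \<in> sets borel"
    using O by (subst (asm) sets_restrict_space_iff) (auto simp: space_restrict_space)
  moreover have "\<gamma> ` B = inv_into \<Omega> \<gamma> -` B \<inter> \<Omega>"
  proof (intro equalityI subsetI)
    fix y assume "y \<in> inv_into \<Omega> \<gamma> -` B \<inter> \<Omega>"
    thus "y \<in> \<gamma> ` B" using lip_transD(9)[OF g, of y] by (auto intro: image_eqI[of _ _ "inv_into \<Omega> \<gamma> y"])
  qed (use B(2) lip_transD(8,10)[OF g] in auto)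
  ultimately show ?thesis by simp
qed

text \<open>The estimate on \<Omega> itself makes the total variations of the push-forwards finite,
  so they have variation measures. In passing to Borel sets, outer regularity is applied to
  \<open>\<kappa>\<close>; on the left-hand side monotonicity does the work.\<close>

lemma push_variation_sum_le:
  fixes \<gamma>1 \<gamma>2 :: "real^'n \<Rightarrow> real^'n"
  assumes g: "\<gamma>1 \<in> lip_trans_on \<Omega> U" "\<gamma>2 \<in> lip_trans_on \<Omega> U" and O: "open \<Omega>" "bounded \<Omega>" "\<Omega> \<noteq> {}" and u: "u \<in> BV \<Omega>"
  obtains \<kappa> \<kappa>1 \<kappa>2 where "finite_measure \<kappa>" "finite_measure \<kappa>1" "finite_measure \<kappa>2"
    "sets \<kappa> = sets borel" "sets \<kappa>1 = sets borel" "sets \<kappa>2 = sets borel" "measure \<kappa> (- \<Omega>) = 0"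
    "\<And>A. A \<in> sets borel \<Longrightarrow> Dvar \<Omega> u A = ereal (measure \<kappa> A)"
    "\<And>A. A \<in> sets borel \<Longrightarrow> Dvar \<Omega> (push \<Omega> \<gamma>1 u) A = ereal (measure \<kappa>1 A)"
    "\<And>A. A \<in> sets borel \<Longrightarrow> Dvar \<Omega> (push \<Omega> \<gamma>2 u) A = ereal (measure \<kappa>2 A)"
    "push \<Omega> \<gamma>1 u \<in> L1 \<Omega>" "push \<Omega> \<gamma>2 u \<in> L1 \<Omega>"
    "\<And>B. B \<in> sets borel \<Longrightarrow> B \<subseteq> \<Omega> \<Longrightarrow> measure \<kappa>1 (\<gamma>1 ` B) + measure \<kappa>2 (\<gamma>2 ` B)
       \<le> 2 * measure \<kappa> B + G_dist \<Omega> \<gamma>1 \<gamma>2 * measure \<kappa> (B \<inter> closure U)"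
proof -
  have gl: "\<gamma>1 \<in> lip_trans \<Omega>" "\<gamma>2 \<in> lip_trans \<Omega>" using g by (auto simp: lip_trans_on_def)
  let ?G = "G_dist \<Omega> \<gamma>1 \<gamma>2"
  obtain \<kappa> \<sigma> where p: "polar \<Omega> \<kappa> \<sigma>" and D: "\<And>A. A \<in> sets borel \<Longrightarrow> Dvar \<Omega> u A = ereal (measure \<kappa> A)"
    and "\<And>W. open W \<Longrightarrow> W \<subseteq> \<Omega> \<Longrightarrow> TV W u = ereal (measure \<kappa> W)"
    and ibp: "\<And>\<phi> i. test_function \<Omega> \<phi> \<Longrightarrow> partial_pairing \<Omega> u i \<phi> = - (\<integral>x. \<phi> x * \<sigma> x $ i \<partial>\<kappa>)"
    by (rule BV_polar_full[OF O(1) u]) (rule that)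
  note uL = BV_L1[OF u]
  have le: "TV (\<gamma>1 ` W) (push \<Omega> \<gamma>1 u) + TV (\<gamma>2 ` W) (push \<Omega> \<gamma>2 u)
      \<le> ereal (2 * measure \<kappa> W + ?G * measure \<kappa> (W \<inter> closure U))" if "open W" "W \<subseteq> \<Omega>" for W by (rule TV_push_sum_le(1)[OF g O p uL ibp that])
  obtain C1 where "C1 > 0" and C1: "\<And>x. x \<in> diff_pts \<Omega> \<gamma>1 \<Longrightarrow> Jac \<gamma>1 x \<le> C1" using Jac_bound[OF gl(1) O(1)] by blast
  obtain C2 where "C2 > 0" and C2: "\<And>x. x \<in> diff_pts \<Omega> \<gamma>2 \<Longrightarrow> Jac \<gamma>2 x \<le> C2" using Jac_bound[OF gl(2) O(1)] by blast
  have L1: "push \<Omega> \<gamma>1 u \<in> L1 \<Omega>" by (rule push_L1(1)[OF gl(1) O(1,2) _ uL]) (rule C1)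
  have L2: "push \<Omega> \<gamma>2 u \<in> L1 \<Omega>" by (rule push_L1(1)[OF gl(2) O(1,2) _ uL]) (rule C2)
  have "TV \<Omega> (push \<Omega> \<gamma>1 u) + TV \<Omega> (push \<Omega> \<gamma>2 u) < \<infinity>" using le[OF O(1) order_refl] by (auto simp: lip_transD(7)[OF gl(1)] lip_transD(7)[OF gl(2)])
  hence T: "TV \<Omega> (push \<Omega> \<gamma>1 u) < \<infinity>" "TV \<Omega> (push \<Omega> \<gamma>2 u) < \<infinity>" by auto
  obtain \<kappa>1 \<sigma>1 where p1: "polar \<Omega> \<kappa>1 \<sigma>1" and D1: "\<And>A. A \<in> sets borel \<Longrightarrow> Dvar \<Omega> (push \<Omega> \<gamma>1 u) A = ereal (measure \<kappa>1 A)"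
    and T1: "\<And>W. open W \<Longrightarrow> W \<subseteq> \<Omega> \<Longrightarrow> TV W (push \<Omega> \<gamma>1 u) = ereal (measure \<kappa>1 W)"
    and "\<And>\<phi> i. test_function \<Omega> \<phi> \<Longrightarrow> partial_pairing \<Omega> (push \<Omega> \<gamma>1 u) i \<phi> = - (\<integral>x. \<phi> x * \<sigma>1 x $ i \<partial>\<kappa>1)"
    by (rule BV_polar_full[OF O(1) TV_finite_imp_BV[OF O(1,2) L1 T(1)]]) (rule that)
  obtain \<kappa>2 \<sigma>2 where p2: "polar \<Omega> \<kappa>2 \<sigma>2" and D2: "\<And>A. A \<in> sets borel \<Longrightarrow> Dvar \<Omega> (push \<Omega> \<gamma>2 u) A = ereal (measure \<kappa>2 A)"
    and T2: "\<And>W. open W \<Longrightarrow> W \<subseteq> \<Omega> \<Longrightarrow> TV W (push \<Omega> \<gamma>2 u) = ereal (measure \<kappa>2 W)"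
    and "\<And>\<phi> i. test_function \<Omega> \<phi> \<Longrightarrow> partial_pairing \<Omega> (push \<Omega> \<gamma>2 u) i \<phi> = - (\<integral>x. \<phi> x * \<sigma>2 x $ i \<partial>\<kappa>2)"
    by (rule BV_polar_full[OF O(1) TV_finite_imp_BV[OF O(1,2) L2 T(2)]]) (rule that)
  have f: "finite_measure \<kappa>" "finite_measure \<kappa>1" "finite_measure \<kappa>2" and s: "sets \<kappa> = sets borel" "sets \<kappa>1 = sets borel" "sets \<kappa>2 = sets borel"
    using p p1 p2 unfolding polar_def by auto
  have z: "measure \<kappa> (- \<Omega>) = 0" using p unfolding polar_def by (simp add: measure_def)
  interpret k: finite_measure \<kappa> by fact
  interpret k1: finite_measure \<kappa>1 by fact
  interpret k2: finite_measure \<kappa>2 by fact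
  have open_le: "measure \<kappa>1 (\<gamma>1 ` W) + measure \<kappa>2 (\<gamma>2 ` W) \<le> 2 * measure \<kappa> W + ?G * measure \<kappa> (W \<inter> closure U)"
    if W: "open W" "W \<subseteq> \<Omega>" for W
  proof -
    have "\<gamma>1 ` W \<subseteq> \<Omega>" "\<gamma>2 ` W \<subseteq> \<Omega>" using lip_transD(10)[OF gl(1)] lip_transD(10)[OF gl(2)] W(2) by blast+
    thus ?thesis
      using le[OF W] T1[OF lip_trans_open_image[OF gl(1) O(1) W]] T2[OF lip_trans_open_image[OF gl(2) O(1) W]] by simp
  qed
  have bor: "measure \<kappa>1 (\<gamma>1 ` B) + measure \<kappa>2 (\<gamma>2 ` B) \<le> 2 * measure \<kappa> B + ?G * measure \<kappa> (B \<inter> closure U)"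
    if B: "B \<in> sets borel" "B \<subseteq> \<Omega>" for B
  proof (rule field_le_epsilon)
    fix e :: real assume "e > 0"
    \<comment> \<open>Replacing \<open>B\<close> by the open set \<open>W\<close> costs at most
      \<open>2 * e'\<close> in the first term and \<open>|G| * e'\<close> in the second.\<close>
    define e' where "e' = e / (2 + \<bar>?G\<bar>)"
    have e': "e' > 0" "(2 + \<bar>?G\<bar>) * e' = e" using \<open>e > 0\<close> by (auto simp: e'_def)
    have "emeasure \<kappa> B = (INF V \<in> {V. B \<subseteq> V \<and> open V}. emeasure \<kappa> V)" by (rule outer_regular[OF s(1) _ B(1)]) (simp add: k.emeasure_finite)
    moreover have "emeasure \<kappa> B < emeasure \<kappa> B + ennreal e'"
      using e'(1) by (simp add: k.emeasure_eq_measure ennreal_plus[symmetric] ennreal_less_iff del: ennreal_plus)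
    ultimately obtain V where V: "B \<subseteq> V" "open V" "emeasure \<kappa> V < emeasure \<kappa> B + ennreal e'" by (auto simp: INF_less_iff)
    define W where "W = V \<inter> \<Omega>"
    have W: "open W" "W \<subseteq> \<Omega>" "B \<subseteq> W" "W \<subseteq> V" using V O B by (auto simp: W_def)
    have ms: "B \<in> sets \<kappa>" "W \<in> sets \<kappa>" "V \<in> sets \<kappa>" "closure U \<in> sets \<kappa>" using B W V s by auto
    have "measure \<kappa> W \<le> measure \<kappa> V" using ms W by (intro k.finite_measure_mono) auto
    moreover have "measure \<kappa> V < measure \<kappa> B + e'"
      using V(3) e'(1) by (simp add: k.emeasure_eq_measure ennreal_plus[symmetric] ennreal_less_iff del: ennreal_plus)
    ultimately have W2: "measure \<kappa> W \<le> measure \<kappa> B + e'" by simp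
    have "measure \<kappa> (W \<inter> closure U) \<le> measure \<kappa> ((B \<inter> closure U) \<union> (W - B))" using ms by (intro k.finite_measure_mono) auto
    also have "... \<le> measure \<kappa> (B \<inter> closure U) + measure \<kappa> (W - B)" using ms by (intro measure_subadditive) auto
    also have "measure \<kappa> (W - B) = measure \<kappa> W - measure \<kappa> B" using ms W by (intro k.finite_measure_Diff) auto
    finally have W3: "measure \<kappa> (W \<inter> closure U) \<le> measure \<kappa> (B \<inter> closure U) + e'" using W2 by simp
    have W4: "measure \<kappa> (B \<inter> closure U) \<le> measure \<kappa> (W \<inter> closure U)" using ms W by (intro k.finite_measure_mono) auto
    \<comment> \<open>For negative \<open>G\<close> the larger set even lowers this term.\<close>
    have "?G * measure \<kappa> (W \<inter> closure U) \<le> ?G * measure \<kappa> (B \<inter> closure U) + \<bar>?G\<bar> * e'"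
    proof (cases "?G \<ge> 0")
      case True thus ?thesis using mult_left_mono[OF W3, of ?G] by (simp add: distrib_left)
    next
      case False
      hence "?G * measure \<kappa> (W \<inter> closure U) \<le> ?G * measure \<kappa> (B \<inter> closure U)" using W4 by (intro mult_left_mono_neg) auto
      thus ?thesis using e'(1) by (simp add: add_increasing2)
    qed
    moreover have "measure \<kappa>1 (\<gamma>1 ` B) \<le> measure \<kappa>1 (\<gamma>1 ` W)" "measure \<kappa>2 (\<gamma>2 ` B) \<le> measure \<kappa>2 (\<gamma>2 ` W)"
      using W s lip_trans_open_image[OF gl(1) O(1) W(1,2)] lip_trans_open_image[OF gl(2) O(1) W(1,2)]
      by (auto intro!: k1.finite_measure_mono k2.finite_measure_mono)
    ultimately show "measure \<kappa>1 (\<gamma>1 ` B) + measure \<kappa>2 (\<gamma>2 ` B) \<le> 2 * measure \<kappa> B + ?G * measure \<kappa> (B \<inter> closure U) + e"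
      using open_le[OF W(1,2)] W2 e'(2) by (simp add: distrib_right)
  qed
  show ?thesis by (rule that[OF f s z D D1 D2 L1 L2 bor])
qed

text \<open>With \<open>p\<close> the projection along \<open>z\<close>, the graph is the zero set
  of the continuous function \<open>z \<bullet> x - f (p x)\<close> on the open set of points
  projected into \<open>V\<close>. It is closed relative to an open set.\<close>

lemma lipschitz_graph_borel:
  fixes \<Gamma> :: "(real^'n) set"
  assumes "lipschitz_graph \<Gamma>" shows "\<Gamma> \<in> sets borel"
proof -
  obtain z V f L where z: "norm z = 1" and V: "openin (top_of_set {v. z \<bullet> v = 0}) V" and f: "L-lipschitz_on V (f :: real^'n \<Rightarrow> real)"
    and G: "\<Gamma> = (\<lambda>v. v + f v *\<^sub>R z) ` V" using assms unfolding lipschitz_graph_def by blast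
  obtain T where T: "open T" "V = {v. z \<bullet> v = 0} \<inter> T" using V by (auto simp: openin_open)
  have zz: "z \<bullet> z = 1" using z by (simp add: norm_eq_1)
  let ?p = "\<lambda>x. x - (z \<bullet> x) *\<^sub>R z"
  have pz: "z \<bullet> ?p x = 0" for x by (simp add: inner_diff_right zz)
  have pc: "continuous_on UNIV ?p" by (intro continuous_intros)
  define S where "S = ?p -` T"
  have S: "open S" unfolding S_def by (rule open_vimage[OF T(1) pc])
  have pV: "?p x \<in> V" if "x \<in> S" for x using that pz T(2) by (simp add: S_def)
  have "continuous_on S (\<lambda>x. f (?p x))" by (rule continuous_on_compose2[OF lipschitz_on_continuous_on[OF f] continuous_on_subset[OF pc]]) (use pV in auto)
  hence "continuous_on S (\<lambda>x. z \<bullet> x - f (?p x))" by (intro continuous_intros)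
  hence "closedin (top_of_set S) {x \<in> S. z \<bullet> x - f (?p x) = 0}" by (rule continuous_closedin_preimage_constant)
  then obtain C where C: "closed C" "{x \<in> S. z \<bullet> x - f (?p x) = 0} = S \<inter> C" by (auto simp: closedin_closed)
  have "\<Gamma> = {x \<in> S. z \<bullet> x - f (?p x) = 0}"
  proof (intro equalityI subsetI)
    fix x assume "x \<in> \<Gamma>"
    then obtain v where v: "v \<in> V" "x = v + f v *\<^sub>R z" unfolding G by blast
    have zx: "z \<bullet> x = f v" using v T(2) zz by (simp add: inner_add_right)
    hence "?p x = v" using v(2) by simp
    thus "x \<in> {x \<in> S. z \<bullet> x - f (?p x) = 0}" using v(1) T(2) zx by (simp add: S_def)
  next
    fix x assume x: "x \<in> {x \<in> S. z \<bullet> x - f (?p x) = 0}"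
    hence "x = ?p x + f (?p x) *\<^sub>R z" by simp
    thus "x \<in> \<Gamma>" unfolding G using pV[of x] x by blast
  qed
  thus ?thesis using C S by simp
qed

text \<open>The two images of \<Gamma> \<inter> \<Omega> and \<Omega> - \<Gamma> are disjoint Borel
  sets with union \<Omega>, so each pushed variation splits exactly; the estimate is used on
  \<Omega> - \<Gamma>. The values on the empty set are recorded for the case of empty \<Gamma>,
  which is the condition without a graph.\<close>

lemma TV_push_separably_le:
  fixes \<gamma>1 \<gamma>2 :: "real^'n \<Rightarrow> real^'n"
  assumes O: "open \<Omega>" "bounded \<Omega>" "\<Omega> \<noteq> {}" and a: "\<alpha> > 0" and u: "u \<in> BV \<Omega>"
    and g: "\<gamma>1 \<in> lip_trans_on \<Omega> U" "\<gamma>2 \<in> lip_trans_on \<Omega> U" and Gb: "\<Gamma> \<in> sets borel"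
  shows "ereal \<alpha> * TV \<Omega> (push \<Omega> \<gamma>1 u) + ereal \<alpha> * TV \<Omega> (push \<Omega> \<gamma>2 u)
      \<le> 2 * (ereal \<alpha> * TV \<Omega> u) + ereal (\<alpha> * T_dist \<Omega> \<gamma>1 \<gamma>2) * Dvar \<Omega> u (closure U - \<Gamma>)
        + ereal \<alpha> * (Dvar \<Omega> (push \<Omega> \<gamma>1 u) (\<gamma>1 ` (\<Gamma> \<inter> \<Omega>)) + Dvar \<Omega> (push \<Omega> \<gamma>2 u) (\<gamma>2 ` (\<Gamma> \<inter> \<Omega>)) - 2 * Dvar \<Omega> u \<Gamma>)"
    and "Dvar \<Omega> u {} = 0" "Dvar \<Omega> (push \<Omega> \<gamma>1 u) {} = 0" "Dvar \<Omega> (push \<Omega> \<gamma>2 u) {} = 0"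
proof -
  have gl: "\<gamma>1 \<in> lip_trans \<Omega>" "\<gamma>2 \<in> lip_trans \<Omega>" using g by (auto simp: lip_trans_on_def)
  obtain \<kappa> \<kappa>1 \<kappa>2 where f: "finite_measure \<kappa>" "finite_measure \<kappa>1" "finite_measure \<kappa>2"
    and s: "sets \<kappa> = sets borel" "sets \<kappa>1 = sets borel" "sets \<kappa>2 = sets borel" and k0: "measure \<kappa> (- \<Omega>) = 0"
    and D: "\<And>A. A \<in> sets borel \<Longrightarrow> Dvar \<Omega> u A = ereal (measure \<kappa> A)"
    and D1: "\<And>A. A \<in> sets borel \<Longrightarrow> Dvar \<Omega> (push \<Omega> \<gamma>1 u) A = ereal (measure \<kappa>1 A)"
    and D2: "\<And>A. A \<in> sets borel \<Longrightarrow> Dvar \<Omega> (push \<Omega> \<gamma>2 u) A = ereal (measure \<kappa>2 A)"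
    and L: "push \<Omega> \<gamma>1 u \<in> L1 \<Omega>" "push \<Omega> \<gamma>2 u \<in> L1 \<Omega>"
    and le: "\<And>B. B \<in> sets borel \<Longrightarrow> B \<subseteq> \<Omega> \<Longrightarrow> measure \<kappa>1 (\<gamma>1 ` B) + measure \<kappa>2 (\<gamma>2 ` B)
       \<le> 2 * measure \<kappa> B + G_dist \<Omega> \<gamma>1 \<gamma>2 * measure \<kappa> (B \<inter> closure U)" by (rule push_variation_sum_le[OF g O u]) (rule that)
  show "Dvar \<Omega> u {} = 0" "Dvar \<Omega> (push \<Omega> \<gamma>1 u) {} = 0" "Dvar \<Omega> (push \<Omega> \<gamma>2 u) {} = 0" by (simp_all add: D D1 D2)
  interpret k: finite_measure \<kappa> by fact
  interpret k1: finite_measure \<kappa>1 by fact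
  interpret k2: finite_measure \<kappa>2 by fact
  have Ob: "\<Omega> \<in> sets borel" using O by simp
  have restr: "measure \<kappa> (\<Omega> \<inter> A) = measure \<kappa> A" if "A \<in> sets borel" for A
  proof -
    have "measure \<kappa> (\<Omega> \<inter> A) \<le> measure \<kappa> A" using that s by (intro k.finite_measure_mono) auto
    moreover have "measure \<kappa> A \<le> measure \<kappa> ((\<Omega> \<inter> A) \<union> - \<Omega>)" using Ob s that by (intro k.finite_measure_mono) auto
    moreover have "measure \<kappa> ((\<Omega> \<inter> A) \<union> - \<Omega>) \<le> measure \<kappa> (\<Omega> \<inter> A) + measure \<kappa> (- \<Omega>)" using Ob s that by (intro measure_subadditive) auto
    ultimately show ?thesis using k0 by simp
  qed
  let ?S = "\<Gamma> \<inter> \<Omega>" and ?B = "\<Omega> - \<Gamma>"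
  have b: "?S \<in> sets borel" "?B \<in> sets borel" "?S \<subseteq> \<Omega>" "?B \<subseteq> \<Omega>" "\<Omega> = ?S \<union> ?B" using Gb Ob by auto
  have split: "measure M \<Omega> = measure M (\<gamma> ` ?S) + measure M (\<gamma> ` ?B)"
    if "finite_measure M" "sets M = sets borel" "\<gamma> \<in> lip_trans \<Omega>" for M and \<gamma> :: "real^'n \<Rightarrow> real^'n"
  proof -
    have "\<gamma> ` ?S \<inter> \<gamma> ` ?B = {}" using inj_on_image_Int[OF lip_transD(6)[OF that(3)] b(3,4)] by auto
    moreover have "\<gamma> ` ?S \<union> \<gamma> ` ?B = \<Omega>" using lip_transD(7)[OF that(3)] b(5) by (metis image_Un)
    ultimately show ?thesis
      using finite_measure.finite_measure_Union[OF that(1), of "\<gamma> ` ?S" "\<gamma> ` ?B"] that(2) lip_trans_borel_image[OF that(3) O(1) b(1,3)] lip_trans_borel_image[OF that(3) O(1) b(2,4)] by simp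
  qed
  have "measure \<kappa> \<Omega> = measure \<kappa> ?S + measure \<kappa> ?B"
    using k.finite_measure_Union[of ?S ?B] b s by (metis Diff_disjoint Int_Diff inf_commute inf_left_commute Int_empty_right)
  moreover have "measure \<kappa> ?S = measure \<kappa> \<Gamma>" using restr[OF Gb] by (simp add: Int_commute)
  moreover have "?B \<inter> closure U = \<Omega> \<inter> (closure U - \<Gamma>)" by blast
  hence eB: "measure \<kappa> (?B \<inter> closure U) = measure \<kappa> (closure U - \<Gamma>)" using restr[of "closure U - \<Gamma>"] Gb by simp
  moreover have "G_dist \<Omega> \<gamma>1 \<gamma>2 * measure \<kappa> (closure U - \<Gamma>) \<le> T_dist \<Omega> \<gamma>1 \<gamma>2 * measure \<kappa> (closure U - \<Gamma>)"
    by (intro mult_right_mono T_dist_ge_G_dist[OF gl O(1,3)]) simp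
  ultimately have "measure \<kappa>1 \<Omega> + measure \<kappa>2 \<Omega> \<le> 2 * measure \<kappa> \<Omega> + T_dist \<Omega> \<gamma>1 \<gamma>2 * measure \<kappa> (closure U - \<Gamma>)
      + (measure \<kappa>1 (\<gamma>1 ` ?S) + measure \<kappa>2 (\<gamma>2 ` ?S) - 2 * measure \<kappa> \<Gamma>)"
    using le[OF b(2,4), unfolded eB] split[OF f(2) s(2) gl(1)] split[OF f(3) s(3) gl(2)] by linarith
  hence "\<alpha> * (measure \<kappa>1 \<Omega> + measure \<kappa>2 \<Omega>) \<le> \<alpha> * (2 * measure \<kappa> \<Omega> + T_dist \<Omega> \<gamma>1 \<gamma>2 * measure \<kappa> (closure U - \<Gamma>)
      + (measure \<kappa>1 (\<gamma>1 ` ?S) + measure \<kappa>2 (\<gamma>2 ` ?S) - 2 * measure \<kappa> \<Gamma>))" using a by (intro mult_left_mono) auto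
  moreover have two: "(2::ereal) = ereal 2" by simp
  ultimately show "ereal \<alpha> * TV \<Omega> (push \<Omega> \<gamma>1 u) + ereal \<alpha> * TV \<Omega> (push \<Omega> \<gamma>2 u)
      \<le> 2 * (ereal \<alpha> * TV \<Omega> u) + ereal (\<alpha> * T_dist \<Omega> \<gamma>1 \<gamma>2) * Dvar \<Omega> u (closure U - \<Gamma>)
        + ereal \<alpha> * (Dvar \<Omega> (push \<Omega> \<gamma>1 u) (\<gamma>1 ` (\<Gamma> \<inter> \<Omega>)) + Dvar \<Omega> (push \<Omega> \<gamma>2 u) (\<gamma>2 ` (\<Gamma> \<inter> \<Omega>)) - 2 * Dvar \<Omega> u \<Gamma>)"
    unfolding TV_eq_Dvar[OF O(1,2) L(1)] TV_eq_Dvar[OF O(1,2) L(2)] TV_eq_Dvar[OF O(1,2) BV_L1[OF u]] two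
      D[OF Ob] D1[OF Ob] D2[OF Ob] D[OF Gb] D1[OF lip_trans_borel_image[OF gl(1) O(1) b(1,3)]] D2[OF lip_trans_borel_image[OF gl(2) O(1) b(1,3)]]
    using Gb by (simp add: D algebra_simps)
qed

lemma TV_double_lipschitz_comparable:
  fixes \<Omega> :: "(real^'n) set"
  assumes O: "open \<Omega>" "bounded \<Omega>" "\<Omega> \<noteq> {}" and a: "\<alpha> > 0"
  shows "double_lipschitz_comparable \<Omega> (\<lambda>u. ereal \<alpha> * TV \<Omega> u)"
  unfolding double_lipschitz_comparable_def
proof (intro exI[of _ \<alpha>] ballI allI impI, elim conjE)
  fix u U and \<gamma>1 \<gamma>2 :: "real^'n \<Rightarrow> real^'n"
  assume *: "u \<in> BV \<Omega>" "\<gamma>1 \<in> lip_trans_on \<Omega> U" "\<gamma>2 \<in> lip_trans_on \<Omega> U"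
  show "ereal \<alpha> * TV \<Omega> (push \<Omega> \<gamma>1 u) + ereal \<alpha> * TV \<Omega> (push \<Omega> \<gamma>2 u)
      \<le> 2 * (ereal \<alpha> * TV \<Omega> u) + ereal (\<alpha> * T_dist \<Omega> \<gamma>1 \<gamma>2) * Dvar \<Omega> u (closure U)" using TV_push_separably_le[OF O a * sets.empty_sets] by simp
qed

lemma TV_separably_double_lipschitz_comparable:
  fixes \<Omega> :: "(real^'n) set"
  assumes O: "open \<Omega>" "bounded \<Omega>" "\<Omega> \<noteq> {}" and a: "\<alpha> > 0"
  shows "separably_double_lipschitz_comparable \<Omega> (\<lambda>u. ereal \<alpha> * TV \<Omega> u)"
  unfolding separably_double_lipschitz_comparable_def
  by (intro exI[of _ \<alpha>] ballI allI impI, elim conjE) (rule TV_push_separably_le(1)[OF O a _ _ _ lipschitz_graph_borel])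

subsection \<open>Truncation\<close>

text \<open>The difference quotients along \<open>h\<close> are already ordered in absolute
  value.\<close>

lemma has_derivative_abs_mono:
  fixes f g :: "'a::real_normed_vector \<Rightarrow> real"
  assumes f: "(f has_derivative D) (at x)" and g: "(g has_derivative E) (at x)" and le: "\<And>y. \<bar>f y - f x\<bar> \<le> \<bar>g y - g x\<bar>"
  shows "\<bar>D h\<bar> \<le> \<bar>E h\<bar>"
proof -
  have lim: "((\<lambda>t. (k (x + t *\<^sub>R h) - k x) / t) \<longlongrightarrow> L h) (at 0)" if "(k has_derivative L) (at x)" for k :: "'a \<Rightarrow> real" and L
  proof -
    have "((\<lambda>t. k (x + t *\<^sub>R h)) has_derivative (\<lambda>s. L (s *\<^sub>R h))) (at 0)"
      by (rule has_derivative_compose[of "\<lambda>t. x + t *\<^sub>R h" "\<lambda>s. s *\<^sub>R h"]) (auto intro!: derivative_eq_intros that)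
    hence "((\<lambda>t. k (x + t *\<^sub>R h)) has_real_derivative L h) (at 0)"
      using has_derivative_linear[OF that] by (simp add: has_field_derivative_def linear_scale mult_commute_abs)
    thus ?thesis by (simp add: DERIV_def)
  qed
  show ?thesis
  proof (rule tendsto_le[OF _ tendsto_rabs[OF lim[OF g]] tendsto_rabs[OF lim[OF f]]])
    show "eventually (\<lambda>t. \<bar>(f (x + t *\<^sub>R h) - f x) / t\<bar> \<le> \<bar>(g (x + t *\<^sub>R h) - g x) / t\<bar>) (at 0)"
      using le by (intro always_eventually allI) (simp add: abs_divide divide_right_mono)
  qed simp
qed

definition truncate :: "real \<Rightarrow> real \<Rightarrow> real" where "truncate M t = max (- M) (min M t)"

lemma truncate_lipschitz: "\<bar>truncate M s - truncate M t\<bar> \<le> \<bar>s - t\<bar>" by (auto simp: truncate_def max_def min_def)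

lemma truncate_measurable[measurable]: "truncate M \<in> borel_measurable borel" unfolding truncate_def by measurable

lemma truncate_L1:
  assumes "u \<in> L1 \<Omega>" "M \<ge> 0" shows "(\<lambda>x. truncate M (u x)) \<in> L1 \<Omega>"
proof -
  have u[measurable]: "integrable (lebesgue_on \<Omega>) u" using assms by (simp add: L1_def)
  have "\<bar>truncate M t\<bar> \<le> \<bar>t\<bar>" for t using assms(2) by (auto simp: truncate_def max_def min_def)
  hence "integrable (lebesgue_on \<Omega>) (\<lambda>x. truncate M (u x))"
    using u by (intro Bochner_Integration.integrable_bound[OF u]) (auto intro: measurable_compose[OF _ truncate_measurable])
  thus ?thesis by (simp add: L1_def)
qed

text \<open>For a mollification \<open>w\<close> on an inner set, truncation is a Lipschitz map with
  constant 1, so the gradient does not grow in norm, and \<open>TV_conv_le\<close> compares with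
  \<open>u\<close>. For a fixed test field the pairing passes to the limit, because truncation is
  also continuous in L1.\<close>

lemma TV_truncate:
  fixes u :: "real^'n \<Rightarrow> real"
  assumes O: "open \<Omega>" "bounded \<Omega>" "\<Omega> \<noteq> {}" and u: "u \<in> L1 \<Omega>" and M: "M \<ge> 0"
  shows "TV \<Omega> (\<lambda>x. truncate M (u x)) \<le> TV \<Omega> u"
proof (cases "TV \<Omega> u")
  case (real c)
  show ?thesis
  proof (rule TV_least)
    fix \<phi> assume \<phi>: "test_field \<Omega> \<phi>"
    obtain K0 where K0: "compact K0" "K0 \<subseteq> \<Omega>" "\<And>x. x \<notin> K0 \<Longrightarrow> \<phi> x = 0" using test_field_support[OF \<phi>] by blast
    obtain x0 where x0: "x0 \<in> \<Omega>" using O(3) by blast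
    \<comment> \<open>The additional point makes the inner set \<open>W\<close> nonempty, even if
      the test field vanishes.\<close>
    define K where "K = insert x0 K0"
    have K: "compact K" "K \<subseteq> \<Omega>" using K0 x0 by (auto simp: K_def)
    have "\<Omega> \<noteq> UNIV" using O(2) not_bounded_UNIV by blast
    then obtain d where d: "d > 0" "\<And>x. x \<in> K \<Longrightarrow> infdist x (- \<Omega>) > d" using compact_subset_infdist[OF K O(1)] by blast
    define W where "W = {x. d < infdist x (- \<Omega>)}"
    have W: "open W" unfolding W_def by (intro open_Collect_less continuous_intros)
    have sub: "x \<in> \<Omega>" if "y \<in> W" "norm (x - y) \<le> d" for x y using infdist_less_imp_ball that by (auto simp: W_def)
    have WO: "W \<subseteq> \<Omega>" using sub d(1) by fastforce
    have Wb: "bounded W" using O(2) WO by (rule bounded_subset)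
    have KW: "K \<subseteq> W" using d(2) by (auto simp: W_def)
    hence W0: "W \<noteq> {}" by (auto simp: K_def)
    have \<phi>W: "test_field W \<phi>" unfolding test_field_def
    proof (intro conjI allI)
      show "test_function W (\<lambda>x. \<phi> x $ i)" for i
      proof (rule test_functionI[OF _ K(1) KW])
        show "C_k k (\<lambda>x. \<phi> x $ i)" for k using \<phi> unfolding test_field_def test_function_def by blast
        show "\<phi> x $ i = 0" if "x \<notin> K" for x using K0(3)[of x] that by (simp add: K_def)
      qed
      show "norm (\<phi> x) \<le> 1" for x using \<phi> unfolding test_field_def by blast
    qed
    obtain e and r :: "nat \<Rightarrow> real^'n \<Rightarrow> real" where ed: "\<And>n. e n \<le> d" and elim: "e \<longlonglongrightarrow> 0" and r: "\<And>n. mollifier (e n) (r n)"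
    using shrinking_mollifiers[OF d(1)] by blast
    have rs: "smooth_ball (e n) (r n)" for n using r unfolding mollifier_def by auto
    obtain v where v: "integrable lborel v" "\<And>x. x \<notin> \<Omega> \<Longrightarrow> v x = 0" "AE x in lebesgue_on \<Omega>. u x = v x" "v \<in> L1 \<Omega>"
      using L1_borel_representative[OF u O(1)] by blast
    define w where "w n = conv (r n) v" for n
    note appr = conv_L1_approximation[OF O(1) u v(1,3) r elim, folded w_def]
    have bound: "(\<integral>x. truncate M (w n x) * divergence \<phi> x \<partial>lebesgue_on \<Omega>) \<le> c" for n
    proof -
      let ?D = "\<lambda>x. gradient (w n) x"
      obtain L where L: "L-lipschitz_on UNIV (w n)" using conv_lipschitz[OF rs v(1)] unfolding w_def by blast
      have "L-lipschitz_on W (\<lambda>x. truncate M (w n x))" using lipschitz_onD[OF L] lipschitz_on_nonneg[OF L]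
        by (intro lipschitz_onI) (auto simp: dist_real_def intro: order_trans[OF truncate_lipschitz])
      then obtain q where q: "q \<in> borel_measurable borel" "\<And>x i. \<bar>q x $ i\<bar> \<le> L"
        "AE x in lborel. x \<in> W \<longrightarrow> ((\<lambda>x. truncate M (w n x)) has_derivative (\<lambda>h. \<Sum>i\<in>UNIV. h $ i * q x $ i)) (at x)"
        "integrable (lebesgue_on W) (\<lambda>y. indicator {y. \<phi> y \<noteq> 0} y * norm (q y))"
        "(\<integral>y. truncate M (w n y) * divergence \<phi> y \<partial>lebesgue_on W) \<le> (\<integral>y. indicator {y. \<phi> y \<noteq> 0} y * norm (q y) \<partial>lebesgue_on W)"
        by (rule lipschitz_divergence_le[OF _ W Wb W0 \<phi>W]) (rule that)
      have wD: "(w n has_derivative (\<lambda>h. h \<bullet> ?D x)) (at x)" for x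
        using conv_has_derivative[OF rs v(1), of n x] unfolding w_def partial_deriv_conv[OF rs v(1)] by (simp add: inner_vec_def)
      \<comment> \<open>The comparison of derivatives is used in the direction \<open>q x\<close>,
        where one of them is the square of the norm.\<close>
      have qD: "norm (q x) \<le> norm (?D x)" if "((\<lambda>x. truncate M (w n x)) has_derivative (\<lambda>h. \<Sum>i\<in>UNIV. h $ i * q x $ i)) (at x)" for x
      proof -
        have "((\<lambda>x. truncate M (w n x)) has_derivative (\<lambda>h. h \<bullet> q x)) (at x)" using that by (simp add: inner_vec_def)
        hence "\<bar>q x \<bullet> q x\<bar> \<le> \<bar>q x \<bullet> ?D x\<bar>" by (rule has_derivative_abs_mono[OF _ wD truncate_lipschitz])
        also have "... \<le> norm (q x) * norm (?D x)" by (rule Cauchy_Schwarz_ineq2)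
        finally have "norm (q x) * norm (q x) \<le> norm (q x) * norm (?D x)" by (simp add: power2_norm_eq_inner[symmetric] power2_eq_square)
        thus ?thesis by (cases "q x = 0") auto
      qed
      have Dm[measurable]: "?D \<in> borel_measurable borel" unfolding w_def by (rule conv_gradient_bounds(1)[OF rs v(1)])
      obtain B where B: "\<And>x. norm (?D x) \<le> B" using conv_gradient_bounds(2)[OF rs v(1)] unfolding w_def by blast
      have Wbo[measurable]: "W \<in> sets borel" using W by simp
      have iW: "integrable lborel (\<lambda>x. indicator W x * norm (?D x))"
      proof -
        have "integrable lborel (indicat_real W)" using W emeasure_bounded_finite[OF Wb] by (intro integrable_real_indicator) auto
        from integrable_bounded_mult[OF this, of "\<lambda>x. norm (?D x)" B] B show ?thesis by (simp add: mult.commute)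
      qed
      have "(\<integral>x. truncate M (w n x) * divergence \<phi> x \<partial>lebesgue_on \<Omega>) = (\<integral>x. truncate M (w n x) * divergence \<phi> x \<partial>lebesgue_on W)"
        by (rule integral_lebesgue_on_subset[symmetric]) (use W O WO test_field_divergence(3)[OF \<phi>W] in auto)
      also note q(5)
      also have "(\<integral>y. indicator {y. \<phi> y \<noteq> 0} y * norm (q y) \<partial>lebesgue_on W) \<le> (\<integral>y. indicator W y * norm (?D y) \<partial>lebesgue_on W)"
      proof (rule integral_mono_AE[OF q(4)])
        show "integrable (lebesgue_on W) (\<lambda>x. indicator W x * norm (?D x))" using W iW by (intro integrable_lebesgue_on_lborel) auto
        have "AE x in lebesgue. x \<in> W \<longrightarrow> ((\<lambda>x. truncate M (w n x)) has_derivative (\<lambda>h. \<Sum>i\<in>UNIV. h $ i * q x $ i)) (at x)" using q(3) by (rule AE_completion)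
        hence "AE x in lebesgue. x \<in> W \<longrightarrow> indicator {y. \<phi> y \<noteq> 0} x * norm (q x) \<le> indicator W x * norm (?D x)"
          by eventually_elim (use qD in \<open>auto simp: indicator_def\<close>)
        thus "AE x in lebesgue_on W. indicator {y. \<phi> y \<noteq> 0} x * norm (q x) \<le> indicator W x * norm (?D x)" using W by (subst AE_restrict_space_iff) auto
      qed
      also have "... = (\<integral>y. indicator W y * norm (?D y) \<partial>lborel)" by (rule integral_lebesgue_on_lborel) (use W in auto)
      finally have 1: "ereal (\<integral>x. truncate M (w n x) * divergence \<phi> x \<partial>lebesgue_on \<Omega>) \<le> TV W (w n)" unfolding w_def TV_conv_eq[OF r v(1) W Wb] by simp
      also have "TV W (w n) \<le> TV \<Omega> v" unfolding w_def by (rule TV_conv_le[OF r v(1,2) O(1) W sub]) (use ed in \<open>auto intro: order_trans\<close>)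
      also have "... = ereal c" using TV_cong_AE[OF u v(4,3)] real by simp
      finally show ?thesis by simp
    qed
    have "(\<lambda>n. \<integral>x. truncate M (w n x) * divergence \<phi> x \<partial>lebesgue_on \<Omega>) \<longlonglongrightarrow> (\<integral>x. truncate M (u x) * divergence \<phi> x \<partial>lebesgue_on \<Omega>)"
    proof (rule L1_divergence_tendsto[OF truncate_L1[OF appr(1) M] truncate_L1[OF u M] _ \<phi>])
      show "(\<lambda>n. norm_L1 \<Omega> (\<lambda>x. truncate M (w n x) - truncate M (u x))) \<longlonglongrightarrow> 0"
      proof (rule tendsto_sandwich[OF _ _ tendsto_const appr(2)])
        show "\<forall>\<^sub>F n in sequentially. 0 \<le> norm_L1 \<Omega> (\<lambda>x. truncate M (w n x) - truncate M (u x))" by (simp add: norm_L1_def)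
        have "norm_L1 \<Omega> (\<lambda>x. truncate M (w n x) - truncate M (u x)) \<le> norm_L1 \<Omega> (\<lambda>x. w n x - u x)" for n
          unfolding norm_L1_def using appr(1)[of n] u truncate_L1[OF appr(1) M, of n] truncate_L1[OF u M]
          by (intro integral_mono truncate_lipschitz) (auto simp: L1_def)
        thus "\<forall>\<^sub>F n in sequentially. norm_L1 \<Omega> (\<lambda>x. truncate M (w n x) - truncate M (u x)) \<le> norm_L1 \<Omega> (\<lambda>x. w n x - u x)" by simp
      qed
    qed
    hence "(\<integral>x. truncate M (u x) * divergence \<phi> x \<partial>lebesgue_on \<Omega>) \<le> c" by (rule LIMSEQ_le_const2) (use bound in blast)
    thus "ereal (\<integral>x. truncate M (u x) * divergence \<phi> x \<partial>lebesgue_on \<Omega>) \<le> TV \<Omega> u" using real by simp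
  qed
qed (use TV_nonneg[of \<Omega> u] in auto)

section \<open>Maximum principle for minimisers\<close>

lemma p_increasing_strict:
  assumes p: "p_increasing p \<phi>" and 0: "\<phi> 0 = 0"
  shows "\<phi> x < \<infinity>" "\<bar>x\<bar> < \<bar>y\<bar> \<Longrightarrow> enn2real (\<phi> x) < enn2real (\<phi> y)" "enn2real (\<phi> \<bar>x\<bar>) = enn2real (\<phi> x)"
proof -
  \<comment> \<open>Comparison with 0 gives finiteness. For \<open>|x| < |y|\<close> and nonzero
    \<open>x\<close> the right-hand side is negative, and for \<open>|x| = |y|\<close> it is 0 in
    both directions, which gives symmetry.\<close>
  obtain C where C: "C > 0" "\<And>x y. enn2ereal (\<phi> x) - enn2ereal (\<phi> y) \<le> ereal (C * (\<bar>x\<bar> - \<bar>y\<bar>) * (if p = 1 then 1 else \<bar>x\<bar> powr (p - 1)))"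
    using p unfolding p_increasing_def by blast
  show fin: "\<phi> x < \<infinity>" for x using C(2)[of x 0] 0 by (cases "\<phi> x") (auto simp: zero_ennreal.rep_eq)
  define q where "q x = (if p = 1 then 1 else \<bar>x\<bar> powr (p - 1))" for x :: real
  have le: "enn2real (\<phi> x) - enn2real (\<phi> y) \<le> C * (\<bar>x\<bar> - \<bar>y\<bar>) * q x" for x y
  proof -
    obtain a b where ab: "a \<ge> 0" "b \<ge> 0" "\<phi> x = ennreal a" "\<phi> y = ennreal b" using fin[of x] fin[of y] by (cases "\<phi> x"; cases "\<phi> y") auto
    thus ?thesis using C(2)[of x y] by (simp add: q_def enn2ereal_ennreal)
  qed
  have strict: "enn2real (\<phi> x) < enn2real (\<phi> y)" if "\<bar>x\<bar> < \<bar>y\<bar>" "x \<noteq> 0" for x y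
  proof -
    have "C * (\<bar>x\<bar> - \<bar>y\<bar>) < 0" "q x > 0" using that C(1) by (auto simp: q_def mult_less_0_iff)
    hence "C * (\<bar>x\<bar> - \<bar>y\<bar>) * q x < 0" by (rule mult_neg_pos)
    thus ?thesis using le[of x y] by simp
  qed
  show "enn2real (\<phi> x) < enn2real (\<phi> y)" if "\<bar>x\<bar> < \<bar>y\<bar>"
  proof (cases "x = 0")
    case True
    \<comment> \<open>At \<open>x = 0\<close> the factor \<open>|x| powr (p - 1)\<close> may vanish,
      so strictness is obtained between \<open>y / 2\<close> and \<open>y\<close>.\<close>
    have "0 \<le> enn2real (\<phi> (y / 2))" by simp
    also have "... < enn2real (\<phi> y)" by (rule strict) (use that True in auto)
    finally show ?thesis using True 0 by simp
  qed (use strict that in auto)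
  show "enn2real (\<phi> \<bar>x\<bar>) = enn2real (\<phi> x)" using le[of "\<bar>x\<bar>" x] le[of x "\<bar>x\<bar>"] by simp
qed

lemma solution_Linf_bound:
  fixes u f :: "real^'n \<Rightarrow> real"
  assumes O: "open \<Omega>" "bounded \<Omega>" "\<Omega> \<noteq> {}" and a: "\<alpha> > 0" and p: "p_increasing p \<phi>" and 0: "\<phi> 0 = 0"
    and f: "f \<in> borel_measurable (lebesgue_on \<Omega>)" and sol: "solution \<Omega> \<phi> (\<lambda>u. ereal \<alpha> * TV \<Omega> u) f u"
  shows "norm_Linf \<Omega> u \<le> norm_Linf \<Omega> f"
proof (cases "norm_Linf \<Omega> f = \<infinity>")
  case False
  let ?M = "lebesgue_on \<Omega>"
  note [measurable] = f
  have aeF: "AE x in ?M. ereal \<bar>f x\<bar> \<le> norm_Linf \<Omega> f" unfolding norm_Linf_def by (rule esssup_AE)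
  \<comment> \<open>A nonempty open set has positive measure; this excludes the essential supremum
    \<open>- \<infinity>\<close> and makes \<open>M\<close> a nonnegative real.\<close>
  have "\<exists>x. ereal \<bar>f x\<bar> \<le> norm_Linf \<Omega> f"
  proof (rule ccontr)
    assume "\<not> ?thesis"
    hence "AE x in ?M. False" using aeF by auto
    hence "AE x in lebesgue. x \<notin> \<Omega>" using O(1) by (subst (asm) AE_restrict_space_iff) auto
    hence "negligible \<Omega>" using O(1) by (simp add: negligible_iff_null_sets AE_iff_null_sets)
    thus False using open_not_negligible[OF O(1,3)] by blast
  qed
  then obtain x0 where "ereal \<bar>f x0\<bar> \<le> norm_Linf \<Omega> f" by blast
  then obtain M where M: "norm_Linf \<Omega> f = ereal M" "M \<ge> 0" using False by (cases "norm_Linf \<Omega> f") (auto intro: order_trans[OF abs_ge_zero])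
  have fM: "AE x in ?M. \<bar>f x\<bar> \<le> M" using aeF unfolding M(1) by simp
  have uL: "u \<in> L1 \<Omega>" using sol by (simp add: solution_def)
  hence um[measurable]: "u \<in> borel_measurable ?M" by (auto simp: L1_def)
  define v where "v x = truncate M (u x)" for x
  have vL: "v \<in> L1 \<Omega>" unfolding v_def by (rule truncate_L1[OF uL M(2)])
  hence vm[measurable]: "v \<in> borel_measurable ?M" by (auto simp: L1_def)
  note fin = p_increasing_strict(1)[OF p 0] and strict = p_increasing_strict(2)[OF p 0] and sym = p_increasing_strict(3)[OF p 0]
  define \<psi> where "\<psi> t = enn2real (\<phi> t)" for t
  have \<phi>\<psi>: "\<phi> t = ennreal (\<psi> t)" for t using fin[of t] by (simp add: \<psi>_def)
  \<comment> \<open>Even, and increasing on the nonnegative half-line, hence Borel.\<close>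
  have \<psi>m[measurable]: "\<psi> \<in> borel_measurable borel"
  proof -
    have "mono (\<lambda>s. \<psi> (max s 0))"
    proof (rule monoI)
      fix s t :: real assume "s \<le> t"
      thus "\<psi> (max s 0) \<le> \<psi> (max t 0)" using strict[of "max s 0" "max t 0"] by (cases "max s 0 = max t 0") (auto simp: \<psi>_def max_def split: if_splits)
    qed
    hence "(\<lambda>s. \<psi> (max s 0)) \<in> borel_measurable borel" by (rule borel_measurable_mono)
    hence "(\<lambda>s. \<psi> (max \<bar>s\<bar> 0)) \<in> borel_measurable borel" by (rule measurable_compose[rotated]) simp
    moreover have "(\<lambda>s. \<psi> (max \<bar>s\<bar> 0)) = \<psi>" by (rule ext) (simp only: \<psi>_def sym max_absorb1[OF abs_ge_zero])
    ultimately show ?thesis by simp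
  qed
  \<comment> \<open>Truncation at a level \<open>M \<ge> |s|\<close> moves \<open>t\<close> towards
    \<open>s\<close>, strictly so if \<open>|t| > M\<close>.\<close>
  have le: "\<psi> (s - truncate M t) \<le> \<psi> (s - t)" "\<bar>t\<bar> > M \<Longrightarrow> \<psi> (s - truncate M t) < \<psi> (s - t)" if "\<bar>s\<bar> \<le> M" for s t
  proof -
    show lt: "\<psi> (s - truncate M t) < \<psi> (s - t)" if "\<bar>t\<bar> > M"
      unfolding \<psi>_def by (rule strict) (use that \<open>\<bar>s\<bar> \<le> M\<close> in \<open>auto simp: truncate_def max_def min_def abs_if split: if_splits\<close>)
    show "\<psi> (s - truncate M t) \<le> \<psi> (s - t)"
    proof (cases "\<bar>t\<bar> > M")
      case False hence "truncate M t = t" by (auto simp: truncate_def)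
      thus ?thesis by simp
    qed (use lt in auto)
  qed
  let ?R = "\<lambda>u. ereal \<alpha> * TV \<Omega> u"
  have o: "objective \<Omega> \<phi> ?R f u \<le> objective \<Omega> \<phi> ?R f v" "\<bar>objective \<Omega> \<phi> ?R f u\<bar> \<noteq> \<infinity>" using sol vL by (auto simp: solution_def)
  obtain F where F: "fidelity \<Omega> \<phi> (\<lambda>x. f x - u x) = ennreal F" "F \<ge> 0"
    using o(2) TV_nonneg[of \<Omega> u] a unfolding objective_def by (cases "fidelity \<Omega> \<phi> (\<lambda>x. f x - u x)"; cases "TV \<Omega> u") auto
  obtain c where c: "TV \<Omega> u = ereal c" "c \<ge> 0" using o(2) TV_nonneg[of \<Omega> u] a F unfolding objective_def by (cases "TV \<Omega> u") (auto simp: enn2ereal_ennreal)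
  have "TV \<Omega> v \<le> ereal c" unfolding v_def using TV_truncate[OF O uL M(2)] c by simp
  then obtain c' where c': "TV \<Omega> v = ereal c'" "c' \<le> c" using TV_nonneg[of \<Omega> v] by (cases "TV \<Omega> v") auto
  have g: "AE x in ?M. \<psi> (f x - v x) \<le> \<psi> (f x - u x)" using fM by eventually_elim (simp add: v_def le(1))
  have "fidelity \<Omega> \<phi> (\<lambda>x. f x - v x) \<le> fidelity \<Omega> \<phi> (\<lambda>x. f x - u x)"
    unfolding fidelity_def \<phi>\<psi> by (rule nn_integral_mono_AE) (use g in \<open>eventually_elim, simp add: ennreal_leI\<close>)
  then obtain F' where F': "fidelity \<Omega> \<phi> (\<lambda>x. f x - v x) = ennreal F'" "F' \<ge> 0" using F by (cases "fidelity \<Omega> \<phi> (\<lambda>x. f x - v x)") (auto simp: top_unique)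
  \<comment> \<open>Optimality of \<open>u\<close> against its truncation, whose regularisation term
    is not larger. Together with \<open>g\<close> it forces the two fidelity integrands to agree
    almost everywhere.\<close>
  have FF': "F \<le> F'"
  proof -
    have "\<alpha> * c' \<le> \<alpha> * c" using a c'(2) by simp
    thus ?thesis using o(1) F F' c c' by (simp add: objective_def enn2ereal_ennreal)
  qed
  have int: "integrable ?M (\<lambda>x. \<psi> (w x)) \<and> (\<integral>x. \<psi> (w x) \<partial>?M) = F"
    if "fidelity \<Omega> \<phi> w = ennreal F" "F \<ge> 0" "w \<in> borel_measurable ?M" for w F
  proof -
    have "\<psi> t \<ge> 0" for t by (simp add: \<psi>_def)
    thus ?thesis
      using nn_integral_eq_integrable[OF measurable_compose[OF that(3) \<psi>m] _ that(2)] that(1) unfolding fidelity_def \<phi>\<psi> by simp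
  qed
  have iu: "integrable ?M (\<lambda>x. \<psi> (f x - u x))" "(\<integral>x. \<psi> (f x - u x) \<partial>?M) = F" using int[OF F] by auto
  have iv: "integrable ?M (\<lambda>x. \<psi> (f x - v x))" "(\<integral>x. \<psi> (f x - v x) \<partial>?M) = F'" using int[OF F'] by auto
  have g': "AE x in ?M. 0 \<le> \<psi> (f x - u x) - \<psi> (f x - v x)" using g by eventually_elim simp
  have i: "integrable ?M (\<lambda>x. \<psi> (f x - u x) - \<psi> (f x - v x))" using iu(1) iv(1) by simp
  have "(\<integral>x. \<psi> (f x - u x) - \<psi> (f x - v x) \<partial>?M) = F - F'" using iu iv by simp
  moreover have "0 \<le> (\<integral>x. \<psi> (f x - u x) - \<psi> (f x - v x) \<partial>?M)" by (rule integral_nonneg_AE[OF g'])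
  ultimately have "(\<integral>x. \<psi> (f x - u x) - \<psi> (f x - v x) \<partial>?M) = 0" using FF' by simp
  hence "AE x in ?M. \<psi> (f x - u x) - \<psi> (f x - v x) = 0" using integral_nonneg_eq_0_iff_AE[OF i g'] by simp
  hence "AE x in ?M. ereal \<bar>u x\<bar> \<le> ereal M" using fM
  proof eventually_elim
    case (elim x)
    thus ?case using le(2)[of "f x" "u x"] by (cases "\<bar>u x\<bar> > M") (auto simp: v_def)
  qed
  thus ?thesis unfolding M(1) unfolding norm_Linf_def by (intro esssup_I) auto
qed simp

lemma TV_admissible_regularisation:
  fixes \<Omega> :: "(real^'n) set"
  assumes O: "open \<Omega>" "bounded \<Omega>" and a: "\<alpha> > 0"
  shows "admissible_regularisation \<Omega> (\<lambda>u. ereal \<alpha> * TV \<Omega> u)"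
  unfolding admissible_regularisation_def
proof (intro conjI ballI allI impI)
  fix u assume "u \<in> L1 \<Omega>"
  have "0 \<le> ereal \<alpha> * TV \<Omega> u" using a TV_nonneg[of \<Omega> u] by simp
  thus "ereal \<alpha> * TV \<Omega> u \<noteq> - \<infinity>" by auto
next
  fix u v assume "u \<in> L1 \<Omega>" "v \<in> L1 \<Omega>" "AE x in lebesgue_on \<Omega>. u x = v x"
  thus "ereal \<alpha> * TV \<Omega> u = ereal \<alpha> * TV \<Omega> v" using TV_cong_AE by metis
next
  fix u v and t :: real assume uv: "u \<in> L1 \<Omega>" "v \<in> L1 \<Omega>" and t: "t \<in> {0..1}"
  have "ereal \<alpha> * TV \<Omega> (\<lambda>x. (1 - t) * u x + t * v x) \<le> ereal \<alpha> * (ereal (1 - t) * TV \<Omega> u + ereal t * TV \<Omega> v)"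
    by (rule ereal_mult_left_mono[OF TV_convex[OF uv t]]) (use a in simp)
  also have "... = ereal \<alpha> * (ereal (1 - t) * TV \<Omega> u) + ereal \<alpha> * (ereal t * TV \<Omega> v)"
    by (rule ereal_right_distrib) (use t TV_nonneg[of \<Omega> u] TV_nonneg[of \<Omega> v] in auto)
  also have "... = ereal (1 - t) * (ereal \<alpha> * TV \<Omega> u) + ereal t * (ereal \<alpha> * TV \<Omega> v)" by (simp only: mult.left_commute)
  finally show "ereal \<alpha> * TV \<Omega> (\<lambda>x. (1 - t) * u x + t * v x) \<le> ereal (1 - t) * (ereal \<alpha> * TV \<Omega> u) + ereal t * (ereal \<alpha> * TV \<Omega> v)" .
next
  fix us u assume ws: "weak_star_BV \<Omega> us u"
  hence L: "\<And>k. us k \<in> L1 \<Omega>" "u \<in> L1 \<Omega>" "(\<lambda>k. norm_L1 \<Omega> (\<lambda>x. us k x - u x)) \<longlonglongrightarrow> 0" by (auto simp: weak_star_BV_def intro: BV_L1)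
  have "ereal \<alpha> * TV \<Omega> u \<le> ereal \<alpha> * liminf (\<lambda>k. TV \<Omega> (us k))" by (rule ereal_mult_left_mono[OF TV_lsc[OF L]]) (use a in simp)
  also have "... = liminf (\<lambda>k. ereal \<alpha> * TV \<Omega> (us k))" by (rule Liminf_ereal_mult_left[symmetric]) (use a in auto)
  finally show "ereal \<alpha> * TV \<Omega> u \<le> liminf (\<lambda>k. ereal \<alpha> * TV \<Omega> (us k))" .
next
  show "\<exists>C>0. \<forall>u\<in>L1 \<Omega>. Dvar \<Omega> u \<Omega> \<le> ereal C * (1 + ereal (norm_L1 \<Omega> u) + ereal \<alpha> * TV \<Omega> u)"
  \<comment> \<open>With this constant the last summand alone equals
    \<open>Dvar \<Omega> u \<Omega>\<close>.\<close>
  proof (intro exI[of _ "1 / \<alpha>"] conjI ballI)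
    fix u assume u: "u \<in> L1 \<Omega>"
    have n: "norm_L1 \<Omega> u \<ge> 0" by (simp add: norm_L1_def)
    show "Dvar \<Omega> u \<Omega> \<le> ereal (1 / \<alpha>) * (1 + ereal (norm_L1 \<Omega> u) + ereal \<alpha> * TV \<Omega> u)" unfolding TV_eq_Dvar[OF O u, symmetric]
      using TV_nonneg[of \<Omega> u] a n by (cases "TV \<Omega> u") (auto simp: one_ereal_def field_simps)
  qed (use a in simp)
qed

theorem proposition4p1:
  fixes \<Omega> :: "(real ^ 'n) set" and \<alpha> :: real
  assumes "CARD('n) \<ge> 2"
    and "open \<Omega>" and "connected \<Omega>" and "\<Omega> \<noteq> {}" and "bounded \<Omega>"
    and "\<alpha> > 0"
  shows "(\<forall>u\<in>L1 \<Omega>. TV \<Omega> u = Dvar \<Omega> u \<Omega>) \<and>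
    admissible_regularisation \<Omega> (\<lambda>u. ereal \<alpha> * TV \<Omega> u) \<and>
    double_lipschitz_comparable \<Omega> (\<lambda>u. ereal \<alpha> * TV \<Omega> u) \<and>
    separably_double_lipschitz_comparable \<Omega> (\<lambda>u. ereal \<alpha> * TV \<Omega> u) \<and>
    (\<forall>\<phi> p f u. admissible_fidelity \<Omega> \<phi> \<and> p \<ge> 1 \<and> p_increasing p \<phi> \<and>
       f \<in> borel_measurable (lebesgue_on \<Omega>) \<and> solution \<Omega> \<phi> (\<lambda>u. ereal \<alpha> * TV \<Omega> u) f u \<longrightarrow>
       norm_Linf \<Omega> u \<le> norm_Linf \<Omega> f)"
proof (intro conjI ballI allI impI)
  note O = assms(2,5,4)
  show "TV \<Omega> u = Dvar \<Omega> u \<Omega>" if "u \<in> L1 \<Omega>" for u by (rule TV_eq_Dvar[OF O(1,2) that])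
  show "admissible_regularisation \<Omega> (\<lambda>u. ereal \<alpha> * TV \<Omega> u)" by (rule TV_admissible_regularisation[OF O(1,2) assms(6)])
  show "double_lipschitz_comparable \<Omega> (\<lambda>u. ereal \<alpha> * TV \<Omega> u)" by (rule TV_double_lipschitz_comparable[OF O assms(6)])
  show "separably_double_lipschitz_comparable \<Omega> (\<lambda>u. ereal \<alpha> * TV \<Omega> u)" by (rule TV_separably_double_lipschitz_comparable[OF O assms(6)])
  fix \<phi> p f u
  assume "admissible_fidelity \<Omega> \<phi> \<and> p \<ge> 1 \<and> p_increasing p \<phi> \<and>
    f \<in> borel_measurable (lebesgue_on \<Omega>) \<and> solution \<Omega> \<phi> (\<lambda>u. ereal \<alpha> * TV \<Omega> u) f u"
  then show "norm_Linf \<Omega> u \<le> norm_Linf \<Omega> f"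
    using solution_Linf_bound[OF O assms(6), of p \<phi> f u] unfolding admissible_fidelity_def by blast
qed

end
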